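(* $\mathcal{P}_4(S_4)$ is the set of points $(p_1,p_2,p_3,q_1,q_2)\in\mathbb{R}^5$ satisfying $0\le p_1\le p_2\le p_3$, $p_1+p_2+p_3=1/2$, $0\le q_1\le q_2$, $q_1+q_2=1/2$, $q_2\le p_1+p_3$, $q_1\le 2p_1$, and $q_2\le 2p_2$.
   Context: For a nondegenerate rank $n$ ring with homomorphisms $\sigma_i$ to $\mathbb{C}$, $|x|=\sqrt{\frac1n\sum|\sigma_i(x)|^2}$ and $\lambda_i$ is the smallest $r$ with $i+1$ linearly independent elements of length $\le r$. Pairs $(R,C)$: $R$ a nondegenerate quartic ring, $C$ a cubic resolvent ring of $R$ in Bhargava's sense; $\Delta=|\mathrm{Disc}(R)|$. $R$ is a $G$-ring if $\mathrm{Gal}(R\otimes\mathbb{Q})\cong G$ as permutation groups. $\mathcal{P}_4(G)$ is the set of limit points of $\{(\log_\Delta\lambda_1(R),\log_\Delta\lambda_2(R),\log_\Delta\lambda_3(R),\log_\Delta\lambda_1(C),\log_\Delta\lambda_2(C))\}$ over isomorphism classes of pairs $(R,C)$ with $R$ a $G$-ring. *)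

theory Defs
  imports
    "Jordan_Normal_Form.Determinant"
    "HOL-Algebra.Algebraic_Closure_Type"
    "HOL-Algebra.Generated_Fields"
    "HOL-Algebra.Sym_Groups"
    "HOL-Analysis.Elementary_Topology"
    "HOL-Library.Infinite_Typeclass"
begin

section \<open>Rings of rank n and their discriminants\<close>

definition int_comb :: "('a, 'm) ring_scheme \<Rightarrow> nat \<Rightarrow> (nat \<Rightarrow> 'a) \<Rightarrow> (nat \<Rightarrow> int) \<Rightarrow> 'a" where
  "int_comb R n b c = (\<Oplus>\<^bsub>R\<^esub>i\<in>{..<n}. [c i] \<cdot>\<^bsub>R\<^esub> b i)"

text \<open>Coefficient functions are required to vanish from \<open>n\<close> on, so that coordinates are unique.\<close>

definition int_basis :: "('a, 'm) ring_scheme \<Rightarrow> nat \<Rightarrow> (nat \<Rightarrow> 'a) \<Rightarrow> bool" where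
  "int_basis R n b \<longleftrightarrow> b ` {..<n} \<subseteq> carrier R \<and>
     (\<forall>x\<in>carrier R. \<exists>!c. (\<forall>i\<ge>n. c i = 0) \<and> x = int_comb R n b c)"

definition coords :: "('a, 'm) ring_scheme \<Rightarrow> nat \<Rightarrow> (nat \<Rightarrow> 'a) \<Rightarrow> 'a \<Rightarrow> nat \<Rightarrow> int" where
  "coords R n b x = (THE c. (\<forall>i\<ge>n. c i = 0) \<and> x = int_comb R n b c)"

definition rank_ring :: "nat \<Rightarrow> ('a, 'm) ring_scheme \<Rightarrow> bool" where
  "rank_ring n R \<longleftrightarrow> cring R \<and> (\<exists>b. int_basis R n b)"

definition ring_trace :: "('a, 'm) ring_scheme \<Rightarrow> nat \<Rightarrow> (nat \<Rightarrow> 'a) \<Rightarrow> 'a \<Rightarrow> int" where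
  "ring_trace R n b x = (\<Sum>i<n. coords R n b (x \<otimes>\<^bsub>R\<^esub> b i) i)"

text \<open>The value does not depend on the basis: a change of basis multiplies the determinant by
  the square of a unit of the integers.\<close>

definition disc :: "nat \<Rightarrow> ('a, 'm) ring_scheme \<Rightarrow> int" where
  "disc n R = (let b = (SOME b. int_basis R n b)
               in det (mat n n (\<lambda>(i, j). ring_trace R n b (b i \<otimes>\<^bsub>R\<^esub> b j))))"

definition nondegenerate_ring :: "nat \<Rightarrow> ('a, 'm) ring_scheme \<Rightarrow> bool" where
  "nondegenerate_ring n R \<longleftrightarrow> rank_ring n R \<and> disc n R \<noteq> 0"


section \<open>Complex embeddings, lengths and successive minima\<close>

abbreviation complex_field :: "complex ring" where
  "complex_field \<equiv> ring_of_type_algebra"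

text \<open>\<open>Ring.ring_hom\<close> is the set of unital homomorphisms of \<open>HOL-Algebra\<close>. It
  only constrains values on the carrier; intersecting with \<open>extensional\<close> makes every
  homomorphism be counted once. A nondegenerate ring of rank \<open>n\<close> has exactly \<open>n\<close> of them.\<close>

definition embeddings :: "('a, 'm) ring_scheme \<Rightarrow> ('a \<Rightarrow> complex) set" where
  "embeddings R = Ring.ring_hom R complex_field \<inter> extensional (carrier R)"

definition ring_length :: "nat \<Rightarrow> ('a, 'm) ring_scheme \<Rightarrow> 'a \<Rightarrow> real" where
  "ring_length n R x = sqrt (1 / real n * (\<Sum>\<sigma>\<in>embeddings R. (cmod (\<sigma> x))\<^sup>2))"

definition int_independent :: "('a, 'm) ring_scheme \<Rightarrow> 'a set \<Rightarrow> bool" where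
  "int_independent R S \<longleftrightarrow> finite S \<and> S \<subseteq> carrier R \<and>
     (\<forall>c :: 'a \<Rightarrow> int. (\<Oplus>\<^bsub>R\<^esub>x\<in>S. [c x] \<cdot>\<^bsub>R\<^esub> x) = \<zero>\<^bsub>R\<^esub> \<longrightarrow> (\<forall>x\<in>S. c x = 0))"

definition succ_min :: "nat \<Rightarrow> ('a, 'm) ring_scheme \<Rightarrow> nat \<Rightarrow> real" where
  "succ_min n R i =
     (LEAST r. \<exists>S. int_independent R S \<and> card S = i + 1 \<and> (\<forall>x\<in>S. ring_length n R x \<le> r))"


section \<open>The Galois group as a permutation group\<close>

text \<open>The homomorphisms from \<open>R\<close> to the complex numbers are those of the \<open>\<rat>\<close>-algebra
  \<open>R \<otimes> \<rat>\<close>. Its splitting field is the compositum of their images, and its Galois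
  group acts on them by composition. Automorphisms of a field of characteristic 0 fix
  \<open>\<rat>\<close> automatically.\<close>

definition splitting_field :: "('a, 'm) ring_scheme \<Rightarrow> complex ring" where
  "splitting_field R =
     complex_field\<lparr>carrier := generate_field complex_field (\<Union>\<sigma>\<in>embeddings R. \<sigma> ` carrier R)\<rparr>"

definition galois_perms :: "('a, 'm) ring_scheme \<Rightarrow> (('a \<Rightarrow> complex) \<Rightarrow> ('a \<Rightarrow> complex)) set" where
  "galois_perms R = {\<pi>. \<pi> permutes embeddings R \<and>
     (\<exists>g \<in> ring_iso (splitting_field R) (splitting_field R).
        \<forall>\<sigma>\<in>embeddings R. \<forall>x\<in>carrier R. \<pi> \<sigma> x = g (\<sigma> x))}"

text \<open>\<open>G\<close> is a group of permutations of \<open>{1..n}\<close>. An isomorphism of permutation groups is a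
  bijection of the underlying sets that carries one group onto the other by conjugation.\<close>

definition G_ring :: "nat \<Rightarrow> (nat \<Rightarrow> nat) monoid \<Rightarrow> ('a, 'm) ring_scheme \<Rightarrow> bool" where
  "G_ring n G R \<longleftrightarrow> (\<exists>f. bij_betw f {1..n} (embeddings R) \<and>
     carrier G = {p. p permutes {1..n} \<and> (\<exists>\<pi>\<in>galois_perms R. \<forall>i\<in>{1..n}. f (p i) = \<pi> (f i))})"


section \<open>Cubic resolvent rings\<close>

text \<open>
  Bhargava's definition for a nondegenerate quartic ring \<open>R\<close>: a cubic ring \<open>C\<close> with
  \<open>Disc C = Disc R\<close> that contains the cubic invariant ring \<open>R\<^sup>i\<^sup>n\<^sup>v\<close>, the subring generated
  by the elements \<open>x x' + x'' x'''\<close> for \<open>x\<close> in \<open>R\<close> with conjugates \<open>x, x', x'', x'''\<close>. Both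
  rings are seen inside the product of three copies of the complex numbers: the three
  coordinates of \<open>x x' + x'' x'''\<close> are given by the three ways of splitting the embeddings of
  \<open>R\<close> into two pairs, and the coordinates of \<open>y\<close> in \<open>C\<close> are its images under the three
  embeddings of \<open>C\<close>. The image of \<open>C\<close> is a subring, so that it contains \<open>R\<^sup>i\<^sup>n\<^sup>v\<close> when it
  contains the generators.
\<close>

definition cubic_resolvent :: "('a, 'm) ring_scheme \<Rightarrow> ('b, 'k) ring_scheme \<Rightarrow> bool" where
  "cubic_resolvent R C \<longleftrightarrow> rank_ring 3 C \<and> disc 3 C = disc 4 R \<and>
     (\<exists>(\<sigma> :: nat \<Rightarrow> 'a \<Rightarrow> complex) (\<tau> :: nat \<Rightarrow> 'b \<Rightarrow> complex).
        bij_betw \<sigma> {1..4} (embeddings R) \<and> bij_betw \<tau> {1..3} (embeddings C) \<and>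
        (\<forall>x\<in>carrier R. \<exists>y\<in>carrier C.
           \<tau> 1 y = \<sigma> 1 x * \<sigma> 2 x + \<sigma> 3 x * \<sigma> 4 x \<and>
           \<tau> 2 y = \<sigma> 1 x * \<sigma> 3 x + \<sigma> 2 x * \<sigma> 4 x \<and>
           \<tau> 3 y = \<sigma> 1 x * \<sigma> 4 x + \<sigma> 2 x * \<sigma> 3 x))"


section \<open>The set of limit points\<close>

definition minima_point ::
  "('a, 'm) ring_scheme \<Rightarrow> ('b, 'k) ring_scheme \<Rightarrow> real \<times> real \<times> real \<times> real \<times> real" where
  "minima_point R C = (let \<Delta> = \<bar>real_of_int (disc 4 R)\<bar> in
     (log \<Delta> (succ_min 4 R 1), log \<Delta> (succ_min 4 R 2), log \<Delta> (succ_min 4 R 3),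
      log \<Delta> (succ_min 3 C 1), log \<Delta> (succ_min 3 C 2)))"

text \<open>The rings range over all rings whose carriers are subsets of the types \<open>'a\<close> and \<open>'b\<close>.
  Rings of finite rank are countable, so when these types are infinite every isomorphism class
  of pairs is represented. The point depends only on the isomorphism class.\<close>

definition P4 :: "'a itself \<Rightarrow> 'b itself \<Rightarrow> (nat \<Rightarrow> nat) monoid \<Rightarrow>
    (real \<times> real \<times> real \<times> real \<times> real) set" where
  "P4 _ _ G = {p. p islimpt {minima_point R C | (R :: 'a ring) (C :: 'b ring).
     nondegenerate_ring 4 R \<and> cubic_resolvent R C \<and> G_ring 4 G R}}"

end

theory Submission
  imports Defs "HOL-Analysis.Convex" "HOL-Analysis.Elementary_Metric_Spaces"
    "HOL-Computational_Algebra.Fundamental_Theorem_Algebra" "HOL-Number_Theory.Cong"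
begin

text \<open>
  Under its complex embeddings a ring of rank \<open>n\<close> becomes a lattice of covolume about \<open>\<surd>\<Delta>\<close>. Reduction
  theory gives an integral basis \<open>1, v\<^sub>1, \<dots>\<close> whose lengths are the successive minima up to a constant, and
  the product of these lengths is \<open>\<surd>\<Delta>\<close> up to a constant. After taking logarithms to base \<open>\<Delta>\<close>, this
  yields the linear constraints that involve \<open>R\<close> alone or \<open>C\<close> alone.

  The three remaining inequalities come from the quadratic map \<open>\<phi>(x) = x x' + x'' x'''\<close> from \<open>R\<close> to \<open>C\<close> and
  its polarisation \<open>B\<close>. Let \<open>u, v, w\<close> be the reduced basis vectors of \<open>R\<close> other than \<open>1\<close>. Since the
  Galois group permutes the four conjugates arbitrarily, \<open>\<phi>(u)\<close> is not rational, so that \<open>q\<^sub>1 \<le> 2 p\<^sub>1\<close>.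
  The elements \<open>1, \<phi>(u), \<phi>(v), B(u, v)\<close> span a space of rank \<open>3\<close>, so that \<open>q\<^sub>2 \<le> 2 p\<^sub>2\<close>, and so do
  \<open>1, \<phi>(u), B(u, v), B(u, w)\<close>, so that \<open>q\<^sub>2 \<le> p\<^sub>1 + p\<^sub>3\<close>.

  Conversely, the pairs of ternary quadratic forms with coefficients \<open>a = 7\<^sup>i\<close>, \<open>b = 7\<^sup>j\<close>, \<open>c = 2\<cdot>7\<^sup>k\<close>,
  \<open>d = -7\<^sup>l\<close> give pairs \<open>(R, C)\<close> with group \<open>S\<^sub>4\<close> whose discriminant and minima are powers of
  \<open>7\<close> up to constants. The exponents \<open>i, j, k, l\<close> are proportional to the slacks \<open>2 p\<^sub>1 - q\<^sub>1\<close>, \<open>p\<^sub>1 + p\<^sub>3 - q\<^sub>2\<close>,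
  \<open>2 p\<^sub>2 - q\<^sub>2\<close>, \<open>2 p\<^sub>3 - q\<^sub>1\<close>, so these pairs come close to every point of the
  polytope, which has no isolated points.
\<close>

section \<open>Lattices of embedded rings\<close>

text \<open>All constants have to be uniform in the ring. This rests on the fact that all rings of a
  given rank together have only finitely many lengths below a given bound: it makes the minima
  attained, keeps nonzero lengths away from 0, and leaves finitely many points of bounded
  discriminant.

  The nonconstant coordinates of \<phi>(x) on a reduced basis of C are quadratic forms in x, and a
  coefficient is at most about the quotient of the lengths involved. The slacks are therefore the
  largest exponents that the four coefficients can have. For the family only upper bounds on the
  minima are computed; their exponents add up to that of the square root of the discriminant, so the
  product of the minima forces each bound to be sharp up to a constant.

  Powers of 7 are 1 modulo 6, so the residues of the coefficients do not depend on the exponents. A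
  rescaled quartic has no root modulo 3, the single factor 2 in \<open>c\<close> excludes rational
  roots of the resolvent cubic, and \<open>d < 0\<close> makes complex conjugation a transposition.
  Together these facts force the full symmetric group.\<close>

lemma mat_mult_entry:
  fixes A B :: "'x :: semiring_0 mat"
  assumes "A \<in> carrier_mat n n" "B \<in> carrier_mat n n" "i < n" "j < n"
  shows "(A * B) $$ (i, j) = (\<Sum>k<n. A $$ (i, k) * B $$ (k, j))"
  using assms by (simp add: scalar_prod_def atLeast0LessThan)

context cring
begin

context
  fixes \<sigma> assumes emb: "\<sigma> \<in> embeddings R"
begin

lemma emb_mult: "x \<in> carrier R \<Longrightarrow> y \<in> carrier R \<Longrightarrow> \<sigma> (x \<otimes> y) = \<sigma> x * \<sigma> y"
  using emb Ring.ring_hom_mult[of \<sigma> R complex_field x y] by (simp add: embeddings_def ring_of_type_algebra_def)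

lemma emb_add: "x \<in> carrier R \<Longrightarrow> y \<in> carrier R \<Longrightarrow> \<sigma> (x \<oplus> y) = \<sigma> x + \<sigma> y"
  using emb Ring.ring_hom_add[of \<sigma> R complex_field x y] by (simp add: embeddings_def ring_of_type_algebra_def)

lemma emb_one: "\<sigma> \<one> = 1"
  using emb Ring.ring_hom_one[of \<sigma> R complex_field] by (simp add: embeddings_def ring_of_type_algebra_def)

lemma emb_zero: "\<sigma> \<zero> = 0"
  using emb_add[of \<zero> \<zero>] by simp

lemma emb_minus: "x \<in> carrier R \<Longrightarrow> \<sigma> (\<ominus> x) = - \<sigma> x"
  using emb_add[of x "\<ominus> x"] emb_zero by (simp add: r_neg eq_neg_iff_add_eq_0 add.commute)

lemma emb_diff: "x \<in> carrier R \<Longrightarrow> y \<in> carrier R \<Longrightarrow> \<sigma> (x \<ominus> y) = \<sigma> x - \<sigma> y"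
  by (simp add: a_minus_def emb_add emb_minus)

lemma emb_nat_smult: "x \<in> carrier R \<Longrightarrow> \<sigma> ([(k::nat)] \<cdot> x) = of_nat k * \<sigma> x"
  by (induction k) (auto simp: emb_zero emb_add algebra_simps)

lemma emb_int_smult: "x \<in> carrier R \<Longrightarrow> \<sigma> ([(k::int)] \<cdot> x) = of_int k * \<sigma> x"
  by (cases "k \<ge> 0") (auto simp: add_pow_int_ge add_pow_int_lt emb_nat_smult emb_minus)

lemma emb_sum:
  "finite A \<Longrightarrow> f \<in> A \<rightarrow> carrier R \<Longrightarrow> \<sigma> (\<Oplus>i\<in>A. f i) = (\<Sum>i\<in>A. \<sigma> (f i))"
  by (induction A rule: finite_induct) (auto simp: emb_zero emb_add Pi_def)

lemma emb_int_comb: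
  "b ` {..<n} \<subseteq> carrier R \<Longrightarrow> \<sigma> (int_comb R n b c) = (\<Sum>i<n. of_int (c i) * \<sigma> (b i))"
  unfolding int_comb_def
  by (subst emb_sum) (auto intro!: sum.cong emb_int_smult)

end

lemma emb_cnj: "s \<in> embeddings R \<Longrightarrow> (\<lambda>x\<in>carrier R. cnj (s x)) \<in> embeddings R"
  by (auto simp: embeddings_def ring_of_type_algebra_def ring_hom_def)

lemma emb_eqI:
  "s \<in> embeddings R \<Longrightarrow> t \<in> embeddings R \<Longrightarrow> (\<And>x. x \<in> carrier R \<Longrightarrow> s x = t x) \<Longrightarrow> s = t"
  by (auto simp: embeddings_def intro: extensionalityI)

lemma int_comb_closed: "b ` {..<n} \<subseteq> carrier R \<Longrightarrow> int_comb R n b c \<in> carrier R"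
  unfolding int_comb_def by (rule finsum_closed) auto

text \<open>Dedekind's argument: comparing a relation at \<open>y x\<close> with \<open>\<tau> y\<close> times the
  relation at \<open>x\<close> eliminates the term of \<open>\<tau>\<close>.\<close>

lemma emb_linear_independent:
  assumes "finite F" "F \<subseteq> embeddings R" "\<forall>x\<in>carrier R. (\<Sum>\<sigma>\<in>F. c \<sigma> * \<sigma> x) = 0"
  shows "\<forall>\<sigma>\<in>F. c \<sigma> = 0"
  using assms
proof (induction F arbitrary: c rule: finite_induct)
  case (insert \<tau> F)
  have tau: "\<tau> \<in> embeddings R" using insert.prems by auto
  have F0: "\<forall>\<sigma>\<in>F. c \<sigma> * (\<sigma> y - \<tau> y) = 0" if y: "y \<in> carrier R" for y
  proof (rule insert.IH)
    show "\<forall>x\<in>carrier R. (\<Sum>\<sigma>\<in>F. c \<sigma> * (\<sigma> y - \<tau> y) * \<sigma> x) = 0"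
    proof
      fix x assume x: "x \<in> carrier R"
      have 1: "c \<tau> * (\<tau> y * \<tau> x) + (\<Sum>\<sigma>\<in>F. c \<sigma> * (\<sigma> y * \<sigma> x)) = 0"
      proof -
        have "(\<Sum>\<sigma>\<in>insert \<tau> F. c \<sigma> * \<sigma> (y \<otimes> x)) = 0" using insert.prems x y by blast
        moreover have "(\<Sum>\<sigma>\<in>insert \<tau> F. c \<sigma> * \<sigma> (y \<otimes> x)) = (\<Sum>\<sigma>\<in>insert \<tau> F. c \<sigma> * (\<sigma> y * \<sigma> x))"
          using insert.prems x y by (intro sum.cong) (auto simp: emb_mult subset_iff)
        ultimately show ?thesis using insert.hyps by simp
      qed
      have 2: "c \<tau> * \<tau> x + (\<Sum>\<sigma>\<in>F. c \<sigma> * \<sigma> x) = 0"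
        using insert.prems x insert.hyps by auto
      have "(\<Sum>\<sigma>\<in>F. c \<sigma> * (\<sigma> y - \<tau> y) * \<sigma> x) = (\<Sum>\<sigma>\<in>F. c \<sigma> * (\<sigma> y * \<sigma> x)) - \<tau> y * (\<Sum>\<sigma>\<in>F. c \<sigma> * \<sigma> x)"
        by (simp add: sum_distrib_left sum_subtractf algebra_simps)
      also have "\<dots> = - (c \<tau> * (\<tau> y * \<tau> x)) - \<tau> y * (- (c \<tau> * \<tau> x))"
        using 1 2 by (simp add: add_eq_0_iff2)
      finally show "(\<Sum>\<sigma>\<in>F. c \<sigma> * (\<sigma> y - \<tau> y) * \<sigma> x) = 0" by simp
    qed
  qed (use insert.prems in auto)
  have c0: "\<forall>\<sigma>\<in>F. c \<sigma> = 0"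
  proof
    fix \<sigma> assume s: "\<sigma> \<in> F"
    then have "\<sigma> \<noteq> \<tau>" using insert.hyps by auto
    then obtain y where "y \<in> carrier R" "\<sigma> y \<noteq> \<tau> y"
      using emb_eqI[of \<sigma> \<tau>] s tau insert.prems by auto
    then show "c \<sigma> = 0" using F0 s by auto
  qed
  have "(\<Sum>\<sigma>\<in>insert \<tau> F. c \<sigma> * \<sigma> \<one>) = 0" using insert.prems by blast
  then have "c \<tau> = 0" using c0 insert.hyps tau by (simp add: emb_one)
  then show ?case using c0 by auto
qed simp

end

text \<open>The number of embeddings is an assumption and nondegeneracy a consequence: with
  \<open>n\<close> embeddings the matrix of their values on a basis is square, and Dedekind's
  argument makes it invertible. For the rings considered the number is known, from the bijections in
  \<open>G_ring\<close> and \<open>cubic_resolvent\<close> or by counting roots.\<close>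

locale embedded_ring = cring R for R (structure) +
  fixes n :: nat
  assumes basis_ex: "\<exists>b. int_basis R n b"
    and card_emb: "card (embeddings R) = n"
    and n_pos: "0 < n"
begin

definition enum_emb :: "nat \<Rightarrow> 'a \<Rightarrow> complex" where
  "enum_emb = (SOME s. bij_betw s {..<n} (embeddings R))"

lemma finite_emb: "finite (embeddings R)"
  using card_emb n_pos card.infinite by force

lemma bij_enum: "bij_betw enum_emb {..<n} (embeddings R)"
  unfolding enum_emb_def
  using someI_ex[OF ex_bij_betw_nat_finite[OF finite_emb]] card_emb by (simp add: atLeast0LessThan)

lemma enum_in: "i < n \<Longrightarrow> enum_emb i \<in> embeddings R"
  using bij_enum by (auto simp: bij_betw_def)

lemma sum_enum: "(\<Sum>i<n. f (enum_emb i)) = (\<Sum>\<sigma>\<in>embeddings R. f \<sigma>)"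
  by (rule sum.reindex_bij_betw[OF bij_enum])

lemma prod_enum: "(\<Prod>i<n. f (enum_emb i)) = (\<Prod>\<sigma>\<in>embeddings R. f \<sigma>)"
  by (rule prod.reindex_bij_betw[OF bij_enum])

lemma coords_eq:
  assumes "int_basis R n b" "x \<in> carrier R"
  shows "x = int_comb R n b (coords R n b x)" and "i \<ge> n \<Longrightarrow> coords R n b x i = 0"
proof -
  have "\<exists>!c. (\<forall>i\<ge>n. c i = 0) \<and> x = int_comb R n b c"
    using assms by (auto simp: int_basis_def)
  from theI'[OF this] show "x = int_comb R n b (coords R n b x)" "i \<ge> n \<Longrightarrow> coords R n b x i = 0"
    by (auto simp: coords_def)
qed

lemma basis_closed: "int_basis R n b \<Longrightarrow> j < n \<Longrightarrow> b j \<in> carrier R"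
  by (auto simp: int_basis_def)

lemma emb_coords:
  assumes "int_basis R n b" "x \<in> carrier R" "s \<in> embeddings R"
  shows "s x = (\<Sum>k<n. of_int (coords R n b x k) * s (b k))"
  using emb_int_comb[OF assms(3), of b n "coords R n b x"] coords_eq(1)[OF assms(1,2)] assms(1)
  by (auto simp: int_basis_def)

definition emb_mat :: "(nat \<Rightarrow> 'a) \<Rightarrow> complex mat" where
  "emb_mat y = mat n n (\<lambda>(i, j). enum_emb i (y j))"

definition coords_mat :: "(nat \<Rightarrow> 'a) \<Rightarrow> (nat \<Rightarrow> 'a) \<Rightarrow> int mat" where
  "coords_mat b y = mat n n (\<lambda>(k, j). coords R n b (y j) k)"

lemma emb_mat_carrier [simp]: "emb_mat y \<in> carrier_mat n n"
  and coords_mat_carrier [simp]: "coords_mat b y \<in> carrier_mat n n"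
  by (simp_all add: emb_mat_def coords_mat_def)

lemma emb_mat_coords:
  assumes "int_basis R n b" "\<And>j. j < n \<Longrightarrow> y j \<in> carrier R"
  shows "emb_mat y = emb_mat b * map_mat of_int (coords_mat b y)"
  by (rule eq_matI)
    (auto simp: emb_mat_def coords_mat_def scalar_prod_def emb_coords[OF assms(1) assms(2) enum_in]
      atLeast0LessThan mult.commute)

lemma det_emb_mat_coords:
  assumes "int_basis R n b" "\<And>j. j < n \<Longrightarrow> y j \<in> carrier R"
  shows "det (emb_mat y) = det (emb_mat b) * of_int (det (coords_mat b y))"
  by (subst emb_mat_coords[OF assms]; simp?; subst det_mult[of _ n]) simp_all

text \<open>A vector in the kernel of the transposed matrix is a relation between the embeddings on
  the basis, hence on the whole ring, and distinct embeddings are linearly independent.\<close>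

lemma det_emb_mat_basis:
  assumes b: "int_basis R n b"
  shows "det (emb_mat b) \<noteq> 0"
proof
  assume "det (emb_mat b) = 0"
  then have "det (transpose_mat (emb_mat b)) = 0" by (simp add: det_transpose[of _ n])
  then obtain v where v: "v \<in> carrier_vec n" "v \<noteq> 0\<^sub>v n" "transpose_mat (emb_mat b) *\<^sub>v v = 0\<^sub>v n"
    using det_0_iff_vec_prod_zero_field[of "transpose_mat (emb_mat b)" n] by auto
  have rel: "(\<Sum>i<n. v $ i * enum_emb i (b j)) = 0" if "j < n" for j
  proof -
    have "(transpose_mat (emb_mat b) *\<^sub>v v) $ j = 0" using v(3) that by simp
    then show ?thesis using that v(1)
      by (simp add: emb_mat_def scalar_prod_def atLeast0LessThan mult.commute)
  qed
  define c where "c \<sigma> = v $ (inv_into {..<n} enum_emb \<sigma>)" for \<sigma>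
  have c: "c (enum_emb i) = v $ i" if "i < n" for i
    unfolding c_def using bij_enum that by (simp add: bij_betw_def inv_into_f_f)
  have "\<forall>\<sigma>\<in>embeddings R. c \<sigma> = 0"
  proof (rule emb_linear_independent[OF finite_emb], simp, rule ballI)
    fix x assume x: "x \<in> carrier R"
    have "(\<Sum>\<sigma>\<in>embeddings R. c \<sigma> * \<sigma> x) = (\<Sum>i<n. v $ i * enum_emb i x)"
      by (subst sum_enum[symmetric]) (simp add: c)
    also have "\<dots> = (\<Sum>i<n. \<Sum>k<n. of_int (coords R n b x k) * (v $ i * enum_emb i (b k)))"
      by (rule sum.cong) (auto simp: emb_coords[OF b x enum_in] sum_distrib_left algebra_simps)
    also have "\<dots> = (\<Sum>k<n. of_int (coords R n b x k) * (\<Sum>i<n. v $ i * enum_emb i (b k)))"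
      by (subst sum.swap) (simp add: sum_distrib_left)
    also have "\<dots> = 0" using rel by simp
    finally show "(\<Sum>\<sigma>\<in>embeddings R. c \<sigma> * \<sigma> x) = 0" .
  qed
  then have "v $ i = 0" if "i < n" for i
    using c[OF that] enum_in[OF that] by auto
  then show False using v(1,2) by auto
qed

definition emb_diag :: "'a \<Rightarrow> complex mat" where
  "emb_diag x = mat n n (\<lambda>(i, j). if i = j then enum_emb i x else 0)"

lemma emb_diag_carrier [simp]: "emb_diag x \<in> carrier_mat n n"
  by (simp add: emb_diag_def)

lemma emb_diag_mat_entry:
  assumes "i < n" "j < n"
  shows "(emb_diag x * emb_mat b) $$ (i, j) = enum_emb i x * enum_emb i (b j)"
proof -
  have "(emb_diag x * emb_mat b) $$ (i, j) = (\<Sum>k<n. (if i = k then enum_emb i x else 0) * enum_emb k (b j))"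
    using assms by (subst mat_mult_entry[of _ n]) (auto simp: emb_diag_def emb_mat_def)
  also have "\<dots> = (\<Sum>k<n. if i = k then enum_emb i x * enum_emb k (b j) else 0)"
    by (rule sum.cong) auto
  finally show ?thesis using assms by simp
qed

text \<open>Multiplication by \<open>x\<close> becomes diagonal in the embedding coordinates. Trace
  and norm are read off from this conjugation.\<close>

lemma emb_diag_mult:
  assumes b: "int_basis R n b" and x: "x \<in> carrier R"
  shows "emb_mat b * map_mat of_int (coords_mat b (\<lambda>j. x \<otimes> b j)) = emb_diag x * emb_mat b"
proof -
  have "emb_mat b * map_mat of_int (coords_mat b (\<lambda>j. x \<otimes> b j)) = emb_mat (\<lambda>j. x \<otimes> b j)"
    by (rule emb_mat_coords[OF b, symmetric]) (use basis_closed[OF b] x in auto)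
  also have "\<dots> = emb_diag x * emb_mat b"
  proof (rule eq_matI)
    fix i j assume "i < dim_row (emb_diag x * emb_mat b)" "j < dim_col (emb_diag x * emb_mat b)"
    then have ij: "i < n" "j < n" by (simp_all add: emb_diag_def emb_mat_def)
    show "emb_mat (\<lambda>j. x \<otimes> b j) $$ (i, j) = (emb_diag x * emb_mat b) $$ (i, j)"
      unfolding emb_diag_mat_entry[OF ij] using ij
      by (simp add: emb_mat_def emb_mult[OF enum_in x basis_closed[OF b]])
  qed (simp_all add: emb_mat_def emb_diag_def)
  finally show ?thesis .
qed

text \<open>The trace is invariant under conjugation. The inverse \<open>W\<close> of the embedding
  matrix makes this explicit entry by entry.\<close>

lemma of_int_ring_trace:
  assumes b: "int_basis R n b" and x: "x \<in> carrier R"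
  shows "of_int (ring_trace R n b x) = (\<Sum>\<sigma>\<in>embeddings R. \<sigma> x)"
proof -
  let ?S = "emb_mat b"
  let ?M = "map_mat of_int (coords_mat b (\<lambda>j. x \<otimes> b j)) :: complex mat"
  obtain W where W: "W \<in> carrier_mat n n" "?S * W = 1\<^sub>m n" "W * ?S = 1\<^sub>m n"
    using det_non_zero_imp_unit[OF _ det_emb_mat_basis[OF b], of n undefined]
    by (auto simp: Units_def ring_mat_def)
  have "?M = W * ?S * ?M" unfolding W(3) by (rule left_mult_one_mat[of _ n n, symmetric]) simp
  also have "\<dots> = W * (?S * ?M)" by (rule assoc_mult_mat[of _ n n _ n _ n]) (use W in auto)
  finally have M: "?M = W * (emb_diag x * ?S)" by (simp add: emb_diag_mult[OF b x])
  have DS: "(emb_diag x * ?S) $$ (k, i) = enum_emb k x * ?S $$ (k, i)" if "k < n" "i < n" for k i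
    using emb_diag_mat_entry[OF that] that by (simp add: emb_mat_def)
  have Mii: "?M $$ (i, i) = (\<Sum>k<n. enum_emb k x * (W $$ (i, k) * ?S $$ (k, i)))" if i: "i < n" for i
  proof -
    have "?M $$ (i, i) = (\<Sum>k<n. W $$ (i, k) * (emb_diag x * ?S) $$ (k, i))"
      unfolding M by (rule mat_mult_entry) (use W i mult_carrier_mat[OF emb_diag_carrier emb_mat_carrier] in auto)
    then show ?thesis using DS i by (simp add: algebra_simps)
  qed
  have SW: "(\<Sum>i<n. W $$ (i, k) * ?S $$ (k, i)) = 1" if "k < n" for k
  proof -
    have "(?S * W) $$ (k, k) = 1" using W that by simp
    then show ?thesis using mat_mult_entry[OF emb_mat_carrier W(1) that that] by (simp add: mult.commute)
  qed
  have "of_int (ring_trace R n b x) = (\<Sum>i<n. ?M $$ (i, i))"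
    by (simp add: ring_trace_def coords_mat_def)
  also have "\<dots> = (\<Sum>k<n. enum_emb k x * (\<Sum>i<n. W $$ (i, k) * ?S $$ (k, i)))"
    by (simp add: Mii sum_distrib_left) (rule sum.swap)
  also have "\<dots> = (\<Sum>k<n. enum_emb k x)" by (simp add: SW)
  finally show ?thesis using sum_enum[of "\<lambda>\<sigma>. \<sigma> x"] by simp
qed

text \<open>The product is the determinant of the integral matrix of multiplication by
  \<open>x\<close>, that is, the norm of \<open>x\<close>.\<close>

lemma prod_emb_int:
  assumes x: "x \<in> carrier R"
  shows "(\<Prod>\<sigma>\<in>embeddings R. \<sigma> x) \<in> \<int>"
proof -
  obtain b where b: "int_basis R n b" using basis_ex by auto
  let ?M = "coords_mat b (\<lambda>j. x \<otimes> b j)"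
  have "det (emb_mat b) * of_int (det ?M) = det (emb_mat b * map_mat of_int ?M)"
    by (subst det_mult[of _ n]) simp_all
  also have "\<dots> = det (emb_diag x) * det (emb_mat b)"
    unfolding emb_diag_mult[OF b x] by (rule det_mult[of _ n]) simp_all
  finally have "of_int (det ?M) = det (emb_diag x)" using det_emb_mat_basis[OF b] by simp
  also have "\<dots> = (\<Prod>i<n. enum_emb i x)"
  proof -
    have "upper_triangular (emb_diag x)" by (auto simp: emb_diag_def)
    then have "det (emb_diag x) = (\<Prod>i = 0..<dim_row (emb_diag x). emb_diag x $$ (i, i))"
      by (simp add: det_upper_triangular[OF _ emb_diag_carrier] prod_list_diag_prod)
    also have "\<dots> = (\<Prod>i<n. enum_emb i x)"
      unfolding atLeast0LessThan by (rule prod.cong) (auto simp: emb_diag_def)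
    finally show ?thesis .
  qed
  also have "\<dots> = (\<Prod>\<sigma>\<in>embeddings R. \<sigma> x)" by (rule prod_enum)
  finally show ?thesis using Ints_of_int[of "det ?M", where ?'a = complex] by (simp only:)
qed

lemma of_int_trace_det:
  assumes b: "int_basis R n b"
  shows "of_int (det (mat n n (\<lambda>(i, j). ring_trace R n b (b i \<otimes> b j)))) = (det (emb_mat b))\<^sup>2"
proof -
  have "map_mat of_int (mat n n (\<lambda>(i, j). ring_trace R n b (b i \<otimes> b j))) = transpose_mat (emb_mat b) * emb_mat b"
    by (rule eq_matI)
      (auto simp: of_int_ring_trace[OF b] basis_closed[OF b] emb_mat_def scalar_prod_def
        atLeast0LessThan sum_enum[symmetric] emb_mult enum_in)
  then have "of_int (det (mat n n (\<lambda>(i, j). ring_trace R n b (b i \<otimes> b j)))) = det (transpose_mat (emb_mat b) * emb_mat b)"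
    by (metis of_int_hom.hom_det)
  also have "\<dots> = (det (emb_mat b))\<^sup>2"
    by (subst det_mult[of _ n]) (auto simp: det_transpose[of _ n] power2_eq_square)
  finally show ?thesis .
qed

text \<open>\<open>disc\<close> refers to a basis picked by choice. The transition determinants to
  and from any other basis are integers with product 1, so their squares are 1.\<close>

lemma disc_emb_mat:
  assumes b: "int_basis R n b"
  shows "of_int (disc n R) = (det (emb_mat b))\<^sup>2"
proof -
  define b0 where "b0 = (SOME b. int_basis R n b)"
  have b0: "int_basis R n b0" unfolding b0_def by (rule someI_ex[OF basis_ex])
  let ?m = "det (coords_mat b0 b)" and ?m' = "det (coords_mat b b0)"
  have 1: "det (emb_mat b) = det (emb_mat b0) * of_int ?m"
    by (rule det_emb_mat_coords[OF b0 basis_closed[OF b]])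
  have 2: "det (emb_mat b0) = det (emb_mat b) * of_int ?m'"
    by (rule det_emb_mat_coords[OF b basis_closed[OF b0]])
  have "det (emb_mat b) * of_int (?m' * ?m) = det (emb_mat b) * 1"
    by (subst (2) 1) (simp add: 2)
  then have "of_int (?m' * ?m) = (1::complex)" using det_emb_mat_basis[OF b] mult_left_cancel by blast
  then have "?m' * ?m = 1" by (rule of_int_eq_1_iff[THEN iffD1])
  then have m: "?m\<^sup>2 = 1" by (auto simp: zmult_eq_1_iff)
  have "of_int (disc n R) = (det (emb_mat b0))\<^sup>2"
    using of_int_trace_det[OF b0] by (simp add: disc_def Let_def b0_def)
  moreover have "(of_int ?m)\<^sup>2 = (1 :: complex)" using m by (metis of_int_1 of_int_power)
  ultimately show ?thesis using 1 by (simp add: power_mult_distrib)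
qed

lemma disc_trace_det:
  assumes b: "int_basis R n b"
  shows "disc n R = det (mat n n (\<lambda>(i, j). ring_trace R n b (b i \<otimes> b j)))"
  using disc_emb_mat[OF b] of_int_trace_det[OF b] by (metis of_int_eq_iff)

lemma disc_nonzero: "disc n R \<noteq> 0"
  using basis_ex disc_emb_mat det_emb_mat_basis by (metis of_int_0 zero_eq_power2)

section \<open>The positive definite form given by the embeddings, and lengths\<close>

definition emb_inner :: "'a \<Rightarrow> 'a \<Rightarrow> real" where
  "emb_inner x y = (\<Sum>\<sigma>\<in>embeddings R. Re (\<sigma> x * cnj (\<sigma> y)))"

text \<open>Composition with complex conjugation permutes the embeddings, so the sum equals its own
  conjugate.\<close>

lemma of_real_emb_inner:
  assumes "x \<in> carrier R" "y \<in> carrier R"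
  shows "of_real (emb_inner x y) = (\<Sum>\<sigma>\<in>embeddings R. \<sigma> x * cnj (\<sigma> y))"
proof -
  let ?s = "\<Sum>\<sigma>\<in>embeddings R. \<sigma> x * cnj (\<sigma> y)"
  let ?c = "\<lambda>\<sigma>. \<lambda>x\<in>carrier R. cnj (\<sigma> x)"
  have bij: "bij_betw ?c (embeddings R) (embeddings R)"
  proof (rule bij_betwI[where g = ?c])
    show "?c \<in> embeddings R \<rightarrow> embeddings R" "?c \<in> embeddings R \<rightarrow> embeddings R"
      by (blast intro: emb_cnj)+
    fix \<sigma> assume s: "\<sigma> \<in> embeddings R"
    have "?c (?c \<sigma>) \<in> embeddings R" by (intro emb_cnj s)
    then have c: "?c (?c \<sigma>) = \<sigma>" by (rule emb_eqI) (auto intro: s)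
    show "?c (?c \<sigma>) = \<sigma>" by (rule c)
    show "?c (?c \<sigma>) = \<sigma>" by (rule c)
  qed
  have "?s = (\<Sum>\<sigma>\<in>embeddings R. ?c \<sigma> x * cnj (?c \<sigma> y))"
    by (rule sum.reindex_bij_betw[OF bij, symmetric])
  also have "\<dots> = cnj ?s" using assms by simp
  finally have "?s = cnj ?s" .
  moreover have "z = of_real (Re z)" if "z = cnj z" for z
    using that by (simp add: complex_eq_iff)
  ultimately have "?s = of_real (Re ?s)" by blast
  then show ?thesis by (simp add: emb_inner_def Re_sum)
qed

lemma emb_inner_self: "emb_inner x x = (\<Sum>\<sigma>\<in>embeddings R. (cmod (\<sigma> x))\<^sup>2)"
  by (simp add: emb_inner_def cmod_power2 flip: power2_eq_square)

lemma ring_length_inner: "ring_length n R x = sqrt (emb_inner x x / n)"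
  by (simp add: ring_length_def emb_inner_self)

text \<open>The Gram matrix is the transposed embedding matrix times its conjugate. Since
  \<open>emb_inner\<close> omits the factor \<open>1 / n\<close> of the length, no power of
  \<open>n\<close> appears.\<close>

lemma abs_disc_gram:
  assumes b: "int_basis R n b"
  shows "\<bar>real_of_int (disc n R)\<bar> = det (mat n n (\<lambda>(i, j). emb_inner (b i) (b j)))"
proof -
  let ?G = "mat n n (\<lambda>(i, j). emb_inner (b i) (b j))"
  interpret cnj_hom: comm_ring_hom cnj by unfold_locales simp_all
  have "map_mat of_real ?G = transpose_mat (emb_mat b) * map_mat cnj (emb_mat b)"
    by (rule eq_matI)
      (auto simp: of_real_emb_inner basis_closed[OF b] emb_mat_def scalar_prod_def
        atLeast0LessThan sum_enum[symmetric])
  then have "of_real (det ?G) = det (transpose_mat (emb_mat b) * map_mat cnj (emb_mat b))"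
    by (metis of_real_hom.hom_det)
  also have "\<dots> = det (emb_mat b) * cnj (det (emb_mat b))"
    by (subst det_mult[of _ n]) (auto simp: det_transpose[of _ n])
  also have "\<dots> = of_real ((cmod (det (emb_mat b)))\<^sup>2)" by (metis complex_norm_square of_real_power)
  finally have "det ?G = (cmod (det (emb_mat b)))\<^sup>2" using of_real_eq_iff by blast
  also have "\<dots> = cmod (of_int (disc n R))" by (simp add: disc_emb_mat[OF b] norm_power)
  finally show ?thesis by simp
qed

lemma emb_injective:
  assumes "x \<in> carrier R" "\<And>\<sigma>. \<sigma> \<in> embeddings R \<Longrightarrow> \<sigma> x = 0"
  shows "x = \<zero>"
proof -
  obtain b where b: "int_basis R n b" using basis_ex by auto
  define v where "v = vec n (\<lambda>k. complex_of_int (coords R n b x k))"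
  have "emb_mat b *\<^sub>v v = 0\<^sub>v n"
  proof (rule eq_vecI)
    fix i assume "i < dim_vec (0\<^sub>v n)"
    then have i: "i < n" by simp
    have "(\<Sum>k<n. of_int (coords R n b x k) * enum_emb i (b k)) = 0"
      using emb_coords[OF b assms(1) enum_in[OF i]] assms(2)[OF enum_in[OF i]] by simp
    then show "(emb_mat b *\<^sub>v v) $ i = 0\<^sub>v n $ i"
      using i by (simp add: emb_mat_def v_def scalar_prod_def atLeast0LessThan mult.commute)
  qed (simp add: emb_mat_def)
  moreover have "v \<in> carrier_vec n" by (simp add: v_def)
  ultimately have "v = 0\<^sub>v n"
    using det_0_iff_vec_prod_zero_field[of "emb_mat b" n] det_emb_mat_basis[OF b] by auto
  then have "coords R n b x k = 0" if "k < n" for k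
    using that by (metis index_vec index_zero_vec(1) of_int_eq_0_iff v_def)
  then have "coords R n b x = (\<lambda>k. 0)" using coords_eq(2)[OF b assms(1)] by (metis not_le)
  then have "x = int_comb R n b (\<lambda>k. 0)" using coords_eq(1)[OF b assms(1)] by simp
  also have "\<dots> = \<zero>" unfolding int_comb_def by (simp add: add_pow_int_ge)
  finally show ?thesis .
qed

text \<open>This is the characteristic polynomial of multiplication by \<open>x\<close>.\<close>

definition emb_poly :: "'a \<Rightarrow> complex poly" where
  "emb_poly x = (\<Prod>\<sigma>\<in>embeddings R. [:- \<sigma> x, 1:])"

text \<open>The value at \<open>k\<close> is the norm of \<open>k - x\<close>. Integral values at
  enough points serve the purpose of integral coefficients and require nothing but norms.\<close>

lemma poly_emb_poly_int:
  assumes x: "x \<in> carrier R"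
  shows "poly (emb_poly x) (of_nat k) \<in> \<int>"
proof -
  have "poly (emb_poly x) (of_nat k) = (\<Prod>\<sigma>\<in>embeddings R. of_nat k - \<sigma> x)"
    by (simp add: emb_poly_def poly_prod)
  also have "\<dots> = (\<Prod>\<sigma>\<in>embeddings R. \<sigma> ([k] \<cdot> \<one> \<ominus> x))"
    using x by (intro prod.cong) (auto simp: emb_diff emb_nat_smult emb_one)
  also have "\<dots> \<in> \<int>" using x by (intro prod_emb_int) auto
  finally show ?thesis .
qed

lemma degree_emb_poly: "Polynomial.degree (emb_poly x) \<le> n"
proof -
  have "Polynomial.degree (emb_poly x) \<le> (\<Sum>\<sigma>\<in>embeddings R. Polynomial.degree [:- \<sigma> x, 1:])"
    unfolding emb_poly_def using degree_prod_sum_le[OF finite_emb, of "\<lambda>\<sigma>. [:- \<sigma> x, 1:]"] by (simp only: o_def)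
  then show ?thesis using card_emb by simp
qed

text \<open>The images of \<open>x\<close> are the roots of the polynomial with multiplicity, so the
  length depends on the polynomial alone. Finitely many polynomials thus give finitely many lengths,
  whatever the ring.\<close>

lemma ring_length_emb_poly:
  "ring_length n R x = sqrt (1 / n * (\<Sum>z\<in>#proots (emb_poly x). (cmod z)\<^sup>2))"
proof -
  have "proots (emb_poly x) = (\<Sum>\<sigma>\<in>embeddings R. {#\<sigma> x#})"
    unfolding emb_poly_def by (subst proots_prod) auto
  moreover have "(\<Sum>z\<in>#(\<Sum>\<sigma>\<in>A. {#\<sigma> x#}). (cmod z)\<^sup>2) = (\<Sum>\<sigma>\<in>A. (cmod (\<sigma> x))\<^sup>2)"
    if "finite A" for A :: "('a \<Rightarrow> complex) set"
    using that by induction auto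
  ultimately show ?thesis using finite_emb by (simp add: ring_length_def)
qed

lemma emb_le_length:
  assumes "s \<in> embeddings R"
  shows "cmod (s x) \<le> sqrt n * ring_length n R x"
proof -
  have "(cmod (s x))\<^sup>2 \<le> (\<Sum>\<sigma>\<in>embeddings R. (cmod (\<sigma> x))\<^sup>2)"
    using assms finite_emb by (intro member_le_sum) auto
  then have "cmod (s x) \<le> sqrt (\<Sum>\<sigma>\<in>embeddings R. (cmod (\<sigma> x))\<^sup>2)"
    by (rule real_le_rsqrt)
  also have "\<dots> = sqrt n * ring_length n R x"
    using n_pos by (simp add: ring_length_def real_sqrt_mult real_sqrt_divide)
  finally show ?thesis .
qed

lemma length_le:
  assumes "\<And>\<sigma>. \<sigma> \<in> embeddings R \<Longrightarrow> cmod (\<sigma> x) \<le> B"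
  shows "ring_length n R x \<le> B"
proof -
  obtain \<sigma> where "\<sigma> \<in> embeddings R" using card_emb n_pos by fastforce
  then have B: "B \<ge> 0" using assms[of \<sigma>] norm_ge_zero order_trans by blast
  have "(\<Sum>\<sigma>\<in>embeddings R. (cmod (\<sigma> x))\<^sup>2) \<le> (\<Sum>\<sigma>\<in>embeddings R. B\<^sup>2)"
    using assms by (intro sum_mono power_mono) auto
  then have "1 / n * (\<Sum>\<sigma>\<in>embeddings R. (cmod (\<sigma> x))\<^sup>2) \<le> B\<^sup>2"
    using card_emb n_pos by (simp add: field_simps)
  then show ?thesis unfolding ring_length_def using B by (simp add: real_le_lsqrt)
qed

lemma length_ge_0: "ring_length n R x \<ge> 0"
  unfolding ring_length_def by (simp add: sum_nonneg)

lemma length_eq_0: "x \<in> carrier R \<Longrightarrow> ring_length n R x = 0 \<Longrightarrow> x = \<zero>"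
  using emb_le_length[of _ x] by (intro emb_injective) auto

end

text \<open>The characteristic polynomial of an element takes bounded integer values at \<open>0, \<dots>, n\<close>.\<close>

lemma finite_ring_lengths:
  fixes B :: real
  shows "\<exists>F. finite F \<and> (\<forall>(R :: ('a, 'm) ring_scheme) x. embedded_ring R n \<longrightarrow> x \<in> carrier R \<longrightarrow>
    ring_length n R x \<le> B \<longrightarrow> ring_length n R x \<in> F)"
proof -
  \<comment> \<open>A value at \<open>k \<le> n\<close> is a product of \<open>n\<close> factors
    \<open>k - \<sigma> x\<close>, each of absolute value at most
    \<open>n + sqrt n * B\<close>.\<close>
  define C where "C = (n + sqrt n * B) ^ n"
  define Z where "Z = {z \<in> \<int>. cmod z \<le> C}"
  define P where "P = {p :: complex poly. Polynomial.degree p \<le> n \<and> (\<forall>k\<le>n. poly p (of_nat k) \<in> Z)}"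
  have "Z \<subseteq> of_int ` {- \<lceil>C\<rceil>..\<lceil>C\<rceil>}"
  proof
    fix z assume "z \<in> Z"
    then obtain m where m: "z = of_int m" "cmod z \<le> C" by (auto simp: Z_def Ints_def)
    then have "\<bar>real_of_int m\<bar> \<le> C" by simp
    then have "m \<in> {- \<lceil>C\<rceil>..\<lceil>C\<rceil>}" by simp linarith
    then show "z \<in> of_int ` {- \<lceil>C\<rceil>..\<lceil>C\<rceil>}" using m by blast
  qed
  then have finZ: "finite Z" by (rule finite_subset) simp
  define ev where "ev p = (\<lambda>k\<in>{..n}. poly p (of_nat k))" for p :: "complex poly"
  have "finite P"
  proof (rule inj_on_finite[of ev])
    show "inj_on ev P"
    proof (rule inj_onI)
      fix p q assume pq: "p \<in> P" "q \<in> P" "ev p = ev q"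
      show "p = q"
      proof (rule poly_eqI_degree[of "of_nat ` {..n}"])
        have "inj_on (of_nat :: nat \<Rightarrow> complex) {..n}" by (simp add: inj_on_def)
        then have "card (of_nat ` {..n} :: complex set) = Suc n" by (simp add: card_image)
        then show "Polynomial.degree p < card (of_nat ` {..n} :: complex set)" "Polynomial.degree q < card (of_nat ` {..n} :: complex set)"
          using pq by (simp_all add: P_def)
        show "poly p x = poly q x" if x: "x \<in> of_nat ` {..n}" for x
        proof -
          obtain k where k: "k \<le> n" "x = of_nat k" using x by auto
          then show ?thesis using fun_cong[OF pq(3), of k] by (simp add: ev_def)
        qed
      qed
    qed
    show "ev ` P \<subseteq> PiE {..n} (\<lambda>_. Z)" by (auto simp: ev_def P_def split: if_splits)
    show "finite (PiE {..n} (\<lambda>_. Z))" using finZ by (intro finite_PiE) auto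
  qed
  define g where "g p = sqrt (1 / n * (\<Sum>z\<in>#proots p. (cmod z)\<^sup>2))" for p
  have "ring_length n R x \<in> g ` P"
    if R: "embedded_ring R n" and x: "x \<in> carrier R" and B: "ring_length n R x \<le> B"
    for R :: "('a, 'm) ring_scheme" and x
  proof -
    interpret embedded_ring R n by (rule R)
    have "poly (emb_poly x) (of_nat k) \<in> Z" if k: "k \<le> n" for k
    proof -
      have "cmod (poly (emb_poly x) (of_nat k)) = (\<Prod>\<sigma>\<in>embeddings R. cmod (of_nat k - \<sigma> x))"
        by (simp add: emb_poly_def poly_prod prod_norm)
      also have "\<dots> \<le> (\<Prod>\<sigma>\<in>embeddings R. n + sqrt n * B)"
      proof (rule prod_mono)
        fix \<sigma> assume s: "\<sigma> \<in> embeddings R"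
        have "cmod (of_nat k - \<sigma> x) \<le> k + cmod (\<sigma> x)" by (metis norm_of_nat norm_triangle_ineq4)
        also have "cmod (\<sigma> x) \<le> sqrt n * B"
          using emb_le_length[OF s, of x] mult_left_mono[OF B, of "sqrt n"] by simp
        finally show "0 \<le> cmod (of_nat k - \<sigma> x) \<and> cmod (of_nat k - \<sigma> x) \<le> n + sqrt n * B"
          using k by simp
      qed
      also have "\<dots> = C" by (simp add: C_def card_emb)
      finally show ?thesis using poly_emb_poly_int[OF x] by (simp add: Z_def)
    qed
    then have "emb_poly x \<in> P" by (simp add: P_def degree_emb_poly)
    then show ?thesis using ring_length_emb_poly[of x] by (auto simp: g_def)
  qed
  then show ?thesis using \<open>finite P\<close> by blast
qed

section \<open>Reduction of lattices of small rank\<close>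

no_notation scalar_prod (infix "\<bullet>" 70)

text \<open>The vectors \<open>x\<close> arise from the orthogonal vectors \<open>y\<close> by a
  unipotent upper triangular matrix \<open>U\<close>, so the Gram matrix is the diagonal one of
  \<open>y\<close> between the transpose of \<open>U\<close> and \<open>U\<close>.\<close>

lemma det_gram:
  fixes x y :: "nat \<Rightarrow> 'v :: real_inner"
  assumes orth: "\<And>i j. i < n \<Longrightarrow> j < n \<Longrightarrow> i \<noteq> j \<Longrightarrow> y i \<bullet> y j = 0"
    and x: "\<And>j. j < n \<Longrightarrow> x j = y j + (\<Sum>i<j. u i j *\<^sub>R y i)"
  shows "det (mat n n (\<lambda>(i, j). x i \<bullet> x j)) = (\<Prod>j<n. y j \<bullet> y j)"
proof -
  define c where "c i j = (if i < j then u i j else if i = j then 1 else 0)" for i j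
  define U where "U = mat n n (\<lambda>(i, j). c i j)"
  define D where "D = mat n n (\<lambda>(i, j). if i = j then y i \<bullet> y i else 0)"
  have U [simp]: "U \<in> carrier_mat n n" and D [simp]: "D \<in> carrier_mat n n"
    by (simp_all add: U_def D_def)
  have x': "x j = (\<Sum>i<n. c i j *\<^sub>R y i)" if j: "j < n" for j
  proof -
    have "(\<Sum>i<n. c i j *\<^sub>R y i) = (\<Sum>i<Suc j. c i j *\<^sub>R y i)"
      using j by (intro sum.mono_neutral_right) (auto simp: c_def)
    also have "\<dots> = y j + (\<Sum>i<j. u i j *\<^sub>R y i)"
      by (simp add: c_def)
    finally show ?thesis using x[OF j] by simp
  qed
  have DU: "(D * U) $$ (k, j) = (y k \<bullet> y k) * c k j" if "k < n" "j < n" for k j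
  proof -
    have "(D * U) $$ (k, j) = (\<Sum>i<n. (if k = i then y k \<bullet> y k else 0) * c i j)"
      using that by (subst mat_mult_entry[of _ n]) (auto simp: U_def D_def)
    also have "\<dots> = (\<Sum>i<n. if k = i then (y k \<bullet> y k) * c i j else 0)"
      by (rule sum.cong) auto
    finally show ?thesis using that by simp
  qed
  have "mat n n (\<lambda>(i, j). x i \<bullet> x j) = transpose_mat U * (D * U)"
  proof (rule eq_matI)
    fix i j assume "i < dim_row (transpose_mat U * (D * U))" "j < dim_col (transpose_mat U * (D * U))"
    then have ij: "i < n" "j < n" by (simp_all add: U_def)
    have "x i \<bullet> x j = (\<Sum>k<n. \<Sum>l<n. c k i * (c l j * (y k \<bullet> y l)))"
      using ij by (simp add: x' inner_sum_left inner_sum_right sum_distrib_left mult.left_commute) (subst sum.swap, simp add: mult.left_commute)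
    also have "\<dots> = (\<Sum>k<n. \<Sum>l<n. if k = l then c k i * ((y k \<bullet> y k) * c k j) else 0)"
      using orth by (intro sum.cong refl) auto
    also have "\<dots> = (\<Sum>k<n. c k i * ((y k \<bullet> y k) * c k j))" by simp
    also have "\<dots> = (\<Sum>k<n. transpose_mat U $$ (i, k) * (D * U) $$ (k, j))"
      using ij by (intro sum.cong) (auto simp: DU, simp add: U_def)
    also have "\<dots> = (transpose_mat U * (D * U)) $$ (i, j)"
      by (rule mat_mult_entry[symmetric]) (use ij mult_carrier_mat[OF D U] in auto)
    finally show "mat n n (\<lambda>(i, j). x i \<bullet> x j) $$ (i, j) = (transpose_mat U * (D * U)) $$ (i, j)"
      using ij by simp
  qed (simp_all add: U_def D_def)
  then have "det (mat n n (\<lambda>(i, j). x i \<bullet> x j)) = det (transpose_mat U) * (det D * det U)"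
    using det_mult[of "transpose_mat U" n "D * U"] det_mult[OF D U] mult_carrier_mat[OF D U] by simp
  moreover have "det U = 1"
  proof -
    have "upper_triangular U" by (auto simp: U_def c_def)
    then have "det U = (\<Prod>i = 0..<dim_row U. U $$ (i, i))"
      by (simp add: det_upper_triangular[OF _ U] prod_list_diag_prod)
    then show ?thesis by (simp add: U_def c_def)
  qed
  moreover have "det D = (\<Prod>j<n. y j \<bullet> y j)"
  proof -
    have "upper_triangular D" by (auto simp: D_def)
    then have "det D = (\<Prod>i = 0..<dim_row D. D $$ (i, i))"
      by (simp add: det_upper_triangular[OF _ D] prod_list_diag_prod)
    also have "\<dots> = (\<Prod>j<n. y j \<bullet> y j)"
      unfolding atLeast0LessThan by (rule prod.cong) (auto simp: D_def)
    finally show ?thesis .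
  qed
  ultimately show ?thesis by (simp add: det_transpose[OF U])
qed

text \<open>The marked vector stands for the unit of a ring. Reduction takes place modulo
  \<open>e\<close>, so \<open>discrete\<close> concerns the projections orthogonal to
  \<open>e\<close>; it speaks of their lengths because these are what the finiteness of ring lengths
  controls. The lattice may span a proper subspace of the ambient space. \<open>primitive\<close>
  starts the induction showing that the reduced vectors generate.\<close>

locale marked_lattice =
  fixes \<Lambda> :: "'v :: euclidean_space set" and e :: 'v and n :: nat
  assumes diff: "\<And>x y. x \<in> \<Lambda> \<Longrightarrow> y \<in> \<Lambda> \<Longrightarrow> x - y \<in> \<Lambda>"
    and e: "e \<in> \<Lambda>" "e \<noteq> 0"
    and dim: "dim \<Lambda> = n"
    and discrete: "\<And>B. finite {norm (z - ((z \<bullet> e) / (e \<bullet> e)) *\<^sub>R e) |z.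
        z \<in> \<Lambda> \<and> norm (z - ((z \<bullet> e) / (e \<bullet> e)) *\<^sub>R e) \<le> B}"
    and primitive: "\<And>t. t *\<^sub>R e \<in> \<Lambda> \<Longrightarrow> \<bar>t\<bar> \<le> 1 / 2 \<Longrightarrow> t = 0"
begin

definition perp :: "'v \<Rightarrow> 'v" where
  "perp z = z - ((z \<bullet> e) / (e \<bullet> e)) *\<^sub>R e"

lemma zero_mem: "0 \<in> \<Lambda>" using diff[OF e(1) e(1)] by simp

lemma minus_mem: "x \<in> \<Lambda> \<Longrightarrow> - x \<in> \<Lambda>" using diff[OF zero_mem] by force

lemma add_mem: "x \<in> \<Lambda> \<Longrightarrow> y \<in> \<Lambda> \<Longrightarrow> x + y \<in> \<Lambda>" using diff[OF _ minus_mem, of x y] by simp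

lemma int_scale_mem: "x \<in> \<Lambda> \<Longrightarrow> of_int k *\<^sub>R x \<in> \<Lambda>"
proof (induction k rule: int_induct[where k = 0])
  case base then show ?case by (simp add: zero_mem)
next
  case (step1 i) then show ?case by (simp add: scaleR_add_left add_mem)
next
  case (step2 i) then show ?case by (simp add: scaleR_diff_left diff)
qed

lemma sum_mem: "(\<And>i. i \<in> A \<Longrightarrow> f i \<in> \<Lambda>) \<Longrightarrow> sum f A \<in> \<Lambda>"
  by (induction A rule: infinite_finite_induct) (auto simp: zero_mem add_mem)

lemma perp_add: "perp (x + y) = perp x + perp y"
  by (simp add: perp_def inner_add_left add_divide_distrib scaleR_add_left)

lemma perp_e: "perp (c *\<^sub>R e) = 0"
  using e by (simp add: perp_def)

lemma perp_orth: "x \<bullet> e = 0 \<Longrightarrow> perp x = x"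
  by (simp add: perp_def)

lemma norm_decomp: "(norm z)\<^sup>2 = (norm (perp z))\<^sup>2 + ((z \<bullet> e) / (e \<bullet> e))\<^sup>2 * (norm e)\<^sup>2"
proof -
  have "orthogonal (perp z) (((z \<bullet> e) / (e \<bullet> e)) *\<^sub>R e)"
    using e by (simp add: orthogonal_def perp_def inner_diff_left)
  from norm_add_Pythagorean[OF this] show ?thesis
    by (simp add: perp_def power_mult_distrib power_divide)
qed

lemma norm_perp_le: "norm (perp z) \<le> norm z"
proof -
  have "0 \<le> ((z \<bullet> e) / (e \<bullet> e))\<^sup>2 * (norm e)\<^sup>2" by simp
  then have "(norm (perp z))\<^sup>2 \<le> (norm z)\<^sup>2" using norm_decomp[of z] by linarith
  then show ?thesis by (rule power2_le_imp_le) simp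
qed

lemma exists_min:
  assumes j: "finite B" "card B < n"
  shows "\<exists>z\<in>\<Lambda> - span B. \<forall>w\<in>\<Lambda> - span B. norm (perp z) \<le> norm (perp w)"
proof -
  have "\<not> \<Lambda> \<subseteq> span B" using j span_card_ge_dim[of \<Lambda> B] dim
    by (metis dim_le_card not_le)
  then obtain z0 where z0: "z0 \<in> \<Lambda> - span B" by auto
  define F where "F = {norm (perp z) |z. z \<in> \<Lambda> - span B \<and> norm (perp z) \<le> norm (perp z0)}"
  have "F \<subseteq> {norm (perp z) |z. z \<in> \<Lambda> \<and> norm (perp z) \<le> norm (perp z0)}" by (auto simp: F_def)
  then have fin: "finite F" using discrete[of "norm (perp z0)"] unfolding perp_def[symmetric]
    by (rule finite_subset)
  moreover have "F \<noteq> {}" using z0 by (auto simp: F_def)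
  ultimately have "Min F \<in> F" by (rule Min_in)
  then obtain z where z: "Min F = norm (perp z)" "z \<in> \<Lambda> - span B" "norm (perp z) \<le> norm (perp z0)"
    by (auto simp: F_def)
  have "norm (perp z) \<le> norm (perp w)" if w: "w \<in> \<Lambda> - span B" for w
  proof (cases "norm (perp w) \<le> norm (perp z0)")
    case True
    then have "norm (perp w) \<in> F" using w by (auto simp: F_def)
    then show ?thesis using fin z(1) Min_le by metis
  qed (use z(3) in auto)
  then show ?thesis using z(2) by auto
qed

text \<open>Minimality of the projection leaves the component along \<open>e\<close> free, hence the
  separate condition that this component is at most half of \<open>e\<close>.\<close>

definition greedy :: "(nat \<Rightarrow> 'v) \<Rightarrow> nat \<Rightarrow> bool" where
  "greedy x j \<longleftrightarrow> x j \<in> \<Lambda> - span (x ` {..<j}) \<and> \<bar>(x j \<bullet> e) / (e \<bullet> e)\<bar> \<le> 1 / 2 \<and>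
     (\<forall>w\<in>\<Lambda> - span (x ` {..<j}). norm (perp (x j)) \<le> norm (perp w))"

lemma greedy_exists:
  "m \<le> n \<Longrightarrow> \<exists>x. x 0 = e \<and> (\<forall>j. 1 \<le> j \<longrightarrow> j < m \<longrightarrow> greedy x j)"
proof (induction m)
  case (Suc m)
  then obtain x where x: "x 0 = e" "\<forall>j. 1 \<le> j \<longrightarrow> j < m \<longrightarrow> greedy x j" by auto
  show ?case
  proof (cases "m = 0")
    case True then show ?thesis using x by auto
  next
    case False
    have "card (x ` {..<m}) < n" using Suc.prems card_image_le[of "{..<m}" x] by simp
    then obtain z where z: "z \<in> \<Lambda> - span (x ` {..<m})"
      "\<forall>w\<in>\<Lambda> - span (x ` {..<m}). norm (perp z) \<le> norm (perp w)"
      using exists_min[of "x ` {..<m}"] by auto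
    \<comment> \<open>Subtracting a multiple of \<open>e\<close> changes neither the projection nor
      membership in the span, since \<open>e\<close> is the first vector of the family.\<close>
    define k where "k = round ((z \<bullet> e) / (e \<bullet> e))"
    define z' where "z' = z - of_int k *\<^sub>R e"
    have eS: "e \<in> span (x ` {..<m})" using False x(1) by (metis span_base image_eqI lessThan_iff neq0_conv)
    have z'S: "z' \<in> \<Lambda> - span (x ` {..<m})"
      using z(1) e eS unfolding z'_def
      by (auto intro: diff int_scale_mem) (metis diff_add_cancel span_add span_scale)
    have "perp (z' + of_int k *\<^sub>R e) = perp z'" by (simp only: perp_add perp_e add_0_right)
    then have pz: "perp z' = perp z" by (simp add: z'_def)
    have "(z' \<bullet> e) / (e \<bullet> e) = (z \<bullet> e) / (e \<bullet> e) - of_int k"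
      using e by (simp add: z'_def inner_diff_left diff_divide_distrib)
    then have "\<bar>(z' \<bullet> e) / (e \<bullet> e)\<bar> \<le> 1 / 2"
      unfolding k_def using of_int_round_abs_le[of "(z \<bullet> e) / (e \<bullet> e)"] by (simp add: abs_minus_commute)
    define x' where "x' = x(m := z')"
    have im: "x' ` {..<j} = x ` {..<j}" if "j \<le> m" for j
      using that by (auto simp: x'_def)
    have "greedy x' j" if "1 \<le> j" "j < Suc m" for j
    proof (cases "j = m")
      case True
      have "x' m = z'" by (simp add: x'_def)
      then show ?thesis using True z(2) z'S pz \<open>\<bar>(z' \<bullet> e) / (e \<bullet> e)\<bar> \<le> 1 / 2\<close>
        unfolding greedy_def by (simp add: im)
    next
      case False
      then have "j < m" using that by simp
      then have "x' j = x j" by (simp add: x'_def)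
      then show ?thesis using x(2) that \<open>j < m\<close> unfolding greedy_def by (simp add: im)
    qed
    moreover have "x' 0 = e" using False x(1) by (simp add: x'_def)
    ultimately show ?thesis by blast
  qed
qed auto

text \<open>Here \<open>y\<close> is the Gram-Schmidt orthogonalisation of the greedy family
  \<open>x\<close>.\<close>

context
  fixes x y :: "nat \<Rightarrow> 'v"
  assumes x0: "x 0 = e" and xg: "\<And>j. 1 \<le> j \<Longrightarrow> j < n \<Longrightarrow> greedy x j"
    and y: "\<And>j. x j - y j \<in> span (x ` {..<j})"
    and yo: "\<And>j w. w \<in> span (x ` {..<j}) \<Longrightarrow> y j \<bullet> w = 0"
begin

lemma x_mem: "j < n \<Longrightarrow> x j \<in> \<Lambda>"
  using xg[of j] x0 e by (cases "j = 0") (auto simp: greedy_def)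

lemma x_new: "j < n \<Longrightarrow> x j \<notin> span (x ` {..<j})"
  using xg[of j] x0 e by (cases "j = 0") (auto simp: greedy_def)

lemma y0: "y 0 = e"
  using y[of 0] x0 by simp

lemma span_mono_le: "i \<le> j \<Longrightarrow> span (x ` {..<i}) \<subseteq> span (x ` {..<j})"
  by (intro span_mono image_mono) auto

lemma y_mem: "i < j \<Longrightarrow> y i \<in> span (x ` {..<j})"
proof -
  assume "i < j"
  then have "x i - y i \<in> span (x ` {..<j})" "x i \<in> span (x ` {..<j})"
    using y[of i] span_mono_le[of i j] by (auto intro: span_base)
  then show ?thesis using span_diff by fastforce
qed

lemma y_orth: "i \<noteq> j \<Longrightarrow> y i \<bullet> y j = 0"
  using yo[OF y_mem, of i j] yo[OF y_mem, of j i] by (cases "i < j") (auto simp: inner_commute)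

lemma e_mem: "1 \<le> j \<Longrightarrow> e \<in> span (x ` {..<j})"
  using y_mem[of 0 j] y0 by simp

lemma y_new: "j < n \<Longrightarrow> y j \<notin> span (x ` {..<j})"
  using x_new[of j] y[of j] by (metis diff_add_cancel span_add)

lemma y_nz: "j < n \<Longrightarrow> y j \<noteq> 0"
  using y_new[of j] span_zero by metis

lemma span_Suc_y:
  assumes "z \<in> span (x ` {..<Suc j})"
  obtains t where "z - t *\<^sub>R y j \<in> span (x ` {..<j})"
proof -
  have "z \<in> span (insert (x j) (x ` {..<j}))" using assms by (simp add: lessThan_Suc)
  then obtain t where t: "z - t *\<^sub>R x j \<in> span (x ` {..<j})" 
    by (auto simp: span_insert)
  have "(z - t *\<^sub>R x j) + t *\<^sub>R (x j - y j) \<in> span (x ` {..<j})"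
    using t y by (intro span_add span_scale)
  then show thesis using that[of t] by (simp add: algebra_simps)
qed

text \<open>Coordinates along the Gram-Schmidt vectors are rounded from the last one downwards,
  since subtracting a multiple of \<open>x j\<close> disturbs only the earlier coordinates. The
  extra vector \<open>u\<close> admits two uses: \<open>u = y j\<close> for reducing
  \<open>x j\<close> itself, and \<open>u = 0\<close> for a vector of the span.\<close>

lemma size_reduce:
  "z - u \<in> span (x ` {..<j}) \<Longrightarrow> \<exists>c s. z - (\<Sum>i<j. of_int (c i) *\<^sub>R x i) = u + (\<Sum>i<j. s i *\<^sub>R y i) \<and>
     (\<forall>i<j. \<bar>s i\<bar> \<le> 1 / 2)"
proof (induction j arbitrary: z u)
  case (Suc j)
  obtain t where t: "(z - u) - t *\<^sub>R y j \<in> span (x ` {..<j})"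
    using Suc.prems by (rule span_Suc_y)
  define k where "k = round t"
  have "((z - u) - t *\<^sub>R y j) - of_int k *\<^sub>R (x j - y j) \<in> span (x ` {..<j})"
    by (rule span_diff[OF t span_scale[OF y]])
  then have "(z - of_int k *\<^sub>R x j) - (u + (t - of_int k) *\<^sub>R y j) \<in> span (x ` {..<j})"
    by (simp add: algebra_simps)
  from Suc.IH[OF this] obtain c s where cs:
    "z - of_int k *\<^sub>R x j - (\<Sum>i<j. of_int (c i) *\<^sub>R x i) = u + (t - of_int k) *\<^sub>R y j + (\<Sum>i<j. s i *\<^sub>R y i)"
    "\<forall>i<j. \<bar>s i\<bar> \<le> 1 / 2" by blast
  have "\<bar>t - of_int k\<bar> \<le> 1 / 2"
    unfolding k_def using of_int_round_abs_le[of t] by (simp add: abs_minus_commute)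
  then have "\<forall>i<Suc j. \<bar>(s(j := t - of_int k)) i\<bar> \<le> 1 / 2" using cs(2) by (simp add: less_Suc_eq)
  moreover have "z - (\<Sum>i<Suc j. of_int ((c(j := k)) i) *\<^sub>R x i) =
      u + (\<Sum>i<Suc j. (s(j := t - of_int k)) i *\<^sub>R y i)"
    using cs(1) by (simp add: algebra_simps)
  ultimately show ?case by blast
qed auto

lemma y_expansion: "z \<in> span (x ` {..<j}) \<Longrightarrow> \<exists>s. z = (\<Sum>i<j. s i *\<^sub>R y i)"
proof (induction j arbitrary: z)
  case (Suc j)
  obtain t where t: "z - t *\<^sub>R y j \<in> span (x ` {..<j})" using Suc.prems by (rule span_Suc_y)
  then obtain s where "z - t *\<^sub>R y j = (\<Sum>i<j. s i *\<^sub>R y i)" using Suc.IH by blast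
  then have "z = (\<Sum>i<Suc j. (s(j := t)) i *\<^sub>R y i)" by (simp add: algebra_simps)
  then show ?case by blast
qed auto

lemma norm_y_sum: "finite A \<Longrightarrow> (norm (\<Sum>i\<in>A. s i *\<^sub>R y i))\<^sup>2 = (\<Sum>i\<in>A. (s i)\<^sup>2 * (norm (y i))\<^sup>2)"
proof (induction A rule: finite_induct)
  case (insert a A)
  have "orthogonal (s a *\<^sub>R y a) (\<Sum>i\<in>A. s i *\<^sub>R y i)"
    using insert.hyps by (auto simp: orthogonal_def inner_sum_right intro!: sum.neutral y_orth)
  then show ?case using insert by (simp add: norm_add_Pythagorean power_mult_distrib)
qed simp

lemma perp_y_sum:
  assumes "1 \<le> j"
  shows "perp (\<Sum>i<j. s i *\<^sub>R y i) = (\<Sum>i\<in>{1..<j}. s i *\<^sub>R y i)"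
proof -
  have "{..<j} = insert 0 {1..<j}" using assms by auto
  then have "(\<Sum>i<j. s i *\<^sub>R y i) = s 0 *\<^sub>R e + (\<Sum>i\<in>{1..<j}. s i *\<^sub>R y i)"
    by (simp add: y0)
  moreover have "(\<Sum>i\<in>{1..<j}. s i *\<^sub>R y i) \<bullet> e = 0"
    using y_orth[of _ 0] y0 by (auto simp: inner_sum_left intro!: sum.neutral)
  ultimately show ?thesis by (simp only: perp_add perp_e perp_orth add_0_left)
qed

text \<open>The projection removes the summand with index 0, which is a multiple of
  \<open>e\<close>; \<open>j - 1\<close> orthogonal summands with coefficients at most 1/2
  remain.\<close>

lemma norm_perp_y_sum_le:
  assumes "1 \<le> j" "\<And>i. 1 \<le> i \<Longrightarrow> i < j \<Longrightarrow> \<bar>s i\<bar> \<le> 1 / 2" "\<And>i. 1 \<le> i \<Longrightarrow> i < j \<Longrightarrow> norm (y i) \<le> B"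
  shows "(norm (perp (\<Sum>i<j. s i *\<^sub>R y i)))\<^sup>2 \<le> real (j - 1) / 4 * B\<^sup>2"
proof -
  have "(norm (perp (\<Sum>i<j. s i *\<^sub>R y i)))\<^sup>2 = (\<Sum>i\<in>{1..<j}. (s i)\<^sup>2 * (norm (y i))\<^sup>2)"
    by (simp add: perp_y_sum[OF assms(1)] norm_y_sum)
  also have "\<dots> \<le> (\<Sum>i\<in>{1..<j}. 1 / 4 * B\<^sup>2)"
  proof (rule sum_mono, rule mult_mono)
    fix i assume i: "i \<in> {1..<j}"
    have "\<bar>s i\<bar>\<^sup>2 \<le> (1 / 2)\<^sup>2" using assms(2)[of i] i by (intro power_mono) auto
    then show "(s i)\<^sup>2 \<le> 1 / 4" by (simp add: power2_eq_square)
    show "(norm (y i))\<^sup>2 \<le> B\<^sup>2" using assms(3)[of i] i by (intro power_mono) auto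
  qed auto
  also have "\<dots> = real (j - 1) / 4 * B\<^sup>2" by simp
  finally show ?thesis .
qed

lemma perp_span: "1 \<le> j \<Longrightarrow> w \<in> span (x ` {..<j}) \<Longrightarrow> perp w \<in> span (x ` {..<j})"
  unfolding perp_def by (intro span_diff span_scale e_mem)

lemma norm_y_le: "1 \<le> j \<Longrightarrow> norm (y j) \<le> norm (perp (x j))"
proof -
  assume j: "1 \<le> j"
  define w where "w = x j - y j"
  have w: "perp w \<in> span (x ` {..<j})" using y[of j] perp_span[OF j] by (simp add: w_def)
  have "perp (y j) = y j" using yo[OF e_mem[OF j]] by (rule perp_orth)
  then have "perp (x j) = y j + perp w" using perp_add[of "y j" w] by (simp add: w_def)
  moreover have "orthogonal (y j) (perp w)" using yo[OF w] by (simp add: orthogonal_def)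
  ultimately have "(norm (perp (x j)))\<^sup>2 = (norm (y j))\<^sup>2 + (norm (perp w))\<^sup>2"
    by (simp add: norm_add_Pythagorean)
  moreover have "0 \<le> (norm (perp w))\<^sup>2" by simp
  ultimately have "(norm (y j))\<^sup>2 \<le> (norm (perp (x j)))\<^sup>2" by linarith
  then show ?thesis by (rule power2_le_imp_le) simp
qed

text \<open>The later vector lies outside the span of the predecessors of the earlier one, so it was
  a competitor in the choice of the earlier one.\<close>

lemma norm_perp_mono:
  assumes "1 \<le> i" "i \<le> j" "j < n"
  shows "norm (perp (x i)) \<le> norm (perp (x j))"
proof -
  have "x j \<in> \<Lambda> - span (x ` {..<i})"
    using assms x_mem[of j] x_new[of j] span_mono_le[of i j] by auto
  then show ?thesis using xg[of i] assms by (auto simp: greedy_def)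
qed

text \<open>The size-reduced form of \<open>x j\<close> competes with \<open>x j\<close>. Its
  projection is \<open>y j\<close> plus at most two summands with coefficients at most 1/2, whose
  squared length is at most half of that of \<open>perp (x j)\<close>; absorbing this half into the
  left side gives the factor 2.\<close>

lemma norm_perp_le_y:
  assumes j: "1 \<le> j" "j < n" and n: "n \<le> 4"
  shows "(norm (perp (x j)))\<^sup>2 \<le> 2 * (norm (y j))\<^sup>2"
proof -
  obtain c s where cs: "x j - (\<Sum>i<j. of_int (c i) *\<^sub>R x i) = y j + (\<Sum>i<j. s i *\<^sub>R y i)"
    "\<forall>i<j. \<bar>s i\<bar> \<le> 1 / 2" using size_reduce[OF y[of j]] by blast
  define z where "z = x j - (\<Sum>i<j. of_int (c i) *\<^sub>R x i)"
  have "z \<in> \<Lambda>" unfolding z_def using j by (intro diff sum_mem int_scale_mem x_mem) auto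
  moreover have "(\<Sum>i<j. of_int (c i) *\<^sub>R x i) \<in> span (x ` {..<j})"
    by (intro span_sum span_scale span_base) auto
  then have "z \<notin> span (x ` {..<j})" using x_new[OF j(2)] unfolding z_def by (metis diff_add_cancel span_add)
  ultimately have "norm (perp (x j)) \<le> norm (perp z)" using xg[OF j] by (auto simp: greedy_def)
  then have 1: "(norm (perp (x j)))\<^sup>2 \<le> (norm (perp z))\<^sup>2" by (intro power_mono) auto
  have 2: "perp z = y j + perp (\<Sum>i<j. s i *\<^sub>R y i)"
    unfolding z_def cs(1) perp_add using perp_orth[OF yo[OF e_mem[OF j(1)]]] by simp
  have "perp (\<Sum>i<j. s i *\<^sub>R y i) \<in> span (x ` {..<j})"
    by (intro perp_span j span_sum span_scale y_mem) auto
  then have "orthogonal (y j) (perp (\<Sum>i<j. s i *\<^sub>R y i))" using yo by (simp add: orthogonal_def)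
  then have 3: "(norm (perp z))\<^sup>2 = (norm (y j))\<^sup>2 + (norm (perp (\<Sum>i<j. s i *\<^sub>R y i)))\<^sup>2"
    unfolding 2 by (rule norm_add_Pythagorean)
  have "(norm (perp (\<Sum>i<j. s i *\<^sub>R y i)))\<^sup>2 \<le> real (j - 1) / 4 * (norm (perp (x j)))\<^sup>2"
  proof (rule norm_perp_y_sum_le[OF j(1)])
    fix i assume i: "1 \<le> i" "i < j"
    show "\<bar>s i\<bar> \<le> 1 / 2" using cs(2) i by auto
    show "norm (y i) \<le> norm (perp (x j))"
      using norm_y_le[OF i(1)] norm_perp_mono[of i j] i j by auto
  qed
  also have "\<dots> \<le> 2 / 4 * (norm (perp (x j)))\<^sup>2" using j n by (intro mult_right_mono) auto
  finally show ?thesis using 1 3 by simp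
qed

lemma perp_pos: "1 \<le> j \<Longrightarrow> j < n \<Longrightarrow> 0 < norm (perp (x j))"
  using norm_y_le[of j] y_nz[of j] by (metis less_le_trans zero_less_norm_iff)

text \<open>The greedy vectors generate: a remainder with coordinates at most \<open>1/2\<close> is
  too short to be independent of the previous vectors, since the rank is at most 4.\<close>

lemma int_span:
  assumes n: "n \<le> 4"
  shows "j \<le> n \<Longrightarrow> z \<in> \<Lambda> \<Longrightarrow> z \<in> span (x ` {..<j}) \<Longrightarrow> \<exists>c. z = (\<Sum>i<j. of_int (c i :: int) *\<^sub>R x i)"
proof (induction j arbitrary: z)
  case (Suc j)
  obtain c s where cs: "z - (\<Sum>i<Suc j. of_int (c i) *\<^sub>R x i) = 0 + (\<Sum>i<Suc j. s i *\<^sub>R y i)"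
    "\<forall>i<Suc j. \<bar>s i\<bar> \<le> 1 / 2" using size_reduce[of z 0 "Suc j"] Suc.prems by auto
  define z' where "z' = z - (\<Sum>i<Suc j. of_int (c i) *\<^sub>R x i)"
  have z': "z' \<in> \<Lambda>" unfolding z'_def using Suc.prems by (intro diff sum_mem int_scale_mem x_mem) auto
  have z's: "z' = (\<Sum>i<Suc j. s i *\<^sub>R y i)" using cs(1) by (simp add: z'_def)
  have "s j = 0"
  proof (cases "j = 0")
    case True
    \<comment> \<open>At index 0 the remainder is a multiple of \<open>e\<close> by at most 1/2,
      which \<open>primitive\<close> excludes unless it is zero.\<close>
    then have "z' = s 0 *\<^sub>R e" using z's y0 by simp
    then show ?thesis using primitive[of "s 0"] z' cs(2) True by simp
  next
    case False
    then have j: "1 \<le> j" "j < n" using Suc.prems by auto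
    show ?thesis
    proof (rule ccontr)
      assume sj: "s j \<noteq> 0"
      have rest: "(\<Sum>i<j. s i *\<^sub>R y i) \<in> span (x ` {..<j})"
        by (intro span_sum span_scale y_mem) auto
      have "z' \<notin> span (x ` {..<j})"
      proof
        assume "z' \<in> span (x ` {..<j})"
        then have "s j *\<^sub>R y j \<in> span (x ` {..<j})"
          using span_diff[OF _ rest] z's by fastforce
        then have "(1 / s j) *\<^sub>R (s j *\<^sub>R y j) \<in> span (x ` {..<j})" by (rule span_scale)
        then show False using y_new[OF j(2)] sj by simp
      qed
      then have "norm (perp (x j)) \<le> norm (perp z')" using xg[OF j] z' by (auto simp: greedy_def)
      then have "(norm (perp (x j)))\<^sup>2 \<le> (norm (perp z'))\<^sup>2" by (intro power_mono) auto
      also have "\<dots> \<le> real (Suc j - 1) / 4 * (norm (perp (x j)))\<^sup>2"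
        unfolding z's
      proof (rule norm_perp_y_sum_le)
        fix i assume i: "1 \<le> i" "i < Suc j"
        show "\<bar>s i\<bar> \<le> 1 / 2" using cs(2) i by auto
        show "norm (y i) \<le> norm (perp (x j))"
          using norm_y_le[OF i(1)] norm_perp_mono[of i j] i j by auto
      qed simp
      also have "\<dots> \<le> 3 / 4 * (norm (perp (x j)))\<^sup>2" using j n by (intro mult_right_mono) auto
      finally show False using perp_pos[OF j] by simp
    qed
  qed
  then have "z' = (\<Sum>i<j. s i *\<^sub>R y i)" using z's by simp
  also have "\<dots> \<in> span (x ` {..<j})" by (intro span_sum span_scale y_mem) auto
  finally obtain d where d: "z' = (\<Sum>i<j. of_int (d i) *\<^sub>R x i)"
    using Suc.IH[OF _ z'] Suc.prems by auto
  have "z = (\<Sum>i<Suc j. of_int (c i + (d(j := 0)) i) *\<^sub>R x i)"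
    using d unfolding z'_def by (simp add: scaleR_add_left sum.distrib algebra_simps)
  then show ?case by (intro exI[of _ "\<lambda>i. c i + (d(j := 0)) i"])
qed auto

lemma x_independent: "j \<le> n \<Longrightarrow> independent (x ` {..<j}) \<and> card (x ` {..<j}) = j"
proof (induction j)
  case (Suc j)
  have xj: "x j \<notin> span (x ` {..<j})" using x_new[of j] Suc.prems by simp
  then have xj': "x j \<notin> x ` {..<j}" using span_base[of "x j" "x ` {..<j}"] by blast
  have IH: "independent (x ` {..<j})" "card (x ` {..<j}) = j" using Suc by auto
  have "x ` {..<Suc j} = insert (x j) (x ` {..<j})" by (simp add: lessThan_Suc)
  then show ?case using independent_insertI[OF xj IH(1)] IH(2) xj' by simp
qed (auto simp: independent_empty)

lemma x_spans: "\<Lambda> \<subseteq> span (x ` {..<n})"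
  by (rule card_ge_dim_independent) (use x_independent[of n] x_mem dim in auto)

end

theorem reduced_basis:
  assumes n: "n \<le> 4"
  obtains x y u where "x 0 = e" "y 0 = e" "\<And>j. j < n \<Longrightarrow> x j \<in> \<Lambda>"
    "independent (x ` {..<n})" "card (x ` {..<n}) = n"
    "\<And>z. z \<in> \<Lambda> \<Longrightarrow> \<exists>c. z = (\<Sum>i<n. of_int (c i :: int) *\<^sub>R x i)"
    "\<And>j z. j \<le> n \<Longrightarrow> z \<in> \<Lambda> \<Longrightarrow> z \<in> span (x ` {..<j}) \<Longrightarrow> \<exists>c. z = (\<Sum>i<j. of_int (c i :: int) *\<^sub>R x i)"
    "\<And>j z. 1 \<le> j \<Longrightarrow> j < n \<Longrightarrow> z \<in> \<Lambda> \<Longrightarrow> z \<notin> span (x ` {..<j}) \<Longrightarrow> norm (perp (x j)) \<le> norm z"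
    "\<And>i j. i \<noteq> j \<Longrightarrow> y i \<bullet> y j = 0"
    "\<And>j. j < n \<Longrightarrow> x j = y j + (\<Sum>i<j. u i j *\<^sub>R y i)"
    "\<And>j. 1 \<le> j \<Longrightarrow> j < n \<Longrightarrow> 0 < norm (perp (x j))"
    "\<And>j. 1 \<le> j \<Longrightarrow> j < n \<Longrightarrow> norm (y j) \<le> norm (perp (x j))"
    "\<And>j. 1 \<le> j \<Longrightarrow> j < n \<Longrightarrow> (norm (perp (x j)))\<^sup>2 \<le> 2 * (norm (y j))\<^sup>2"
    "\<And>i j. 1 \<le> i \<Longrightarrow> i \<le> j \<Longrightarrow> j < n \<Longrightarrow> norm (perp (x i)) \<le> norm (perp (x j))"
    "\<And>j. 1 \<le> j \<Longrightarrow> j < n \<Longrightarrow> (norm (x j))\<^sup>2 \<le> (norm (perp (x j)))\<^sup>2 + (norm e)\<^sup>2 / 4"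
proof -
  obtain x where x0: "x 0 = e" and xg: "\<And>j. 1 \<le> j \<Longrightarrow> j < n \<Longrightarrow> greedy x j"
    using greedy_exists[of n] by auto
  have "\<exists>v. x j - v \<in> span (x ` {..<j}) \<and> (\<forall>w\<in>span (x ` {..<j}). v \<bullet> w = 0)" for j
  proof -
    obtain v w where "v \<in> span (x ` {..<j})" "\<And>z. z \<in> span (x ` {..<j}) \<Longrightarrow> orthogonal w z" "x j = v + w"
      using orthogonal_subspace_decomp_exists[of "x ` {..<j}" "x j"] by metis
    then show ?thesis by (intro exI[of _ w]) (auto simp: orthogonal_def)
  qed
  then obtain y where y: "\<And>j. x j - y j \<in> span (x ` {..<j})"
    and yo: "\<And>j w. w \<in> span (x ` {..<j}) \<Longrightarrow> y j \<bullet> w = 0" by metis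
  note facts = x0 xg y yo
  have "\<exists>s. x j - y j = (\<Sum>i<j. s i *\<^sub>R y i)" for j
    using y_expansion[OF facts y[of j]] by blast
  then obtain v where v: "\<And>j. x j - y j = (\<Sum>i<j. v j i *\<^sub>R y i)" by metis
  show thesis
  proof (rule that[of x y "\<lambda>i j. v j i"])
    show "x j = y j + (\<Sum>i<j. v j i *\<^sub>R y i)" for j using v[of j] by (simp add: algebra_simps)
    show "\<exists>c. z = (\<Sum>i<n. of_int (c i :: int) *\<^sub>R x i)" if "z \<in> \<Lambda>" for z
      using int_span[OF facts n, of n z] x_spans[OF facts] that by auto
    show "norm (perp (x j)) \<le> norm z" if "1 \<le> j" "j < n" "z \<in> \<Lambda>" "z \<notin> span (x ` {..<j})" for j z
      using xg[of j] that norm_perp_le[of z] by (force simp: greedy_def)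
    show "(norm (x j))\<^sup>2 \<le> (norm (perp (x j)))\<^sup>2 + (norm e)\<^sup>2 / 4" if "1 \<le> j" "j < n" for j
    proof -
      have "\<bar>(x j \<bullet> e) / (e \<bullet> e)\<bar> \<le> 1 / 2" using xg[OF that] by (simp add: greedy_def)
      then have "\<bar>(x j \<bullet> e) / (e \<bullet> e)\<bar>\<^sup>2 \<le> (1 / 2)\<^sup>2" by (intro power_mono) auto
      then have "((x j \<bullet> e) / (e \<bullet> e))\<^sup>2 * (norm e)\<^sup>2 \<le> 1 / 4 * (norm e)\<^sup>2"
        by (intro mult_right_mono) (auto simp: power_divide)
      then show ?thesis using norm_decomp[of "x j"] by simp
    qed
  qed (use x_mem[OF facts] x_independent[OF facts, of n] y_orth[OF facts] y0[OF facts] x0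
      int_span[OF facts n] perp_pos[OF facts] norm_y_le[OF facts] norm_perp_le_y[OF facts _ _ n] norm_perp_mono[OF facts] in blast)+
qed

end

text \<open>Cross-multiplication with a pivot \<open>a m p\<close> eliminates the unknown at
  \<open>p\<close> without leaving the integers. The value of \<open>d'\<close> at \<open>p\<close>
  is then chosen so that equation \<open>m\<close> holds.\<close>

lemma int_dependence:
  fixes a :: "nat \<Rightarrow> 'x \<Rightarrow> int"
  shows "finite S \<Longrightarrow> m < card S \<Longrightarrow> \<exists>d. (\<exists>x\<in>S. d x \<noteq> 0) \<and> (\<forall>k<m. (\<Sum>x\<in>S. d x * a k x) = 0)"
proof (induction m arbitrary: S a)
  case 0
  then have "S \<noteq> {}" by auto
  then show ?case by (intro exI[of _ "\<lambda>_. 1"]) auto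
next
  case (Suc m)
  show ?case
  proof (cases "\<forall>x\<in>S. a m x = 0")
    case True
    obtain d where "\<exists>x\<in>S. d x \<noteq> 0" "\<forall>k<m. (\<Sum>x\<in>S. d x * a k x) = 0"
      using Suc.IH[of S a] Suc.prems by auto
    then show ?thesis using True by (intro exI[of _ d]) (auto simp: less_Suc_eq)
  next
    case False
    then obtain p where p: "p \<in> S" "a m p \<noteq> 0" by auto
    define T where "T = S - {p}"
    have T: "finite T" "m < card T" "S = insert p T" "p \<notin> T"
      using Suc.prems p by (auto simp: T_def)
    obtain d where d: "\<exists>x\<in>T. d x \<noteq> 0"
      "\<forall>k<m. (\<Sum>x\<in>T. d x * (a m p * a k x - a k p * a m x)) = 0"
      using Suc.IH[OF T(1,2), of "\<lambda>k x. a m p * a k x - a k p * a m x"] by auto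
    define d' where "d' x = (if x = p then - (\<Sum>x\<in>T. d x * a m x) else a m p * d x)" for x
    have sum: "(\<Sum>x\<in>S. d' x * a k x) = (\<Sum>x\<in>T. d x * (a m p * a k x - a k p * a m x))" for k
    proof -
      have "(\<Sum>x\<in>T. d' x * a k x) = (\<Sum>x\<in>T. a m p * d x * a k x)"
        using T(4) by (intro sum.cong) (auto simp: d'_def)
      then have "(\<Sum>x\<in>S. d' x * a k x) = - (\<Sum>x\<in>T. d x * a m x) * a k p + (\<Sum>x\<in>T. a m p * d x * a k x)"
        using T by (simp add: d'_def)
      then show ?thesis by (simp add: sum_distrib_left sum_distrib_right sum_subtractf algebra_simps)
    qed
    have "(\<Sum>x\<in>S. d' x * a k x) = 0" if "k < Suc m" for k
    proof (cases "k = m")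
      case True
      show ?thesis unfolding sum True by (simp add: algebra_simps)
    qed (use that d(2) sum in \<open>auto simp: less_Suc_eq\<close>)
    moreover have "\<exists>x\<in>S. d' x \<noteq> 0"
      using d(1) p(2) T(3,4) by (auto simp: d'_def)
    ultimately show ?thesis by blast
  qed
qed

lemma dim_eq_family:
  fixes v :: "nat \<Rightarrow> 'v :: euclidean_space"
  assumes ker: "\<And>r i. (\<Sum>j<n. r j *\<^sub>R v j) = 0 \<Longrightarrow> i < n \<Longrightarrow> r i = 0"
    and V: "v ` {..<n} \<subseteq> V" "V \<subseteq> span (v ` {..<n})"
  shows "dim V = n"
proof -
  have inj: "inj_on v {..<n}"
  proof (rule inj_onI, rule ccontr)
    fix i j assume ij: "i \<in> {..<n}" "j \<in> {..<n}" "v i = v j" "i \<noteq> j"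
    define c where "c k = (if k = i then 1 else 0) - (if k = j then 1 else (0::real))" for k
    have "(\<Sum>k<n. c k *\<^sub>R v k) = (\<Sum>k<n. (if k = i then v k else 0)) - (\<Sum>k<n. (if k = j then v k else 0))"
      unfolding sum_subtractf[symmetric] by (rule sum.cong) (auto simp: c_def)
    then have "(\<Sum>k<n. c k *\<^sub>R v k) = 0" using ij by simp
    then show False using ker[of c i] ij by (simp add: c_def)
  qed
  have "independent (v ` {..<n})"
  proof (rule independent_if_scalars_zero)
    fix g x assume g: "(\<Sum>x\<in>v ` {..<n}. g x *\<^sub>R x) = 0" and x: "x \<in> v ` {..<n}"
    then obtain k where k: "x = v k" "k < n" by auto
    have "(\<Sum>j<n. g (v j) *\<^sub>R v j) = 0" using g inj by (simp add: sum.reindex)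
    then show "g x = 0" using ker[of "\<lambda>j. g (v j)" k] k by simp
  qed simp
  then have "dim V = card (v ` {..<n})" using V by (intro dim_unique) auto
  then show ?thesis using inj by (simp add: card_image)
qed

section \<open>Successive minima of embedded rings\<close>

context embedded_ring
begin

text \<open>Independence of the vectors of images over the complex numbers is checked instead. It
  also rules out repetitions in the family, since two equal members would satisfy a relation with
  coefficients 1 and -1.\<close>

lemma int_independentI_emb:
  assumes z: "\<And>i. i < m \<Longrightarrow> z i \<in> carrier R"
    and ind: "\<And>c. (\<And>\<sigma>. \<sigma> \<in> embeddings R \<Longrightarrow> (\<Sum>i<m. c i * \<sigma> (z i)) = 0) \<Longrightarrow> (\<And>i. i < m \<Longrightarrow> c i = (0::complex))"
  shows "int_independent R (z ` {..<m})" and "card (z ` {..<m}) = m"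
proof -
  have inj: "inj_on z {..<m}"
  proof (rule inj_onI, rule ccontr)
    fix i j assume ij: "i \<in> {..<m}" "j \<in> {..<m}" "z i = z j" "i \<noteq> j"
    define c where "c k = (if k = i then 1 else 0) - (if k = j then 1 else (0::complex))" for k
    have "c i = 0"
    proof (rule ind)
      fix \<sigma>
      have "(\<Sum>k<m. c k * \<sigma> (z k)) = (\<Sum>k<m. (if k = i then \<sigma> (z k) else 0)) - (\<Sum>k<m. (if k = j then \<sigma> (z k) else 0))"
        unfolding sum_subtractf[symmetric] by (rule sum.cong) (auto simp: c_def)
      then show "(\<Sum>k<m. c k * \<sigma> (z k)) = 0" using ij by simp
    qed (use ij in auto)
    then show False using ij by (simp add: c_def)
  qed
  then show "card (z ` {..<m}) = m" by (simp add: card_image)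
  show "int_independent R (z ` {..<m})"
    unfolding int_independent_def
  proof (intro conjI allI impI ballI)
    show "z ` {..<m} \<subseteq> carrier R" using z by auto
    fix c :: "'a \<Rightarrow> int" and x
    assume 0: "(\<Oplus>x\<in>z ` {..<m}. [c x] \<cdot> x) = \<zero>" and x: "x \<in> z ` {..<m}"
    then obtain k where k: "x = z k" "k < m" by auto
    have "of_int (c (z k)) = (0::complex)"
    proof (rule ind[of "\<lambda>i. of_int (c (z i))", OF _ k(2)])
      fix \<sigma> assume s: "\<sigma> \<in> embeddings R"
      have "(\<Sum>i<m. of_int (c (z i)) * \<sigma> (z i)) = (\<Sum>x\<in>z ` {..<m}. of_int (c x) * \<sigma> x)"
        using inj by (simp add: sum.reindex)
      also have "\<dots> = (\<Sum>x\<in>z ` {..<m}. \<sigma> ([c x] \<cdot> x))"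
        using z by (intro sum.cong) (auto simp: emb_int_smult[OF s])
      also have "\<dots> = \<sigma> (\<Oplus>x\<in>z ` {..<m}. [c x] \<cdot> x)"
        using z by (subst emb_sum[OF s]) auto
      also have "\<dots> = 0" by (simp add: 0 emb_zero[OF s])
      finally show "(\<Sum>i<m. of_int (c (z i)) * \<sigma> (z i)) = 0" .
    qed
    then show "c x = 0" by (simp add: k)
  qed auto
qed

lemma basis_kernel:
  assumes b: "int_basis R n b" and c: "\<And>\<sigma>. \<sigma> \<in> embeddings R \<Longrightarrow> (\<Sum>i<n. c i * \<sigma> (b i)) = 0"
  shows "i < n \<Longrightarrow> c i = 0"
proof -
  assume i: "i < n"
  have "emb_mat b *\<^sub>v vec n c = 0\<^sub>v n"
  proof (rule eq_vecI)
    fix k assume "k < dim_vec (0\<^sub>v n)"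
    then have k: "k < n" by simp
    show "(emb_mat b *\<^sub>v vec n c) $ k = 0\<^sub>v n $ k"
      using c[OF enum_in[OF k]] k by (simp add: emb_mat_def Matrix.scalar_prod_def atLeast0LessThan mult.commute)
  qed (simp add: emb_mat_def)
  then have "vec n c = 0\<^sub>v n"
    using det_0_iff_vec_prod_zero_field[of "emb_mat b" n] det_emb_mat_basis[OF b] vec_carrier[of n c] emb_mat_carrier[of b] by blast
  then show "c i = 0" using i by (metis index_vec index_zero_vec(1))
qed

lemma basis_independent:
  assumes b: "int_basis R n b" and j: "j \<le> n"
  shows "int_independent R (b ` {..<j})" and "card (b ` {..<j}) = j"
proof -
  have ind: "c i = 0" if c: "\<And>\<sigma>. \<sigma> \<in> embeddings R \<Longrightarrow> (\<Sum>i<j. c i * \<sigma> (b i)) = 0" and i: "i < j" for c :: "nat \<Rightarrow> complex" and i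
  proof -
    have "(\<lambda>i. if i < j then c i else 0) i = 0"
    proof (rule basis_kernel[OF b])
      fix \<sigma> assume s: "\<sigma> \<in> embeddings R"
      have "(\<Sum>i<n. (if i < j then c i else 0) * \<sigma> (b i)) = (\<Sum>i<j. (if i < j then c i else 0) * \<sigma> (b i))"
        using j by (intro sum.mono_neutral_right) auto
      also have "\<dots> = (\<Sum>i<j. c i * \<sigma> (b i))" by (rule sum.cong) auto
      finally show "(\<Sum>i<n. (if i < j then c i else 0) * \<sigma> (b i)) = 0" using c[OF s] by simp
    qed (use i j in auto)
    then show ?thesis using i by simp
  qed
  show "int_independent R (b ` {..<j})" "card (b ` {..<j}) = j"
    by (rule int_independentI_emb; use ind basis_closed[OF b] j in force)+
qed

definition sm_bound :: "nat \<Rightarrow> real \<Rightarrow> bool" where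
  "sm_bound i r \<longleftrightarrow> (\<exists>S. int_independent R S \<and> card S = i + 1 \<and> (\<forall>x\<in>S. ring_length n R x \<le> r))"

lemma succ_min_sm_bound: "succ_min n R i = (LEAST r. sm_bound i r)"
  by (simp add: succ_min_def sm_bound_def)

text \<open>The largest length in a witnessing set is itself a bound. Candidates for the minimum can
  therefore be restricted to lengths of elements.\<close>

lemma sm_bound_attained:
  assumes "sm_bound i r"
  shows "\<exists>x\<in>carrier R. ring_length n R x \<le> r \<and> sm_bound i (ring_length n R x)"
proof -
  obtain S where S: "int_independent R S" "card S = i + 1" "\<forall>x\<in>S. ring_length n R x \<le> r"
    using assms by (auto simp: sm_bound_def)
  have fin: "finite S" "S \<noteq> {}" "S \<subseteq> carrier R" using S by (auto simp: int_independent_def)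
  then have "Max (ring_length n R ` S) \<in> ring_length n R ` S" by (intro Max_in) auto
  then obtain x where x: "x \<in> S" "Max (ring_length n R ` S) = ring_length n R x" by auto
  have "\<forall>y\<in>S. ring_length n R y \<le> ring_length n R x"
    unfolding x(2)[symmetric] using fin by auto
  then show ?thesis using S x fin by (auto simp: sm_bound_def)
qed

text \<open>\<open>LEAST\<close> on the reals has a meaning only when the minimum is attained.
  Bounds can be lowered to lengths of elements, of which only finitely many are below the bound
  \<open>r0\<close> given by a basis.\<close>

lemma succ_min_least:
  assumes i: "i < n"
  shows "sm_bound i (succ_min n R i)" and "sm_bound i r \<Longrightarrow> succ_min n R i \<le> r"
proof -
  obtain b where b: "int_basis R n b" using basis_ex by auto
  have "sm_bound i (Max (ring_length n R ` b ` {..<i + 1}))"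
    unfolding sm_bound_def using basis_independent[OF b, of "i + 1"] i by (intro exI[of _ "b ` {..<i + 1}"]) auto
  then obtain r0 where r0: "sm_bound i r0" by auto
  obtain F where F: "finite F" "\<And>x. x \<in> carrier R \<Longrightarrow> ring_length n R x \<le> r0 \<Longrightarrow> ring_length n R x \<in> F"
    using finite_ring_lengths[of n r0, where ?'a = 'a and ?'m = 'b] embedded_ring_axioms by blast
  define W where "W = {ring_length n R x |x. x \<in> carrier R \<and> ring_length n R x \<le> r0 \<and> sm_bound i (ring_length n R x)}"
  have "finite W" by (rule finite_subset[OF _ F(1)]) (auto simp: W_def intro: F(2))
  moreover have "W \<noteq> {}" using sm_bound_attained[OF r0] by (auto simp: W_def)
  ultimately have m: "Min W \<in> W" by (rule Min_in)
  have least: "Min W \<le> r" if r: "sm_bound i r" for r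
  proof -
    obtain x where x: "x \<in> carrier R" "ring_length n R x \<le> r" "sm_bound i (ring_length n R x)"
      using sm_bound_attained[OF r] by auto
    show ?thesis
    proof (cases "ring_length n R x \<le> r0")
      case True
      then have "ring_length n R x \<in> W" using x by (auto simp: W_def)
      then show ?thesis using Min_le[OF \<open>finite W\<close>] x(2) by fastforce
    next
      case False
      then show ?thesis using m x(2) by (auto simp: W_def)
    qed
  qed
  have "sm_bound i (Min W)" using m by (auto simp: W_def)
  then have "succ_min n R i = Min W"
    unfolding succ_min_sm_bound using least by (rule Least_equality)
  then show "sm_bound i (succ_min n R i)" "sm_bound i r \<Longrightarrow> succ_min n R i \<le> r"
    using least \<open>sm_bound i (Min W)\<close> by auto
qed

lemma succ_min_length:
  assumes "i < n"
  shows "\<exists>x\<in>carrier R. succ_min n R i = ring_length n R x"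
proof -
  obtain x where "x \<in> carrier R" "ring_length n R x \<le> succ_min n R i" "sm_bound i (ring_length n R x)"
    using sm_bound_attained[OF succ_min_least(1)[OF assms]] by auto
  then show ?thesis using succ_min_least(2)[OF assms] by (intro bexI[of _ x]) (auto intro: antisym)
qed

lemma succ_min_leI:
  assumes "i < n" "int_independent R S" "card S = i + 1" "\<And>x. x \<in> S \<Longrightarrow> ring_length n R x \<le> r"
  shows "succ_min n R i \<le> r"
  by (rule succ_min_least(2)[OF assms(1)]) (use assms in \<open>auto simp: sm_bound_def\<close>)

lemma int_independent_subset:
  assumes S: "int_independent R S" and T: "T \<subseteq> S"
  shows "int_independent R T"
  unfolding int_independent_def
proof (intro conjI allI impI ballI)
  have fin: "finite S" "S \<subseteq> carrier R" using S by (auto simp: int_independent_def)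
  then show "finite T" "T \<subseteq> carrier R" using T finite_subset by auto
  fix c :: "'a \<Rightarrow> int" and x
  assume c: "(\<Oplus>x\<in>T. [c x] \<cdot> x) = \<zero>" and x: "x \<in> T"
  define d where "d x = (if x \<in> T then c x else 0)" for x
  have "(\<Oplus>x\<in>S. [d x] \<cdot> x) = (\<Oplus>x\<in>T. [d x] \<cdot> x)"
  proof -
    have "(\<Oplus>x\<in>T \<union> (S - T). [d x] \<cdot> x) = (\<Oplus>x\<in>T. [d x] \<cdot> x) \<oplus> (\<Oplus>x\<in>S - T. [d x] \<cdot> x)"
      using fin T finite_subset by (intro add.finprod_Un_disjoint) auto
    moreover have "(\<Oplus>x\<in>S - T. [d x] \<cdot> x) = \<zero>"
      by (rule add.finprod_one_eqI) (auto simp: d_def add_pow_int_ge)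
    moreover have "T \<union> (S - T) = S" using T by auto
    ultimately show ?thesis using fin T finsum_closed[of "\<lambda>x. [d x] \<cdot> x" T] by (auto simp: Pi_def subset_iff)
  qed
  also have "\<dots> = (\<Oplus>x\<in>T. [c x] \<cdot> x)"
    using fin T by (intro finsum_cong') (auto simp: d_def)
  finally have "\<forall>x\<in>S. d x = 0" using S c unfolding int_independent_def by metis
  then have "d x = 0" using x T by auto
  then show "c x = 0" using x by (simp add: d_def)
qed

lemma succ_min_mono:
  assumes "i \<le> j" "j < n"
  shows "succ_min n R i \<le> succ_min n R j"
proof -
  obtain S where S: "int_independent R S" "card S = j + 1" "\<forall>x\<in>S. ring_length n R x \<le> succ_min n R j"
    using succ_min_least(1)[OF assms(2)] by (auto simp: sm_bound_def)
  obtain T where "T \<subseteq> S" "card T = i + 1" using obtain_subset_with_card_n[of "i + 1" S] S(2) assms by auto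
  then show ?thesis using S assms int_independent_subset
    by (intro succ_min_leI[of i T]) auto
qed

end

text \<open>Only finitely many lengths up to 1 occur in all rings of rank \<open>n\<close> together,
  and only zero has length zero; so one positive constant serves all rings.\<close>

lemma min_ring_length:
  shows "\<exists>c>0. \<forall>(R :: ('a, 'm) ring_scheme) x. embedded_ring R n \<longrightarrow> x \<in> carrier R \<longrightarrow> x \<noteq> \<zero>\<^bsub>R\<^esub> \<longrightarrow>
    c \<le> ring_length n R x"
proof -
  obtain F where F: "finite F" "\<And>(R :: ('a, 'm) ring_scheme) x. embedded_ring R n \<Longrightarrow> x \<in> carrier R \<Longrightarrow>
    ring_length n R x \<le> 1 \<Longrightarrow> ring_length n R x \<in> F"
    using finite_ring_lengths[of n 1, where ?'a = 'a and ?'m = 'm] by blast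
  define G where "G = insert 1 {f\<in>F. f > 0}"
  have G: "finite G" "G \<noteq> {}" "\<forall>g\<in>G. g > 0" using F(1) by (auto simp: G_def)
  have "Min G \<le> ring_length n R x" if R: "embedded_ring R n" and x: "x \<in> carrier R" "x \<noteq> \<zero>\<^bsub>R\<^esub>"
    for R :: "('a, 'm) ring_scheme" and x
  proof (cases "ring_length n R x \<le> 1")
    case True
    interpret embedded_ring R n by (rule R)
    have "ring_length n R x > 0" using length_eq_0[OF x(1)] x(2) length_ge_0[of x] by fastforce
    then have "ring_length n R x \<in> G" using F(2)[OF R x(1) True] by (simp add: G_def)
    then show ?thesis using G(1) by simp
  next
    case False
    have "Min G \<le> 1" using G(1) by (intro Min_le) (auto simp: G_def)
    then show ?thesis using False by simp
  qed
  moreover have "Min G > 0" using G by simp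
  ultimately show ?thesis by blast
qed

text \<open>An additive isometry into a Euclidean space. The space is a type parameter because it
  varies with the rank: three or four copies of the complex numbers, whose real dimension exceeds
  the rank.\<close>

definition (in embedded_ring) lattice_rep :: "('a \<Rightarrow> 'v :: euclidean_space) \<Rightarrow> bool" where
  "lattice_rep f \<longleftrightarrow> (\<forall>x\<in>carrier R. \<forall>y\<in>carrier R. f (x \<oplus> y) = f x + f y \<and> f x \<bullet> f y = emb_inner x y)"

context embedded_ring
begin

context
  fixes f :: "'a \<Rightarrow> 'v :: euclidean_space"
  assumes f: "lattice_rep f"
begin

lemma rep_add: "x \<in> carrier R \<Longrightarrow> y \<in> carrier R \<Longrightarrow> f (x \<oplus> y) = f x + f y"
  and rep_inner: "x \<in> carrier R \<Longrightarrow> y \<in> carrier R \<Longrightarrow> f x \<bullet> f y = emb_inner x y"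
  using f by (auto simp: lattice_rep_def)

lemma rep_zero: "f \<zero> = 0" using rep_add[of \<zero> \<zero>] by simp

lemma rep_minus: "x \<in> carrier R \<Longrightarrow> f (\<ominus> x) = - f x"
  using rep_add[of x "\<ominus> x"] rep_zero by (simp add: r_neg eq_neg_iff_add_eq_0 add.commute)

lemma rep_diff: "x \<in> carrier R \<Longrightarrow> y \<in> carrier R \<Longrightarrow> f (x \<ominus> y) = f x - f y"
  by (simp add: a_minus_def rep_add rep_minus)

lemma rep_nat_smult: "x \<in> carrier R \<Longrightarrow> f ([(k::nat)] \<cdot> x) = of_nat k *\<^sub>R f x"
  by (induction k) (auto simp: rep_zero rep_add algebra_simps)

lemma rep_int_smult: "x \<in> carrier R \<Longrightarrow> f ([(k::int)] \<cdot> x) = of_int k *\<^sub>R f x"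
  by (cases "k \<ge> 0") (auto simp: add_pow_int_ge add_pow_int_lt rep_nat_smult rep_minus)

lemma rep_sum: "finite A \<Longrightarrow> g \<in> A \<rightarrow> carrier R \<Longrightarrow> f (\<Oplus>i\<in>A. g i) = (\<Sum>i\<in>A. f (g i))"
  by (induction A rule: finite_induct) (auto simp: rep_zero rep_add Pi_def)

lemma rep_int_comb: "b ` {..<n} \<subseteq> carrier R \<Longrightarrow> f (int_comb R n b c) = (\<Sum>i<n. of_int (c i) *\<^sub>R f (b i))"
  unfolding int_comb_def
  by (subst rep_sum) (auto intro!: sum.cong rep_int_smult)

lemma norm_rep: "x \<in> carrier R \<Longrightarrow> norm (f x) = sqrt n * ring_length n R x"
  using n_pos by (simp add: norm_eq_sqrt_inner rep_inner ring_length_inner real_sqrt_divide)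

lemma rep_inj: "x \<in> carrier R \<Longrightarrow> f x = 0 \<Longrightarrow> x = \<zero>"
  using norm_rep[of x] n_pos length_eq_0[of x] by simp

lemma rep_one_inner: "f \<one> \<bullet> f \<one> = n"
  using card_emb by (simp add: rep_inner emb_inner_def emb_one cong: sum.cong)

lemma rep_trace:
  assumes "x \<in> carrier R"
  obtains t :: int where "f x \<bullet> f \<one> = of_int t"
proof -
  obtain b where b: "int_basis R n b" using basis_ex by auto
  have "f x \<bullet> f \<one> = Re (\<Sum>\<sigma>\<in>embeddings R. \<sigma> x)"
    using assms by (simp add: rep_inner emb_inner_def emb_one Re_sum cong: sum.cong)
  also have "\<dots> = of_int (ring_trace R n b x)"
    by (simp add: of_int_ring_trace[OF b assms, symmetric])
  finally show thesis by (rule that)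
qed

text \<open>A real relation between the images of a basis lies in the kernel of the Gram matrix,
  whose determinant is the absolute discriminant and so nonzero.\<close>

lemma rep_dim: "Real_Vector_Spaces.dim (f ` carrier R) = n"
proof -
  obtain b where b: "int_basis R n b" using basis_ex by auto
  let ?B = "(\<lambda>j. f (b j)) ` {..<n}"
  have bc: "b ` {..<n} \<subseteq> carrier R" using b by (simp add: int_basis_def)
  have ker: "r i = 0" if r: "(\<Sum>j<n. r j *\<^sub>R f (b j)) = 0" and i: "i < n" for r :: "nat \<Rightarrow> real" and i
  proof -
    let ?G = "mat n n (\<lambda>(i, j). emb_inner (b i) (b j))"
    have "?G *\<^sub>v vec n r = 0\<^sub>v n"
    proof (rule eq_vecI)
      fix k assume "k < dim_vec (0\<^sub>v n)"
      then have k: "k < n" by simp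
      have "(\<Sum>j<n. emb_inner (b k) (b j) * r j) = f (b k) \<bullet> (\<Sum>j<n. r j *\<^sub>R f (b j))"
        unfolding inner_sum_right using k basis_closed[OF b] by (intro sum.cong) (auto simp: rep_inner)
      then show "(?G *\<^sub>v vec n r) $ k = 0\<^sub>v n $ k"
        using k r by (simp add: Matrix.scalar_prod_def atLeast0LessThan)
    qed simp
    moreover have "det ?G \<noteq> 0" using abs_disc_gram[OF b] disc_nonzero by linarith
    moreover have "?G \<in> carrier_mat n n" by simp
    ultimately have "vec n r = 0\<^sub>v n" using det_0_iff_vec_prod_zero_field[of ?G n] vec_carrier[of n r] by blast
    then show "r i = 0" using i by (metis index_vec index_zero_vec(1))
  qed
  show ?thesis
  proof (rule dim_eq_family[where n = n and v = "\<lambda>j. f (b j)"])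
    show "f ` carrier R \<subseteq> Real_Vector_Spaces.span ?B"
    proof
      fix z assume "z \<in> f ` carrier R"
      then obtain x where x: "x \<in> carrier R" "z = f x" by auto
      have "z = f (int_comb R n b (coords R n b x))" using coords_eq(1)[OF b x(1)] x(2) by simp
      also have "\<dots> = (\<Sum>i<n. of_int (coords R n b x i) *\<^sub>R f (b i))" by (rule rep_int_comb[OF bc])
      also have "\<dots> \<in> Real_Vector_Spaces.span ?B" by (intro span_sum span_scale span_base) auto
      finally show "z \<in> Real_Vector_Spaces.span ?B" .
    qed
  qed (use bc ker in auto)
qed

text \<open>With \<open>t\<close> the trace of \<open>x\<close>, the element \<open>n x - t\<close>
  of the ring represents \<open>n\<close> times the projection. Projections therefore inherit from
  ring elements both the finiteness of lengths and the positive lower bound.\<close>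

lemma rep_perp:
  assumes "x \<in> carrier R"
  obtains w where "w \<in> carrier R" "f x - ((f x \<bullet> f \<one>) / (f \<one> \<bullet> f \<one>)) *\<^sub>R f \<one> = (1 / n) *\<^sub>R f w"
proof -
  obtain t where t: "f x \<bullet> f \<one> = of_int t" using rep_trace[OF assms] .
  have "(1 / n) *\<^sub>R f ([n] \<cdot> x \<ominus> [t] \<cdot> \<one>) = f x - (t / n) *\<^sub>R f \<one>"
    using assms n_pos by (simp add: rep_diff rep_nat_smult rep_int_smult scaleR_diff_right)
  then show thesis using assms by (intro that[of "[n] \<cdot> x \<ominus> [t] \<cdot> \<one>"]) (auto simp: t rep_one_inner)
qed

lemma rep_marked_lattice: "marked_lattice (f ` carrier R) (f \<one>) n"
proof
  show "x - y \<in> f ` carrier R" if "x \<in> f ` carrier R" "y \<in> f ` carrier R" for x y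
    using that by (auto simp: rep_diff[symmetric])
  show "f \<one> \<in> f ` carrier R" by simp
  show "f \<one> \<noteq> 0" using rep_one_inner n_pos by auto
  show "Real_Vector_Spaces.dim (f ` carrier R) = n" by (rule rep_dim)
  show "finite {norm (z - ((z \<bullet> f \<one>) / (f \<one> \<bullet> f \<one>)) *\<^sub>R f \<one>) |z.
        z \<in> f ` carrier R \<and> norm (z - ((z \<bullet> f \<one>) / (f \<one> \<bullet> f \<one>)) *\<^sub>R f \<one>) \<le> B}" (is "finite ?A") for B
  proof -
    obtain F where F: "finite F" "\<And>x. x \<in> carrier R \<Longrightarrow> ring_length n R x \<le> n * B / sqrt n \<Longrightarrow> ring_length n R x \<in> F"
      using finite_ring_lengths[of n "n * B / sqrt n", where ?'a = 'a and ?'m = 'b] embedded_ring_axioms by blast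
    have "?A \<subseteq> (\<lambda>l. sqrt n * l / n) ` F"
    proof
      fix r assume "r \<in> ?A"
      then obtain x where x: "x \<in> carrier R" "r \<le> B"
        "r = norm (f x - ((f x \<bullet> f \<one>) / (f \<one> \<bullet> f \<one>)) *\<^sub>R f \<one>)" by auto
      obtain w where w: "w \<in> carrier R" "f x - ((f x \<bullet> f \<one>) / (f \<one> \<bullet> f \<one>)) *\<^sub>R f \<one> = (1 / n) *\<^sub>R f w"
        using rep_perp[OF x(1)] .
      have r: "r = sqrt n * ring_length n R w / n"
        using x(3) w norm_rep[OF w(1)] by simp
      then have "ring_length n R w \<le> n * B / sqrt n" using mult_right_mono[OF x(2), of "real n"] n_pos by (simp add: field_simps)
      then show "r \<in> (\<lambda>l. sqrt n * l / n) ` F" using F(2) w(1) r by auto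
    qed
    then show ?thesis using F(1) finite_surj by blast
  qed
  show "t = 0" if t: "t *\<^sub>R f \<one> \<in> f ` carrier R" "\<bar>t\<bar> \<le> 1 / 2" for t
  proof -
    obtain x where x: "x \<in> carrier R" "f x = t *\<^sub>R f \<one>" using t by auto
    \<comment> \<open>This sum is the squared distance of \<open>f x\<close> from \<open>t\<close>
      times \<open>f \<one>\<close>, so \<open>x\<close> has the value \<open>t\<close> under every
      embedding. Its norm \<open>t ^ n\<close> is then an integer of absolute value below 1.\<close>
    have "(\<Sum>\<sigma>\<in>embeddings R. (cmod (\<sigma> x - of_real t))\<^sup>2) =
        (\<Sum>\<sigma>\<in>embeddings R. Re (\<sigma> x * cnj (\<sigma> x)) - 2 * t * Re (\<sigma> x * cnj (\<sigma> \<one>)) + t\<^sup>2 * Re (\<sigma> \<one> * cnj (\<sigma> \<one>)))"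
      by (rule sum.cong, simp, subst cmod_power2) (simp add: emb_one power2_eq_square algebra_simps)
    also have "\<dots> = emb_inner x x - 2 * t * emb_inner x \<one> + t\<^sup>2 * emb_inner \<one> \<one>"
      by (simp only: emb_inner_def sum.distrib sum_subtractf sum_distrib_left)
    also have "\<dots> = f x \<bullet> f x - 2 * t * (f x \<bullet> f \<one>) + t\<^sup>2 * (f \<one> \<bullet> f \<one>)"
      using x(1) by (simp add: rep_inner)
    also have "\<dots> = 0" by (simp add: x(2) power2_eq_square)
    finally have "\<forall>\<sigma>\<in>embeddings R. (cmod (\<sigma> x - of_real t))\<^sup>2 = 0"
      using finite_emb by (subst (asm) sum_nonneg_eq_0_iff) auto
    then have "(\<Prod>\<sigma>\<in>embeddings R. \<sigma> x) = (\<Prod>\<sigma>\<in>embeddings R. of_real t)"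
      by (intro prod.cong) auto
    then have "(\<Prod>\<sigma>\<in>embeddings R. \<sigma> x) = of_real t ^ n" by (simp add: card_emb)
    then have "(of_real (t ^ n) :: complex) \<in> \<int>" using prod_emb_int[OF x(1)] by simp
    then obtain m where m: "t ^ n = of_int m"
      by (metis Ints_cases of_real_eq_iff of_real_of_int_eq)
    have "\<bar>t ^ n\<bar> \<le> \<bar>t\<bar> ^ 1" unfolding power_abs using t(2) n_pos by (intro power_decreasing) auto
    then have "\<bar>real_of_int m\<bar> < 1" using t(2) m by simp
    then have "m = 0" by linarith
    then show "t = 0" using m by simp
  qed
qed

end

end

section \<open>Minima, reduced bases and the discriminant\<close>

lemma prod_le_power:
  fixes g h :: "nat \<Rightarrow> real"
  assumes "\<And>j. j \<in> A \<Longrightarrow> 0 \<le> g j \<and> g j \<le> C * h j"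
  shows "prod g A \<le> C ^ card A * prod h A"
proof -
  have "prod g A \<le> (\<Prod>j\<in>A. C * h j)" using assms by (intro prod_mono) auto
  then show ?thesis by (simp add: prod.distrib)
qed

lemma prod_lessThan_split:
  fixes g :: "nat \<Rightarrow> real"
  assumes "0 < n"
  shows "(\<Prod>j<n. g j) = g 0 * (\<Prod>j\<in>{1..<n}. g j)"
proof -
  have "{..<n} = insert 0 {1..<n}" using assms by auto
  then show ?thesis by simp
qed

text \<open>The projected length \<open>N j\<close> of a reduced vector mediates between both sides.
  The first \<open>j + 1\<close> basis elements bound the minimum above in terms of it, and any
  \<open>j + 1\<close> independent elements include one outside the span of the first
  \<open>j\<close> basis vectors, which bounds the minimum below. \<open>K\<close> is uniform
  because it is built from \<open>n\<close> and from a bound \<open>c\<close> common to all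
  rings.\<close>

theorem successive_minima_reduction:
  fixes n :: nat
  assumes n: "n \<le> 4"
    and rep: "\<And>R :: ('a, 'm) ring_scheme. embedded_ring R n \<Longrightarrow> \<exists>f :: 'a \<Rightarrow> 'v :: euclidean_space. embedded_ring.lattice_rep R f"
  shows "\<exists>K\<ge>1. \<forall>R :: ('a, 'm) ring_scheme. embedded_ring R n \<longrightarrow>
    (\<exists>b. int_basis R n b \<and> b 0 = \<one>\<^bsub>R\<^esub> \<and>
      (\<forall>j. 1 \<le> j \<longrightarrow> j < n \<longrightarrow> ring_length n R (b j) \<le> K * succ_min n R j \<and> 1 / K \<le> succ_min n R j) \<and>
      sqrt \<bar>real_of_int (disc n R)\<bar> \<le> K * (\<Prod>j\<in>{1..<n}. succ_min n R j) \<and>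
      (\<Prod>j\<in>{1..<n}. succ_min n R j) \<le> K * sqrt \<bar>real_of_int (disc n R)\<bar>)"
proof -
  obtain c where c: "c > 0" "\<And>(R :: ('a, 'm) ring_scheme) x. embedded_ring R n \<Longrightarrow> x \<in> carrier R \<Longrightarrow> x \<noteq> \<zero>\<^bsub>R\<^esub> \<Longrightarrow>
    c \<le> ring_length n R x" using min_ring_length[of n, where ?'a = 'a and ?'m = 'm] by blast
  \<comment> \<open>A nonzero projection is \<open>1 / n\<close> times the vector of a ring element,
    which has norm at least \<open>sqrt n * c\<close>; so \<open>c'\<close> bounds the projections
    below.\<close>
  define c' where "c' = sqrt n * c / n"
  \<comment> \<open>The first term compares a reduced vector with its projection, the squared
    component along the unit being at most \<open>n / 4\<close>. The second one compares the unit,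
    of norm \<open>sqrt n\<close>, with any projection.\<close>
  define A where "A = max (sqrt (1 + n / (4 * c'\<^sup>2))) (sqrt n / c')"
  define p where "p = card {1..<n}"
  define K where "K = 1 + A + n / c + sqrt n * sqrt n ^ p + (A * sqrt 2) ^ p"
  have A1: "A \<ge> 1" unfolding A_def by (rule max.coboundedI1) simp
  have K: "K \<ge> 1" "K \<ge> A" "K \<ge> n / c" "K \<ge> sqrt n * sqrt n ^ p" "K \<ge> (A * sqrt 2) ^ p"
    using A1 c(1) by (auto simp: K_def intro!: add_nonneg_nonneg)
  have "\<exists>b. int_basis R n b \<and> b 0 = \<one>\<^bsub>R\<^esub> \<and>
      (\<forall>j. 1 \<le> j \<longrightarrow> j < n \<longrightarrow> ring_length n R (b j) \<le> K * succ_min n R j \<and> 1 / K \<le> succ_min n R j) \<and>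
      sqrt \<bar>real_of_int (disc n R)\<bar> \<le> K * (\<Prod>j\<in>{1..<n}. succ_min n R j) \<and>
      (\<Prod>j\<in>{1..<n}. succ_min n R j) \<le> K * sqrt \<bar>real_of_int (disc n R)\<bar>"
    if R: "embedded_ring R n" for R :: "('a, 'm) ring_scheme"
  proof -
    interpret embedded_ring R n by (rule R)
    obtain f :: "'a \<Rightarrow> 'v" where f: "lattice_rep f" using rep[OF R] by auto
    interpret marked_lattice "f ` carrier R" "f \<one>\<^bsub>R\<^esub>" n by (rule rep_marked_lattice[OF f])
    obtain x y u where x0: "x 0 = f \<one>\<^bsub>R\<^esub>" and y0: "y 0 = f \<one>\<^bsub>R\<^esub>"
      and xm: "\<And>j. j < n \<Longrightarrow> x j \<in> f ` carrier R"
      and xi: "\<not> Real_Vector_Spaces.dependent (x ` {..<n})" "card (x ` {..<n}) = n"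
      and xs: "\<And>z. z \<in> f ` carrier R \<Longrightarrow> \<exists>c. z = (\<Sum>i<n. of_int (c i :: int) *\<^sub>R x i)"
      and xs': "\<And>j z. j \<le> n \<Longrightarrow> z \<in> f ` carrier R \<Longrightarrow> z \<in> span (x ` {..<j}) \<Longrightarrow> \<exists>c. z = (\<Sum>i<j. of_int (c i :: int) *\<^sub>R x i)"
      and xl: "\<And>j z. 1 \<le> j \<Longrightarrow> j < n \<Longrightarrow> z \<in> f ` carrier R \<Longrightarrow> z \<notin> span (x ` {..<j}) \<Longrightarrow> norm (perp (x j)) \<le> norm z"
      and yo: "\<And>i j. i \<noteq> j \<Longrightarrow> y i \<bullet> y j = 0"
      and xy: "\<And>j. j < n \<Longrightarrow> x j = y j + (\<Sum>i<j. u i j *\<^sub>R y i)"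
      and Np: "\<And>j. 1 \<le> j \<Longrightarrow> j < n \<Longrightarrow> 0 < norm (perp (x j))"
      and yN: "\<And>j. 1 \<le> j \<Longrightarrow> j < n \<Longrightarrow> norm (y j) \<le> norm (perp (x j))"
      and Ny: "\<And>j. 1 \<le> j \<Longrightarrow> j < n \<Longrightarrow> (norm (perp (x j)))\<^sup>2 \<le> 2 * (norm (y j))\<^sup>2"
      and Nm: "\<And>i j. 1 \<le> i \<Longrightarrow> i \<le> j \<Longrightarrow> j < n \<Longrightarrow> norm (perp (x i)) \<le> norm (perp (x j))"
      and xN: "\<And>j. 1 \<le> j \<Longrightarrow> j < n \<Longrightarrow> (norm (x j))\<^sup>2 \<le> (norm (perp (x j)))\<^sup>2 + (norm (f \<one>\<^bsub>R\<^esub>))\<^sup>2 / 4"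
      apply (rule reduced_basis[OF n])
      subgoal premises p for x y u by (rule p(1)[of x y u, OF p(2-)])
      done
    have "\<exists>w. w \<in> carrier R \<and> (j < n \<longrightarrow> f w = x j) \<and> (j = 0 \<longrightarrow> w = \<one>\<^bsub>R\<^esub>)" for j
      using xm[of j] x0 by (cases "j = 0"; cases "j < n") auto
    then obtain b where b: "\<And>j. b j \<in> carrier R" "\<And>j. j < n \<Longrightarrow> f (b j) = x j" "b 0 = \<one>\<^bsub>R\<^esub>" by metis
    have bc: "b ` {..<n} \<subseteq> carrier R" using b(1) by auto
    have xinj: "inj_on x {..<n}" using xi(2) by (simp add: eq_card_imp_inj_on)
    have xker: "r i = 0" if r: "(\<Sum>j<n. r j *\<^sub>R x j) = 0" and i: "i < n" for r :: "nat \<Rightarrow> real" and i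
    proof -
      define g where "g = (\<lambda>v. r (inv_into {..<n} x v))"
      have "(\<Sum>v\<in>x ` {..<n}. g v *\<^sub>R v) = (\<Sum>j<n. r j *\<^sub>R x j)"
        using xinj by (simp add: sum.reindex g_def inv_into_f_f)
      then have "g (x i) = 0"
        using independentD[OF xi(1) finite_imageI[OF finite_lessThan] subset_refl, of g "x i"] r i by auto
      then show ?thesis using xinj i by (simp add: g_def inv_into_f_f)
    qed
    have fcomb: "f (int_comb R n b d) = (\<Sum>i<n. of_int (d i) *\<^sub>R x i)" for d
      using rep_int_comb[OF f bc, of d] b(2) by simp
    have basis: "int_basis R n b"
      unfolding int_basis_def
    proof (intro conjI bc ballI)
      fix z assume z: "z \<in> carrier R"
      then obtain d where d: "f z = (\<Sum>i<n. of_int (d i :: int) *\<^sub>R x i)" using xs[of "f z"] by auto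
      define d' where "d' i = (if i < n then d i else 0)" for i
      have "f (int_comb R n b d') = f z" unfolding fcomb d by (rule sum.cong) (auto simp: d'_def)
      then have "f (z \<ominus>\<^bsub>R\<^esub> int_comb R n b d') = 0" using z int_comb_closed[OF bc] by (simp add: rep_diff[OF f])
      then have "z \<ominus>\<^bsub>R\<^esub> int_comb R n b d' = \<zero>\<^bsub>R\<^esub>" using z int_comb_closed[OF bc] by (intro rep_inj[OF f]) auto
      then have zd: "z = int_comb R n b d'" using z int_comb_closed[OF bc, of d'] by simp
      show "\<exists>!c. (\<forall>i\<ge>n. c i = 0) \<and> z = int_comb R n b c"
      proof (rule ex1I[of _ d'])
        show "(\<forall>i\<ge>n. d' i = 0) \<and> z = int_comb R n b d'" using zd by (simp add: d'_def)
        fix k assume k: "(\<forall>i\<ge>n. k i = 0) \<and> z = int_comb R n b k"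
        have "(\<Sum>i<n. (of_int (k i) - of_int (d' i)) *\<^sub>R x i) = f (int_comb R n b k) - f (int_comb R n b d')"
          by (simp only: fcomb sum_subtractf scaleR_diff_left)
        also have "\<dots> = 0" using k zd by simp
        finally have "real_of_int (k i) - of_int (d' i) = 0" if "i < n" for i
          using xker[of "\<lambda>i. of_int (k i) - of_int (d' i)" i] that by simp
        then have "k i = d' i" for i using k by (cases "i < n") (auto simp: d'_def)
        then show "k = d'" by auto
      qed
    qed
    define N where "N j = norm (perp (x j))" for j
    have normx: "norm (x j) = sqrt n * ring_length n R (b j)" if "j < n" for j
      using norm_rep[OF f b(1), of j] b(2)[OF that] by simp
    have ne: "(norm (f \<one>\<^bsub>R\<^esub>))\<^sup>2 = n" using rep_one_inner[OF f] by (simp add: power2_norm_eq_inner)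
    have c'pos: "c' > 0" using c(1) n_pos by (simp add: c'_def)
    have Nc: "N j \<ge> c'" if j: "1 \<le> j" "j < n" for j
    proof -
      obtain w where w: "w \<in> carrier R" "f (b j) - ((f (b j) \<bullet> f \<one>\<^bsub>R\<^esub>) / (f \<one>\<^bsub>R\<^esub> \<bullet> f \<one>\<^bsub>R\<^esub>)) *\<^sub>R f \<one>\<^bsub>R\<^esub> = (1 / n) *\<^sub>R f w"
        using rep_perp[OF f b(1)] .
      have pw: "perp (x j) = (1 / n) *\<^sub>R f w" using w(2) b(2)[OF j(2)] by (simp add: perp_def)
      then have "f w \<noteq> 0" using Np[OF j] by auto
      then have "w \<noteq> \<zero>\<^bsub>R\<^esub>" using rep_zero[OF f] by auto
      then have "ring_length n R w \<ge> c" using c(2)[OF R w(1)] by simp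
      then have "sqrt n * c \<le> norm (f w)" by (simp add: norm_rep[OF f w(1)] mult_left_mono)
      then show ?thesis by (simp add: N_def pw c'_def divide_right_mono)
    qed
    have normx_le: "norm (x i) \<le> A * N j" if ij: "i \<le> j" "1 \<le> j" "j < n" for i j
    proof (cases "i = 0")
      case True
      have "norm (x i) = sqrt n / c' * c'" using True x0 ne c'pos by (simp add: real_sqrt_unique)
      also have "\<dots> \<le> A * N j"
      proof (rule mult_mono)
        show "sqrt n / c' \<le> A" by (simp add: A_def)
      qed (use Nc[OF ij(2,3)] c'pos A1 in auto)
      finally show ?thesis .
    next
      case False
      then have i: "1 \<le> i" "i < n" using ij by auto
      have "n / 4 = n / (4 * c'\<^sup>2) * c'\<^sup>2" using c'pos by simp
      also have "\<dots> \<le> n / (4 * c'\<^sup>2) * (N i)\<^sup>2"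
        using Nc[OF i] c'pos by (intro mult_left_mono power_mono) auto
      finally have "n / 4 \<le> n / (4 * c'\<^sup>2) * (N i)\<^sup>2" .
      moreover have "(norm (x i))\<^sup>2 \<le> (N i)\<^sup>2 + n / 4" using xN[OF i] ne by (simp add: N_def)
      ultimately have "(norm (x i))\<^sup>2 \<le> (N i)\<^sup>2 + n / (4 * c'\<^sup>2) * (N i)\<^sup>2" by linarith
      also have "\<dots> = (sqrt (1 + n / (4 * c'\<^sup>2)) * N i)\<^sup>2"
        by (simp add: power_mult_distrib algebra_simps)
      finally have "norm (x i) \<le> sqrt (1 + n / (4 * c'\<^sup>2)) * N i"
        by (rule power2_le_imp_le) (simp add: N_def)
      also have "\<dots> \<le> A * N j"
      proof (rule mult_mono)
        show "sqrt (1 + n / (4 * c'\<^sup>2)) \<le> A" by (simp add: A_def)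
      qed (use Nm[OF i(1) ij(1,3)] A1 in \<open>auto simp: N_def\<close>)
      finally show ?thesis .
    qed
    have sqn: "sqrt n \<ge> 1" using n_pos by simp
    have blen: "ring_length n R (b i) \<le> A * N j" if ij: "i \<le> j" "1 \<le> j" "j < n" for i j
    proof -
      have "ring_length n R (b i) \<le> sqrt n * ring_length n R (b i)"
        using mult_right_mono[OF sqn length_ge_0[of "b i"]] by simp
      then show ?thesis using normx_le[OF ij] normx[of i] ij by simp
    qed
    have upper: "succ_min n R j \<le> A * N j" if j: "1 \<le> j" "j < n" for j
      by (rule succ_min_leI[OF j(2) basis_independent(1)[OF basis, of "j + 1"]])
        (use basis_independent(2)[OF basis, of "j + 1"] j blen[of _ j] in auto)
    have lower: "N j \<le> sqrt n * succ_min n R j" if j: "1 \<le> j" "j < n" for j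
    proof -
      obtain S where S: "int_independent R S" "card S = j + 1" "\<forall>z\<in>S. ring_length n R z \<le> succ_min n R j"
        using succ_min_least(1)[OF j(2)] by (auto simp: sm_bound_def)
      have Sf: "finite S" "S \<subseteq> carrier R" using S(1) by (auto simp: int_independent_def)
      \<comment> \<open>Otherwise the \<open>j + 1\<close> elements of \<open>S\<close> would be
        integral combinations of \<open>j\<close> vectors and hence dependent over the
        integers.\<close>
      have "\<exists>z\<in>S. f z \<notin> span (x ` {..<j})"
      proof (rule ccontr)
        assume "\<not> (\<exists>z\<in>S. f z \<notin> span (x ` {..<j}))"
        then have "\<exists>k. z \<in> S \<longrightarrow> f z = (\<Sum>i<j. of_int (k i :: int) *\<^sub>R x i)" for z
          using xs'[of j "f z"] Sf j by (cases "z \<in> S") auto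
        then obtain k where k: "\<And>z. z \<in> S \<Longrightarrow> f z = (\<Sum>i<j. of_int (k z i :: int) *\<^sub>R x i)" by metis
        obtain d where d: "\<exists>z\<in>S. d z \<noteq> 0" "\<forall>i<j. (\<Sum>z\<in>S. d z * k z i) = 0"
          using int_dependence[OF Sf(1), of j "\<lambda>i z. k z i"] S(2) by auto
        have "f (\<Oplus>\<^bsub>R\<^esub>z\<in>S. [d z] \<cdot>\<^bsub>R\<^esub> z) = (\<Sum>z\<in>S. f ([d z] \<cdot>\<^bsub>R\<^esub> z))"
          using Sf by (intro rep_sum[OF f]) auto
        also have "\<dots> = (\<Sum>z\<in>S. of_int (d z) *\<^sub>R f z)"
          using Sf by (intro sum.cong) (auto simp: rep_int_smult[OF f])
        also have "\<dots> = (\<Sum>z\<in>S. \<Sum>i<j. of_int (d z * k z i) *\<^sub>R x i)"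
          by (rule sum.cong) (auto simp: k scaleR_sum_right)
        also have "\<dots> = (\<Sum>i<j. of_int (\<Sum>z\<in>S. d z * k z i) *\<^sub>R x i)"
          by (subst sum.swap) (simp add: scaleR_sum_left)
        also have "\<dots> = 0" using d(2) by simp
        finally have "(\<Oplus>\<^bsub>R\<^esub>z\<in>S. [d z] \<cdot>\<^bsub>R\<^esub> z) = \<zero>\<^bsub>R\<^esub>"
          using Sf by (intro rep_inj[OF f] finsum_closed) auto
        then show False using S(1) d(1) by (auto simp: int_independent_def)
      qed
      then obtain z where z: "z \<in> S" "f z \<notin> span (x ` {..<j})" by auto
      have "N j \<le> norm (f z)" using xl[OF j _ z(2)] z(1) Sf by (auto simp: N_def)
      also have "\<dots> \<le> sqrt n * succ_min n R j"
        using S(3) z(1) Sf by (subst norm_rep[OF f]) (auto intro!: mult_left_mono)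
      finally show ?thesis .
    qed
    have smc: "succ_min n R j \<ge> c / n" if j: "1 \<le> j" "j < n" for j
    proof -
      have "sqrt n * (c / n) \<le> sqrt n * succ_min n R j" using Nc[OF j] lower[OF j] by (simp add: c'_def)
      then show ?thesis by (rule mult_left_le_imp_le) (use n_pos in simp)
    qed
    have smp: "succ_min n R j > 0" if j: "1 \<le> j" "j < n" for j
      using less_le_trans[OF _ smc[OF j], of 0] c(1) n_pos by simp
    have K0: "K > 0" using K(1) by simp
    \<comment> \<open>The Gram determinant of the reduced basis is the product of the squared
      Gram-Schmidt lengths, and the factor belonging to the unit is \<open>n\<close>.\<close>
    have dprod: "sqrt \<bar>real_of_int (disc n R)\<bar> = sqrt n * (\<Prod>j\<in>{1..<n}. norm (y j))"
    proof -
      have "\<bar>real_of_int (disc n R)\<bar> = det (mat n n (\<lambda>(i, j). emb_inner (b i) (b j)))"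
        by (rule abs_disc_gram[OF basis])
      also have "mat n n (\<lambda>(i, j). emb_inner (b i) (b j)) = mat n n (\<lambda>(i, j). x i \<bullet> x j)"
        by (rule eq_matI) (auto simp: rep_inner[OF f b(1) b(1), symmetric] b(2))
      also have "det \<dots> = (\<Prod>j<n. y j \<bullet> y j)" by (rule det_gram) (use yo xy in auto)
      also have "\<dots> = (\<Prod>j<n. norm (y j))\<^sup>2" by (simp add: prod_power_distrib power2_norm_eq_inner)
      finally have "sqrt \<bar>real_of_int (disc n R)\<bar> = (\<Prod>j<n. norm (y j))" by (simp add: prod_nonneg)
      also have "norm (y 0) = sqrt n" using y0 ne by (simp add: real_sqrt_unique)
      then have "(\<Prod>j<n. norm (y j)) = sqrt n * (\<Prod>j\<in>{1..<n}. norm (y j))"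
        using prod_lessThan_split[OF n_pos, of "\<lambda>j. norm (y j)"] by simp
      finally show ?thesis .
    qed
    show ?thesis
    proof (intro exI[of _ b] conjI allI impI basis b(3))
      fix j assume j: "1 \<le> j" "j < n"
      have "sqrt n * ring_length n R (b j) \<le> A * N j" using normx_le[of j j] normx[of j] j by simp
      also have "\<dots> \<le> A * (sqrt n * succ_min n R j)" using lower[OF j] A1 by (intro mult_left_mono) auto
      finally have "ring_length n R (b j) \<le> A * succ_min n R j" using sqn by (simp add: mult.left_commute[of A])
      also have "\<dots> \<le> K * succ_min n R j" using K(2) smp[OF j] by (intro mult_right_mono) auto
      finally show "ring_length n R (b j) \<le> K * succ_min n R j" .
      have "1 / K \<le> 1 / (n / c)" using K(3) c(1) n_pos K0 by (intro divide_left_mono) auto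
      then show "1 / K \<le> succ_min n R j" using smc[OF j] by simp
    next
      have "(\<Prod>j\<in>{1..<n}. norm (y j)) \<le> sqrt n ^ p * (\<Prod>j\<in>{1..<n}. succ_min n R j)"
        unfolding p_def by (rule prod_le_power) (use yN lower in \<open>force simp: N_def\<close>)
      then have "sqrt n * (\<Prod>j\<in>{1..<n}. norm (y j)) \<le> sqrt n * (sqrt n ^ p * (\<Prod>j\<in>{1..<n}. succ_min n R j))"
        by (rule mult_left_mono) simp
      also have "\<dots> \<le> K * (\<Prod>j\<in>{1..<n}. succ_min n R j)"
        unfolding mult.assoc[symmetric] using K(4) smp by (intro mult_right_mono prod_nonneg) (auto intro: less_imp_le)
      finally show "sqrt \<bar>real_of_int (disc n R)\<bar> \<le> K * (\<Prod>j\<in>{1..<n}. succ_min n R j)"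
        unfolding dprod .
      have Ny': "N j \<le> sqrt 2 * norm (y j)" if j: "1 \<le> j" "j < n" for j
      proof -
        have "(N j)\<^sup>2 \<le> (sqrt 2 * norm (y j))\<^sup>2" using Ny[OF j] by (simp add: N_def power_mult_distrib)
        then show ?thesis by (rule power2_le_imp_le) simp
      qed
      have "(\<Prod>j\<in>{1..<n}. succ_min n R j) \<le> (A * sqrt 2) ^ p * (\<Prod>j\<in>{1..<n}. norm (y j))"
        unfolding p_def
      proof (rule prod_le_power)
        fix j assume "j \<in> {1..<n}"
        then have j: "1 \<le> j" "j < n" by auto
        have "A * N j \<le> A * (sqrt 2 * norm (y j))" using Ny'[OF j] A1 by (intro mult_left_mono) auto
        then show "0 \<le> succ_min n R j \<and> succ_min n R j \<le> A * sqrt 2 * norm (y j)"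
          using upper[OF j] smp[OF j] by simp
      qed
      also have "\<dots> \<le> K * (\<Prod>j\<in>{1..<n}. norm (y j))"
        using K(5) by (intro mult_right_mono prod_nonneg) auto
      also have "\<dots> \<le> K * (sqrt n * (\<Prod>j\<in>{1..<n}. norm (y j)))"
      proof (rule mult_left_mono)
        show "(\<Prod>j\<in>{1..<n}. norm (y j)) \<le> sqrt n * (\<Prod>j\<in>{1..<n}. norm (y j))"
          using mult_right_mono[OF sqn, of "\<Prod>j\<in>{1..<n}. norm (y j)"] by (simp add: prod_nonneg)
      qed (use K0 in simp)
      finally show "(\<Prod>j\<in>{1..<n}. succ_min n R j) \<le> K * sqrt \<bar>real_of_int (disc n R)\<bar>"
        unfolding dprod .
    qed
  qed
  then show ?thesis using K(1) by blast
qed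

lemma (in embedded_ring) lattice_rep4:
  assumes "n = 4"
  shows "\<exists>f :: 'a \<Rightarrow> complex \<times> complex \<times> complex \<times> complex. lattice_rep f"
proof -
  let ?s = enum_emb
  have lt: "?s 0 \<in> embeddings R" "?s (Suc 0) \<in> embeddings R" "?s 2 \<in> embeddings R" "?s 3 \<in> embeddings R"
    using assms enum_in by auto
  have "{..<n} = {0, 1, 2, 3}" using assms by auto
  then have "emb_inner x y = (\<Sum>i\<in>{0, 1, 2, 3}. Re (?s i x * cnj (?s i y)))" for x y
    unfolding emb_inner_def using sum_enum[of "\<lambda>\<sigma>. Re (\<sigma> x * cnj (\<sigma> y))"] by simp
  then have "lattice_rep (\<lambda>x. (?s 0 x, ?s 1 x, ?s 2 x, ?s 3 x))"
    by (simp add: lattice_rep_def emb_add[OF lt(1)] emb_add[OF lt(2)] emb_add[OF lt(3)] emb_add[OF lt(4)] inner_prod_def inner_complex_def)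
  then show ?thesis by blast
qed

lemma (in embedded_ring) lattice_rep3:
  assumes "n = 3"
  shows "\<exists>f :: 'a \<Rightarrow> complex \<times> complex \<times> complex. lattice_rep f"
proof -
  let ?s = enum_emb
  have lt: "?s 0 \<in> embeddings R" "?s (Suc 0) \<in> embeddings R" "?s 2 \<in> embeddings R"
    using assms enum_in by auto
  have "{..<n} = {0, 1, 2}" using assms by auto
  then have "emb_inner x y = (\<Sum>i\<in>{0, 1, 2}. Re (?s i x * cnj (?s i y)))" for x y
    unfolding emb_inner_def using sum_enum[of "\<lambda>\<sigma>. Re (\<sigma> x * cnj (\<sigma> y))"] by simp
  then have "lattice_rep (\<lambda>x. (?s 0 x, ?s 1 x, ?s 2 x))"
    by (simp add: lattice_rep_def emb_add[OF lt(1)] emb_add[OF lt(2)] emb_add[OF lt(3)] inner_prod_def inner_complex_def)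
  then show ?thesis by blast
qed

section \<open>Extension of field embeddings\<close>

definition complex_subfield :: "complex set \<Rightarrow> bool" where
  "complex_subfield F \<longleftrightarrow> 1 \<in> F \<and> (\<forall>x\<in>F. \<forall>y\<in>F. x - y \<in> F \<and> x * y \<in> F) \<and> (\<forall>x\<in>F. inverse x \<in> F)"

text \<open>Fields are sets of complex numbers and homomorphisms are functions constrained on such a
  set only. No target is fixed, so that images can be looked for among all complex roots of a
  polynomial.\<close>

definition field_hom_on :: "complex set \<Rightarrow> (complex \<Rightarrow> complex) \<Rightarrow> bool" where
  "field_hom_on F g \<longleftrightarrow> g 1 = 1 \<and> (\<forall>x\<in>F. \<forall>y\<in>F. g (x + y) = g x + g y \<and> g (x * y) = g x * g y)"

definition poly_over :: "complex set \<Rightarrow> complex poly \<Rightarrow> bool" where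
  "poly_over F p \<longleftrightarrow> (\<forall>i. Polynomial.coeff p i \<in> F)"

context
  fixes F :: "complex set" assumes F: "complex_subfield F"
begin

lemma subfield_one: "1 \<in> F"
  and subfield_diff: "x \<in> F \<Longrightarrow> y \<in> F \<Longrightarrow> x - y \<in> F"
  and subfield_mult: "x \<in> F \<Longrightarrow> y \<in> F \<Longrightarrow> x * y \<in> F"
  and subfield_inverse: "x \<in> F \<Longrightarrow> inverse x \<in> F"
  using F by (auto simp: complex_subfield_def)

lemma subfield_zero: "0 \<in> F"
  using subfield_diff[OF subfield_one subfield_one] by simp

lemma subfield_minus: "x \<in> F \<Longrightarrow> - x \<in> F"
  using subfield_diff[OF subfield_zero] by force

lemma subfield_add: "x \<in> F \<Longrightarrow> y \<in> F \<Longrightarrow> x + y \<in> F"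
  using subfield_diff[OF _ subfield_minus, of x y] by simp

lemma subfield_sum: "(\<And>i. i \<in> A \<Longrightarrow> h i \<in> F) \<Longrightarrow> sum h A \<in> F"
  by (induction A rule: infinite_finite_induct) (auto simp: subfield_zero subfield_add)

lemma subfield_of_nat: "of_nat k \<in> F"
  by (induction k) (auto simp: subfield_zero subfield_one subfield_add)

lemma subfield_of_int: "of_int k \<in> F"
  by (cases k) (auto simp: subfield_of_nat intro!: subfield_minus subfield_diff subfield_one)

lemma subfield_Rats: "\<rat> \<subseteq> F"
proof
  fix x :: complex assume "x \<in> \<rat>"
  then obtain a b :: int where "x = of_int a / of_int b" by (elim Rats_cases') auto
  then show "x \<in> F" by (simp add: divide_inverse subfield_mult subfield_inverse subfield_of_int)
qed

lemma over_const: "a \<in> F \<Longrightarrow> poly_over F [:a:]"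
  by (auto simp: poly_over_def coeff_pCons subfield_zero split: nat.split)

lemma over_zero: "poly_over F 0" by (simp add: poly_over_def subfield_zero)

lemma over_diff: "poly_over F p \<Longrightarrow> poly_over F q \<Longrightarrow> poly_over F (p - q)"
  by (simp add: poly_over_def subfield_diff)

lemma over_add: "poly_over F p \<Longrightarrow> poly_over F q \<Longrightarrow> poly_over F (p + q)"
  by (simp add: poly_over_def subfield_add)

lemma over_mult: "poly_over F p \<Longrightarrow> poly_over F q \<Longrightarrow> poly_over F (p * q)"
  unfolding poly_over_def coeff_mult by (auto intro!: subfield_sum subfield_mult)

lemma over_smult: "a \<in> F \<Longrightarrow> poly_over F p \<Longrightarrow> poly_over F (Polynomial.smult a p)"
  by (simp add: poly_over_def subfield_mult)

lemma over_monom: "a \<in> F \<Longrightarrow> poly_over F (Polynomial.monom a k)"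
  by (auto simp: poly_over_def subfield_zero)

lemma over_X: "poly_over F [:0, 1:]"
  by (auto simp: poly_over_def coeff_pCons subfield_zero subfield_one split: nat.split)

text \<open>Long division by a monic polynomial, carried out so that quotient and remainder visibly
  keep their coefficients in \<open>F\<close>, although the polynomial type allows all complex
  coefficients.\<close>

lemma over_divide:
  assumes m: "poly_over F m" "Polynomial.lead_coeff m = 1"
  shows "poly_over F p \<Longrightarrow> \<exists>q r. poly_over F q \<and> poly_over F r \<and> p = m * q + r \<and> (r = 0 \<or> Polynomial.degree r < Polynomial.degree m)"
proof (induction "Polynomial.degree p" arbitrary: p rule: less_induct)
  case less
  show ?case
  proof (cases "p = 0 \<or> Polynomial.degree p < Polynomial.degree m")
    case True
    then show ?thesis using less.prems by (intro exI[of _ 0] exI[of _ p]) (auto simp: over_zero)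
  next
    case False
    define k where "k = Polynomial.degree p - Polynomial.degree m"
    define t where "t = Polynomial.monom (Polynomial.lead_coeff p) k"
    have "Polynomial.lead_coeff p \<in> F" using less.prems by (simp add: poly_over_def)
    then have t: "poly_over F t" unfolding t_def by (rule over_monom)
    have lp: "Polynomial.lead_coeff p \<noteq> 0" "m \<noteq> 0" using False m by auto
    have t0: "t \<noteq> 0" using lp by (simp add: t_def)
    have deg: "Polynomial.degree (m * t) = Polynomial.degree p"
      using False lp t0 by (simp add: degree_mult_eq t_def degree_monom_eq k_def)
    have lc: "Polynomial.lead_coeff (m * t) = Polynomial.lead_coeff p"
      using m(2) lp by (simp add: lead_coeff_mult t_def degree_monom_eq)
    define p' where "p' = p - m * t"
    have p': "poly_over F p'" unfolding p'_def by (intro over_diff over_mult less.prems m t)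
    have small: "p' = 0 \<or> Polynomial.degree p' < Polynomial.degree p"
    proof (cases "Polynomial.degree p = 0")
      case True
      then have "Polynomial.coeff p' i = 0" for i
        using deg lc coeff_eq_0[of p i] coeff_eq_0[of "m * t" i] by (cases "i = 0") (auto simp: p'_def)
      then show ?thesis by (simp add: poly_eq_iff)
    next
      case False
      have "Polynomial.coeff p' (Polynomial.degree p) = 0" using deg lc by (simp add: p'_def)
      moreover have "Polynomial.degree p' \<le> Polynomial.degree p" unfolding p'_def using deg by (intro degree_diff_le) auto
      ultimately show ?thesis using False by (metis eq_zero_or_degree_less)
    qed
    obtain q r where qr: "poly_over F q" "poly_over F r" "p' = m * q + r" "r = 0 \<or> Polynomial.degree r < Polynomial.degree m"
    proof (cases "p' = 0")
      case True
      then show thesis using that[of 0 0] by (simp add: over_zero)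
    next
      case False
      then show thesis using less.hyps[of p'] small p' that by blast
    qed
    have "p = m * (q + t) + r" using qr(3) by (simp add: p'_def algebra_simps)
    then show ?thesis using qr t over_add by blast
  qed
qed

definition min_over :: "complex \<Rightarrow> complex poly \<Rightarrow> bool" where
  "min_over \<alpha> m \<longleftrightarrow> poly_over F m \<and> Polynomial.lead_coeff m = 1 \<and> poly m \<alpha> = 0 \<and>
     (\<forall>q. poly_over F q \<longrightarrow> q \<noteq> 0 \<longrightarrow> poly q \<alpha> = 0 \<longrightarrow> Polynomial.degree m \<le> Polynomial.degree q)"

lemma min_over_exists:
  assumes "poly_over F p" "p \<noteq> 0" "poly p \<alpha> = 0"
  shows "\<exists>m. min_over \<alpha> m"
proof -
  define P where "P q \<longleftrightarrow> poly_over F q \<and> q \<noteq> 0 \<and> poly q \<alpha> = 0" for q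
  obtain q where q: "P q" "\<And>r. P r \<Longrightarrow> Polynomial.degree q \<le> Polynomial.degree r"
    using ex_has_least_nat[of P p Polynomial.degree] assms by (auto simp: P_def)
  define m where "m = Polynomial.smult (inverse (Polynomial.lead_coeff q)) q"
  have "poly_over F m" unfolding m_def using q(1) by (intro over_smult subfield_inverse) (auto simp: P_def poly_over_def)
  moreover have "Polynomial.lead_coeff m = 1" using q(1) by (simp add: m_def P_def)
  moreover have "Polynomial.degree m = Polynomial.degree q" using q(1) by (simp add: m_def P_def)
  moreover have "poly m \<alpha> = 0" using q(1) by (simp add: m_def P_def)
  ultimately show ?thesis using q(2) by (intro exI[of _ m]) (auto simp: min_over_def P_def)
qed

lemma min_over_dvd:
  assumes m: "min_over \<alpha> m" and p: "poly_over F p" "poly p \<alpha> = 0"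
  shows "\<exists>q. poly_over F q \<and> p = m * q"
proof -
  obtain q r where qr: "poly_over F q" "poly_over F r" "p = m * q + r" "r = 0 \<or> Polynomial.degree r < Polynomial.degree m"
    using over_divide[of m p] m p by (auto simp: min_over_def)
  have "poly r \<alpha> = 0" using qr(3) p(2) m by (simp add: min_over_def)
  then have "r = 0" using qr m unfolding min_over_def by (metis not_le)
  then show ?thesis using qr by auto
qed

lemma min_over_nonconst:
  assumes m: "min_over \<alpha> m"
  shows "Polynomial.degree m > 0"
proof (rule ccontr)
  assume "\<not> Polynomial.degree m > 0"
  then obtain c where "m = [:c:]" by (metis degree_eq_zeroE neq0_conv)
  then show False using m by (auto simp: min_over_def)
qed

definition adjoin :: "complex \<Rightarrow> complex set" where
  "adjoin \<alpha> = {poly p \<alpha> |p. poly_over F p}"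

text \<open>Dividing \<open>m\<close> by the monic multiple of \<open>p\<close> expresses the value
  of \<open>p\<close> times another value as minus the value of a remainder of smaller degree, which
  is invertible by induction. A zero remainder forces \<open>p\<close> to be constant by the
  minimality of \<open>m\<close>.\<close>

lemma adjoin_inverse:
  assumes m: "min_over \<alpha> m"
  shows "poly_over F p \<Longrightarrow> p \<noteq> 0 \<Longrightarrow> Polynomial.degree p < Polynomial.degree m \<Longrightarrow>
    \<exists>q. poly_over F q \<and> poly p \<alpha> * poly q \<alpha> = 1"
proof (induction "Polynomial.degree p" arbitrary: p rule: less_induct)
  case less
  define a where "a = Polynomial.lead_coeff p"
  have a: "a \<in> F" "a \<noteq> 0" using less.prems by (auto simp: a_def poly_over_def)
  define p1 where "p1 = Polynomial.smult (inverse a) p"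
  have p1: "poly_over F p1" "Polynomial.lead_coeff p1 = 1" "Polynomial.degree p1 = Polynomial.degree p"
    using a less.prems by (auto simp: p1_def a_def intro!: over_smult subfield_inverse)
  obtain q r where qr: "poly_over F q" "poly_over F r" "m = p1 * q + r" "r = 0 \<or> Polynomial.degree r < Polynomial.degree p"
    using over_divide[OF p1(1,2), of m] m p1(3) by (auto simp: min_over_def)
  have pa: "poly p1 \<alpha> * poly q \<alpha> = - poly r \<alpha>" using qr(3) m by (auto simp: min_over_def eq_neg_iff_add_eq_0)
  show ?case
  proof (cases "r = 0")
    case True
    have "q \<noteq> 0" using qr(3) True m by (auto simp: min_over_def)
    have p1nz: "p1 \<noteq> 0" using p1(2) by auto
    have dm: "Polynomial.degree m = Polynomial.degree p1 + Polynomial.degree q"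
      using qr(3) True \<open>q \<noteq> 0\<close> p1nz by (simp add: degree_mult_eq)
    have "poly p1 \<alpha> \<noteq> 0" using m p1 p1nz less.prems(3) unfolding min_over_def by (metis not_le)
    then have "poly q \<alpha> = 0" using pa True by simp
    then have "Polynomial.degree m \<le> Polynomial.degree q" using m qr(1) \<open>q \<noteq> 0\<close> by (auto simp: min_over_def)
    then have "Polynomial.degree p = 0" using dm p1(3) by simp
    then obtain c where "p = [:c:]" by (metis degree_eq_zeroE)
    then have "p = [:a:]" by (simp add: a_def)
    then show ?thesis using a by (intro exI[of _ "[:inverse a:]"]) (simp add: over_const subfield_inverse)
  next
    case False
    then have "Polynomial.degree r < Polynomial.degree p" using qr by auto
    then obtain s where s: "poly_over F s" "poly r \<alpha> * poly s \<alpha> = 1"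
      using less.hyps[of r] qr False less.prems by auto
    define w where "w = Polynomial.smult (- inverse a) (q * s)"
    have "poly_over F w" unfolding w_def using a qr s by (intro over_smult over_mult subfield_minus subfield_inverse) auto
    moreover have "poly p \<alpha> * poly w \<alpha> = - (poly p1 \<alpha> * poly q \<alpha>) * poly s \<alpha>"
      by (simp add: w_def p1_def)
    then have "poly p \<alpha> * poly w \<alpha> = 1" using pa s(2) by simp
    ultimately show ?thesis by blast
  qed
qed

lemma adjoin_subfield:
  assumes m: "min_over \<alpha> m"
  shows "complex_subfield (adjoin \<alpha>)"
  unfolding complex_subfield_def
proof (intro conjI ballI)
  show "1 \<in> adjoin \<alpha>" unfolding adjoin_def using over_const[OF subfield_one] by (intro CollectI exI[of _ "[:1:]"]) auto
  fix x assume "x \<in> adjoin \<alpha>"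
  then obtain p where p: "x = poly p \<alpha>" "poly_over F p" by (auto simp: adjoin_def)
  show "inverse x \<in> adjoin \<alpha>"
  proof (cases "x = 0")
    case True
    then show ?thesis unfolding adjoin_def using over_zero by (intro CollectI exI[of _ 0]) auto
  next
    case False
    obtain q r where qr: "poly_over F q" "poly_over F r" "p = m * q + r" "r = 0 \<or> Polynomial.degree r < Polynomial.degree m"
      using over_divide[of m p] m p by (auto simp: min_over_def)
    have xr: "x = poly r \<alpha>" using qr(3) p(1) m by (simp add: min_over_def)
    then obtain s where "poly_over F s" "poly r \<alpha> * poly s \<alpha> = 1"
      using adjoin_inverse[OF m qr(2)] qr(4) False by (metis poly_0)
    then have "inverse x = poly s \<alpha>" using xr by (metis inverse_unique)
    then show ?thesis using \<open>poly_over F s\<close> by (auto simp: adjoin_def)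
  qed
  fix y assume "y \<in> adjoin \<alpha>"
  then obtain q where q: "y = poly q \<alpha>" "poly_over F q" by (auto simp: adjoin_def)
  show "x - y \<in> adjoin \<alpha>" unfolding adjoin_def using p q over_diff by (intro CollectI exI[of _ "p - q"]) auto
  show "x * y \<in> adjoin \<alpha>" unfolding adjoin_def using p q over_mult by (intro CollectI exI[of _ "p * q"]) auto
qed

lemma adjoin_mem: "\<alpha> \<in> adjoin \<alpha>" and adjoin_mono: "F \<subseteq> adjoin \<alpha>"
proof -
  show "\<alpha> \<in> adjoin \<alpha>" unfolding adjoin_def using over_X by (intro CollectI exI[of _ "[:0, 1:]"]) auto
  show "F \<subseteq> adjoin \<alpha>" unfolding adjoin_def using over_const by (intro subsetI CollectI) (metis poly_pCons mult_zero_right add_0_right poly_0)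
qed

section \<open>Extending homomorphisms to simple extensions\<close>

context
  fixes g assumes g: "field_hom_on F g"
begin

lemma hom_one: "g 1 = 1"
  and hom_add: "x \<in> F \<Longrightarrow> y \<in> F \<Longrightarrow> g (x + y) = g x + g y"
  and hom_mult: "x \<in> F \<Longrightarrow> y \<in> F \<Longrightarrow> g (x * y) = g x * g y"
  using g by (auto simp: field_hom_on_def)

lemma hom_zero: "g 0 = 0"
  using hom_add[OF subfield_zero subfield_zero] by simp

lemma hom_minus: "x \<in> F \<Longrightarrow> g (- x) = - g x"
  using hom_add[OF _ subfield_minus, of x x] hom_zero by (simp add: eq_neg_iff_add_eq_0 add.commute)

lemma hom_diff: "x \<in> F \<Longrightarrow> y \<in> F \<Longrightarrow> g (x - y) = g x - g y"
  using hom_add[OF _ subfield_minus, of x y] hom_minus by simp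

lemma hom_eq_0: "x \<in> F \<Longrightarrow> g x = 0 \<longleftrightarrow> x = 0"
  using hom_mult[OF _ subfield_inverse, of x x] hom_one hom_zero by (cases "x = 0") auto

lemma hom_inj: "x \<in> F \<Longrightarrow> y \<in> F \<Longrightarrow> g x = g y \<longleftrightarrow> x = y"
  using hom_eq_0[OF subfield_diff, of x y] hom_diff[of x y] by auto

lemma hom_inverse:
  assumes "x \<in> F"
  shows "g (inverse x) = inverse (g x)"
proof (cases "x = 0")
  case False
  then have "g x * g (inverse x) = 1"
    using hom_mult[OF assms subfield_inverse[OF assms]] hom_one by simp
  then show ?thesis by (rule inverse_unique[symmetric])
qed (simp add: hom_zero)

lemma hom_sum: "(\<And>i. i \<in> A \<Longrightarrow> h i \<in> F) \<Longrightarrow> g (sum h A) = (\<Sum>i\<in>A. g (h i))"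
  by (induction A rule: infinite_finite_induct) (auto simp: hom_zero hom_add subfield_sum)

lemma hom_of_nat: "g (of_nat k) = of_nat k"
  by (induction k) (auto simp: hom_zero hom_one hom_add subfield_one subfield_of_nat)

lemma hom_of_int: "g (of_int k) = of_int k"
proof (cases k)
  case (neg n)
  have "g (- of_nat (Suc n)) = - of_nat (Suc n)"
    using hom_minus[OF subfield_of_nat, of "Suc n"] hom_of_nat[of "Suc n"] by simp
  then show ?thesis using neg by (simp only: of_int_minus of_int_of_nat_eq)
qed (simp add: hom_of_nat)

lemma map_hom_mult:
  assumes "poly_over F p" "poly_over F q"
  shows "map_poly g (p * q) = map_poly g p * map_poly g q"
proof (rule poly_eqI)
  fix n
  have "Polynomial.coeff (map_poly g (p * q)) n = (\<Sum>i\<le>n. g (Polynomial.coeff p i * Polynomial.coeff q (n - i)))"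
    using assms by (simp add: coeff_map_poly hom_zero coeff_mult hom_sum subfield_mult poly_over_def)
  then show "Polynomial.coeff (map_poly g (p * q)) n = Polynomial.coeff (map_poly g p * map_poly g q) n"
    using assms by (simp add: coeff_map_poly hom_zero coeff_mult hom_mult poly_over_def)
qed

lemma map_hom_add:
  assumes "poly_over F p" "poly_over F q"
  shows "map_poly g (p + q) = map_poly g p + map_poly g q"
  using assms by (intro poly_eqI) (simp add: coeff_map_poly hom_zero hom_add poly_over_def)

lemma map_hom_diff:
  assumes "poly_over F p" "poly_over F q"
  shows "map_poly g (p - q) = map_poly g p - map_poly g q"
  using assms by (intro poly_eqI) (simp add: coeff_map_poly hom_zero hom_diff poly_over_def)

lemma map_hom_degree: "poly_over F p \<Longrightarrow> Polynomial.degree (map_poly g p) = Polynomial.degree p"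
  by (cases "p = 0") (auto intro!: map_poly_degree_eq simp: hom_eq_0 poly_over_def)

text \<open>An element of the extension is written as a polynomial in \<alpha>, and the transported
  polynomial is evaluated at \<beta>. Two such polynomials differ by a multiple of \<open>m\<close>,
  whose transport vanishes at \<beta>, so the choice does not matter.\<close>

lemma extend_hom:
  assumes m: "min_over \<alpha> m" and \<beta>: "poly (map_poly g m) \<beta> = 0"
  shows "\<exists>g'. field_hom_on (adjoin \<alpha>) g' \<and> (\<forall>x\<in>F. g' x = g x) \<and> g' \<alpha> = \<beta>"
proof -
  have wd: "poly (map_poly g p) \<beta> = poly (map_poly g q) \<beta>"
    if pq: "poly_over F p" "poly_over F q" "poly p \<alpha> = poly q \<alpha>" for p q
  proof -
    obtain r where r: "poly_over F r" "p - q = m * r"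
      using min_over_dvd[OF m over_diff[OF pq(1,2)]] pq(3) by auto
    have "map_poly g (p - q) = map_poly g m * map_poly g r"
      unfolding r(2) using m r(1) by (intro map_hom_mult) (auto simp: min_over_def)
    then show ?thesis using map_hom_diff[OF pq(1,2)] \<beta>
      by (metis eq_iff_diff_eq_0 mult_zero_left poly_diff poly_mult)
  qed
  define P where "P x = (SOME p. poly_over F p \<and> x = poly p \<alpha>)" for x
  have P: "poly_over F (P x) \<and> x = poly (P x) \<alpha>" if "x \<in> adjoin \<alpha>" for x
  proof -
    have "\<exists>p. poly_over F p \<and> x = poly p \<alpha>" using that unfolding adjoin_def by blast
    from someI_ex[OF this] show ?thesis unfolding P_def .
  qed
  define g' where "g' x = poly (map_poly g (P x)) \<beta>" for x
  have g': "g' (poly p \<alpha>) = poly (map_poly g p) \<beta>" if p: "poly_over F p" for p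
  proof -
    have "poly p \<alpha> \<in> adjoin \<alpha>" using p unfolding adjoin_def by blast
    from P[OF this] show ?thesis unfolding g'_def by (intro wd[OF _ p]) simp_all
  qed
  have const: "g' x = g x" if "x \<in> F" for x
  proof -
    have "g' (poly [:x:] \<alpha>) = poly (map_poly g [:x:]) \<beta>" by (rule g'[OF over_const[OF that]])
    then show ?thesis by (simp add: map_poly_pCons hom_zero)
  qed
  have "field_hom_on (adjoin \<alpha>) g'"
    unfolding field_hom_on_def
  proof (intro conjI ballI)
    show "g' 1 = 1" using const[OF subfield_one] hom_one by (rule trans)
    fix x y assume "x \<in> adjoin \<alpha>" "y \<in> adjoin \<alpha>"
    then obtain p q where p: "x = poly p \<alpha>" "poly_over F p" and q: "y = poly q \<alpha>" "poly_over F q"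
      by (auto simp: adjoin_def)
    show "g' (x + y) = g' x + g' y"
      using g'[OF over_add[OF p(2) q(2)]] g'[OF p(2)] g'[OF q(2)] p q by (simp add: map_hom_add)
    show "g' (x * y) = g' x * g' y"
      using g'[OF over_mult[OF p(2) q(2)]] g'[OF p(2)] g'[OF q(2)] p q by (simp add: map_hom_mult)
  qed
  moreover have "g' \<alpha> = \<beta>"
    using g'[OF over_X] by (simp add: map_poly_pCons hom_zero hom_one)
  ultimately show ?thesis using const by blast
qed

lemma extend_hom_step:
  assumes p: "poly_over F p" "p \<noteq> 0" "poly p \<alpha> = 0"
  shows "\<exists>F' g'. complex_subfield F' \<and> F \<subseteq> F' \<and> \<alpha> \<in> F' \<and> field_hom_on F' g' \<and> (\<forall>x\<in>F. g' x = g x)"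
proof -
  obtain m where m: "min_over \<alpha> m" using min_over_exists[OF p] by auto
  have "Polynomial.degree (map_poly g m) > 0"
    using map_hom_degree[of m] m min_over_nonconst[OF m] by (simp add: min_over_def)
  then have "\<not> constant (poly (map_poly g m))" by (simp add: constant_degree)
  then obtain \<beta> where "poly (map_poly g m) \<beta> = 0" using fundamental_theorem_of_algebra by blast
  from extend_hom[OF m this] show ?thesis
    using adjoin_subfield[OF m] adjoin_mem[of \<alpha>] adjoin_mono[of \<alpha>] by blast
qed

end

end

lemma complex_subfield_Rats: "complex_subfield \<rat>"
  by (simp add: complex_subfield_def)

lemma poly_over_mono: "poly_over F p \<Longrightarrow> F \<subseteq> G \<Longrightarrow> poly_over G p"
  by (auto simp: poly_over_def)

lemma extend_hom_finite:
  assumes "finite S" "complex_subfield F" "field_hom_on F g"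
    and "\<And>\<alpha>. \<alpha> \<in> S \<Longrightarrow> \<exists>p. poly_over \<rat> p \<and> p \<noteq> 0 \<and> poly p \<alpha> = 0"
  shows "\<exists>F' g'. complex_subfield F' \<and> F \<union> S \<subseteq> F' \<and> field_hom_on F' g' \<and> (\<forall>x\<in>F. g' x = g x)"
  using assms
proof (induction S arbitrary: F g rule: finite_induct)
  case (insert \<alpha> S)
  obtain F1 g1 where 1: "complex_subfield F1" "F \<union> S \<subseteq> F1" "field_hom_on F1 g1" "\<forall>x\<in>F. g1 x = g x"
    using insert by force
  obtain p where p: "poly_over \<rat> p" "p \<noteq> 0" "poly p \<alpha> = 0" using insert.prems by blast
  have "poly_over F1 p" using p(1) subfield_Rats[OF 1(1)] by (rule poly_over_mono)
  from extend_hom_step[OF 1(1) 1(3) this p(2,3)] 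
  obtain F2 g2 where 2: "complex_subfield F2" "F1 \<subseteq> F2" "\<alpha> \<in> F2" "field_hom_on F2 g2" "\<forall>x\<in>F1. g2 x = g1 x"
    by blast
  show ?case
  proof (intro exI conjI)
    show "F \<union> insert \<alpha> S \<subseteq> F2" using 1 2 by auto
    show "\<forall>x\<in>F. g2 x = g x" using 1 2 by auto
  qed (use 2 in auto)
qed blast

text \<open>The minimal polynomial of \<open>\<alpha>\<close> is separable, since its derivative has smaller degree; so it
  has a root other than \<open>\<alpha>\<close>.\<close>

lemma irrational_moved:
  assumes \<alpha>: "\<alpha> \<notin> \<rat>" "poly_over \<rat> p" "p \<noteq> 0" "poly p \<alpha> = 0"
    and S: "finite S" "\<And>\<alpha>. \<alpha> \<in> S \<Longrightarrow> \<exists>p. poly_over \<rat> p \<and> p \<noteq> 0 \<and> poly p \<alpha> = 0"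
  shows "\<exists>F g. complex_subfield F \<and> S \<subseteq> F \<and> \<alpha> \<in> F \<and> field_hom_on F g \<and> g \<alpha> \<noteq> \<alpha>"
proof -
  note Q = complex_subfield_Rats
  have id: "field_hom_on \<rat> (\<lambda>x. x)" by (simp add: field_hom_on_def)
  obtain m where m: "min_over \<rat> \<alpha> m" using min_over_exists[OF Q \<alpha>(2-4)] by auto
  have mp: "poly_over \<rat> m" "Polynomial.lead_coeff m = 1" "poly m \<alpha> = 0"
    and least: "\<And>q. poly_over \<rat> q \<Longrightarrow> q \<noteq> 0 \<Longrightarrow> poly q \<alpha> = 0 \<Longrightarrow> Polynomial.degree m \<le> Polynomial.degree q"
    using m by (auto simp: min_over_def[OF Q])
  have m0: "m \<noteq> 0" using mp(2) by auto
  obtain q where q: "m = [:- \<alpha>, 1:] * q" using mp(3) by (metis poly_eq_0_iff_dvd dvdE)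
  have q0: "q \<noteq> 0" using q m0 by auto
  have dm: "Polynomial.degree m = Suc (Polynomial.degree q)" unfolding q using q0 by (subst degree_mult_eq) auto
  have dq: "Polynomial.degree q > 0"
  proof (rule ccontr)
    assume "\<not> Polynomial.degree q > 0"
    then obtain c where c: "q = [:c:]" by (metis degree_eq_zeroE neq0_conv)
    then have "c = 1" using mp(2) q q0 by auto
    then have "Polynomial.coeff m 0 = - \<alpha>" using q c by simp
    then show False using mp(1) \<alpha>(1) by (metis Rats_minus_iff poly_over_def)
  qed
  have "poly_over \<rat> (pderiv m)"
    using mp(1) by (auto simp: poly_over_def coeff_pderiv)
  moreover have "Polynomial.degree (pderiv m) < Polynomial.degree m"
    using dm by (simp add: degree_pderiv)
  moreover have "pderiv m \<noteq> 0" using dm by (simp add: pderiv_eq_0_iff)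
  ultimately have "poly (pderiv m) \<alpha> \<noteq> 0" using least not_le by blast
  moreover have "poly (pderiv m) \<alpha> = poly q \<alpha>" unfolding q by (simp only: pderiv_mult poly_add poly_mult) (simp add: pderiv_pCons)
  ultimately have qa: "poly q \<alpha> \<noteq> 0" by simp
  obtain \<beta> where \<beta>: "poly q \<beta> = 0"
    using fundamental_theorem_of_algebra[of q] dq by (auto simp: constant_degree)
  have "\<beta> \<noteq> \<alpha>" using qa \<beta> by auto
  have "map_poly (\<lambda>x. x) m = m" by simp
  then have "poly (map_poly (\<lambda>x. x) m) \<beta> = 0" using q \<beta> by simp
  from extend_hom[OF Q id m this] obtain g1 where g1: "field_hom_on (adjoin \<rat> \<alpha>) g1" "g1 \<alpha> = \<beta>" by blast
  obtain F g where F: "complex_subfield F" "adjoin \<rat> \<alpha> \<union> S \<subseteq> F" "field_hom_on F g" "\<forall>x\<in>adjoin \<rat> \<alpha>. g x = g1 x"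
    using extend_hom_finite[OF S(1) adjoin_subfield[OF Q m] g1(1) S(2)] by blast
  have "\<alpha> \<in> adjoin \<rat> \<alpha>" by (rule adjoin_mem[OF Q])
  then show ?thesis using F g1(2) \<open>\<beta> \<noteq> \<alpha>\<close> by (intro exI[of _ F] exI[of _ g]) auto
qed

section \<open>Quartic rings with symmetric group\<close>

lemma complex_field_simps [simp]:
  "carrier complex_field = UNIV" "monoid.mult complex_field x y = x * y"
  "ring.add complex_field x y = x + y" "\<one>\<^bsub>complex_field\<^esub> = 1" "\<zero>\<^bsub>complex_field\<^esub> = 0"
  by (simp_all add: ring_of_type_algebra_def)

lemma complex_field_a_inv [simp]: "\<ominus>\<^bsub>complex_field\<^esub> x = - (x :: complex)"
proof -
  interpret cf: field complex_field by (rule field_from_type_algebra)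
  show ?thesis by (rule cf.minus_equality) simp_all
qed

lemma complex_field_m_inv: "x \<noteq> 0 \<Longrightarrow> inv\<^bsub>complex_field\<^esub> x = inverse (x :: complex)"
proof -
  assume "x \<noteq> 0"
  interpret cf: field complex_field by (rule field_from_type_algebra)
  show ?thesis by (rule cf.comm_inv_char) (use \<open>x \<noteq> 0\<close> in simp_all)
qed

lemma complex_subfield_generate: "complex_subfield (generate_field complex_field H)"
proof -
  let ?L = "generate_field complex_field H"
  have 1: "1 \<in> ?L" using generate_field.one[of complex_field H] by simp
  have minus: "- x \<in> ?L" if "x \<in> ?L" for x using generate_field.a_inv[OF that] by simp
  have add: "x + y \<in> ?L" if "x \<in> ?L" "y \<in> ?L" for x y using generate_field.eng_add[OF that] by simp
  have mult: "x * y \<in> ?L" if "x \<in> ?L" "y \<in> ?L" for x y using generate_field.eng_mult[OF that] by simp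
  have diff: "x - y \<in> ?L" if "x \<in> ?L" "y \<in> ?L" for x y using add[OF that(1) minus[OF that(2)]] by simp
  have inv: "inverse x \<in> ?L" if "x \<in> ?L" for x
  proof (cases "x = 0")
    case False
    then show ?thesis using generate_field.m_inv[OF that] complex_field_m_inv by simp
  qed (use diff[OF 1 1] in simp)
  show ?thesis unfolding complex_subfield_def using 1 diff mult inv by blast
qed

lemma generate_field_least:
  assumes F: "complex_subfield F" and H: "H \<subseteq> F"
  shows "generate_field complex_field H \<subseteq> F"
proof
  fix x assume "x \<in> generate_field complex_field H"
  then show "x \<in> F"
  proof induction
    case one then show ?case using subfield_one[OF F] by simp
  next
    case (incl h) then show ?case using H by auto
  next
    case (a_inv h) then show ?case using subfield_minus[OF F] by simp
  next
    case (m_inv h)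
    then have "inv\<^bsub>complex_field\<^esub> h = inverse h" by (intro complex_field_m_inv) simp
    then show ?case using m_inv subfield_inverse[OF F] by simp
  next
    case (eng_add h1 h2) then show ?case using subfield_add[OF F] by simp
  next
    case (eng_mult h1 h2) then show ?case using subfield_mult[OF F] by simp
  qed
qed

lemma carrier_splitting_field:
  "carrier (splitting_field R) = generate_field complex_field (\<Union>\<sigma>\<in>embeddings R. \<sigma> ` carrier R)"
  by (simp add: splitting_field_def)

lemma splitting_subfield: "complex_subfield (carrier (splitting_field R))"
  unfolding carrier_splitting_field by (rule complex_subfield_generate)

lemma splitting_mem: "\<sigma> \<in> embeddings R \<Longrightarrow> x \<in> carrier R \<Longrightarrow> \<sigma> x \<in> carrier (splitting_field R)"
  unfolding carrier_splitting_field by (rule generate_field.incl) auto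

lemma ring_hom_splitting:
  "g \<in> Ring.ring_hom (splitting_field R) (splitting_field S) \<longleftrightarrow>
    g ` carrier (splitting_field R) \<subseteq> carrier (splitting_field S) \<and> field_hom_on (carrier (splitting_field R)) g"
proof -
  have s: "monoid.mult (splitting_field R) = monoid.mult complex_field" "ring.add (splitting_field R) = ring.add complex_field"
    "one (splitting_field R) = one complex_field" for R :: "('x, 'y) ring_scheme"
    by (simp_all add: splitting_field_def)
  show ?thesis
    by (auto simp: Ring.ring_hom_def field_hom_on_def s)
qed

section \<open>Permutations of the embeddings\<close>

lemma permutes_two:
  assumes "a \<in> E" "b \<in> E" "c \<in> E" "d \<in> E" "a \<noteq> b" "c \<noteq> d"
  shows "\<exists>\<pi>. \<pi> permutes E \<and> \<pi> a = c \<and> \<pi> b = d"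
proof -
  let ?b = "Transposition.transpose a c b"
  have "?b \<in> E" using assms by (auto simp: transpose_def)
  moreover have "?b \<noteq> c" using assms by (auto simp: transpose_def)
  ultimately show ?thesis
    using assms by (intro exI[of _ "Transposition.transpose ?b d \<circ> Transposition.transpose a c"])
      (auto intro!: permutes_compose permutes_swap_id simp: transpose_def)
qed

text \<open>The permutation is transported to the numbers along the bijection of
  \<open>G_ring\<close> and extended by the identity. The Galois permutation obtained from it agrees
  on the embeddings, and both fix everything else.\<close>

lemma G_ring_sym_perms:
  assumes G: "G_ring n (sym_group n) R" and \<pi>: "\<pi> permutes embeddings R"
  shows "\<pi> \<in> galois_perms R"
proof -
  obtain f where f: "bij_betw f {1..n} (embeddings R)"
    "\<And>p. p permutes {1..n} \<Longrightarrow> \<exists>\<pi>\<in>galois_perms R. \<forall>i\<in>{1..n}. f (p i) = \<pi> (f i)"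
    using G by (auto simp: G_ring_def sym_group_def)
  define p where "p i = (if i \<in> {1..n} then inv_into {1..n} f (\<pi> (f i)) else i)" for i
  have fin: "inv_into {1..n} f s \<in> {1..n}" if "s \<in> embeddings R" for s
    using bij_betw_inv_into[OF f(1)] that by (auto simp: bij_betw_def)
  have fp: "f (p i) = \<pi> (f i)" if i: "i \<in> {1..n}" for i
  proof -
    have "\<pi> (f i) \<in> embeddings R" using f(1) i permutes_in_image[OF \<pi>] by (auto simp: bij_betw_def)
    then show ?thesis using f(1) i by (simp add: p_def bij_betw_inv_into_right)
  qed
  have pin: "p i \<in> {1..n}" if i: "i \<in> {1..n}" for i
  proof -
    have "\<pi> (f i) \<in> embeddings R" using f(1) i permutes_in_image[OF \<pi>] by (auto simp: bij_betw_def)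
    from fin[OF this] show ?thesis using i by (simp add: p_def)
  qed
  have "p permutes {1..n}"
  proof (rule bij_imp_permutes)
    have "inj_on p {1..n}"
    proof (rule inj_onI)
      fix i j assume ij: "i \<in> {1..n}" "j \<in> {1..n}" "p i = p j"
      then have "\<pi> (f i) = \<pi> (f j)" using fp by metis
      then have "f i = f j" using permutes_inj[OF \<pi>] by (auto dest: injD)
      then show "i = j" using f(1) ij by (auto simp: bij_betw_def dest: inj_onD)
    qed
    moreover have "p ` {1..n} \<subseteq> {1..n}" using pin by blast
    ultimately show "bij_betw p {1..n} {1..n}" by (simp add: bij_betw_def endo_inj_surj)
  qed (auto simp: p_def)
  then obtain \<pi>' where \<pi>': "\<pi>' \<in> galois_perms R" "\<forall>i\<in>{1..n}. f (p i) = \<pi>' (f i)" using f(2) by blast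
  have "\<pi>' = \<pi>"
  proof
    fix s show "\<pi>' s = \<pi> s"
    proof (cases "s \<in> embeddings R")
      case True
      then have "s \<in> f ` {1..n}" using f(1) by (simp add: bij_betw_def)
      then obtain i where "i \<in> {1..n}" "s = f i" by blast
      then show ?thesis using fp \<pi>'(2) by metis
    next
      case False
      have "\<pi>' permutes embeddings R" using \<pi>'(1) by (simp add: galois_perms_def)
      then show ?thesis using False \<pi> by (simp add: permutes_not_in)
    qed
  qed
  then show ?thesis using \<pi>' by simp
qed

text \<open>Of the symmetric Galois group only this is kept for the inequalities: every permutation
  of the embeddings comes from a field homomorphism, which carries relations between conjugates to
  the permuted conjugates.\<close>

definition symmetric_ring :: "('a, 'm) ring_scheme \<Rightarrow> bool" where
  "symmetric_ring R \<longleftrightarrow> (\<forall>\<pi>. \<pi> permutes embeddings R \<longrightarrow>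
     (\<exists>g. field_hom_on (carrier (splitting_field R)) g \<and>
       (\<forall>\<sigma>\<in>embeddings R. \<forall>x\<in>carrier R. \<pi> \<sigma> x = g (\<sigma> x))))"

lemma G_ring_symmetric: "G_ring n (sym_group n) R \<Longrightarrow> symmetric_ring R"
  unfolding symmetric_ring_def
proof (intro allI impI)
  fix \<pi> assume "G_ring n (sym_group n) R" "\<pi> permutes embeddings R"
  then have "\<pi> \<in> galois_perms R" by (rule G_ring_sym_perms)
  then obtain g where g: "g \<in> ring_iso (splitting_field R) (splitting_field R)"
    "\<forall>\<sigma>\<in>embeddings R. \<forall>x\<in>carrier R. \<pi> \<sigma> x = g (\<sigma> x)" by (auto simp: galois_perms_def)
  then show "\<exists>g. field_hom_on (carrier (splitting_field R)) g \<and> (\<forall>\<sigma>\<in>embeddings R. \<forall>x\<in>carrier R. \<pi> \<sigma> x = g (\<sigma> x))"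
    by (intro exI[of _ g]) (auto simp: ring_iso_def ring_hom_splitting)
qed

lemma symmetric_ring_agree:
  assumes S: "symmetric_ring R" and x: "x \<in> carrier R"
    and a: "a \<in> embeddings R" "b \<in> embeddings R" "a \<noteq> b" "a x = b x"
    and c: "c \<in> embeddings R" "d \<in> embeddings R"
  shows "c x = d x"
proof (cases "c = d")
  case False
  obtain \<pi> where \<pi>: "\<pi> permutes embeddings R" "\<pi> a = c" "\<pi> b = d"
    using permutes_two[OF a(1,2) c a(3) False] by blast
  then obtain g where g: "\<forall>\<sigma>\<in>embeddings R. \<forall>x\<in>carrier R. \<pi> \<sigma> x = g (\<sigma> x)"
    using S unfolding symmetric_ring_def by blast
  have "c x = g (a x)" using g \<pi>(2) a(1) x by metis
  also have "\<dots> = d x" using g \<pi>(3) a x by metis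
  finally show ?thesis .
qed simp

text \<open>The determinant with rows \<open>(1, \<sigma> u, \<sigma> v)\<close> for three
  embeddings. It vanishes when the three points \<open>(\<sigma> u, \<sigma> v)\<close> are
  collinear.\<close>

definition minor3 :: "('a \<Rightarrow> complex) \<Rightarrow> ('a \<Rightarrow> complex) \<Rightarrow> ('a \<Rightarrow> complex) \<Rightarrow> 'a \<Rightarrow> 'a \<Rightarrow> complex" where
  "minor3 a b c u v = (b u - a u) * (c v - a v) - (c u - a u) * (b v - a v)"

lemma symmetric_ring_minor:
  assumes S: "symmetric_ring R" and uv: "u \<in> carrier R" "v \<in> carrier R"
    and abc: "a \<in> embeddings R" "b \<in> embeddings R" "c \<in> embeddings R"
    and 0: "minor3 a b c u v = 0" and \<pi>: "\<pi> permutes embeddings R"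
  shows "minor3 (\<pi> a) (\<pi> b) (\<pi> c) u v = 0"
proof -
  let ?L = "carrier (splitting_field R)"
  obtain g where g: "field_hom_on ?L g" "\<And>\<sigma> x. \<sigma> \<in> embeddings R \<Longrightarrow> x \<in> carrier R \<Longrightarrow> \<pi> \<sigma> x = g (\<sigma> x)"
    using S \<pi> unfolding symmetric_ring_def by blast
  note L = splitting_subfield[of R]
  note mem = splitting_mem[OF abc(1) uv(1)] splitting_mem[OF abc(1) uv(2)] splitting_mem[OF abc(2) uv(1)]
    splitting_mem[OF abc(2) uv(2)] splitting_mem[OF abc(3) uv(1)] splitting_mem[OF abc(3) uv(2)]
  have "minor3 (\<pi> a) (\<pi> b) (\<pi> c) u v = g (minor3 a b c u v)"
    unfolding minor3_def
    using mem abc uv by (simp add: g(2) hom_diff[OF L g(1)] hom_mult[OF L g(1)] subfield_diff[OF L] subfield_mult[OF L])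
  then show ?thesis using 0 hom_zero[OF L g(1)] by simp
qed

lemma embedded_ringI: "rank_ring n R \<Longrightarrow> card (embeddings R) = n \<Longrightarrow> 0 < n \<Longrightarrow> embedded_ring R n"
  by (simp add: rank_ring_def embedded_ring_def embedded_ring_axioms_def)

lemma atLeast1_atMost_4: "{1..4::nat} = {1, 2, 3, 4}" by auto

lemma atLeast1_atMost_3: "{1..3::nat} = {1, 2, 3}" by auto

section \<open>Upper bounds for the minima of the resolvent\<close>

lemma (in embedded_ring) succ_min_le_two:
  fixes \<tau> :: "nat \<Rightarrow> 'a \<Rightarrow> complex"
  assumes n: "n = 3" and \<tau>: "bij_betw \<tau> {1..3} (embeddings R)"
    and y: "y \<in> carrier R" "\<tau> 1 y \<noteq> \<tau> 2 y"
    and B: "1 \<le> B" "\<And>k. k \<in> {1..3} \<Longrightarrow> cmod (\<tau> k y) \<le> B"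
  shows "succ_min 3 R 1 \<le> B"
proof -
  have E: "embeddings R = \<tau> ` {1..3}" using \<tau> by (simp add: bij_betw_def)
  have t: "\<tau> 1 \<in> embeddings R" "\<tau> 2 \<in> embeddings R" unfolding E by auto
  define z where "z i = (if i = 0 then \<one> else y)" for i :: nat
  have set2: "{..<2::nat} = {0, 1}" by auto
  have z: "z i \<in> carrier R" if "i < 2" for i using y by (simp add: z_def)
  have ker: "c i = 0" if c: "\<And>\<sigma>. \<sigma> \<in> embeddings R \<Longrightarrow> (\<Sum>i<2. c i * \<sigma> (z i)) = 0" and i: "i < 2" for c :: "nat \<Rightarrow> complex" and i
  proof -
    have 1: "c 0 + c 1 * \<tau> 1 y = 0" "c 0 + c 1 * \<tau> 2 y = 0"
      using c[OF t(1)] c[OF t(2)] unfolding set2 by (simp_all add: z_def emb_one[OF t(1)] emb_one[OF t(2)] del: One_nat_def)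
    have "c 1 * (\<tau> 1 y - \<tau> 2 y) = (c 0 + c 1 * \<tau> 1 y) - (c 0 + c 1 * \<tau> 2 y)" by (simp add: algebra_simps)
    then have "c 1 * (\<tau> 1 y - \<tau> 2 y) = 0" by (simp only: 1 diff_zero)
    then have "c 1 = 0" using y by simp
    moreover from this have "c 0 = 0" using 1(1) by simp
    moreover have "i = 0 \<or> i = 1" using i by auto
    ultimately show ?thesis by auto
  qed
  have len: "ring_length 3 R x \<le> B" if "x \<in> z ` {..<2}" for x
  proof -
    have "x = \<one> \<or> x = y" using that by (auto simp: z_def)
    then show ?thesis
      using length_le[of y B] length_le[of \<one> B] B unfolding n by (auto simp: E emb_one simp del: atLeastAtMost_iff)
  qed
  have "int_independent R (z ` {..<2})" "card (z ` {..<2}) = 2"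
    by (rule int_independentI_emb; use z ker in force)+
  then show ?thesis
    using succ_min_leI[of 1 "z ` {..<2}" B] len n by simp
qed

text \<open>The determinant of the columns 1, \<open>f\<close>, \<open>g\<close> on the indices 1,
  2, 3; it is nonzero when these are linearly independent.\<close>

definition det3 :: "(nat \<Rightarrow> complex) \<Rightarrow> (nat \<Rightarrow> complex) \<Rightarrow> complex" where
  "det3 f g = (f 2 - f 1) * (g 3 - g 1) - (f 3 - f 1) * (g 2 - g 1)"

lemma (in embedded_ring) succ_min_le_three:
  fixes \<tau> :: "nat \<Rightarrow> 'a \<Rightarrow> complex"
  assumes n: "n = 3" and \<tau>: "bij_betw \<tau> {1..3} (embeddings R)"
    and y: "y \<in> carrier R" "y' \<in> carrier R" "det3 (\<lambda>k. \<tau> k y) (\<lambda>k. \<tau> k y') \<noteq> 0"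
    and B: "1 \<le> B" "\<And>k. k \<in> {1..3} \<Longrightarrow> cmod (\<tau> k y) \<le> B" "\<And>k. k \<in> {1..3} \<Longrightarrow> cmod (\<tau> k y') \<le> B"
  shows "succ_min 3 R 2 \<le> B"
proof -
  have E: "embeddings R = \<tau> ` {1..3}" using \<tau> by (simp add: bij_betw_def)
  have t: "\<tau> 1 \<in> embeddings R" "\<tau> 2 \<in> embeddings R" "\<tau> 3 \<in> embeddings R" unfolding E by auto
  define z where "z i = (if i = 0 then \<one> else if i = 1 then y else y')" for i :: nat
  have set3: "{..<3::nat} = {0, 1, 2}" by auto
  have z: "z i \<in> carrier R" if "i < 3" for i using y by (simp add: z_def)
  have ker: "c i = 0" if c: "\<And>\<sigma>. \<sigma> \<in> embeddings R \<Longrightarrow> (\<Sum>i<3. c i * \<sigma> (z i)) = 0" and i: "i < 3" for c :: "nat \<Rightarrow> complex" and i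
  proof -
    have e: "c 0 + c 1 * \<tau> 1 y + c 2 * \<tau> 1 y' = 0" "c 0 + c 1 * \<tau> 2 y + c 2 * \<tau> 2 y' = 0" "c 0 + c 1 * \<tau> 3 y + c 2 * \<tau> 3 y' = 0"
      using c[OF t(1)] c[OF t(2)] c[OF t(3)] unfolding set3
      by (simp_all add: z_def emb_one[OF t(1)] emb_one[OF t(2)] emb_one[OF t(3)] add.assoc del: One_nat_def mult_eq_0_iff)
    have d: "c 1 * (\<tau> 2 y - \<tau> 1 y) + c 2 * (\<tau> 2 y' - \<tau> 1 y') = 0" "c 1 * (\<tau> 3 y - \<tau> 1 y) + c 2 * (\<tau> 3 y' - \<tau> 1 y') = 0"
    proof -
      have "c 1 * (\<tau> 2 y - \<tau> 1 y) + c 2 * (\<tau> 2 y' - \<tau> 1 y') = (c 0 + c 1 * \<tau> 2 y + c 2 * \<tau> 2 y') - (c 0 + c 1 * \<tau> 1 y + c 2 * \<tau> 1 y')"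
        "c 1 * (\<tau> 3 y - \<tau> 1 y) + c 2 * (\<tau> 3 y' - \<tau> 1 y') = (c 0 + c 1 * \<tau> 3 y + c 2 * \<tau> 3 y') - (c 0 + c 1 * \<tau> 1 y + c 2 * \<tau> 1 y')"
        by (simp_all add: algebra_simps)
      then show "c 1 * (\<tau> 2 y - \<tau> 1 y) + c 2 * (\<tau> 2 y' - \<tau> 1 y') = 0" "c 1 * (\<tau> 3 y - \<tau> 1 y) + c 2 * (\<tau> 3 y' - \<tau> 1 y') = 0"
        by (simp_all only: e diff_zero)
    qed
    \<comment> \<open>Cramer's rule for the two equations left after the elimination of
      \<open>c 0\<close>.\<close>
    have "c 1 * det3 (\<lambda>k. \<tau> k y) (\<lambda>k. \<tau> k y') = 0" "c 2 * det3 (\<lambda>k. \<tau> k y) (\<lambda>k. \<tau> k y') = 0"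
    proof -
      have "c 1 * det3 (\<lambda>k. \<tau> k y) (\<lambda>k. \<tau> k y') =
        (c 1 * (\<tau> 2 y - \<tau> 1 y) + c 2 * (\<tau> 2 y' - \<tau> 1 y')) * (\<tau> 3 y' - \<tau> 1 y')
        - (c 1 * (\<tau> 3 y - \<tau> 1 y) + c 2 * (\<tau> 3 y' - \<tau> 1 y')) * (\<tau> 2 y' - \<tau> 1 y')"
        "c 2 * det3 (\<lambda>k. \<tau> k y) (\<lambda>k. \<tau> k y') =
        (c 1 * (\<tau> 3 y - \<tau> 1 y) + c 2 * (\<tau> 3 y' - \<tau> 1 y')) * (\<tau> 2 y - \<tau> 1 y)
        - (c 1 * (\<tau> 2 y - \<tau> 1 y) + c 2 * (\<tau> 2 y' - \<tau> 1 y')) * (\<tau> 3 y - \<tau> 1 y)"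
        unfolding det3_def by (simp_all only: ring_distribs mult.assoc) (simp_all add: algebra_simps)
      then show "c 1 * det3 (\<lambda>k. \<tau> k y) (\<lambda>k. \<tau> k y') = 0" "c 2 * det3 (\<lambda>k. \<tau> k y) (\<lambda>k. \<tau> k y') = 0"
        by (simp_all only: d mult_zero_left diff_zero)
    qed
    then have "c 1 = 0" "c 2 = 0" using y by simp_all
    moreover from this have "c 0 = 0" using e(1) by simp
    moreover have "i = 0 \<or> i = 1 \<or> i = 2" using i by auto
    ultimately show ?thesis by auto
  qed
  have len: "ring_length 3 R x \<le> B" if "x \<in> z ` {..<3}" for x
  proof -
    have "x = \<one> \<or> x = y \<or> x = y'" using that by (auto simp: z_def)
    then show ?thesis
      using length_le[of y B] length_le[of y' B] length_le[of \<one> B] B unfolding n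
      by (auto simp: E emb_one simp del: atLeastAtMost_iff)
  qed
  have "int_independent R (z ` {..<3})" "card (z ` {..<3}) = 3"
    by (rule int_independentI_emb; use z ker in force)+
  then show ?thesis
    using succ_min_leI[of 2 "z ` {..<3}" B] len n by simp
qed

text \<open>The weights \<open>a1\<close>, \<open>a2\<close>, \<open>a3\<close> on the three
  pairings define a quadratic form on 4-tuples. Its polar form at 1 and any tuple is
  \<open>a1 + a2 + a3\<close> times the sum of the entries, so the hypotheses make it vanish on the
  span of 1, x and y. The conclusion is its value at the tuple \<open>z\<close> of this span that
  vanishes at the positions 3 and 4.\<close>

lemma quad_minor_zero:
  fixes a1 a2 a3 x1 x2 x3 x4 y1 y2 y3 y4 :: complex
  assumes "a1 + a2 + a3 = 0"
    "a1 * (x1 * x2 + x3 * x4) + a2 * (x1 * x3 + x2 * x4) + a3 * (x1 * x4 + x2 * x3) = 0"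
    "a1 * (y1 * y2 + y3 * y4) + a2 * (y1 * y3 + y2 * y4) + a3 * (y1 * y4 + y2 * y3) = 0"
    "a1 * (x1 * y2 + y1 * x2 + x3 * y4 + y3 * x4) + a2 * (x1 * y3 + y1 * x3 + x2 * y4 + y2 * x4)
      + a3 * (x1 * y4 + y1 * x4 + x2 * y3 + y2 * x3) = 0"
  shows "a1 * (((x3 - x1) * (y4 - y1) - (x4 - x1) * (y3 - y1)) * ((x3 - x2) * (y4 - y2) - (x4 - x2) * (y3 - y2))) = 0"
proof -
  define p q r where "p = x3 * y4 - x4 * y3" "q = y3 - y4" "r = x4 - x3"
  define z where "z x y = p + q * x + r * y" for x y
  have z0: "z x3 y3 = 0" "z x4 y4 = 0" by (simp_all add: z_def p_q_r_def algebra_simps)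
  have z1: "z x y = (x3 - x) * (y4 - y) - (x4 - x) * (y3 - y)" for x y by (simp add: z_def p_q_r_def algebra_simps)
  have "a1 * (z x1 y1 * z x2 y2 + z x3 y3 * z x4 y4) + a2 * (z x1 y1 * z x3 y3 + z x2 y2 * z x4 y4)
    + a3 * (z x1 y1 * z x4 y4 + z x2 y2 * z x3 y3) =
    (a1 + a2 + a3) * (2 * p\<^sup>2 + p * q * (x1 + x2 + x3 + x4) + p * r * (y1 + y2 + y3 + y4))
    + q\<^sup>2 * (a1 * (x1 * x2 + x3 * x4) + a2 * (x1 * x3 + x2 * x4) + a3 * (x1 * x4 + x2 * x3))
    + r\<^sup>2 * (a1 * (y1 * y2 + y3 * y4) + a2 * (y1 * y3 + y2 * y4) + a3 * (y1 * y4 + y2 * y3))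
    + q * r * (a1 * (x1 * y2 + y1 * x2 + x3 * y4 + y3 * x4) + a2 * (x1 * y3 + y1 * x3 + x2 * y4 + y2 * x4)
      + a3 * (x1 * y4 + y1 * x4 + x2 * y3 + y2 * x3))"
    unfolding z_def by (simp add: algebra_simps power2_eq_square)
  then have "a1 * (z x1 y1 * z x2 y2) = 0" using assms by (simp add: z0)
  then show ?thesis by (simp only: z1)
qed

text \<open>Images are at most \<open>sqrt 4 = 2\<close> times the length. A value of the resolvent
  map is a sum of two products of images and a value of its polarisation a sum of four, whence 8 and
  16. What remains is independence in \<open>C\<close>; every case reduces to the fact that the
  conjugates of \<open>u\<close> are distinct.\<close>

lemma cubic_resolvent_minima:
  assumes "symmetric_ring (R :: ('a, 'm) ring_scheme)" and R: "embedded_ring R 4"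
    and C: "embedded_ring (C :: ('b, 'k) ring_scheme) 3"
    and res: "cubic_resolvent R C"
    and b: "int_basis R 4 b" "b 0 = \<one>\<^bsub>R\<^esub>"
    and l: "\<And>j. j \<in> {1, 2, 3} \<Longrightarrow> ring_length 4 R (b j) \<le> L j" "1 \<le> L 1" "L 1 \<le> L 2" "L 2 \<le> L 3"
  shows "succ_min 3 C 1 \<le> 8 * (L 1)\<^sup>2" and "succ_min 3 C 2 \<le> 16 * (L 2)\<^sup>2"
    and "succ_min 3 C 2 \<le> 16 * (L 1 * L 3)"
proof -
  interpret R: embedded_ring R 4 by (rule R)
  interpret C: embedded_ring C 3 by (rule C)
  obtain s :: "nat \<Rightarrow> 'a \<Rightarrow> complex" and t :: "nat \<Rightarrow> 'b \<Rightarrow> complex" where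
    s: "bij_betw s {1..4} (embeddings R)" and t: "bij_betw t {1..3} (embeddings C)"
    and "\<forall>x\<in>carrier R. \<exists>y\<in>carrier C. t 1 y = s 1 x * s 2 x + s 3 x * s 4 x \<and>
       t 2 y = s 1 x * s 3 x + s 2 x * s 4 x \<and> t 3 y = s 1 x * s 4 x + s 2 x * s 3 x"
    using res unfolding cubic_resolvent_def by blast
  then obtain h where h: "\<And>x. x \<in> carrier R \<Longrightarrow> h x \<in> carrier C \<and> t 1 (h x) = s 1 x * s 2 x + s 3 x * s 4 x \<and>
       t 2 (h x) = s 1 x * s 3 x + s 2 x * s 4 x \<and> t 3 (h x) = s 1 x * s 4 x + s 2 x * s 3 x" by metis
  have E: "embeddings R = {s 1, s 2, s 3, s 4}"
    using s unfolding bij_betw_def atLeast1_atMost_4 by auto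
  have EC: "embeddings C = {t 1, t 2, t 3}"
    using t unfolding bij_betw_def atLeast1_atMost_3 by auto
  have se: "s 1 \<in> embeddings R" "s 2 \<in> embeddings R" "s 3 \<in> embeddings R" "s 4 \<in> embeddings R"
    unfolding E by auto
  have te: "t 1 \<in> embeddings C" "t 2 \<in> embeddings C" "t 3 \<in> embeddings C"
    unfolding EC by auto
  have sne: "s 1 \<noteq> s 2" "s 1 \<noteq> s 3" "s 1 \<noteq> s 4" "s 2 \<noteq> s 3" "s 2 \<noteq> s 4" "s 3 \<noteq> s 4"
    using s unfolding bij_betw_def by (auto dest: inj_onD)
  define u v w where "u = b 1" "v = b 2" "w = b 3"
  have uvw: "u \<in> carrier R" "v \<in> carrier R" "w \<in> carrier R"
    using R.basis_closed[OF b(1)] by (auto simp: u_v_w_def)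
  have "\<exists>y\<in>carrier C. \<forall>k\<in>{1,2,3}. t k y = t k (h (x \<oplus>\<^bsub>R\<^esub> z)) - t k (h x) - t k (h z)"
    if xz: "x \<in> carrier R" "z \<in> carrier R" for x z
    by (rule bexI[of _ "h (x \<oplus>\<^bsub>R\<^esub> z) \<ominus>\<^bsub>C\<^esub> h x \<ominus>\<^bsub>C\<^esub> h z"])
      (use h xz te in \<open>auto simp: C.emb_diff\<close>)
  then obtain B where B: "\<And>x z. x \<in> carrier R \<Longrightarrow> z \<in> carrier R \<Longrightarrow> B x z \<in> carrier C \<and>
    (\<forall>k\<in>{1,2,3}. t k (B x z) = t k (h (x \<oplus>\<^bsub>R\<^esub> z)) - t k (h x) - t k (h z))" by metis
  have Bt: "B x z \<in> carrier C"
    "t 1 (B x z) = s 1 x * s 2 z + s 1 z * s 2 x + s 3 x * s 4 z + s 3 z * s 4 x"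
    "t 2 (B x z) = s 1 x * s 3 z + s 1 z * s 3 x + s 2 x * s 4 z + s 2 z * s 4 x"
    "t 3 (B x z) = s 1 x * s 4 z + s 1 z * s 4 x + s 2 x * s 3 z + s 2 z * s 3 x"
    if xz: "x \<in> carrier R" "z \<in> carrier R" for x z
    using B[OF xz] h[OF xz(1)] h[OF xz(2)] h[OF R.a_closed[OF xz]] xz se
    by (simp_all add: R.emb_add algebra_simps)
  have slen: "cmod (s k x) \<le> 2 * ring_length 4 R x" if "k \<in> {1..4}" for k x
  proof -
    have "s k \<in> embeddings R" using that s unfolding bij_betw_def by blast
    from R.emb_le_length[OF this, of x] show ?thesis by simp
  qed
  have bl: "cmod (s k (b j)) \<le> 2 * L j" if "k \<in> {1..4}" "j \<in> {1,2,3}" for k j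
    using slen[OF that(1), of "b j"] l(1)[OF that(2)] by linarith
  have prod4: "cmod (p1 * q1 + p2 * q2) \<le> 2 * (M * N)"
    if "cmod p1 \<le> M" "cmod q1 \<le> N" "cmod p2 \<le> M" "cmod q2 \<le> N" for p1 q1 p2 q2 and M N :: real
  proof -
    have M: "0 \<le> M" using that(1) norm_ge_zero order_trans by blast
    have "cmod (p1 * q1 + p2 * q2) \<le> cmod p1 * cmod q1 + cmod p2 * cmod q2"
      using norm_triangle_ineq[of "p1 * q1" "p2 * q2"] by (simp add: norm_mult)
    also have "\<dots> \<le> M * N + M * N" using that M by (intro add_mono mult_mono) auto
    finally show ?thesis by simp
  qed
  have hlen: "cmod (t k (h (b j))) \<le> 8 * (L j)\<^sup>2" if "k \<in> {1..3}" "j \<in> {1,2,3}" for k j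
  proof -
    have bj: "b j \<in> carrier R" using R.basis_closed[OF b(1)] that(2) by auto
    have "k = 1 \<or> k = 2 \<or> k = 3" using that(1) by auto
    moreover have "cmod (p1 * q1 + p2 * q2) \<le> 8 * (L j)\<^sup>2"
      if "cmod p1 \<le> 2 * L j" "cmod q1 \<le> 2 * L j" "cmod p2 \<le> 2 * L j" "cmod q2 \<le> 2 * L j" for p1 q1 p2 q2
      using prod4[OF that] by (simp add: power2_eq_square)
    ultimately show ?thesis
      using h[OF bj] bl[OF _ that(2)] by (elim disjE) auto
  qed
  have Blen: "cmod (t k (B (b i) (b j))) \<le> 16 * (L i * L j)" if "k \<in> {1..3}" "i \<in> {1,2,3}" "j \<in> {1,2,3}" for k i j
  proof -
    have bij: "b i \<in> carrier R" "b j \<in> carrier R" using R.basis_closed[OF b(1)] that by auto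
    have sum4: "cmod (p1 * q1 + q2 * p2 + p3 * q3 + q4 * p4) \<le> 4 * (M * N)"
      if "cmod p1 \<le> M" "cmod q1 \<le> N" "cmod p2 \<le> M" "cmod q2 \<le> N" "cmod p3 \<le> M" "cmod q3 \<le> N" "cmod p4 \<le> M" "cmod q4 \<le> N"
      for p1 p2 p3 p4 q1 q2 q3 q4 and M N :: real
    proof -
      have "cmod ((p1 * q1 + p2 * q2) + (p3 * q3 + p4 * q4)) \<le> 2 * (M * N) + 2 * (M * N)"
        by (rule norm_triangle_mono) (use that in \<open>auto intro!: prod4\<close>)
      then show ?thesis by (simp add: algebra_simps)
    qed
    have "k = 1 \<or> k = 2 \<or> k = 3" using that(1) by auto
    moreover have "cmod (p1 * q1 + q2 * p2 + p3 * q3 + q4 * p4) \<le> 16 * (L i * L j)"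
      if "cmod p1 \<le> 2 * L i" "cmod q1 \<le> 2 * L j" "cmod p2 \<le> 2 * L i" "cmod q2 \<le> 2 * L j"
        "cmod p3 \<le> 2 * L i" "cmod q3 \<le> 2 * L j" "cmod p4 \<le> 2 * L i" "cmod q4 \<le> 2 * L j"
      for p1 p2 p3 p4 q1 q2 q3 q4
      using sum4[OF that] by simp
    ultimately show ?thesis
      using Bt[OF bij] bl[OF _ that(2)] bl[OF _ that(3)] by (elim disjE) auto
  qed
  \<comment> \<open>Equality of two conjugates of \<open>u\<close> would carry over to every other
    pair. All conjugates would be one complex number, and 1 and \<open>u\<close> would be
    dependent.\<close>
  have distinct: "c u \<noteq> d u" if cd: "c \<in> embeddings R" "d \<in> embeddings R" "c \<noteq> d" for c d
  proof
    assume "c u = d u"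
    then have all: "\<sigma> u = s 1 u" if "\<sigma> \<in> embeddings R" for \<sigma>
      using symmetric_ring_agree[OF assms(1) uvw(1) cd _ that se(1)] by blast
    define k where "k i = (if i = 0 then - s 1 u else if i = 1 then 1 else (0::complex))" for i :: nat
    have "k 1 = 0"
    proof (rule R.basis_kernel[OF b(1), of k])
      fix \<sigma> assume \<sigma>: "\<sigma> \<in> embeddings R"
      have "{..<4::nat} = {0, 1, 2, 3}" by auto
      then have "(\<Sum>i<4. k i * \<sigma> (b i)) = - s 1 u * \<sigma> (b 0) + \<sigma> (b 1)" by (simp add: k_def)
      then show "(\<Sum>i<4. k i * \<sigma> (b i)) = 0"
        using all[OF \<sigma>] R.emb_one[OF \<sigma>] b(2) by (simp add: u_v_w_def)
    qed simp
    then show False by (simp add: k_def)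
  qed
  \<comment> \<open>These are the minors of 1 and \<open>h u\<close>, so a vanishing combination
    with these weights means linear dependence on 1 and \<open>h u\<close>. They factor into
    differences of conjugates of \<open>u\<close>.\<close>
  define a1 a2 a3 where "a1 = t 3 (h u) - t 2 (h u)" "a2 = t 1 (h u) - t 3 (h u)" "a3 = t 2 (h u) - t 1 (h u)"
  have a: "a1 = (s 1 u - s 2 u) * (s 4 u - s 3 u)" "a2 = (s 1 u - s 3 u) * (s 2 u - s 4 u)" "a3 = (s 1 u - s 4 u) * (s 3 u - s 2 u)"
    using h[OF uvw(1)] by (simp_all add: a1_a2_a3_def algebra_simps)
  have anz: "a1 \<noteq> 0" "a2 \<noteq> 0" "a3 \<noteq> 0"
    unfolding a using distinct se sne by auto
  have asum: "a1 + a2 + a3 = 0" by (simp add: a1_a2_a3_def)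
  have adet: "det3 (\<lambda>k. t k (h u)) (\<lambda>k. t k y) = a1 * t 1 y + a2 * t 2 y + a3 * t 3 y" for y
    by (simp add: det3_def a1_a2_a3_def algebra_simps)
  have L0: "0 < L 1" "0 < L 2" "0 < L 3" "1 \<le> L 2" "1 \<le> L 3" using l by auto
  have L1: "1 \<le> (L 1)\<^sup>2" "1 \<le> (L 2)\<^sup>2" "1 \<le> L 1 * L 3" "(L 1)\<^sup>2 \<le> (L 2)\<^sup>2" "L 1 * L 2 \<le> (L 2)\<^sup>2" "(L 1)\<^sup>2 \<le> L 1 * L 3" "L 1 * L 2 \<le> L 1 * L 3"
    using l L0 mult_mono[of 1 "L 1" 1 "L 3"] mult_mono[of 1 "L 1" 1 "L 1"] mult_mono[of 1 "L 2" 1 "L 2"] by (auto simp: power2_eq_square intro!: mult_mono)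
  show "succ_min 3 C 1 \<le> 8 * (L 1)\<^sup>2"
    using C.succ_min_le_two[OF refl t, of "h u" "8 * (L 1)\<^sup>2"] h[OF uvw(1)] anz(3) hlen[of _ 1] L1
    by (simp add: a1_a2_a3_def u_v_w_def)
  show "succ_min 3 C 2 \<le> 16 * (L 2)\<^sup>2"
  proof -
    \<comment> \<open>Otherwise the quadratic form with weights \<open>a1\<close>,
      \<open>a2\<close>, \<open>a3\<close> vanishes on the span of 1, \<open>u\<close>,
      \<open>v\<close>, and \<open>quad_minor_zero\<close> yields three embeddings with collinear
      points.\<close>
    have "\<exists>y\<in>{h v, B u v}. det3 (\<lambda>k. t k (h u)) (\<lambda>k. t k y) \<noteq> 0"
    proof (rule ccontr)
      assume "\<not> (\<exists>y\<in>{h v, B u v}. det3 (\<lambda>k. t k (h u)) (\<lambda>k. t k y) \<noteq> 0)"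
      then have 0: "a1 * t 1 (h v) + a2 * t 2 (h v) + a3 * t 3 (h v) = 0"
        "a1 * t 1 (B u v) + a2 * t 2 (B u v) + a3 * t 3 (B u v) = 0"
        by (simp_all add: adet)
      have 1: "a1 * t 1 (h u) + a2 * t 2 (h u) + a3 * t 3 (h u) = 0"
        by (simp add: a1_a2_a3_def algebra_simps)
      have "a1 * (minor3 (s 1) (s 3) (s 4) u v * minor3 (s 2) (s 3) (s 4) u v) = 0"
        unfolding minor3_def
        by (rule quad_minor_zero[OF asum]) (use 0 1 h[OF uvw(1)] h[OF uvw(2)] Bt[OF uvw(1,2)] in \<open>simp_all add: algebra_simps\<close>)
      then obtain k where k: "k \<in> {1, 2}" "minor3 (s k) (s 3) (s 4) u v = 0" using anz by auto
      define \<sigma> where "\<sigma> = s k"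
      have \<sigma>: "\<sigma> \<in> embeddings R" "minor3 \<sigma> (s 3) (s 4) u v = 0" "\<sigma> \<noteq> s 3" "\<sigma> \<noteq> s 4"
        using k se sne by (auto simp: \<sigma>_def)
      \<comment> \<open>Exchanging two embeddings other than \<open>s 3\<close> and
        \<open>s 4\<close> fixes these two, so every point \<open>(\<tau> u, \<tau> v)\<close> is on
        the line through theirs. That is a linear relation between 1, \<open>u\<close> and
        \<open>v\<close>.\<close>
      have minor0: "minor3 \<tau> (s 3) (s 4) u v = 0" if \<tau>: "\<tau> \<in> embeddings R" for \<tau>
      proof (cases "\<tau> = s 3 \<or> \<tau> = s 4")
        case True then show ?thesis by (auto simp: minor3_def)
      next
        case False
        have "Transposition.transpose \<sigma> \<tau> permutes embeddings R" using \<sigma> \<tau> by (intro permutes_swap_id)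
        from symmetric_ring_minor[OF assms(1) uvw(1,2) \<sigma>(1) se(3,4) \<sigma>(2) this]
        have "minor3 (Transposition.transpose \<sigma> \<tau> \<sigma>) (Transposition.transpose \<sigma> \<tau> (s 3))
          (Transposition.transpose \<sigma> \<tau> (s 4)) u v = 0" .
        moreover have "Transposition.transpose \<sigma> \<tau> (s 3) = s 3" "Transposition.transpose \<sigma> \<tau> (s 4) = s 4"
          using False \<sigma>(3,4) by (auto simp: transpose_def)
        ultimately         show ?thesis by simp
      qed
      define kk where "kk i = (if i = 0 then s 3 u * s 4 v - s 4 u * s 3 v else if i = 1 then s 3 v - s 4 v
        else if i = 2 then s 4 u - s 3 u else (0::complex))" for i :: nat
      have "kk 2 = 0"
      proof (rule R.basis_kernel[OF b(1), of kk])
        fix \<tau> assume \<tau>: "\<tau> \<in> embeddings R"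
        have "{..<4::nat} = {0, 1, 2, 3}" by auto
        then have "(\<Sum>i<4. kk i * \<tau> (b i)) = kk 0 * \<tau> (b 0) + kk 1 * \<tau> u + kk 2 * \<tau> v"
          by (simp add: kk_def u_v_w_def)
        also have "\<dots> = minor3 \<tau> (s 3) (s 4) u v"
          using R.emb_one[OF \<tau>] b(2) by (simp add: kk_def minor3_def algebra_simps)
        finally show "(\<Sum>i<4. kk i * \<tau> (b i)) = 0" using minor0[OF \<tau>] by simp
      qed simp
      then show False using distinct[OF se(3,4) sne(6)] by (simp add: kk_def)
    qed
    then obtain y where y: "y \<in> {h v, B u v}" "det3 (\<lambda>k. t k (h u)) (\<lambda>k. t k y) \<noteq> 0" by blast
    have "cmod (t k y) \<le> 16 * (L 2)\<^sup>2" if "k \<in> {1..3}" for k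
      using y(1) hlen[OF that, of 2] Blen[OF that, of 1 2] L1 by (auto simp: u_v_w_def)
    moreover have "cmod (t k (h u)) \<le> 16 * (L 2)\<^sup>2" if "k \<in> {1..3}" for k
      using hlen[OF that, of 1] L1 by (auto simp: u_v_w_def)
    ultimately show ?thesis
      using y h uvw Bt L1 by (intro C.succ_min_le_three[OF refl t _ _ y(2)]) auto
  qed
  show "succ_min 3 C 2 \<le> 16 * (L 1 * L 3)"
  proof -
    have "\<exists>y\<in>{B u v, B u w}. det3 (\<lambda>k. t k (h u)) (\<lambda>k. t k y) \<noteq> 0"
    proof (rule ccontr)
      assume "\<not> (\<exists>y\<in>{B u v, B u w}. det3 (\<lambda>k. t k (h u)) (\<lambda>k. t k y) \<noteq> 0)"
      then have 0: "a1 * t 1 (B u v) + a2 * t 2 (B u v) + a3 * t 3 (B u v) = 0"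
        "a1 * t 1 (B u w) + a2 * t 2 (B u w) + a3 * t 3 (B u w) = 0"
        by (simp_all add: adet)
      have 1: "a1 * t 1 (h u) + a2 * t 2 (h u) + a3 * t 3 (h u) = 0"
        by (simp add: a1_a2_a3_def algebra_simps)
      \<comment> \<open>\<open>f\<close> holds the coefficients of the polar form with
        \<open>u\<close> in one argument. This form vanishes at 1 and \<open>u\<close> in any case,
        and at \<open>v\<close> and \<open>w\<close> by assumption; so it vanishes on the whole
        ring, and the independence of the embeddings makes every coefficient zero.\<close>
      define f where "f \<sigma> = (if \<sigma> = s 1 then a1 * s 2 u + a2 * s 3 u + a3 * s 4 u
        else if \<sigma> = s 2 then a1 * s 1 u + a2 * s 4 u + a3 * s 3 u
        else if \<sigma> = s 3 then a1 * s 4 u + a2 * s 1 u + a3 * s 2 u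
        else a1 * s 3 u + a2 * s 2 u + a3 * s 1 u)" for \<sigma>
      have fs: "(\<Sum>\<sigma>\<in>embeddings R. f \<sigma> * \<sigma> x) = (a1 * s 2 u + a2 * s 3 u + a3 * s 4 u) * s 1 x
        + (a1 * s 1 u + a2 * s 4 u + a3 * s 3 u) * s 2 x + (a1 * s 4 u + a2 * s 1 u + a3 * s 2 u) * s 3 x
        + (a1 * s 3 u + a2 * s 2 u + a3 * s 1 u) * s 4 x" for x
        unfolding E using sne sne[symmetric] by (simp add: f_def add.assoc del: One_nat_def)
      have fb: "(\<Sum>\<sigma>\<in>embeddings R. f \<sigma> * \<sigma> (b j)) = 0" if j: "j < 4" for j
      proof -
        have "j = 0 \<or> b j = u \<or> b j = v \<or> b j = w" using j by (auto simp: u_v_w_def less_Suc_eq eval_nat_numeral)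
        then show ?thesis
        proof (elim disjE)
          assume "j = 0"
          then have "(\<Sum>\<sigma>\<in>embeddings R. f \<sigma> * \<sigma> (b j)) = (a1 + a2 + a3) * (s 1 u + s 2 u + s 3 u + s 4 u)"
            unfolding fs \<open>j = 0\<close> b(2) R.emb_one[OF se(1)] R.emb_one[OF se(2)] R.emb_one[OF se(3)] R.emb_one[OF se(4)]
            by (simp add: algebra_simps)
          then show ?thesis by (simp add: asum)
        next
          assume bj: "b j = u"
          have "(\<Sum>\<sigma>\<in>embeddings R. f \<sigma> * \<sigma> (b j)) = 2 * (a1 * t 1 (h u) + a2 * t 2 (h u) + a3 * t 3 (h u))"
            unfolding fs bj using h[OF uvw(1)] by (simp add: algebra_simps)
          then show ?thesis by (simp only: 1 mult_zero_right)
        next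
          assume bj: "b j = v"
          have "(\<Sum>\<sigma>\<in>embeddings R. f \<sigma> * \<sigma> (b j)) = a1 * t 1 (B u v) + a2 * t 2 (B u v) + a3 * t 3 (B u v)"
            unfolding fs bj using Bt[OF uvw(1,2)] by (simp add: algebra_simps)
          then show ?thesis using 0 by simp
        next
          assume bj: "b j = w"
          have "(\<Sum>\<sigma>\<in>embeddings R. f \<sigma> * \<sigma> (b j)) = a1 * t 1 (B u w) + a2 * t 2 (B u w) + a3 * t 3 (B u w)"
            unfolding fs bj using Bt[OF uvw(1,3)] by (simp add: algebra_simps)
          then show ?thesis using 0 by simp
        qed
      qed
      have "\<forall>\<sigma>\<in>embeddings R. f \<sigma> = 0"
      proof (rule R.emb_linear_independent[OF R.finite_emb subset_refl], rule ballI)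
        fix x assume x: "x \<in> carrier R"
        have "(\<Sum>\<sigma>\<in>embeddings R. f \<sigma> * \<sigma> x) = (\<Sum>\<sigma>\<in>embeddings R. \<Sum>k<4. of_int (coords R 4 b x k) * (f \<sigma> * \<sigma> (b k)))"
          by (intro sum.cong refl) (subst R.emb_coords[OF b(1) x], auto simp: sum_distrib_left algebra_simps)
        also have "\<dots> = (\<Sum>k<4. of_int (coords R 4 b x k) * (\<Sum>\<sigma>\<in>embeddings R. f \<sigma> * \<sigma> (b k)))"
          by (subst sum.swap) (simp add: sum_distrib_left)
        finally show "(\<Sum>\<sigma>\<in>embeddings R. f \<sigma> * \<sigma> x) = 0" using fb by simp
      qed
      then have f0: "f (s 1) = 0" "f (s 2) = 0" "f (s 3) = 0" using se by blast+
      have f1: "a1 * s 2 u + a2 * s 3 u + a3 * s 4 u = 0" "a1 * s 1 u + a2 * s 4 u + a3 * s 3 u = 0"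
        "a1 * s 4 u + a2 * s 1 u + a3 * s 2 u = 0"
        using f0 sne sne[symmetric] by (simp_all add: f_def)
      \<comment> \<open>Adding two vanishing coefficients and using \<open>a1 + a2 + a3 = 0\<close>
        leaves a single product each time; the difference of the two resulting equations gives
        \<open>s 2 u = s 3 u\<close>.\<close>
      have "a1 * (s 1 u + s 2 u - s 3 u - s 4 u) = 0" "a2 * (s 1 u + s 3 u - s 2 u - s 4 u) = 0"
      proof -
        have "a1 * (s 1 u + s 2 u - s 3 u - s 4 u) = (a1 * s 2 u + a2 * s 3 u + a3 * s 4 u)
            + (a1 * s 1 u + a2 * s 4 u + a3 * s 3 u) - (a1 + a2 + a3) * (s 3 u + s 4 u)"
          "a2 * (s 1 u + s 3 u - s 2 u - s 4 u) = (a1 * s 2 u + a2 * s 3 u + a3 * s 4 u)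
            + (a1 * s 4 u + a2 * s 1 u + a3 * s 2 u) - (a1 + a2 + a3) * (s 2 u + s 4 u)"
          by (simp_all add: algebra_simps)
        then show "a1 * (s 1 u + s 2 u - s 3 u - s 4 u) = 0" "a2 * (s 1 u + s 3 u - s 2 u - s 4 u) = 0"
          by (simp_all only: f1 asum mult_zero_left diff_zero add_0_left)
      qed
      then have "s 1 u + s 2 u - s 3 u - s 4 u = 0" "s 1 u + s 3 u - s 2 u - s 4 u = 0" using anz by simp_all
      moreover have "2 * (s 2 u - s 3 u) = (s 1 u + s 2 u - s 3 u - s 4 u) - (s 1 u + s 3 u - s 2 u - s 4 u)"
        by (simp add: algebra_simps)
      ultimately have "2 * (s 2 u - s 3 u) = 0" by (simp only: diff_zero)
      then show False using distinct[OF se(2,3) sne(4)] by simp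
    qed
    then obtain y where y: "y \<in> {B u v, B u w}" "det3 (\<lambda>k. t k (h u)) (\<lambda>k. t k y) \<noteq> 0" by blast
    have "cmod (t k y) \<le> 16 * (L 1 * L 3)" if "k \<in> {1..3}" for k
      using y(1) Blen[OF that, of 1 3] Blen[OF that, of 1 2] L1 by (auto simp: u_v_w_def)
    moreover have "cmod (t k (h u)) \<le> 16 * (L 1 * L 3)" if "k \<in> {1..3}" for k
      using hlen[OF that, of 1] L1 by (auto simp: u_v_w_def)
    ultimately show ?thesis
      using y h uvw Bt L1 by (intro C.succ_min_le_three[OF refl t _ _ y(2)]) auto
  qed
qed

section \<open>Inequalities valid for all pairs with symmetric group\<close>

lemma atLeast1_lessThan_4: "{1..<4::nat} = {1, 2, 3}" by auto

lemma atLeast1_lessThan_3: "{1..<3::nat} = {1, 2}" by auto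

lemma quartic_minima:
  "\<exists>K\<ge>1. \<forall>R :: ('a, 'm) ring_scheme. embedded_ring R 4 \<longrightarrow>
    (\<exists>b. int_basis R 4 b \<and> b 0 = \<one>\<^bsub>R\<^esub> \<and>
      (\<forall>j\<in>{1, 2, 3}. ring_length 4 R (b j) \<le> K * succ_min 4 R j \<and> 1 \<le> K * succ_min 4 R j) \<and>
      sqrt \<bar>real_of_int (disc 4 R)\<bar> \<le> K * (succ_min 4 R 1 * succ_min 4 R 2 * succ_min 4 R 3) \<and>
      succ_min 4 R 1 * succ_min 4 R 2 * succ_min 4 R 3 \<le> K * sqrt \<bar>real_of_int (disc 4 R)\<bar>)"
proof -
  obtain K where K: "K \<ge> 1" "\<forall>R :: ('a, 'm) ring_scheme. embedded_ring R 4 \<longrightarrow>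
    (\<exists>b. int_basis R 4 b \<and> b 0 = \<one>\<^bsub>R\<^esub> \<and>
      (\<forall>j. 1 \<le> j \<longrightarrow> j < 4 \<longrightarrow> ring_length 4 R (b j) \<le> K * succ_min 4 R j \<and> 1 / K \<le> succ_min 4 R j) \<and>
      sqrt \<bar>real_of_int (disc 4 R)\<bar> \<le> K * (\<Prod>j\<in>{1..<4}. succ_min 4 R j) \<and>
      (\<Prod>j\<in>{1..<4}. succ_min 4 R j) \<le> K * sqrt \<bar>real_of_int (disc 4 R)\<bar>)"
    using successive_minima_reduction[of 4, where ?'a = 'a and ?'m = 'm and ?'v = "complex \<times> complex \<times> complex \<times> complex"]
      embedded_ring.lattice_rep4 by blast
  have "(\<forall>j. 1 \<le> j \<longrightarrow> j < 4 \<longrightarrow> P j) \<longleftrightarrow> (\<forall>j\<in>{1, 2, 3}. P j)" for P :: "nat \<Rightarrow> bool"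
    by (metis One_nat_def atLeast1_lessThan_4 atLeastLessThan_iff)
  note eq = this
  have prod: "(\<Prod>j\<in>{1..<4}. f j) = f 1 * f 2 * f 3" for f :: "nat \<Rightarrow> real"
    unfolding atLeast1_lessThan_4 by simp
  have div: "1 / K \<le> x \<longleftrightarrow> 1 \<le> K * x" for x :: real using K(1) by (simp add: field_simps)
  show ?thesis using K unfolding eq prod div by blast
qed

lemma cubic_minima:
  "\<exists>K\<ge>1. \<forall>R :: ('a, 'm) ring_scheme. embedded_ring R 3 \<longrightarrow>
    (\<exists>b. int_basis R 3 b \<and> b 0 = \<one>\<^bsub>R\<^esub> \<and>
      (\<forall>j\<in>{1, 2}. ring_length 3 R (b j) \<le> K * succ_min 3 R j \<and> 1 \<le> K * succ_min 3 R j) \<and>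
      sqrt \<bar>real_of_int (disc 3 R)\<bar> \<le> K * (succ_min 3 R 1 * succ_min 3 R 2) \<and>
      succ_min 3 R 1 * succ_min 3 R 2 \<le> K * sqrt \<bar>real_of_int (disc 3 R)\<bar>)"
proof -
  obtain K where K: "K \<ge> 1" "\<forall>R :: ('a, 'm) ring_scheme. embedded_ring R 3 \<longrightarrow>
    (\<exists>b. int_basis R 3 b \<and> b 0 = \<one>\<^bsub>R\<^esub> \<and>
      (\<forall>j. 1 \<le> j \<longrightarrow> j < 3 \<longrightarrow> ring_length 3 R (b j) \<le> K * succ_min 3 R j \<and> 1 / K \<le> succ_min 3 R j) \<and>
      sqrt \<bar>real_of_int (disc 3 R)\<bar> \<le> K * (\<Prod>j\<in>{1..<3}. succ_min 3 R j) \<and>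
      (\<Prod>j\<in>{1..<3}. succ_min 3 R j) \<le> K * sqrt \<bar>real_of_int (disc 3 R)\<bar>)"
    using successive_minima_reduction[of 3, where ?'a = 'a and ?'m = 'm and ?'v = "complex \<times> complex \<times> complex"]
      embedded_ring.lattice_rep3 by fastforce
  have "(\<forall>j. 1 \<le> j \<longrightarrow> j < 3 \<longrightarrow> P j) \<longleftrightarrow> (\<forall>j\<in>{1, 2}. P j)" for P :: "nat \<Rightarrow> bool"
    by (metis One_nat_def atLeast1_lessThan_3 atLeastLessThan_iff)
  note eq = this
  have prod: "(\<Prod>j\<in>{1..<3}. f j) = f 1 * f 2" for f :: "nat \<Rightarrow> real"
    unfolding atLeast1_lessThan_3 by simp
  have div: "1 / K \<le> x \<longleftrightarrow> 1 \<le> K * x" for x :: real using K(1) by (simp add: field_simps)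
  show ?thesis using K unfolding eq prod div by blast
qed

text \<open>The constraints of the polytope in multiplicative form. Taking logarithms to base
  \<open>D\<close> turns \<open>K\<close> into an error \<open>ln K / ln D\<close>.\<close>

definition minima_bounds :: "real \<Rightarrow> real \<Rightarrow> (real \<times> real \<times> real \<times> real \<times> real) \<Rightarrow> bool" where
  "minima_bounds K D = (\<lambda>(l1, l2, l3, m1, m2). 1 \<le> D \<and> 1 \<le> K * l1 \<and> l1 \<le> l2 \<and> l2 \<le> l3 \<and>
     sqrt D \<le> K * (l1 * l2 * l3) \<and> l1 * l2 * l3 \<le> K * sqrt D \<and> 1 \<le> K * m1 \<and> m1 \<le> m2 \<and>
     sqrt D \<le> K * (m1 * m2) \<and> m1 * m2 \<le> K * sqrt D \<and>
     m2 \<le> K * (l1 * l3) \<and> m1 \<le> K * (l1 * l1) \<and> m2 \<le> K * (l2 * l2))"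

lemma card_embeddings_bij: "bij_betw f {1..n} (embeddings R) \<Longrightarrow> card (embeddings R) = n"
  by (drule bij_betw_same_card) simp

lemma S4_pair_embedded:
  assumes "nondegenerate_ring 4 R" "cubic_resolvent R C" "G_ring 4 (sym_group 4) R"
  shows "embedded_ring R 4" "embedded_ring C 3"
proof -
  obtain f g :: "nat \<Rightarrow> _" where fg: "bij_betw f {1..4} (embeddings R)" "bij_betw g {1..3} (embeddings C)"
    using assms unfolding G_ring_def cubic_resolvent_def by blast
  have "card (embeddings R) = 4" "card (embeddings C) = 3"
    by (rule card_embeddings_bij[OF fg(1)], rule card_embeddings_bij[OF fg(2)])
  then show "embedded_ring R 4" "embedded_ring C 3"
    using assms by (auto simp: nondegenerate_ring_def cubic_resolvent_def intro!: embedded_ringI)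
qed

theorem S4_pair_minima_bounds:
  "\<exists>K\<ge>1. \<forall>(R :: ('a, 'm) ring_scheme) (C :: ('b, 'k) ring_scheme).
    nondegenerate_ring 4 R \<longrightarrow> cubic_resolvent R C \<longrightarrow> G_ring 4 (sym_group 4) R \<longrightarrow>
    minima_bounds K \<bar>real_of_int (disc 4 R)\<bar>
      (succ_min 4 R 1, succ_min 4 R 2, succ_min 4 R 3, succ_min 3 C 1, succ_min 3 C 2)"
proof -
  obtain K1 where K1: "K1 \<ge> 1" "\<forall>R :: ('a, 'm) ring_scheme. embedded_ring R 4 \<longrightarrow>
    (\<exists>b. int_basis R 4 b \<and> b 0 = \<one>\<^bsub>R\<^esub> \<and>
      (\<forall>j\<in>{1, 2, 3}. ring_length 4 R (b j) \<le> K1 * succ_min 4 R j \<and> 1 \<le> K1 * succ_min 4 R j) \<and>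
      sqrt \<bar>real_of_int (disc 4 R)\<bar> \<le> K1 * (succ_min 4 R 1 * succ_min 4 R 2 * succ_min 4 R 3) \<and>
      succ_min 4 R 1 * succ_min 4 R 2 * succ_min 4 R 3 \<le> K1 * sqrt \<bar>real_of_int (disc 4 R)\<bar>)"
    using quartic_minima[where ?'a = 'a and ?'m = 'm] by (elim exE conjE) (rule that)
  obtain K2 where K2: "K2 \<ge> 1" "\<forall>R :: ('b, 'k) ring_scheme. embedded_ring R 3 \<longrightarrow>
    (\<exists>b. int_basis R 3 b \<and> b 0 = \<one>\<^bsub>R\<^esub> \<and>
      (\<forall>j\<in>{1, 2}. ring_length 3 R (b j) \<le> K2 * succ_min 3 R j \<and> 1 \<le> K2 * succ_min 3 R j) \<and>
      sqrt \<bar>real_of_int (disc 3 R)\<bar> \<le> K2 * (succ_min 3 R 1 * succ_min 3 R 2) \<and>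
      succ_min 3 R 1 * succ_min 3 R 2 \<le> K2 * sqrt \<bar>real_of_int (disc 3 R)\<bar>)"
    using cubic_minima[where ?'a = 'b and ?'m = 'k] by (elim exE conjE) (rule that)
  \<comment> \<open>The bounds for the resolvent are applied to
    \<open>L j = K1 * succ_min 4 R j\<close>, so their constants acquire the factor
    \<open>K1\<^sup>2\<close>.\<close>
  define K where "K = 16 * K1\<^sup>2 + K1 + K2"
  have K: "K \<ge> 1" "K1 \<le> K" "K2 \<le> K" "8 * K1\<^sup>2 \<le> K" "16 * K1\<^sup>2 \<le> K"
    using K1(1) K2(1) zero_le_power2[of K1] unfolding K_def by linarith+
  have "minima_bounds K \<bar>real_of_int (disc 4 R)\<bar>
      (succ_min 4 R 1, succ_min 4 R 2, succ_min 4 R 3, succ_min 3 C 1, succ_min 3 C 2)"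
    if RC: "nondegenerate_ring 4 R" "cubic_resolvent R C" "G_ring 4 (sym_group 4) R"
    for R :: "('a, 'm) ring_scheme" and C :: "('b, 'k) ring_scheme"
  proof -
    note emb = S4_pair_embedded[OF RC]
    interpret R: embedded_ring R 4 by (rule emb)
    interpret C: embedded_ring C 3 by (rule emb)
    obtain b where b: "int_basis R 4 b" "b 0 = \<one>\<^bsub>R\<^esub>"
      "\<And>j. j \<in> {1, 2, 3} \<Longrightarrow> ring_length 4 R (b j) \<le> K1 * succ_min 4 R j"
      "\<And>j. j \<in> {1, 2, 3} \<Longrightarrow> 1 \<le> K1 * succ_min 4 R j"
      "sqrt \<bar>real_of_int (disc 4 R)\<bar> \<le> K1 * (succ_min 4 R 1 * succ_min 4 R 2 * succ_min 4 R 3)"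
      "succ_min 4 R 1 * succ_min 4 R 2 * succ_min 4 R 3 \<le> K1 * sqrt \<bar>real_of_int (disc 4 R)\<bar>"
      using K1(2)[rule_format, OF emb(1)] by blast
    have c: "1 \<le> K2 * succ_min 3 C 1" "1 \<le> K2 * succ_min 3 C 2"
      "sqrt \<bar>real_of_int (disc 3 C)\<bar> \<le> K2 * (succ_min 3 C 1 * succ_min 3 C 2)"
      "succ_min 3 C 1 * succ_min 3 C 2 \<le> K2 * sqrt \<bar>real_of_int (disc 3 C)\<bar>"
      using K2(2)[rule_format, OF emb(2)] by auto
    have d: "disc 3 C = disc 4 R" using RC(2) by (simp add: cubic_resolvent_def)
    have mono: "succ_min 4 R 1 \<le> succ_min 4 R 2" "succ_min 4 R 2 \<le> succ_min 4 R 3" "succ_min 3 C 1 \<le> succ_min 3 C 2"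
      by (intro R.succ_min_mono C.succ_min_mono; simp)+
    have pos: "0 < succ_min 4 R 1" "0 < succ_min 3 C 1"
    proof -
      have pos: "0 < x" if "1 \<le> k * x" "1 \<le> k" for k x :: real
        by (rule zero_less_mult_pos[of k x]) (use that in auto)
      show "0 < succ_min 4 R 1" "0 < succ_min 3 C 1"
        by (rule pos[OF b(4)[of 1] K1(1)], simp, rule pos[OF c(1) K2(1)])
    qed
    have pos': "0 < succ_min 4 R 2" "0 < succ_min 4 R 3" "0 < succ_min 3 C 2" using pos mono by auto
    have K1p: "K1 * succ_min 4 R 1 \<le> K1 * succ_min 4 R 2" "K1 * succ_min 4 R 2 \<le> K1 * succ_min 4 R 3"
      using mono K1(1) by auto
    have L1: "1 \<le> K1 * succ_min 4 R 1" using b(4)[of 1] by simp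
    note res = cubic_resolvent_minima[OF G_ring_symmetric[OF RC(3)] emb RC(2) b(1,2), of "\<lambda>j. K1 * succ_min 4 R j",
        OF b(3) L1 K1p, simplified]
    have D: "1 \<le> \<bar>real_of_int (disc 4 R)\<bar>" using R.disc_nonzero by linarith
    have up: "p \<le> K * q" if "p \<le> k * q" "0 \<le> q" "k \<le> K" for p q k :: real
      using mult_right_mono[OF that(3,2)] that(1) by linarith
    have r1: "succ_min 3 C 1 \<le> 8 * K1\<^sup>2 * (succ_min 4 R 1 * succ_min 4 R 1)"
      using res(1) by (simp add: power2_eq_square algebra_simps)
    have r2: "succ_min 3 C 2 \<le> 16 * K1\<^sup>2 * (succ_min 4 R 2 * succ_min 4 R 2)"
      using res(2) by (simp add: power2_eq_square algebra_simps)
    have r3: "succ_min 3 C 2 \<le> 16 * K1\<^sup>2 * (succ_min 4 R 1 * succ_min 4 R 3)"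
      using res(3) by (simp add: power2_eq_square algebra_simps)
    show ?thesis
      unfolding minima_bounds_def prod.case
      using D mono pos pos' up[OF b(5) _ K(2)] up[OF b(6) _ K(2)] up[OF b(4)[of 1] _ K(2)]
        up[OF c(1) _ K(3)] up[OF c(3) _ K(3)] up[OF c(4) _ K(3)] up[OF r1 _ K(4)] up[OF r2 _ K(5)] up[OF r3 _ K(5)]
      unfolding d by simp
  qed
  then show ?thesis using K(1) by blast
qed

section \<open>A family of quartic rings and their resolvents\<close>

text \<open>Laplace expansion along the first row, for matrices given by a function, so that
  determinants of fixed small size are evaluated by rewriting.\<close>

lemma det_mat_Suc:
  fixes f :: "nat \<Rightarrow> nat \<Rightarrow> 'x :: comm_ring_1"
  shows "det (mat (Suc n) (Suc n) (\<lambda>(i, j). f i j)) =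
    (\<Sum>j<Suc n. f 0 j * ((-1) ^ j * det (mat n n (\<lambda>(k, l). f (Suc k) (if l < j then l else Suc l)))))"
proof -
  have "mat_delete (mat (Suc n) (Suc n) (\<lambda>(i, j). f i j)) 0 j = mat n n (\<lambda>(k, l). f (Suc k) (if l < j then l else Suc l))" for j
    by (rule eq_matI) (auto simp: mat_delete_def)
  then show ?thesis
    by (subst laplace_expansion_row[of _ "Suc n" 0]) (auto simp: cofactor_def intro!: sum.cong)
qed

text \<open>The rings must have carriers in arbitrary infinite types. They are built on tuples of
  integers, whose addition is kept, and transported along an injection \<open>e\<close>.\<close>

definition push_ring :: "('q :: ab_group_add \<Rightarrow> 'a) \<Rightarrow> ('q \<Rightarrow> 'q \<Rightarrow> 'q) \<Rightarrow> 'q \<Rightarrow> 'a ring" where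
  "push_ring e m i = \<lparr>carrier = range e, monoid.mult = (\<lambda>x y. e (m (the_inv e x) (the_inv e y))), one = e i,
     ring.zero = e 0, ring.add = (\<lambda>x y. e (the_inv e x + the_inv e y))\<rparr>"

context
  fixes e :: "'q :: ab_group_add \<Rightarrow> 'a" and m :: "'q \<Rightarrow> 'q \<Rightarrow> 'q" and i :: 'q
  assumes e: "inj e"
begin

lemma push_carrier [simp]: "carrier (push_ring e m i) = range e"
  and push_one [simp]: "\<one>\<^bsub>push_ring e m i\<^esub> = e i"
  and push_zero [simp]: "\<zero>\<^bsub>push_ring e m i\<^esub> = e 0"
  by (simp_all add: push_ring_def)

lemma push_mult [simp]: "e x \<otimes>\<^bsub>push_ring e m i\<^esub> e y = e (m x y)"
  and push_add [simp]: "e x \<oplus>\<^bsub>push_ring e m i\<^esub> e y = e (x + y)"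
  by (simp_all add: push_ring_def the_inv_f_f[OF e])

lemma push_cring:
  assumes "\<And>x y z. m (m x y) z = m x (m y z)" "\<And>x y. m x y = m y x" "\<And>x. m i x = x"
    "\<And>x y z. m (x + y) z = m x z + m y z"
  shows "cring (push_ring e m i)"
proof (rule cringI)
  show "abelian_group (push_ring e m i)"
  proof (rule abelian_groupI)
    fix x assume "x \<in> carrier (push_ring e m i)"
    then obtain x' where "x = e x'" by auto
    then show "\<exists>y\<in>carrier (push_ring e m i). y \<oplus>\<^bsub>push_ring e m i\<^esub> x = \<zero>\<^bsub>push_ring e m i\<^esub>"
      by (intro bexI[of _ "e (- x')"]) auto
  qed (auto simp: ac_simps)
  show "comm_monoid (push_ring e m i)"
    by (rule comm_monoidI) (auto simp: assms(1) assms(3) intro!: arg_cong[of _ _ e] assms(2))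
qed (auto simp: assms(4))

lemma push_smult:
  assumes "cring (push_ring e m i)"
  shows "[(k::int)] \<cdot>\<^bsub>push_ring e m i\<^esub> e x = e (if k \<ge> 0 then ((+) x ^^ nat k) 0 else - ((+) x ^^ nat (- k)) 0)"
proof -
  interpret cring "push_ring e m i" by (rule assms)
  have n: "[(k::nat)] \<cdot>\<^bsub>push_ring e m i\<^esub> e x = e (((+) x ^^ k) 0)" for k
    by (induction k) (auto simp: add.commute)
  have minus: "\<ominus>\<^bsub>push_ring e m i\<^esub> e y = e (- y)" for y
    by (rule minus_equality) auto
  show ?thesis
    by (cases "k \<ge> 0") (auto simp: add_pow_int_ge add_pow_int_lt n minus)
qed

end

lemma funpow_add4: "((+) (x0, x1, x2, x3) ^^ k) 0 = (int k * x0, int k * x1, int k * x2, int k * x3)"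
  by (induction k) (auto simp: algebra_simps zero_prod_def)

lemma funpow_add3: "((+) (x0, x1, x2) ^^ k) 0 = (int k * x0, int k * x1, int k * x2)"
  by (induction k) (auto simp: algebra_simps zero_prod_def)

lemma lessThan_4: "{..<4::nat} = {0, 1, 2, 3}" by auto

lemma lessThan_3: "{..<3::nat} = {0, 1, 2}" by auto

lemma (in cring) int_comb4:
  assumes "b 0 \<in> carrier R" "b 1 \<in> carrier R" "b 2 \<in> carrier R" "b 3 \<in> carrier R"
  shows "int_comb R 4 b c = [c 0] \<cdot> b 0 \<oplus> ([c 1] \<cdot> b 1 \<oplus> ([c 2] \<cdot> b 2 \<oplus> [c 3] \<cdot> b 3))"
  unfolding int_comb_def lessThan_4 using assms by (simp add: Pi_def)

lemma (in cring) int_comb3: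
  assumes "b 0 \<in> carrier R" "b 1 \<in> carrier R" "b 2 \<in> carrier R"
  shows "int_comb R 3 b c = [c 0] \<cdot> b 0 \<oplus> ([c 1] \<cdot> b 1 \<oplus> [c 2] \<cdot> b 2)"
  unfolding int_comb_def lessThan_3 using assms by (simp add: Pi_def)

definition coord4 :: "int \<times> int \<times> int \<times> int \<Rightarrow> nat \<Rightarrow> int" where
  "coord4 = (\<lambda>(x0, x1, x2, x3) i. if i = 0 then x0 else if i = 1 then x1 else if i = 2 then x2 else if i = 3 then x3 else 0)"

definition coord3 :: "int \<times> int \<times> int \<Rightarrow> nat \<Rightarrow> int" where
  "coord3 = (\<lambda>(x0, x1, x2) i. if i = 0 then x0 else if i = 1 then x1 else if i = 2 then x2 else 0)"

definition unit4 :: "nat \<Rightarrow> int \<times> int \<times> int \<times> int" where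
  "unit4 i = (if i = 0 then (1, 0, 0, 0) else if i = 1 then (0, 1, 0, 0) else if i = 2 then (0, 0, 1, 0) else (0, 0, 0, 1))"

definition unit3 :: "nat \<Rightarrow> int \<times> int \<times> int" where
  "unit3 i = (if i = 0 then (1, 0, 0) else if i = 1 then (0, 1, 0) else (0, 0, 1))"

lemma push_basis4:
  fixes e :: "int \<times> int \<times> int \<times> int \<Rightarrow> 'a"
  assumes e: "inj e" and R: "cring (push_ring e m i)"
  shows "int_basis (push_ring e m i) 4 (\<lambda>j. e (unit4 j))"
    and "coords (push_ring e m i) 4 (\<lambda>j. e (unit4 j)) (e x) = coord4 x"
proof -
  interpret cring "push_ring e m i" by (rule R)
  have comb: "int_comb (push_ring e m i) 4 (\<lambda>j. e (unit4 j)) c = e (c 0, c 1, c 2, c 3)" for c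
  proof -
    have s: "[k] \<cdot>\<^bsub>push_ring e m i\<^esub> e (x0, x1, x2, x3) = e (k * x0, k * x1, k * x2, k * x3)" for k x0 x1 x2 x3
      unfolding push_smult[OF e R] by (auto simp: funpow_add4)
    show ?thesis by (subst int_comb4) (auto simp: unit4_def s push_add[OF e] push_carrier[OF e])
  qed
  have ex1: "(\<forall>i\<ge>4. c i = 0) \<and> e x = int_comb (push_ring e m i) 4 (\<lambda>j. e (unit4 j)) c \<longleftrightarrow> c = coord4 x" for c x
  proof -
    obtain x0 x1 x2 x3 where x: "x = (x0, x1, x2, x3)" by (cases x) auto
    have "c = coord4 x" if "\<forall>i\<ge>4. c i = 0" "c 0 = x0" "c 1 = x1" "c 2 = x2" "c 3 = x3"
    proof
      fix i :: nat
      have "i = 0 \<or> i = 1 \<or> i = 2 \<or> i = 3 \<or> i \<ge> 4" by auto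
      then show "c i = coord4 x i" using that by (auto simp: coord4_def x)
    qed
    then show ?thesis unfolding comb by (auto simp: inj_eq[OF e] x coord4_def)
  qed
  show "int_basis (push_ring e m i) 4 (\<lambda>j. e (unit4 j))"
    unfolding int_basis_def
  proof (intro conjI ballI)
    fix x assume "x \<in> carrier (push_ring e m i)"
    then obtain x' where x: "x = e x'" by (auto simp: push_carrier[OF e])
    show "\<exists>!c. (\<forall>i\<ge>4. c i = 0) \<and> x = int_comb (push_ring e m i) 4 (\<lambda>j. e (unit4 j)) c"
      unfolding x ex1 by simp
  qed (auto simp: push_carrier[OF e])
  show "coords (push_ring e m i) 4 (\<lambda>j. e (unit4 j)) (e x) = coord4 x"
    unfolding coords_def ex1 by simp
qed

lemma push_basis3:
  fixes e :: "int \<times> int \<times> int \<Rightarrow> 'a"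
  assumes e: "inj e" and R: "cring (push_ring e m i)"
  shows "int_basis (push_ring e m i) 3 (\<lambda>j. e (unit3 j))"
    and "coords (push_ring e m i) 3 (\<lambda>j. e (unit3 j)) (e x) = coord3 x"
proof -
  interpret cring "push_ring e m i" by (rule R)
  have comb: "int_comb (push_ring e m i) 3 (\<lambda>j. e (unit3 j)) c = e (c 0, c 1, c 2)" for c
  proof -
    have s: "[k] \<cdot>\<^bsub>push_ring e m i\<^esub> e (x0, x1, x2) = e (k * x0, k * x1, k * x2)" for k x0 x1 x2
      unfolding push_smult[OF e R] by (auto simp: funpow_add3)
    show ?thesis by (subst int_comb3) (auto simp: unit3_def s push_add[OF e] push_carrier[OF e])
  qed
  have ex1: "(\<forall>i\<ge>3. c i = 0) \<and> e x = int_comb (push_ring e m i) 3 (\<lambda>j. e (unit3 j)) c \<longleftrightarrow> c = coord3 x" for c x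
  proof -
    obtain x0 x1 x2 where x: "x = (x0, x1, x2)" by (cases x) auto
    have "c = coord3 x" if "\<forall>i\<ge>3. c i = 0" "c 0 = x0" "c 1 = x1" "c 2 = x2"
    proof
      fix i :: nat
      have "i = 0 \<or> i = 1 \<or> i = 2 \<or> i \<ge> 3" by auto
      then show "c i = coord3 x i" using that by (auto simp: coord3_def x)
    qed
    then show ?thesis unfolding comb by (auto simp: inj_eq[OF e] x coord3_def)
  qed
  show "int_basis (push_ring e m i) 3 (\<lambda>j. e (unit3 j))"
    unfolding int_basis_def
  proof (intro conjI ballI)
    fix x assume "x \<in> carrier (push_ring e m i)"
    then obtain x' where x: "x = e x'" by (auto simp: push_carrier[OF e])
    show "\<exists>!c. (\<forall>i\<ge>3. c i = 0) \<and> x = int_comb (push_ring e m i) 3 (\<lambda>j. e (unit3 j)) c"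
      unfolding x ex1 by simp
  qed (auto simp: push_carrier[OF e])
  show "coords (push_ring e m i) 3 (\<lambda>j. e (unit3 j)) (e x) = coord3 x"
    unfolding coords_def ex1 by simp
qed

text \<open>The ring and the resolvent that Bhargava attaches to the ternary quadratic forms
  \<open>a x\<^sup>2 + y z + d z\<^sup>2\<close> and \<open>b x z + c y\<^sup>2\<close>.\<close>

locale form_pair =
  fixes a b c d :: int
  assumes nz: "a \<noteq> 0" "b \<noteq> 0" "c \<noteq> 0" "d \<noteq> 0"
begin

text \<open>For a root u of the quartic \<open>q_root\<close> these are products in the basis 1, u,
  v = u^2/(a b), w = a b c d/u. The rules are u^2 = a b v, u w = a b c d, v w = c d u, v^2 = c u - a
  c^2 d, u v = a b c - a c w and w^2 = b w - b d v.\<close>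

fun qmul :: "int \<times> int \<times> int \<times> int \<Rightarrow> int \<times> int \<times> int \<times> int \<Rightarrow> int \<times> int \<times> int \<times> int" where
  "qmul (x0, x1, x2, x3) (y0, y1, y2, y3) =
    (x0 * y0 + a * b * c * (x1 * y2 + x2 * y1) + a * b * c * d * (x1 * y3 + x3 * y1) - a * c * c * d * (x2 * y2),
     x0 * y1 + x1 * y0 + c * (x2 * y2) + c * d * (x2 * y3 + x3 * y2),
     x0 * y2 + x2 * y0 + a * b * (x1 * y1) - b * d * (x3 * y3),
     x0 * y3 + x3 * y0 - a * c * (x1 * y2 + x2 * y1) + b * (x3 * y3))"

text \<open>For a root w of the cubic \<open>c_root\<close> the basis is 1, w, t = a b^2 c/w, with
  w^2 = 4 a b^2 c^2 d + b^2 c t, w t = a b^2 c and t^2 = a w - 4 a c d t.\<close>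

fun cmul :: "int \<times> int \<times> int \<Rightarrow> int \<times> int \<times> int \<Rightarrow> int \<times> int \<times> int" where
  "cmul (x0, x1, x2) (y0, y1, y2) =
    (x0 * y0 + 4 * a * b * b * c * c * d * (x1 * y1) + a * b * b * c * (x1 * y2 + x2 * y1),
     x0 * y1 + x1 * y0 + a * (x2 * y2),
     x0 * y2 + x2 * y0 + b * b * c * (x1 * y1) - 4 * a * c * d * (x2 * y2))"

lemma qmul_laws:
  "qmul (qmul x y) z = qmul x (qmul y z)" "qmul x y = qmul y x" "qmul (1, 0, 0, 0) x = x"
  "qmul (x + y) z = qmul x z + qmul y z"
  by (cases x; cases y; cases z; simp add: algebra_simps)+

lemma cmul_laws:
  "cmul (cmul x' y') z' = cmul x' (cmul y' z')" "cmul x' y' = cmul y' x'" "cmul (1, 0, 0) x' = x'"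
  "cmul (x' + y') z' = cmul x' z' + cmul y' z'"
  by (cases x'; cases y'; cases z'; simp add: algebra_simps)+

definition Q_ring :: "(int \<times> int \<times> int \<times> int \<Rightarrow> 'a) \<Rightarrow> 'a ring" where
  "Q_ring e = push_ring e qmul (1, 0, 0, 0)"

definition C_ring :: "(int \<times> int \<times> int \<Rightarrow> 'a) \<Rightarrow> 'a ring" where
  "C_ring e = push_ring e cmul (1, 0, 0)"

definition q_emb :: "(int \<times> int \<times> int \<times> int \<Rightarrow> 'a) \<Rightarrow> complex \<Rightarrow> 'a \<Rightarrow> complex" where
  "q_emb e u = (\<lambda>x\<in>range e. case the_inv e x of (n0, n1, n2, n3) \<Rightarrow>
     of_int n0 + of_int n1 * u + of_int n2 * (u * u / (of_int a * of_int b)) + of_int n3 * (of_int a * of_int b * of_int c * of_int d / u))"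

definition c_emb :: "(int \<times> int \<times> int \<Rightarrow> 'a) \<Rightarrow> complex \<Rightarrow> 'a \<Rightarrow> complex" where
  "c_emb e w = (\<lambda>x\<in>range e. case the_inv e x of (n0, n1, n2) \<Rightarrow>
     of_int n0 + of_int n1 * w + of_int n2 * (of_int a * of_int b * of_int b * of_int c / w))"

definition P :: complex where "P = of_int a * of_int a * of_int b * of_int b * of_int c"

definition Q :: complex where "Q = of_int a * of_int a * of_int a * of_int b * of_int b * of_int c * of_int c * of_int d"

definition q_root :: "complex \<Rightarrow> bool" where "q_root u \<longleftrightarrow> u ^ 4 - P * u + Q = 0"

definition c_root :: "complex \<Rightarrow> bool" where
  "c_root w \<longleftrightarrow> w ^ 3 = 4 * of_int a * of_int b * of_int b * of_int c * of_int c * of_int d * w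
     + of_int a * of_int b ^ 4 * of_int c ^ 2"

lemma nzc: "(of_int a :: complex) \<noteq> 0" "(of_int b :: complex) \<noteq> 0" "(of_int c :: complex) \<noteq> 0" "(of_int d :: complex) \<noteq> 0"
  using nz by auto

lemma q_root_nz: "q_root u \<Longrightarrow> u \<noteq> 0"
  using nzc by (auto simp: q_root_def Q_def)

lemma c_root_nz: "c_root w \<Longrightarrow> w \<noteq> 0"
  using nzc by (auto simp: c_root_def)

context
  fixes e :: "int \<times> int \<times> int \<times> int \<Rightarrow> 'a" assumes e: "inj e"
begin

lemma Q_cring: "cring (Q_ring e)"
  unfolding Q_ring_def by (rule push_cring[OF e]) (fact qmul_laws)+

lemma Q_simps [simp]: "carrier (Q_ring e) = range e" "e x \<otimes>\<^bsub>Q_ring e\<^esub> e y = e (qmul x y)"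
  "e x \<oplus>\<^bsub>Q_ring e\<^esub> e y = e (x + y)" "\<one>\<^bsub>Q_ring e\<^esub> = e (1, 0, 0, 0)"
  by (simp_all add: Q_ring_def e)

lemma q_emb_apply: "q_emb e u (e (n0, n1, n2, n3)) =
   of_int n0 + of_int n1 * u + of_int n2 * (u * u / (of_int a * of_int b)) + of_int n3 * (of_int a * of_int b * of_int c * of_int d / u)"
  by (simp add: q_emb_def the_inv_f_f[OF e])

lemma q_emb_in:
  assumes u: "q_root u"
  shows "q_emb e u \<in> embeddings (Q_ring e)"
proof -
  have u0: "u \<noteq> 0" by (rule q_root_nz[OF u])
  define A B C D :: complex where "A = of_int a" "B = of_int b" "C = of_int c" "D = of_int d"
  have n0: "A \<noteq> 0" "B \<noteq> 0" "C \<noteq> 0" "D \<noteq> 0" using nzc by (simp_all add: A_B_C_D_def)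
  define v w where "v = u * u / (A * B)" "w = A * B * C * D / u"
  have u4: "u ^ 4 = A * A * B * B * C * u - A * A * A * B * B * C * C * D"
    using u by (simp add: q_root_def P_def Q_def A_B_C_D_def algebra_simps)
  have u4': "u * u * (u * u) = A * A * B * B * C * u - A * A * A * B * B * C * C * D"
    using u4 by (simp add: power4_eq_xxxx mult.assoc)
  have r: "u * u = A * B * v" "u * w = A * B * C * D" "v * w = C * D * u"
    using u0 n0 by (simp_all add: v_w_def)
  have r2: "v * v = C * u - A * C * C * D"
  proof -
    have "v * v = (u * u * (u * u)) / (A * B * (A * B))" by (simp add: v_w_def)
    then show ?thesis unfolding u4' using n0 by (simp add: field_simps)
  qed
  have r3: "u * v = A * B * C - A * C * w"
  proof -
    have "u * (u * v) = (u * u * (u * u)) / (A * B)" by (simp add: v_w_def)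
    also have "\<dots> = A * B * C * u - A * C * (A * B * C * D)" unfolding u4' using n0 by (simp add: field_simps)
    also have "\<dots> = u * (A * B * C - A * C * w)" unfolding r(2)[symmetric] by (simp add: algebra_simps)
    finally show ?thesis using u0 by simp
  qed
  have r4: "w * w = B * w - B * D * v"
  proof -
    have "u * (w * w) = A * B * C * D * w" using r(2) by (simp add: mult.assoc[symmetric])
    also have "\<dots> = B * D * (A * C * w)" by simp
    also have "A * C * w = A * B * C - u * v" using r3 by simp
    also have "B * D * (A * B * C - u * v) = u * (B * w - B * D * v)"
      using r(2) by (simp add: algebra_simps)
    finally show ?thesis using u0 by simp
  qed
  have ap: "q_emb e u (e (n0, n1, n2, n3)) = of_int n0 + of_int n1 * u + of_int n2 * v + of_int n3 * w" for n0 n1 n2 n3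
    by (simp add: q_emb_apply v_w_def A_B_C_D_def)
  have mult: "q_emb e u (e (qmul x y)) = q_emb e u (e x) * q_emb e u (e y)" for x y
  proof -
    obtain x0 x1 x2 x3 y0 y1 y2 y3 where xy: "x = (x0, x1, x2, x3)" "y = (y0, y1, y2, y3)"
      by (cases x; cases y) auto
    have "(X0 + X1 * u + X2 * v + X3 * w) * (Y0 + Y1 * u + Y2 * v + Y3 * w) =
      (X0 * Y0 + A * B * C * (X1 * Y2 + X2 * Y1) + A * B * C * D * (X1 * Y3 + X3 * Y1) - A * C * C * D * (X2 * Y2))
      + (X0 * Y1 + X1 * Y0 + C * (X2 * Y2) + C * D * (X2 * Y3 + X3 * Y2)) * u
      + (X0 * Y2 + X2 * Y0 + A * B * (X1 * Y1) - B * D * (X3 * Y3)) * v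
      + (X0 * Y3 + X3 * Y0 - A * C * (X1 * Y2 + X2 * Y1) + B * (X3 * Y3)) * w"
      for X0 X1 X2 X3 Y0 Y1 Y2 Y3
    proof -
      have "(X0 + X1 * u + X2 * v + X3 * w) * (Y0 + Y1 * u + Y2 * v + Y3 * w) = X0 * Y0
        + (X0 * Y1 + X1 * Y0) * u + (X0 * Y2 + X2 * Y0) * v + (X0 * Y3 + X3 * Y0) * w
        + (X1 * Y1) * (u * u) + (X2 * Y2) * (v * v) + (X3 * Y3) * (w * w)
        + (X1 * Y2 + X2 * Y1) * (u * v) + (X1 * Y3 + X3 * Y1) * (u * w) + (X2 * Y3 + X3 * Y2) * (v * w)"
        by (simp add: algebra_simps)
      then show ?thesis unfolding r r2 r3 r4 by (simp add: algebra_simps)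
    qed
    then show ?thesis unfolding xy qmul.simps ap by (simp add: A_B_C_D_def)
  qed
  show ?thesis
    unfolding embeddings_def
  proof (intro IntI ring_hom_memI)
    fix x y assume "x \<in> carrier (Q_ring e)" "y \<in> carrier (Q_ring e)"
    then obtain x' y' where xy: "x = e x'" "y = e y'" by auto
    show "q_emb e u (x \<otimes>\<^bsub>Q_ring e\<^esub> y) = q_emb e u x \<otimes>\<^bsub>complex_field\<^esub> q_emb e u y"
      by (simp add: xy mult)
    show "q_emb e u (x \<oplus>\<^bsub>Q_ring e\<^esub> y) = q_emb e u x \<oplus>\<^bsub>complex_field\<^esub> q_emb e u y"
      by (cases x'; cases y') (simp add: xy ap algebra_simps)
  next
    show "q_emb e u \<one>\<^bsub>Q_ring e\<^esub> = \<one>\<^bsub>complex_field\<^esub>" by (simp add: ap)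
    show "q_emb e u \<in> extensional (carrier (Q_ring e))" by (simp add: q_emb_def)
  qed simp
qed

text \<open>The products u^2 and u w determine the images of the other two basis vectors from that
  of the first one; inserting them into the rule for v^2 gives the quartic.\<close>

lemma q_emb_conv:
  assumes s: "s \<in> embeddings (Q_ring e)"
  shows "q_root (s (e (0, 1, 0, 0)))" "s = q_emb e (s (e (0, 1, 0, 0)))"
proof -
  interpret cring "Q_ring e" by (rule Q_cring)
  note sm = emb_mult[OF s, of "e x" "e y" for x y, simplified] and sa = emb_add[OF s, of "e x" "e y" for x y, simplified]
  define A B C D :: complex where "A = of_int a" "B = of_int b" "C = of_int c" "D = of_int d"
  have n0: "A \<noteq> 0" "B \<noteq> 0" "C \<noteq> 0" "D \<noteq> 0" using nzc by (simp_all add: A_B_C_D_def)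
  define u v w where "u = s (e (0, 1, 0, 0))" "v = s (e (0, 0, 1, 0))" "w = s (e (0, 0, 0, 1))"
  have ap: "s (e (n0, n1, n2, n3)) = of_int n0 + of_int n1 * u + of_int n2 * v + of_int n3 * w" for n0 n1 n2 n3
  proof -
    have "e (n0, n1, n2, n3) = int_comb (Q_ring e) 4 (\<lambda>j. e (unit4 j)) (coord4 (n0, n1, n2, n3))"
    proof -
      interpret E: cring "push_ring e qmul (1, 0, 0, 0)" using Q_cring by (simp add: Q_ring_def)
      have R: "cring (push_ring e qmul (1, 0, 0, 0))" by (rule E.cring_axioms)
      have "int_basis (push_ring e qmul (1, 0, 0, 0)) 4 (\<lambda>j. e (unit4 j))" by (rule push_basis4(1)[OF e R])
      then have "\<exists>!k. (\<forall>i\<ge>4. k i = 0) \<and> e (n0, n1, n2, n3) = int_comb (push_ring e qmul (1, 0, 0, 0)) 4 (\<lambda>j. e (unit4 j)) k"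
        by (auto simp: int_basis_def push_carrier[OF e])
      from theI'[OF this] show ?thesis
        using push_basis4(2)[OF e R, of "(n0, n1, n2, n3)"] by (simp add: coords_def Q_ring_def)
    qed
    then have "s (e (n0, n1, n2, n3)) = (\<Sum>i<4. of_int (coord4 (n0, n1, n2, n3) i) * s (e (unit4 i)))"
      using emb_int_comb[OF s, of "\<lambda>j. e (unit4 j)" 4] by (simp add: image_subset_iff)
    also have "\<dots> = of_int n0 * s \<one>\<^bsub>Q_ring e\<^esub> + of_int n1 * u + of_int n2 * v + of_int n3 * w"
      unfolding lessThan_4 by (simp add: coord4_def unit4_def u_v_w_def)
    finally show ?thesis by (simp only: emb_one[OF s] mult_1_right)
  qed
  have r1: "u * u = A * B * v" "u * w = A * B * C * D"
    using sm[of "(0, 1, 0, 0)" "(0, 1, 0, 0)"] sm[of "(0, 1, 0, 0)" "(0, 0, 0, 1)"]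
    by (simp_all add: ap A_B_C_D_def)
  have r2: "v * v = C * u - A * C * C * D"
    using sm[of "(0, 0, 1, 0)" "(0, 0, 1, 0)"] by (simp add: ap A_B_C_D_def algebra_simps)
  have u0: "u \<noteq> 0" using r1(2) n0 by auto
  have "u ^ 4 = (u * u) * (u * u)" by (simp add: power4_eq_xxxx)
  also have "\<dots> = A * B * (A * B) * (v * v)" unfolding r1 by simp
  also have "\<dots> = A * B * (A * B) * (C * u - A * C * C * D)" unfolding r2 ..
  finally show "q_root (s (e (0, 1, 0, 0)))"
    by (simp add: q_root_def P_def Q_def u_v_w_def A_B_C_D_def algebra_simps)
  have "v = u * u / (A * B)" "w = A * B * C * D / u" using r1 n0 u0 by (simp_all add: field_simps)
  note vw = this
  show "s = q_emb e (s (e (0, 1, 0, 0)))"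
  proof (rule extensionalityI[of _ "range e"])
    show "s \<in> extensional (range e)" using s by (simp add: embeddings_def)
    show "q_emb e (s (e (0, 1, 0, 0))) \<in> extensional (range e)" by (simp add: q_emb_def)
    fix x assume "x \<in> range e"
    then obtain n0 n1 n2 n3 where x: "x = e (n0, n1, n2, n3)" by auto
    show "s x = q_emb e (s (e (0, 1, 0, 0))) x"
      unfolding x ap q_emb_apply u_v_w_def(1)[symmetric] vw by (simp add: A_B_C_D_def)
  qed
qed

lemma Q_embeddings: "embeddings (Q_ring e) = q_emb e ` {u. q_root u}"
proof (intro subset_antisym subsetI)
  fix s assume "s \<in> embeddings (Q_ring e)"
  from q_emb_conv[OF this] show "s \<in> q_emb e ` {u. q_root u}" by (intro image_eqI[of _ _ "s (e (0, 1, 0, 0))"]) simp_all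
qed (auto intro: q_emb_in)

lemma q_emb_inj:
  assumes "q_emb e u = q_emb e u'"
  shows "u = u'"
proof -
  have "q_emb e u (e (0, 1, 0, 0)) = q_emb e u' (e (0, 1, 0, 0))" by (rule fun_cong[OF assms])
  then show ?thesis by (simp add: q_emb_apply)
qed

lemma Q_basis: "int_basis (Q_ring e) 4 (\<lambda>j. e (unit4 j))"
  using push_basis4(1)[OF e] Q_cring by (simp add: Q_ring_def)

lemma Q_embedded:
  assumes "card {u. q_root u} = 4"
  shows "embedded_ring (Q_ring e) 4"
proof (rule embedded_ring.intro[OF Q_cring], unfold_locales)
  show "\<exists>b. int_basis (Q_ring e) 4 b" using Q_basis by blast
  have "inj_on (q_emb e) {u. q_root u}" by (auto intro!: inj_onI dest: q_emb_inj)
  then show "card (embeddings (Q_ring e)) = 4" using assms by (simp add: Q_embeddings card_image)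
qed simp

lemma Q_trace: "ring_trace (Q_ring e) 4 (\<lambda>j. e (unit4 j)) (e (x0, x1, x2, x3)) = 4 * x0 + b * x3"
proof -
  have "coords (Q_ring e) 4 (\<lambda>j. e (unit4 j)) (e x) = coord4 x" for x
    using push_basis4(2)[OF e] Q_cring by (simp add: Q_ring_def)
  then show ?thesis unfolding ring_trace_def lessThan_4 by (simp add: unit4_def coord4_def)
qed

text \<open>\<open>C_disc\<close> has the same closed form; the equality of discriminants in the
  definition of a resolvent is obtained by comparing the two.\<close>

lemma Q_disc:
  assumes "card {u. q_root u} = 4"
  shows "disc 4 (Q_ring e) = a * a * b * b * c * c * (256 * a * c * c * d ^ 3 - 27 * b * b)"
proof -
  interpret embedded_ring "Q_ring e" 4 by (rule Q_embedded[OF assms])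
  define g where "g i j = (case qmul (unit4 i) (unit4 j) of (x0, x1, x2, x3) \<Rightarrow> 4 * x0 + b * x3)" for i j
  have "ring_trace (Q_ring e) 4 (\<lambda>j. e (unit4 j)) (e (qmul (unit4 i) (unit4 j))) = g i j" for i j
    unfolding g_def by (cases "qmul (unit4 i) (unit4 j)") (simp add: Q_trace)
  then have "disc 4 (Q_ring e) = det (mat 4 4 (\<lambda>(i, j). g i j))"
    using disc_trace_det[OF Q_basis] by simp
  also have "\<dots> = a * a * b * b * c * c * (256 * a * c * c * d ^ 3 - 27 * b * b)"
    by (simp add: numeral_eq_Suc det_mat_Suc g_def unit4_def) (simp add: power3_eq_cube algebra_simps)
  finally show ?thesis .
qed

end

context
  fixes e :: "int \<times> int \<times> int \<Rightarrow> 'a" assumes e: "inj e"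
begin

lemma C_cring: "cring (C_ring e)"
  unfolding C_ring_def by (rule push_cring[OF e]) (fact cmul_laws)+

lemma C_simps [simp]: "carrier (C_ring e) = range e" "e x \<otimes>\<^bsub>C_ring e\<^esub> e y = e (cmul x y)"
  "e x \<oplus>\<^bsub>C_ring e\<^esub> e y = e (x + y)" "\<one>\<^bsub>C_ring e\<^esub> = e (1, 0, 0)"
  by (simp_all add: C_ring_def e)

lemma c_emb_apply: "c_emb e w (e (n0, n1, n2)) =
   of_int n0 + of_int n1 * w + of_int n2 * (of_int a * of_int b * of_int b * of_int c / w)"
  by (simp add: c_emb_def the_inv_f_f[OF e])

lemma c_emb_in:
  assumes w: "c_root w"
  shows "c_emb e w \<in> embeddings (C_ring e)"
proof -
  have w0: "w \<noteq> 0" by (rule c_root_nz[OF w])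
  define A B C D :: complex where "A = of_int a" "B = of_int b" "C = of_int c" "D = of_int d"
  have n0: "A \<noteq> 0" "B \<noteq> 0" "C \<noteq> 0" "D \<noteq> 0" using nzc by (simp_all add: A_B_C_D_def)
  define t where "t = A * B * B * C / w"
  have w3: "w * (w * w) = 4 * A * B * B * C * C * D * w + A * B * B * B * B * C * C"
    using w by (simp add: c_root_def A_B_C_D_def eval_nat_numeral algebra_simps)
  have r1: "w * t = A * B * B * C" using w0 by (simp add: t_def)
  have r2: "w * w = 4 * A * B * B * C * C * D + B * B * C * t"
  proof -
    have "w * (w * w) = w * (4 * A * B * B * C * C * D) + B * B * C * (w * t)"
      unfolding r1 w3 by (simp add: algebra_simps)
    also have "\<dots> = w * (4 * A * B * B * C * C * D + B * B * C * t)" by (simp add: algebra_simps)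
    finally show ?thesis using w0 by simp
  qed
  have r3: "t * t = A * w - 4 * A * C * D * t"
  proof -
    have "w * (t * t) = A * B * B * C * t" using r1 by (simp add: mult.assoc[symmetric])
    also have "\<dots> = A * (w * w) - 4 * A * C * D * (A * B * B * C)" unfolding r2 by (simp add: algebra_simps)
    also have "\<dots> = w * (A * w - 4 * A * C * D * t)" unfolding r1[symmetric] by (simp add: algebra_simps)
    finally show ?thesis using w0 by simp
  qed
  have ap: "c_emb e w (e (n0, n1, n2)) = of_int n0 + of_int n1 * w + of_int n2 * t" for n0 n1 n2
    by (simp add: c_emb_apply t_def A_B_C_D_def)
  have mult: "c_emb e w (e (cmul x y)) = c_emb e w (e x) * c_emb e w (e y)" for x y
  proof -
    obtain x0 x1 x2 y0 y1 y2 where xy: "x = (x0, x1, x2)" "y = (y0, y1, y2)"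
      by (cases x; cases y) auto
    have "(X0 + X1 * w + X2 * t) * (Y0 + Y1 * w + Y2 * t) =
      (X0 * Y0 + 4 * A * B * B * C * C * D * (X1 * Y1) + A * B * B * C * (X1 * Y2 + X2 * Y1))
      + (X0 * Y1 + X1 * Y0 + A * (X2 * Y2)) * w
      + (X0 * Y2 + X2 * Y0 + B * B * C * (X1 * Y1) - 4 * A * C * D * (X2 * Y2)) * t"
      for X0 X1 X2 Y0 Y1 Y2
    proof -
      have "(X0 + X1 * w + X2 * t) * (Y0 + Y1 * w + Y2 * t) = X0 * Y0
        + (X0 * Y1 + X1 * Y0) * w + (X0 * Y2 + X2 * Y0) * t
        + (X1 * Y1) * (w * w) + (X2 * Y2) * (t * t) + (X1 * Y2 + X2 * Y1) * (w * t)"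
        by (simp add: algebra_simps)
      then show ?thesis unfolding r1 r2 r3 by (simp add: algebra_simps)
    qed
    then show ?thesis unfolding xy cmul.simps ap by (simp add: A_B_C_D_def)
  qed
  show ?thesis
    unfolding embeddings_def
  proof (intro IntI ring_hom_memI)
    fix x y assume "x \<in> carrier (C_ring e)" "y \<in> carrier (C_ring e)"
    then obtain x' y' where xy: "x = e x'" "y = e y'" by auto
    show "c_emb e w (x \<otimes>\<^bsub>C_ring e\<^esub> y) = c_emb e w x \<otimes>\<^bsub>complex_field\<^esub> c_emb e w y"
      by (simp add: xy mult)
    show "c_emb e w (x \<oplus>\<^bsub>C_ring e\<^esub> y) = c_emb e w x \<oplus>\<^bsub>complex_field\<^esub> c_emb e w y"
      by (cases x'; cases y') (simp add: xy ap algebra_simps)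
  next
    show "c_emb e w \<one>\<^bsub>C_ring e\<^esub> = \<one>\<^bsub>complex_field\<^esub>" by (simp add: ap)
    show "c_emb e w \<in> extensional (carrier (C_ring e))" by (simp add: c_emb_def)
  qed simp
qed

lemma c_emb_conv:
  assumes s: "s \<in> embeddings (C_ring e)"
  shows "c_root (s (e (0, 1, 0)))" "s = c_emb e (s (e (0, 1, 0)))"
proof -
  interpret cring "C_ring e" by (rule C_cring)
  note sm = emb_mult[OF s, of "e x" "e y" for x y, simplified]
  define A B C D :: complex where "A = of_int a" "B = of_int b" "C = of_int c" "D = of_int d"
  have n0: "A \<noteq> 0" "B \<noteq> 0" "C \<noteq> 0" "D \<noteq> 0" using nzc by (simp_all add: A_B_C_D_def)
  define w t where "w = s (e (0, 1, 0))" "t = s (e (0, 0, 1))"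
  have ap: "s (e (n0, n1, n2)) = of_int n0 + of_int n1 * w + of_int n2 * t" for n0 n1 n2
  proof -
    have "e (n0, n1, n2) = int_comb (C_ring e) 3 (\<lambda>j. e (unit3 j)) (coord3 (n0, n1, n2))"
    proof -
      have R: "cring (push_ring e cmul (1, 0, 0))" using C_cring by (simp add: C_ring_def)
      have "int_basis (push_ring e cmul (1, 0, 0)) 3 (\<lambda>j. e (unit3 j))" by (rule push_basis3(1)[OF e R])
      then have "\<exists>!k. (\<forall>i\<ge>3. k i = 0) \<and> e (n0, n1, n2) = int_comb (push_ring e cmul (1, 0, 0)) 3 (\<lambda>j. e (unit3 j)) k"
        by (auto simp: int_basis_def push_carrier[OF e])
      from theI'[OF this] show ?thesis
        using push_basis3(2)[OF e R, of "(n0, n1, n2)"] by (simp add: coords_def C_ring_def)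
    qed
    then have "s (e (n0, n1, n2)) = (\<Sum>i<3. of_int (coord3 (n0, n1, n2) i) * s (e (unit3 i)))"
      using emb_int_comb[OF s, of "\<lambda>j. e (unit3 j)" 3] by (simp add: image_subset_iff)
    also have "\<dots> = of_int n0 * s \<one>\<^bsub>C_ring e\<^esub> + of_int n1 * w + of_int n2 * t"
      unfolding lessThan_3 by (simp add: coord3_def unit3_def w_t_def)
    finally show ?thesis by (simp only: emb_one[OF s] mult_1_right)
  qed
  have r1: "w * w = 4 * A * B * B * C * C * D + B * B * C * t" "w * t = A * B * B * C"
    using sm[of "(0, 1, 0)" "(0, 1, 0)"] sm[of "(0, 1, 0)" "(0, 0, 1)"]
    by (simp_all add: ap A_B_C_D_def)
  have w0: "w \<noteq> 0" using r1(2) n0 by auto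
  have "w ^ 3 = w * (w * w)" by (simp add: power3_eq_cube)
  also have "\<dots> = 4 * A * B * B * C * C * D * w + B * B * C * (w * t)" unfolding r1(1) by (simp add: algebra_simps)
  finally have "w ^ 3 = 4 * A * B * B * C * C * D * w + B * B * C * (A * B * B * C)" unfolding r1(2) .
  then show "c_root (s (e (0, 1, 0)))"
    by (simp add: c_root_def w_t_def A_B_C_D_def eval_nat_numeral algebra_simps)
  have t: "t = A * B * B * C / w" using r1 w0 by (simp add: field_simps)
  show "s = c_emb e (s (e (0, 1, 0)))"
  proof (rule extensionalityI[of _ "range e"])
    show "s \<in> extensional (range e)" using s by (simp add: embeddings_def)
    show "c_emb e (s (e (0, 1, 0))) \<in> extensional (range e)" by (simp add: c_emb_def)
    fix x assume "x \<in> range e"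
    then obtain n0 n1 n2 where x: "x = e (n0, n1, n2)" by auto
    show "s x = c_emb e (s (e (0, 1, 0))) x"
      unfolding x ap c_emb_apply w_t_def(1)[symmetric] t by (simp add: A_B_C_D_def)
  qed
qed

lemma C_embeddings: "embeddings (C_ring e) = c_emb e ` {w. c_root w}"
proof (intro subset_antisym subsetI)
  fix s assume "s \<in> embeddings (C_ring e)"
  from c_emb_conv[OF this] show "s \<in> c_emb e ` {u. c_root u}" by (intro image_eqI[of _ _ "s (e (0, 1, 0))"]) simp_all
qed (auto intro: c_emb_in)

lemma c_emb_inj:
  assumes "c_emb e u = c_emb e u'"
  shows "u = u'"
proof -
  have "c_emb e u (e (0, 1, 0)) = c_emb e u' (e (0, 1, 0))" by (rule fun_cong[OF assms])
  then show ?thesis by (simp add: c_emb_apply)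
qed

lemma C_basis: "int_basis (C_ring e) 3 (\<lambda>j. e (unit3 j))"
  using push_basis3(1)[OF e] C_cring by (simp add: C_ring_def)

lemma C_embedded:
  assumes "card {w. c_root w} = 3"
  shows "embedded_ring (C_ring e) 3"
proof (rule embedded_ring.intro[OF C_cring], unfold_locales)
  show "\<exists>b. int_basis (C_ring e) 3 b" using C_basis by blast
  have "inj_on (c_emb e) {w. c_root w}" by (auto intro!: inj_onI dest: c_emb_inj)
  then show "card (embeddings (C_ring e)) = 3" using assms by (simp add: C_embeddings card_image)
qed simp

lemma C_trace: "ring_trace (C_ring e) 3 (\<lambda>j. e (unit3 j)) (e (x0, x1, x2)) = 3 * x0 - 4 * a * c * d * x2"
proof -
  have "coords (C_ring e) 3 (\<lambda>j. e (unit3 j)) (e x) = coord3 x" for x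
    using push_basis3(2)[OF e] C_cring by (simp add: C_ring_def)
  then show ?thesis unfolding ring_trace_def lessThan_3 by (simp add: unit3_def coord3_def)
qed

lemma C_disc:
  assumes "card {w. c_root w} = 3"
  shows "disc 3 (C_ring e) = a * a * b * b * c * c * (256 * a * c * c * d ^ 3 - 27 * b * b)"
proof -
  interpret embedded_ring "C_ring e" 3 by (rule C_embedded[OF assms])
  define g where "g i j = (case cmul (unit3 i) (unit3 j) of (x0, x1, x2) \<Rightarrow> 3 * x0 - 4 * a * c * d * x2)" for i j
  have "ring_trace (C_ring e) 3 (\<lambda>j. e (unit3 j)) (e (cmul (unit3 i) (unit3 j))) = g i j" for i j
    unfolding g_def by (cases "cmul (unit3 i) (unit3 j)") (simp add: C_trace)
  then have "disc 3 (C_ring e) = det (mat 3 3 (\<lambda>(i, j). g i j))"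
    using disc_trace_det[OF C_basis] by simp
  also have "\<dots> = a * a * b * b * c * c * (256 * a * c * c * d ^ 3 - 27 * b * b)"
    by (simp add: numeral_eq_Suc det_mat_Suc g_def unit3_def) (simp add: power3_eq_cube algebra_simps)
  finally show ?thesis .
qed

end

end

lemma transpose_conj:
  assumes "\<pi> permutes E"
  shows "\<pi> \<circ> Transposition.transpose x y \<circ> inv_into UNIV \<pi> = Transposition.transpose (\<pi> x) (\<pi> y)"
proof
  fix z
  obtain w where w: "z = \<pi> w" using permutes_surj[OF assms] by (metis surjD)
  have i: "inv_into UNIV \<pi> (\<pi> w) = w" using permutes_inj[OF assms] by simp
  show "(\<pi> \<circ> Transposition.transpose x y \<circ> inv_into UNIV \<pi>) z = Transposition.transpose (\<pi> x) (\<pi> y) z"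
    using permutes_inj[OF assms] unfolding w by (simp add: i transpose_def inj_eq)
qed

text \<open>``Equal or exchanged by a transposition in the group'' is an equivalence relation invariant under
  the group. Its class of \<open>s3\<close> has at least three elements, so it is fixed by the group, and so is its
  complement.\<close>

lemma perms_of_four:
  assumes E: "E = {s1, s2, s3, s4}"
    and sub: "\<And>\<pi>. \<pi> \<in> G \<Longrightarrow> \<pi> permutes E"
    and comp: "\<And>\<pi> \<rho>. \<pi> \<in> G \<Longrightarrow> \<rho> \<in> G \<Longrightarrow> \<pi> \<circ> \<rho> \<in> G"
    and inv: "\<And>\<pi>. \<pi> \<in> G \<Longrightarrow> inv_into UNIV \<pi> \<in> G"
    and ne: "s1 \<noteq> s2" "s3 \<noteq> s4" "s1 \<noteq> s3" "s1 \<noteq> s4" "s2 \<noteq> s3" "s2 \<noteq> s4"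
    and t34: "Transposition.transpose s3 s4 \<in> G"
    and split: "\<pi>0 \<in> G" "{\<pi>0 s3, \<pi>0 s4} \<noteq> {s3, s4}" "{\<pi>0 s3, \<pi>0 s4} \<noteq> {s1, s2}"
    and move: "\<pi>1 \<in> G" "\<pi>1 s1 \<noteq> s1" "\<pi>2 \<in> G" "\<pi>2 s2 \<noteq> s2"
    and \<pi>: "\<pi> permutes E"
  shows "\<pi> \<in> G"
proof -
  define t where "t x y \<longleftrightarrow> x = y \<or> Transposition.transpose x y \<in> G" for x y
  have refl: "t x x" for x by (simp add: t_def)
  have sym: "t x y \<Longrightarrow> t y x" for x y by (auto simp: t_def transpose_commute)
  have conj: "t x y \<Longrightarrow> \<rho> \<in> G \<Longrightarrow> t (\<rho> x) (\<rho> y)" for x y \<rho>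
    using transpose_conj[OF sub, of \<rho> x y] comp inv unfolding t_def by metis
  have trans: "t x z" if xy: "t x y" and yz: "t y z" for x y z
  proof (cases "x = y \<or> y = z \<or> x = z")
    case False
    then have y: "Transposition.transpose y z \<in> G" using yz by (auto simp: t_def)
    have "t (Transposition.transpose y z x) (Transposition.transpose y z y)" by (rule conj[OF xy y])
    moreover have "Transposition.transpose y z x = x" "Transposition.transpose y z y = z"
      using False by (auto simp: transpose_def)
    ultimately show ?thesis by simp
  qed (use xy yz refl in auto)
  have in4: "\<rho> x = s1 \<or> \<rho> x = s2 \<or> \<rho> x = s3 \<or> \<rho> x = s4" if "\<rho> \<in> G" "x \<in> E" for \<rho> x
    using permutes_in_image[OF sub[OF that(1)], of x] that(2) E by auto
  have inj: "\<rho> x = \<rho> y \<longleftrightarrow> x = y" if "\<rho> \<in> G" for \<rho> x y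
    using permutes_inj[OF sub[OF that]] by (simp add: inj_eq)
  have tt: "t s3 s4" using t34 by (simp add: t_def)
  \<comment> \<open>If every point of \<open>E\<close> other than \<open>z\<close> is in the class
    of \<open>s3\<close> and \<rho> moves \<open>z\<close>, then \<rho> carries two points of that
    class to \<open>z\<close> and to another point of the class.\<close>
  have big: "t z s3" if z: "z \<in> E" "\<rho> \<in> G" "\<rho> z \<noteq> z" and T: "\<And>y. y \<in> E \<Longrightarrow> y \<noteq> z \<Longrightarrow> t y s3" for z \<rho>
  proof -
    have "z \<in> \<rho> ` E" using permutes_image[OF sub[OF z(2)]] z(1) by simp
    then obtain y where y: "y \<in> E" "\<rho> y = z" by auto
    have yz: "y \<noteq> z" using y z by auto
    have "\<exists>y'\<in>E. y' \<noteq> y \<and> y' \<noteq> z" unfolding E using ne by auto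
    then obtain y' where y': "y' \<in> E" "y' \<noteq> y" "y' \<noteq> z" by blast
    have "t y y'" using T[OF y(1) yz] sym[OF T[OF y'(1,3)]] by (rule trans)
    then have "t z (\<rho> y')" using conj[OF _ z(2), of y y'] y(2) by simp
    moreover have "\<rho> y' \<in> E" using permutes_in_image[OF sub[OF z(2)]] y'(1) by simp
    moreover have "\<rho> y' \<noteq> z" using inj[OF z(2), of y' y] y y'(2) by simp
    ultimately show ?thesis using T[of "\<rho> y'"] trans by blast
  qed
  have t0: "t (\<pi>0 s3) (\<pi>0 s4)" by (rule conj[OF tt split(1)])
  have "\<pi>0 s3 \<noteq> \<pi>0 s4" using inj[OF split(1)] ne by simp
  \<comment> \<open>The pair of images is neither \<open>{s3, s4}\<close> nor its complement, so it
    has one point in each of them.\<close>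
  then have "(\<exists>x\<in>{s1, s2}. \<exists>y\<in>{s3, s4}. t x y)"
    using in4[OF split(1), of s3] in4[OF split(1), of s4] t0 split(2,3) sym[OF t0] unfolding E by auto
  then obtain x where x: "x = s1 \<or> x = s2" "t x s3" using trans sym[OF tt] by blast
  have all: "t y s3" if "y \<in> E" for y
  proof -
    have 1: "t s1 s3" "t s2 s3" if "x = s1"
    proof -
      show "t s1 s3" using x that by simp
      show "t s2 s3" by (rule big[OF _ move(3,4)]) (use that x refl sym[OF tt] in \<open>auto simp: E\<close>)
    qed
    have 2: "t s1 s3" "t s2 s3" if "x = s2"
    proof -
      show "t s2 s3" using x that by simp
      show "t s1 s3" by (rule big[OF _ move(1,2)]) (use that x refl sym[OF tt] in \<open>auto simp: E\<close>)
    qed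
    show ?thesis using x(1) 1 2 that refl sym[OF tt] unfolding E by auto
  qed
  have tr: "Transposition.transpose x y \<in> G" if "x \<in> E" "y \<in> E" "x \<noteq> y" for x y
    using trans[OF all[OF that(1)] sym[OF all[OF that(2)]]] that(3) by (simp add: t_def)
  have fin: "finite E" by (simp add: E)
  have id: "id \<in> G" using comp[OF t34 t34] by simp
  show ?thesis
    using \<pi> fin
  proof (induction rule: permutes_induct)
    case (swap a b p) then show ?case using comp[OF tr] by blast
  qed (rule id)
qed

context embedded_ring
begin

text \<open>Composition with \<open>g\<close> is injective on the finite set of embeddings, hence a
  permutation. That \<open>g\<close> maps the splitting field onto itself is checked on generators:
  the image of the field, and the set of its elements with image in the field, are subfields
  containing all values of the embeddings.\<close>

lemma hom_induces_galois_perm: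
  assumes g: "field_hom_on (carrier (splitting_field R)) g"
  shows "\<exists>\<pi>\<in>galois_perms R. \<forall>\<sigma>\<in>embeddings R. \<forall>x\<in>carrier R. \<pi> \<sigma> x = g (\<sigma> x)"
proof -
  let ?L = "carrier (splitting_field R)"
  note L = splitting_subfield[of R]
  have mem: "\<sigma> x \<in> ?L" if "\<sigma> \<in> embeddings R" "x \<in> carrier R" for \<sigma> x
    using that by (rule splitting_mem)
  define \<pi> where "\<pi> \<sigma> = (if \<sigma> \<in> embeddings R then (\<lambda>x\<in>carrier R. g (\<sigma> x)) else \<sigma>)" for \<sigma>
  have \<pi>x: "\<pi> \<sigma> x = g (\<sigma> x)" if "\<sigma> \<in> embeddings R" "x \<in> carrier R" for \<sigma> x
    using that by (simp add: \<pi>_def)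
  have \<pi>E: "\<pi> \<sigma> \<in> embeddings R" if s: "\<sigma> \<in> embeddings R" for \<sigma>
    unfolding embeddings_def
  proof (intro IntI ring_hom_memI)
    fix x y assume xy: "x \<in> carrier R" "y \<in> carrier R"
    show "\<pi> \<sigma> (x \<otimes> y) = \<pi> \<sigma> x \<otimes>\<^bsub>complex_field\<^esub> \<pi> \<sigma> y"
      using xy s by (simp add: \<pi>x emb_mult hom_mult[OF L g] mem)
    show "\<pi> \<sigma> (x \<oplus> y) = \<pi> \<sigma> x \<oplus>\<^bsub>complex_field\<^esub> \<pi> \<sigma> y"
      using xy s by (simp add: \<pi>x emb_add hom_add[OF L g] mem)
  next
    show "\<pi> \<sigma> \<one> = \<one>\<^bsub>complex_field\<^esub>" using s by (simp add: \<pi>x emb_one hom_one[OF L g])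
    show "\<pi> \<sigma> \<in> extensional (carrier R)" using s by (simp add: \<pi>_def)
  qed simp
  have inj: "inj_on \<pi> (embeddings R)"
  proof (rule inj_onI)
    fix \<sigma> \<tau> assume st: "\<sigma> \<in> embeddings R" "\<tau> \<in> embeddings R" "\<pi> \<sigma> = \<pi> \<tau>"
    show "\<sigma> = \<tau>"
    proof (rule emb_eqI[OF st(1,2)])
      fix x assume x: "x \<in> carrier R"
      have "g (\<sigma> x) = g (\<tau> x)" using \<pi>x[OF st(1) x] \<pi>x[OF st(2) x] st(3) by simp
      then show "\<sigma> x = \<tau> x" using hom_inj[OF L g] mem st x by blast
    qed
  qed
  have surj: "\<pi> ` embeddings R = embeddings R"
    by (rule endo_inj_surj[OF finite_emb _ inj]) (use \<pi>E in auto)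
  have perm: "\<pi> permutes embeddings R"
    by (rule bij_imp_permutes) (use inj surj in \<open>auto simp: bij_betw_def \<pi>_def\<close>)
  have gens: "(\<Union>\<sigma>\<in>embeddings R. \<sigma> ` carrier R) \<subseteq> g ` ?L"
  proof
    fix z assume "z \<in> (\<Union>\<sigma>\<in>embeddings R. \<sigma> ` carrier R)"
    then obtain \<sigma> x where z: "\<sigma> \<in> embeddings R" "x \<in> carrier R" "z = \<sigma> x" by auto
    then obtain \<tau> where "\<tau> \<in> embeddings R" "\<sigma> = \<pi> \<tau>" using surj by (metis image_iff)
    then show "z \<in> g ` ?L" using z \<pi>x mem by auto
  qed
  have "complex_subfield (g ` ?L)"
    unfolding complex_subfield_def
  proof (intro conjI ballI)
    show "1 \<in> g ` ?L" using hom_one[OF L g] subfield_one[OF L] by (metis imageI)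
    fix x assume "x \<in> g ` ?L"
    then obtain x' where x: "x' \<in> ?L" "x = g x'" by auto
    show "inverse x \<in> g ` ?L" using hom_inverse[OF L g x(1)] subfield_inverse[OF L x(1)] x(2) by (metis imageI)
    fix y assume "y \<in> g ` ?L"
    then obtain y' where y: "y' \<in> ?L" "y = g y'" by auto
    show "x - y \<in> g ` ?L" using hom_diff[OF L g x(1) y(1)] subfield_diff[OF L x(1) y(1)] x y by (metis imageI)
    show "x * y \<in> g ` ?L" using hom_mult[OF L g x(1) y(1)] subfield_mult[OF L x(1) y(1)] x y by (metis imageI)
  qed
  then have sup: "?L \<subseteq> g ` ?L"
    unfolding carrier_splitting_field using gens generate_field_least
    by (metis carrier_splitting_field)
  have "complex_subfield {z \<in> ?L. g z \<in> ?L}"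
    unfolding complex_subfield_def
    using subfield_one[OF L] subfield_diff[OF L] subfield_mult[OF L] subfield_inverse[OF L]
      hom_one[OF L g] hom_diff[OF L g] hom_mult[OF L g] hom_inverse[OF L g] by auto
  moreover have "(\<Union>\<sigma>\<in>embeddings R. \<sigma> ` carrier R) \<subseteq> {z \<in> ?L. g z \<in> ?L}"
    using mem \<pi>x \<pi>E by (auto, metis)
  ultimately have sub: "?L \<subseteq> {z \<in> ?L. g z \<in> ?L}"
    using generate_field_least[of "{z \<in> ?L. g z \<in> ?L}" "\<Union>\<sigma>\<in>embeddings R. \<sigma> ` carrier R"]
    unfolding carrier_splitting_field by blast
  then have im: "g ` ?L = ?L" using sup by auto
  have "inj_on g ?L" using hom_inj[OF L g] by (auto intro: inj_onI)
  then have "g \<in> ring_iso (splitting_field R) (splitting_field R)"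
    using im g by (simp add: ring_iso_def ring_hom_splitting bij_betw_def)
  then have "\<pi> \<in> galois_perms R" unfolding galois_perms_def using perm \<pi>x by blast
  then show ?thesis using \<pi>x by blast
qed

lemma galois_perms_comp:
  assumes "\<pi> \<in> galois_perms R" "\<rho> \<in> galois_perms R"
  shows "\<pi> \<circ> \<rho> \<in> galois_perms R"
proof -
  obtain g where g: "\<pi> permutes embeddings R" "g \<in> ring_iso (splitting_field R) (splitting_field R)"
    "\<forall>\<sigma>\<in>embeddings R. \<forall>x\<in>carrier R. \<pi> \<sigma> x = g (\<sigma> x)" using assms(1) by (auto simp: galois_perms_def)
  obtain h where h: "\<rho> permutes embeddings R" "h \<in> ring_iso (splitting_field R) (splitting_field R)"
    "\<forall>\<sigma>\<in>embeddings R. \<forall>x\<in>carrier R. \<rho> \<sigma> x = h (\<sigma> x)" using assms(2) by (auto simp: galois_perms_def)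
  have "g \<circ> h \<in> ring_iso (splitting_field R) (splitting_field R)" using h(2) g(2) by (rule ring_iso_set_trans)
  moreover have "(\<pi> \<circ> \<rho>) \<sigma> x = (g \<circ> h) (\<sigma> x)" if "\<sigma> \<in> embeddings R" "x \<in> carrier R" for \<sigma> x
    using that g(3) h(3) permutes_in_image[OF h(1)] by simp
  ultimately show ?thesis using permutes_compose[OF h(1) g(1)] unfolding galois_perms_def by blast
qed

lemma galois_perms_inv:
  assumes "\<pi> \<in> galois_perms R"
  shows "inv_into UNIV \<pi> \<in> galois_perms R"
proof -
  let ?L = "carrier (splitting_field R)"
  obtain g where g: "\<pi> permutes embeddings R" "g \<in> ring_iso (splitting_field R) (splitting_field R)"
    "\<forall>\<sigma>\<in>embeddings R. \<forall>x\<in>carrier R. \<pi> \<sigma> x = g (\<sigma> x)" using assms(1) by (auto simp: galois_perms_def)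
  interpret cf: field complex_field by (rule field_from_type_algebra)
  have "field (splitting_field R)"
    unfolding splitting_field_def by (rule cf.generate_field_is_field) simp
  then have "ring (splitting_field R)" by (simp add: field_def domain_def cring_def)
  then have gi: "inv_into ?L g \<in> ring_iso (splitting_field R) (splitting_field R)"
    using g(2) by (rule ring_iso_set_sym)
  have inj: "inj_on g ?L" using g(2) by (simp add: ring_iso_def bij_betw_def)
  have ip: "inv_into UNIV \<pi> permutes embeddings R" by (rule permutes_inv[OF g(1)])
  have "inv_into UNIV \<pi> \<sigma> x = inv_into ?L g (\<sigma> x)" if s: "\<sigma> \<in> embeddings R" "x \<in> carrier R" for \<sigma> x
  proof -
    define \<tau> where "\<tau> = inv_into UNIV \<pi> \<sigma>"
    have \<tau>: "\<tau> \<in> embeddings R" using permutes_in_image[OF ip] s(1) by (simp add: \<tau>_def)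
    have "\<pi> \<tau> = \<sigma>" using permutes_surj[OF g(1)] by (simp add: \<tau>_def surj_f_inv_f)
    then have "\<sigma> x = g (\<tau> x)" using g(3) \<tau> s(2) by metis
    then show ?thesis using inj splitting_mem[OF \<tau> s(2)] by (simp add: \<tau>_def[symmetric])
  qed
  then show ?thesis using ip gi unfolding galois_perms_def by blast
qed

end

lemma G_ringI:
  assumes f: "bij_betw f {1..n} (embeddings R)"
    and all: "\<And>\<pi>. \<pi> permutes embeddings R \<Longrightarrow> \<pi> \<in> galois_perms R"
  shows "G_ring n (sym_group n) R"
proof -
  have "\<exists>\<pi>\<in>galois_perms R. \<forall>i\<in>{1..n}. f (p i) = \<pi> (f i)" if p: "p permutes {1..n}" for p
  proof -
    define \<pi> where "\<pi> s = (if s \<in> embeddings R then f (p (inv_into {1..n} f s)) else s)" for s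
    have inj: "inj_on f {1..n}" and im: "f ` {1..n} = embeddings R" using f by (auto simp: bij_betw_def)
    have \<pi>f: "\<pi> (f i) = f (p i)" if "i \<in> {1..n}" for i
      using that inj im by (auto simp: \<pi>_def inv_into_f_f)
    have "bij_betw \<pi> (embeddings R) (embeddings R)"
    proof -
      have "bij_betw (f \<circ> p \<circ> inv_into {1..n} f) (embeddings R) (embeddings R)"
        using bij_betw_inv_into[OF f] permutes_imp_bij[OF p] f by (blast intro: bij_betw_trans)
      then show ?thesis by (rule bij_betw_cong[THEN iffD1, rotated]) (simp add: \<pi>_def)
    qed
    then have "\<pi> permutes embeddings R" by (rule bij_imp_permutes) (simp add: \<pi>_def)
    then show ?thesis using all \<pi>f by metis
  qed
  then show ?thesis unfolding G_ring_def sym_group_def using f by auto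
qed

section \<open>The resolvent of the family\<close>

context form_pair
begin

text \<open>The data describe a factorisation of the quartic into \<open>z\<^sup>2 - s z + p\<close>
  and \<open>z\<^sup>2 + s z + q\<close>. Eliminating \<open>s\<close> shows that p + q is a root of
  y^3 - 4 Q y - P^2, which is the cubic of \<open>c_root\<close> up to the scaling by
  \<open>a\<close>.\<close>

lemma c_root_from_split:
  fixes s p q :: complex
  assumes "s * s = p + q" "P = s * (q - p)" "Q = p * q"
  shows "c_root ((p + q) / of_int a)"
proof -
  define A B C D :: complex where "A = of_int a" "B = of_int b" "C = of_int c" "D = of_int d"
  have n0: "A \<noteq> 0" using nzc by (simp add: A_B_C_D_def)
  have "(p + q) ^ 3 = 4 * Q * (p + q) + P * P"
  proof -
    have "P * P = (s * s) * ((q - p) * (q - p))" unfolding assms(2) by (simp add: algebra_simps)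
    then show ?thesis unfolding assms(1,3) by (simp add: power3_eq_cube algebra_simps)
  qed
  then have "((p + q) / A) ^ 3 = (4 * Q * (p + q) + P * P) / A ^ 3" by (simp add: power_divide)
  also have "\<dots> = 4 * A * B * B * C * C * D * ((p + q) / A) + A * B ^ 4 * C ^ 2"
    using n0 by (simp add: P_def Q_def flip: A_B_C_D_def) (simp add: field_simps eval_nat_numeral)
  finally show ?thesis unfolding c_root_def by (simp add: A_B_C_D_def)
qed

text \<open>The coordinates on the last two basis vectors of the cubic ring are the two ternary
  forms evaluated at \<open>(n1, n2, n3)\<close>; this is how the pair of rings belongs to the pair
  of forms. The roots enter only through the sum \<open>s\<close> and product \<open>p\<close> of
  the first two and through \<open>- s\<close> and \<open>q\<close> for the others.\<close>

lemma resolvent_identity: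
  fixes u1 u2 u3 u4 :: complex
  assumes e1: "u1 + u2 + u3 + u4 = 0"
    and e2: "u1 * u2 + u1 * u3 + u1 * u4 + u2 * u3 + u2 * u4 + u3 * u4 = 0"
    and e3: "u1 * u2 * u3 + u1 * u2 * u4 + u1 * u3 * u4 + u2 * u3 * u4 = P"
    and e4: "u1 * u2 * u3 * u4 = Q"
    and e: "inj (e :: int \<times> int \<times> int \<times> int \<Rightarrow> 'a)" and e': "inj (e' :: int \<times> int \<times> int \<Rightarrow> 'b)"
  defines "w \<equiv> (u1 * u2 + u3 * u4) / of_int a"
  shows "c_root w"
    and "q_emb e u1 (e (n0, n1, n2, n3)) * q_emb e u2 (e (n0, n1, n2, n3)) + q_emb e u3 (e (n0, n1, n2, n3)) * q_emb e u4 (e (n0, n1, n2, n3))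
     = c_emb e' w (e' (2 * n0 * n0 + b * n0 * n3 - a * b * c * n1 * n2 + 2 * a * c * c * d * n2 * n2,
          a * n1 * n1 + n2 * n3 + d * n3 * n3, b * n1 * n3 + c * n2 * n2))"
proof -
  define A B C D :: complex where "A = of_int a" "B = of_int b" "C = of_int c" "D = of_int d"
  have nA: "A \<noteq> 0" "B \<noteq> 0" "C \<noteq> 0" "D \<noteq> 0" using nzc by (simp_all add: A_B_C_D_def)
  have PQ: "P = A * A * B * B * C" "Q = A * A * A * B * B * C * C * D" by (simp_all add: P_def Q_def A_B_C_D_def)
  define s p q where "s = u1 + u2" "p = u1 * u2" "q = u3 * u4"
  have s2: "u3 + u4 = - s" using e1 unfolding s_p_q_def by (simp add: algebra_simps eq_neg_iff_add_eq_0)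
  have ss: "s * s = p + q"
  proof -
    have "p + q + s * (u3 + u4) = 0" using e2 by (simp add: s_p_q_def algebra_simps)
    then show ?thesis unfolding s2 by (simp add: algebra_simps add_eq_0_iff)
  qed
  have PP: "P = s * (q - p)"
  proof -
    have "P = p * (u3 + u4) + q * s" using e3 by (simp add: s_p_q_def algebra_simps)
    then show ?thesis unfolding s2 by (simp add: algebra_simps)
  qed
  have QQ: "Q = p * q" using e4 by (simp add: s_p_q_def algebra_simps)
  have w: "w = (p + q) / A" by (simp add: w_def s_p_q_def A_B_C_D_def)
  show cr: "c_root w" unfolding w A_B_C_D_def by (rule c_root_from_split[OF ss PP QQ])
  have w0: "w \<noteq> 0" by (rule c_root_nz[OF cr])
  have Aw: "p + q = A * w" using nA by (simp add: w)
  define t where "t = A * B * B * C / w"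
  have w3: "w * (w * w) = 4 * A * B * B * C * C * D * w + A * B * B * B * B * C * C"
    using cr by (simp add: c_root_def A_B_C_D_def eval_nat_numeral algebra_simps)
  have ww: "w * w = 4 * A * B * B * C * C * D + B * B * C * t"
  proof -
    have "w * (w * w) = w * (4 * A * B * B * C * C * D + B * B * C * t)"
      unfolding w3 using w0 by (simp add: t_def algebra_simps)
    then show ?thesis using w0 by simp
  qed
  \<comment> \<open>\<open>k * Q\<close> equals \<open>A * B * C * D\<close> and \<open>Q\<close> is
    the product of the roots, so the reciprocal of a root in the last basis vector becomes a product
    of the three other roots.\<close>
  define J k where "J = 1 / (A * B)" "k = 1 / (A * A * B * C)"
  have Jk: "A * B * J = 1" "A * A * B * C * k = 1" using nA by (simp_all add: J_k_def)
  have Q0: "Q \<noteq> 0" using nA by (simp add: PQ)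
  have u0: "u1 \<noteq> 0" "u2 \<noteq> 0" "u3 \<noteq> 0" "u4 \<noteq> 0" using e4 Q0 by auto
  have kQ: "A * B * C * D = k * Q" using nA by (simp add: PQ J_k_def)
  have i: "A * B * C * D / u1 = k * (u2 * q)" "A * B * C * D / u2 = k * (u1 * q)"
    "A * B * C * D / u3 = k * (u4 * p)" "A * B * C * D / u4 = k * (u3 * p)"
    unfolding kQ e4[symmetric] using u0 by (simp_all add: s_p_q_def)
  define N0 N1 N2 N3 :: complex where "N0 = of_int n0" "N1 = of_int n1" "N2 = of_int n2" "N3 = of_int n3"
  have em: "q_emb e u (e (n0, n1, n2, n3)) = N0 + N1 * u + N2 * (u * u * J) + N3 * (A * B * C * D / u)" for u
    by (simp add: q_emb_apply[OF e] A_B_C_D_def N0_N1_N2_N3_def J_k_def)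
  have "(N0 + N1 * u1 + N2 * (u1 * u1 * J) + N3 * (k * (u2 * q))) * (N0 + N1 * u2 + N2 * (u2 * u2 * J) + N3 * (k * (u1 * q)))
     + (N0 + N1 * u3 + N2 * (u3 * u3 * J) + N3 * (k * (u4 * p))) * (N0 + N1 * u4 + N2 * (u4 * u4 * J) + N3 * (k * (u3 * p)))
   = 2 * N0 * N0 + N0 * N1 * (u1 + u2 + (u3 + u4)) + N0 * N2 * J * ((u1 * u1 + u2 * u2) + (u3 * u3 + u4 * u4))
     + N0 * N3 * k * ((u1 + u2) * q + (u3 + u4) * p) + N1 * N1 * (u1 * u2 + u3 * u4)
     + N2 * N2 * J * J * ((u1 * u2) * (u1 * u2) + (u3 * u4) * (u3 * u4)) + N3 * N3 * k * k * (u1 * u2 * q * q + u3 * u4 * p * p)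
     + N1 * N2 * J * (u1 * u2 * (u1 + u2) + u3 * u4 * (u3 + u4))
     + N1 * N3 * k * ((u1 * u1 + u2 * u2) * q + (u3 * u3 + u4 * u4) * p)
     + N2 * N3 * J * k * ((u1 * u1 * u1 + u2 * u2 * u2) * q + (u3 * u3 * u3 + u4 * u4 * u4) * p)"
    by (simp add: algebra_simps)
  also have "u1 * u1 + u2 * u2 = s * s - 2 * p" by (simp add: s_p_q_def algebra_simps)
  also have "u3 * u3 + u4 * u4 = s * s - 2 * q"
  proof -
    have "u3 * u3 + u4 * u4 = (u3 + u4) * (u3 + u4) - 2 * q" by (simp add: s_p_q_def algebra_simps)
    then show ?thesis unfolding s2 by simp
  qed
  also have "u1 * u1 * u1 + u2 * u2 * u2 = s * (s * s - 3 * p)" by (simp add: s_p_q_def algebra_simps)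
  also have "u3 * u3 * u3 + u4 * u4 * u4 = - s * (s * s - 3 * q)"
  proof -
    have "u3 * u3 * u3 + u4 * u4 * u4 = (u3 + u4) * ((u3 + u4) * (u3 + u4) - 3 * q)" by (simp add: s_p_q_def algebra_simps)
    then show ?thesis unfolding s2 by simp
  qed
  also have "u1 + u2 = s" by (simp add: s_p_q_def)
  also note s2
  also have "u1 * u2 = p" by (simp add: s_p_q_def)
  also have "u3 * u4 = q" by (simp add: s_p_q_def)
  finally have big: "q_emb e u1 (e (n0, n1, n2, n3)) * q_emb e u2 (e (n0, n1, n2, n3)) + q_emb e u3 (e (n0, n1, n2, n3)) * q_emb e u4 (e (n0, n1, n2, n3))
   = 2 * N0 * N0 + N0 * N1 * (s + - s) + N0 * N2 * J * ((s * s - 2 * p) + (s * s - 2 * q))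
     + N0 * N3 * k * (s * q + - s * p) + N1 * N1 * (p + q) + N2 * N2 * J * J * (p * p + q * q) + N3 * N3 * k * k * (p * q * q + q * p * p)
     + N1 * N2 * J * (p * s + q * - s)
     + N1 * N3 * k * ((s * s - 2 * p) * q + (s * s - 2 * q) * p)
     + N2 * N3 * J * k * (s * (s * s - 3 * p) * q + - s * (s * s - 3 * q) * p)"
    unfolding em i .
  have c02: "(s * s - 2 * p) + (s * s - 2 * q) = 0" unfolding ss by simp
  have c03: "k * (s * q + - s * p) = B"
  proof -
    have "s * q + - s * p = P" unfolding PP by (simp add: algebra_simps)
    then show ?thesis using nA by (simp add: PQ J_k_def)
  qed
  have c22: "J * J * (p * p + q * q) = C * t + 2 * A * C * C * D"
  proof -
    have "p * p + q * q = A * w * (A * w) - 2 * Q" unfolding Aw[symmetric] QQ by (simp add: algebra_simps)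
    also have "\<dots> = A * A * (w * w) - 2 * Q" by simp
    also have "\<dots> = A * A * B * B * (C * t + 2 * A * C * C * D)" unfolding ww PQ by (simp add: algebra_simps)
    finally show ?thesis using nA by (simp add: J_k_def)
  qed
  have c33: "k * k * (p * q * q + q * p * p) = D * w"
  proof -
    have "p * q * q + q * p * p = Q * (A * w)" unfolding Aw[symmetric] QQ by (simp add: algebra_simps)
    then show ?thesis using nA by (simp add: J_k_def PQ)
  qed
  have c12: "J * (p * s + q * - s) = - A * B * C"
  proof -
    have "p * s + q * - s = - P" unfolding PP by (simp add: algebra_simps)
    then show ?thesis using nA by (simp add: J_k_def PQ)
  qed
  have c13: "k * ((s * s - 2 * p) * q + (s * s - 2 * q) * p) = B * t"
  proof -
    have "(s * s - 2 * p) * q + (s * s - 2 * q) * p = A * w * (A * w) - 4 * Q"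
      unfolding ss Aw[symmetric] QQ by (simp add: algebra_simps)
    also have "\<dots> = A * A * (w * w) - 4 * Q" by simp
    also have "\<dots> = A * A * B * B * C * t" unfolding ww PQ by (simp add: algebra_simps)
    finally show ?thesis using nA by (simp add: J_k_def)
  qed
  have c23: "J * k * (s * (s * s - 3 * p) * q + - s * (s * s - 3 * q) * p) = w"
  proof -
    have "s * (s * s - 3 * p) * q + - s * (s * s - 3 * q) * p = (s * s) * (s * (q - p))" by (simp add: algebra_simps)
    also have "\<dots> = A * w * P" unfolding ss Aw PP[symmetric] ..
    finally show ?thesis using nA by (simp add: J_k_def PQ)
  qed
  show "q_emb e u1 (e (n0, n1, n2, n3)) * q_emb e u2 (e (n0, n1, n2, n3)) + q_emb e u3 (e (n0, n1, n2, n3)) * q_emb e u4 (e (n0, n1, n2, n3))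
     = c_emb e' w (e' (2 * n0 * n0 + b * n0 * n3 - a * b * c * n1 * n2 + 2 * a * c * c * d * n2 * n2,
          a * n1 * n1 + n2 * n3 + d * n3 * n3, b * n1 * n3 + c * n2 * n2))"
  proof -
    have "c_emb e' w (e' (2 * n0 * n0 + b * n0 * n3 - a * b * c * n1 * n2 + 2 * a * c * c * d * n2 * n2,
          a * n1 * n1 + n2 * n3 + d * n3 * n3, b * n1 * n3 + c * n2 * n2)) =
        (2 * N0 * N0 + B * N0 * N3 - A * B * C * N1 * N2 + 2 * A * C * C * D * N2 * N2)
        + (A * N1 * N1 + N2 * N3 + D * N3 * N3) * w + (B * N1 * N3 + C * N2 * N2) * t"
      unfolding c_emb_apply[OF e'] t_def A_B_C_D_def N0_N1_N2_N3_def by simp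
    also have "\<dots> = 2 * N0 * N0 + N0 * N2 * J * 0 + N0 * N3 * B + N1 * N1 * (A * w) + N2 * N2 * (C * t + 2 * A * C * C * D)
        + N3 * N3 * (D * w) + N1 * N2 * (- A * B * C) + N1 * N3 * (B * t) + N2 * N3 * w"
      by (simp add: algebra_simps)
    also have "\<dots> = 2 * N0 * N0 + N0 * N2 * J * ((s * s - 2 * p) + (s * s - 2 * q)) + N0 * N3 * (k * (s * q + - s * p))
        + N1 * N1 * (p + q) + N2 * N2 * (J * J * (p * p + q * q)) + N3 * N3 * (k * k * (p * q * q + q * p * p))
        + N1 * N2 * (J * (p * s + q * - s)) + N1 * N3 * (k * ((s * s - 2 * p) * q + (s * s - 2 * q) * p))
        + N2 * N3 * (J * k * (s * (s * s - 3 * p) * q + - s * (s * s - 3 * q) * p))"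
      unfolding c02 c03 c22 c33 c12 c13 c23 Aw ..
    finally show ?thesis unfolding big by (simp add: algebra_simps)
  qed
qed

text \<open>The cubic with roots \<open>y1\<close>, \<open>y2\<close>, \<open>y3\<close> has
  symmetric functions e2, e1 e3 - 4 e4 and e3^2 + e1^2 e4 - 4 e2 e4. Since e1 = e2 = 0 here, it is
  y^3 - 4 Q y - P^2, and division of the roots by \<open>a\<close> gives the cubic of
  \<open>c_root\<close>.\<close>

lemma roots_of_quartic:
  fixes u1 u2 u3 u4 :: complex
  assumes "u1 + u2 + u3 + u4 = 0"
    and "u1 * u2 + u1 * u3 + u1 * u4 + u2 * u3 + u2 * u4 + u3 * u4 = 0"
    and "u1 * u2 * u3 + u1 * u2 * u4 + u1 * u3 * u4 + u2 * u3 * u4 = P"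
    and "u1 * u2 * u3 * u4 = Q"
  shows "{u. q_root u} = {u1, u2, u3, u4}"
    and "{w. c_root w} = {(u1 * u2 + u3 * u4) / of_int a, (u1 * u3 + u2 * u4) / of_int a, (u1 * u4 + u2 * u3) / of_int a}"
proof -
  have "z ^ 4 - P * z + Q = (z - u1) * (z - u2) * (z - u3) * (z - u4)" for z
  proof -
    have "(z - u1) * (z - u2) * (z - u3) * (z - u4) = z ^ 4 - (u1 + u2 + u3 + u4) * z ^ 3
      + (u1 * u2 + u1 * u3 + u1 * u4 + u2 * u3 + u2 * u4 + u3 * u4) * z ^ 2
      - (u1 * u2 * u3 + u1 * u2 * u4 + u1 * u3 * u4 + u2 * u3 * u4) * z + u1 * u2 * u3 * u4"
      by (simp add: eval_nat_numeral algebra_simps)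
    then show ?thesis by (simp add: assms)
  qed
  then show "{u. q_root u} = {u1, u2, u3, u4}" by (auto simp: q_root_def)
  define A B C D :: complex where "A = of_int a" "B = of_int b" "C = of_int c" "D = of_int d"
  have nA: "A \<noteq> 0" using nzc by (simp_all add: A_B_C_D_def)
  define y1 y2 y3 where "y1 = u1 * u2 + u3 * u4" "y2 = u1 * u3 + u2 * u4" "y3 = u1 * u4 + u2 * u3"
  have y: "(y - y1) * (y - y2) * (y - y3) = y ^ 3 - 4 * Q * y - P * P" for y
  proof -
    define e1 e2 e3 e4 where "e1 = u1 + u2 + u3 + u4"
      "e2 = u1 * u2 + u1 * u3 + u1 * u4 + u2 * u3 + u2 * u4 + u3 * u4"
      "e3 = u1 * u2 * u3 + u1 * u2 * u4 + u1 * u3 * u4 + u2 * u3 * u4" "e4 = u1 * u2 * u3 * u4"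
    have 1: "y1 + y2 + y3 = e2" by (simp add: y1_y2_y3_def e1_e2_e3_e4_def algebra_simps)
    have 2: "y1 * y2 + y1 * y3 + y2 * y3 = e1 * e3 - 4 * e4" by (simp add: y1_y2_y3_def e1_e2_e3_e4_def algebra_simps)
    have 3: "y1 * y2 * y3 = e3 * e3 + e1 * e1 * e4 - 4 * e2 * e4" by (simp add: y1_y2_y3_def e1_e2_e3_e4_def algebra_simps)
    have "(y - y1) * (y - y2) * (y - y3) = y ^ 3 - (y1 + y2 + y3) * y ^ 2 + (y1 * y2 + y1 * y3 + y2 * y3) * y - y1 * y2 * y3"
      by (simp add: eval_nat_numeral algebra_simps)
    then show ?thesis unfolding 1 2 3 using assms by (simp add: e1_e2_e3_e4_def)
  qed
  have "c_root w \<longleftrightarrow> (A * w - y1) * (A * w - y2) * (A * w - y3) = 0" for w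
  proof -
    have "(A * w - y1) * (A * w - y2) * (A * w - y3) =
        A ^ 3 * (w ^ 3 - (4 * A * B * B * C * C * D * w + A * B ^ 4 * C ^ 2))"
      unfolding y by (simp add: P_def Q_def flip: A_B_C_D_def) (simp add: eval_nat_numeral algebra_simps)
    moreover have "c_root w \<longleftrightarrow> w ^ 3 - (4 * A * B * B * C * C * D * w + A * B ^ 4 * C ^ 2) = 0"
      by (simp add: c_root_def A_B_C_D_def)
    ultimately show ?thesis using nA by simp
  qed
  moreover have "A * w - y = 0 \<longleftrightarrow> w = y / A" for w y using nA by (auto simp: field_simps)
  ultimately have "{w. c_root w} = {y1 / A, y2 / A, y3 / A}" by auto
  then show "{w. c_root w} = {(u1 * u2 + u3 * u4) / of_int a, (u1 * u3 + u2 * u4) / of_int a, (u1 * u4 + u2 * u3) / of_int a}"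
    by (simp add: y1_y2_y3_def A_B_C_D_def)
qed

lemma cubic_resolvent_pair:
  fixes u1 u2 u3 u4 :: complex
  assumes e1: "u1 + u2 + u3 + u4 = 0"
    and e2: "u1 * u2 + u1 * u3 + u1 * u4 + u2 * u3 + u2 * u4 + u3 * u4 = 0"
    and e3: "u1 * u2 * u3 + u1 * u2 * u4 + u1 * u3 * u4 + u2 * u3 * u4 = P"
    and e4: "u1 * u2 * u3 * u4 = Q"
    and ne: "u1 \<noteq> u2" "u1 \<noteq> u3" "u1 \<noteq> u4" "u2 \<noteq> u3" "u2 \<noteq> u4" "u3 \<noteq> u4"
    and e: "inj (e :: int \<times> int \<times> int \<times> int \<Rightarrow> 'a)" and e': "inj (e' :: int \<times> int \<times> int \<Rightarrow> 'b)"
  shows "embedded_ring (Q_ring e) 4" "embedded_ring (C_ring e') 3" "cubic_resolvent (Q_ring e) (C_ring e')"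
proof -
  note roots = roots_of_quartic[OF e1 e2 e3 e4]
  define A :: complex where "A = of_int a"
  have nA: "A \<noteq> 0" using nzc by (simp add: A_def)
  define w1 w2 w3 where "w1 = (u1 * u2 + u3 * u4) / A" "w2 = (u1 * u3 + u2 * u4) / A" "w3 = (u1 * u4 + u2 * u3) / A"
  \<comment> \<open>A difference of two resolvent values is a product of two differences of roots,
    so distinct roots of the quartic give distinct roots of the cubic.\<close>
  have d: "u1 * u2 + u3 * u4 - (u1 * u3 + u2 * u4) = (u1 - u4) * (u2 - u3)"
    "u1 * u2 + u3 * u4 - (u1 * u4 + u2 * u3) = (u1 - u3) * (u2 - u4)"
    "u1 * u3 + u2 * u4 - (u1 * u4 + u2 * u3) = (u1 - u2) * (u3 - u4)"
    by (simp_all add: algebra_simps)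
  have dz: "u1 * u2 + u3 * u4 - (u1 * u3 + u2 * u4) \<noteq> 0" "u1 * u2 + u3 * u4 - (u1 * u4 + u2 * u3) \<noteq> 0"
    "u1 * u3 + u2 * u4 - (u1 * u4 + u2 * u3) \<noteq> 0"
    unfolding d using ne by simp_all
  then have wne: "w1 \<noteq> w2" "w1 \<noteq> w3" "w2 \<noteq> w3"
    using nA unfolding w1_w2_w3_def by auto
  have c4: "card {u. q_root u} = 4" unfolding roots using ne by simp
  have cr: "{w. c_root w} = {w1, w2, w3}" unfolding roots by (simp add: w1_w2_w3_def A_def)
  have c3: "card {w. c_root w} = 3" unfolding cr using wne by simp
  show Q: "embedded_ring (Q_ring e) 4" by (rule Q_embedded[OF e c4])
  show C: "embedded_ring (C_ring e') 3" by (rule C_embedded[OF e' c3])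
  define U where "U i = (if i = 1 then u1 else if i = 2 then u2 else if i = 3 then u3 else u4)" for i :: nat
  define W where "W i = (if i = 1 then w1 else if i = 2 then w2 else w3)" for i :: nat
  have bU: "bij_betw U {1..4} {u. q_root u}"
    unfolding roots(1) atLeast1_atMost_4 using ne by (auto simp: bij_betw_def inj_on_def U_def)
  have bW: "bij_betw W {1..3} {w. c_root w}"
    unfolding cr atLeast1_atMost_3 using wne by (auto simp: bij_betw_def inj_on_def W_def)
  have "bij_betw (q_emb e) {u. q_root u} (embeddings (Q_ring e))"
    using q_emb_inj[OF e] by (auto simp: bij_betw_def Q_embeddings[OF e] intro!: inj_onI)
  then have bs: "bij_betw (q_emb e \<circ> U) {1..4} (embeddings (Q_ring e))" using bU by (rule bij_betw_trans[rotated])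
  have "bij_betw (c_emb e') {w. c_root w} (embeddings (C_ring e'))"
    using c_emb_inj[OF e'] by (auto simp: bij_betw_def C_embeddings[OF e'] intro!: inj_onI)
  then have bt: "bij_betw (c_emb e' \<circ> W) {1..3} (embeddings (C_ring e'))" using bW by (rule bij_betw_trans[rotated])
  show "cubic_resolvent (Q_ring e) (C_ring e')"
    unfolding cubic_resolvent_def
  proof (intro conjI exI ballI)
    show "rank_ring 3 (C_ring e')" using C_cring[OF e'] C_basis[OF e'] by (auto simp: rank_ring_def)
    show "disc 3 (C_ring e') = disc 4 (Q_ring e)" unfolding C_disc[OF e' c3] Q_disc[OF e c4] ..
    show "bij_betw (q_emb e \<circ> U) {1..4} (embeddings (Q_ring e))" by (rule bs)
    show "bij_betw (c_emb e' \<circ> W) {1..3} (embeddings (C_ring e'))" by (rule bt)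
    fix x assume "x \<in> carrier (Q_ring e)"
    then obtain n0 n1 n2 n3 where x: "x = e (n0, n1, n2, n3)" using Q_simps[OF e] by auto
    let ?y = "e' (2 * n0 * n0 + b * n0 * n3 - a * b * c * n1 * n2 + 2 * a * c * c * d * n2 * n2,
          a * n1 * n1 + n2 * n3 + d * n3 * n3, b * n1 * n3 + c * n2 * n2)"
    have 1: "q_emb e u1 x * q_emb e u2 x + q_emb e u3 x * q_emb e u4 x = c_emb e' w1 ?y"
      unfolding x w1_w2_w3_def A_def by (rule resolvent_identity(2)[OF e1 e2 e3 e4 e e'])
    have 2: "q_emb e u1 x * q_emb e u3 x + q_emb e u2 x * q_emb e u4 x = c_emb e' w2 ?y"
      unfolding x w1_w2_w3_def A_def by (rule resolvent_identity(2)[OF _ _ _ _ e e'])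
        (use e1 e2 e3 e4 in \<open>simp_all add: ac_simps\<close>)
    have 3: "q_emb e u1 x * q_emb e u4 x + q_emb e u2 x * q_emb e u3 x = c_emb e' w3 ?y"
      unfolding x w1_w2_w3_def A_def by (rule resolvent_identity(2)[OF _ _ _ _ e e'])
        (use e1 e2 e3 e4 in \<open>simp_all add: ac_simps\<close>)
    show "\<exists>y\<in>carrier (C_ring e').
       (c_emb e' \<circ> W) 1 y = (q_emb e \<circ> U) 1 x * (q_emb e \<circ> U) 2 x + (q_emb e \<circ> U) 3 x * (q_emb e \<circ> U) 4 x \<and>
       (c_emb e' \<circ> W) 2 y = (q_emb e \<circ> U) 1 x * (q_emb e \<circ> U) 3 x + (q_emb e \<circ> U) 2 x * (q_emb e \<circ> U) 4 x \<and>
       (c_emb e' \<circ> W) 3 y = (q_emb e \<circ> U) 1 x * (q_emb e \<circ> U) 4 x + (q_emb e \<circ> U) 2 x * (q_emb e \<circ> U) 3 x"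
      by (rule bexI[of _ ?y]) (use 1 2 3 in \<open>simp_all add: U_def W_def C_simps[OF e']\<close>)
  qed
qed

end

section \<open>Irrationality of the roots and the Galois group of the family\<close>

lemma quartic_mod_3:
  fixes m n :: int
  assumes "3 dvd m ^ 4 + m * n ^ 3 - n ^ 4"
  shows "3 dvd m \<and> 3 dvd n"
proof -
  have "(m ^ 4 + m * n ^ 3 - n ^ 4) mod 3 = ((m mod 3) ^ 4 + (m mod 3) * (n mod 3) ^ 3 - (n mod 3) ^ 4) mod 3"
    unfolding Cong.cong_def[symmetric]
    by (intro cong_diff cong_add cong_mult cong_pow) (simp_all add: Cong.cong_def)
  then have 0: "((m mod 3) ^ 4 + (m mod 3) * (n mod 3) ^ 3 - (n mod 3) ^ 4) mod 3 = 0" using assms by simp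
  have m: "m mod 3 = 0 \<or> m mod 3 = 1 \<or> m mod 3 = 2" and n: "n mod 3 = 0 \<or> n mod 3 = 1 \<or> n mod 3 = 2" by auto
  have "m mod 3 = 0 \<and> n mod 3 = 0" using m n 0 by (elim disjE) simp_all
  then show ?thesis by auto
qed

lemma Rats_coprime:
  assumes "(z :: complex) \<in> \<rat>"
  obtains m n :: int where "n \<noteq> 0" "coprime m n" "z = of_int m / of_int n"
proof -
  obtain a b :: int where "b > 0" "coprime a b" "z = of_int a / of_int b" using assms by (rule Rats_cases')
  then show thesis using that[of b a] by simp
qed

text \<open>The residues modulo 6 fix the rescaled quartic modulo 3 and the powers of 2:
  \<open>c\<close> has exactly one factor 2, the other coefficients are odd. The sign of
  \<open>d\<close> makes \<open>Q\<close> negative, which gives exactly two real roots.\<close>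

locale S4_form_pair = form_pair +
  fixes c'
  assumes pos: "a > 0" "b > 0" "c > 0" "d < 0"
    and cong: "a mod 6 = 1" "b mod 6 = 1" "c = 2 * c'" "c' mod 6 = 1" "d mod 6 = 5"
begin

text \<open>The quartic is negative at 0, so the intermediate value theorem gives real roots of both
  signs. Dividing by their factors leaves the quadratic z^2 + s z + v, whose discriminant is
  negative. The roots are returned through their elementary symmetric functions, the form in which
  the resolvent lemmas take them.\<close>

lemma real_roots:
  obtains r1 r2 :: real and u :: complex where "Im u \<noteq> 0" "r1 \<noteq> r2"
    "of_real r1 + of_real r2 + u + cnj u = 0"
    "of_real r1 * of_real r2 + of_real r1 * u + of_real r1 * cnj u + of_real r2 * u + of_real r2 * cnj u + u * cnj u = 0"
    "of_real r1 * of_real r2 * u + of_real r1 * of_real r2 * cnj u + of_real r1 * u * cnj u + of_real r2 * u * cnj u = P"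
    "of_real r1 * of_real r2 * u * cnj u = Q"
proof -
  define p q :: real where "p = of_int (a * a * b * b * c)" "q = of_int (a * a * a * b * b * c * c * d)"
  have p0: "p > 0" unfolding p_q_def of_int_0_less_iff using pos by (intro mult_pos_pos)
  have q0: "q < 0" unfolding p_q_def of_int_less_0_iff using pos by (intro mult_pos_neg mult_pos_pos)
  define h where "h x = x ^ 4 - p * x + q" for x :: real
  have cont: "continuous_on S h" for S unfolding h_def by (intro continuous_intros)
  have h0: "h 0 < 0" using q0 by (simp add: h_def)
  have h4: "x ^ 4 \<ge> x" if "x \<ge> 1" for x :: real using that power_increasing[of 1 4 x] by simp
  have hm: "h (- (1 - q)) \<ge> 0"
  proof -
    have "(1 - q) ^ 4 \<ge> 1 - q" using q0 by (intro h4) simp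
    moreover have "p * (1 - q) \<ge> 0" using p0 q0 by simp
    moreover have "h (- y) = y ^ 4 + p * y + q" for y by (simp add: h_def)
    then have "h (- (1 - q)) = (1 - q) ^ 4 + p * (1 - q) + q" by blast
    ultimately show ?thesis by linarith
  qed
  have hp: "h (1 + p - q) \<ge> 0"
  proof -
    define M where "M = 1 + p - q"
    have M: "M \<ge> 1" "M \<ge> p + 1" "M \<ge> - q" using p0 q0 by (simp_all add: M_def)
    have "M ^ 3 \<ge> M ^ 1" using M(1) by (intro power_increasing) auto
    then have "M ^ 3 - p \<ge> 1" using M(2) by simp
    then have "M * (M ^ 3 - p) \<ge> M * 1" using M(1) by (intro mult_left_mono) auto
    then have "M ^ 4 - p * M \<ge> M" by (simp add: eval_nat_numeral algebra_simps)
    then show ?thesis using M(3) by (simp add: h_def M_def[symmetric])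
  qed
  obtain r1 where r1: "r1 \<le> 0" "h r1 = 0"
    using IVT2'[of h 0 0 "- (1 - q)"] hm h0 q0 cont by (auto simp: less_imp_le)
  obtain r2 where r2: "0 \<le> r2" "h r2 = 0"
    using IVT'[of h 0 0 "1 + p - q"] hp h0 q0 p0 cont by (auto simp: less_imp_le)
  have rneg: "r1 < 0" "r2 > 0" using r1 r2 h0 by (auto simp: order_less_le)
  define s where "s = r1 + r2"
  define v where "v = r1 * r1 + r1 * r2 + r2 * r2"
  have pe: "p = s * (r1 * r1 + r2 * r2)"
  proof -
    have "(r1 - r2) * (s * (r1 * r1 + r2 * r2) - p) = h r1 - h r2"
      by (simp add: h_def s_def eval_nat_numeral algebra_simps)
    then have "(r1 - r2) * (s * (r1 * r1 + r2 * r2) - p) = 0" using r1 r2 by simp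
    then show ?thesis using rneg by simp
  qed
  have qe: "q = r1 * r2 * v"
  proof -
    have "q = p * r1 - r1 ^ 4" using r1(2) by (simp add: h_def)
    then show ?thesis unfolding pe by (simp add: s_def v_def eval_nat_numeral algebra_simps)
  qed
  define t where "t = sqrt (v - s * s / 4)"
  have tpos: "v - s * s / 4 > 0"
  proof -
    have "v - s * s / 4 = ((r1 + r2) * (r1 + r2) + 2 * (r1 * r1) + 2 * (r2 * r2)) / 4"
      by (simp add: v_def s_def algebra_simps)
    moreover have "r1 * r1 > 0" using rneg by (simp add: mult_neg_neg)
    then have "0 < (r1 + r2) * (r1 + r2) + 2 * (r1 * r1) + 2 * (r2 * r2)"
      by (intro add_pos_nonneg add_nonneg_pos) auto
    ultimately show ?thesis by simp
  qed
  then have tt: "t * t = v - s * s / 4" by (simp add: t_def)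
  define u where "u = Complex (- s / 2) t"
  have u1: "u + cnj u = - of_real s" by (simp add: u_def complex_eq_iff)
  have u2: "u * cnj u = of_real v" using tt by (simp add: u_def complex_eq_iff)
  define R1 R2 where "R1 = complex_of_real r1" "R2 = complex_of_real r2"
  have S: "of_real s = R1 + R2" "of_real v = R1 * R1 + R1 * R2 + R2 * R2" by (simp_all add: s_def v_def R1_R2_def)
  have Pe: "P = (R1 + R2) * (R1 * R1 + R2 * R2)"
  proof -
    have "P = of_real p" by (simp add: P_def p_q_def)
    then show ?thesis unfolding pe by (simp add: s_def R1_R2_def)
  qed
  have Qe: "Q = R1 * R2 * (R1 * R1 + R1 * R2 + R2 * R2)"
  proof -
    have "Q = of_real q" by (simp add: Q_def p_q_def)
    then show ?thesis unfolding qe by (simp add: v_def R1_R2_def)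
  qed
  show thesis
  proof (rule that[of u r1 r2], unfold R1_R2_def[symmetric])
    show "Im u \<noteq> 0" using tpos by (simp add: u_def t_def)
    show "r1 \<noteq> r2" using rneg by simp
    show "R1 + R2 + u + cnj u = 0" using u1 unfolding S by (simp add: add.assoc)
    have "R1 * R2 + R1 * u + R1 * cnj u + R2 * u + R2 * cnj u + u * cnj u = R1 * R2 + (R1 + R2) * (u + cnj u) + u * cnj u"
      by (simp add: algebra_simps)
    then show "R1 * R2 + R1 * u + R1 * cnj u + R2 * u + R2 * cnj u + u * cnj u = 0"
      unfolding u1 u2 S by (simp add: algebra_simps)
    have "R1 * R2 * u + R1 * R2 * cnj u + R1 * u * cnj u + R2 * u * cnj u = R1 * R2 * (u + cnj u) + (R1 + R2) * (u * cnj u)"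
      by (simp add: algebra_simps)
    then show "R1 * R2 * u + R1 * R2 * cnj u + R1 * u * cnj u + R2 * u * cnj u = P"
      unfolding u1 u2 S Pe by (simp add: algebra_simps)
    have "R1 * R2 * u * cnj u = R1 * R2 * (u * cnj u)" by simp
    then show "R1 * R2 * u * cnj u = Q" unfolding u2 S Qe .
  qed
qed

lemma q_root_irrational:
  assumes z: "q_root z"
  shows "z \<notin> \<rat>"
proof
  assume "z \<in> \<rat>"
  define A B C D :: complex where "A = of_int a" "B = of_int b" "C = of_int c" "D = of_int d"
  have nA: "A \<noteq> 0" "B \<noteq> 0" "C \<noteq> 0" "D \<noteq> 0" using nzc by (simp_all add: A_B_C_D_def)
  \<comment> \<open>The substitution brings the equation to a c^2 x^4 + b^2 x + d b^2 = 0, which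
    modulo 3 reads x^4 + x - 1 = 0 and has no solution there, even in homogeneous
    coordinates.\<close>
  define x where "x = - z / (A * C)"
  have "x \<in> \<rat>" using \<open>z \<in> \<rat>\<close> by (auto simp: x_def A_B_C_D_def)
  then obtain m n :: int where mn: "n \<noteq> 0" "coprime m n" "x = of_int m / of_int n" by (rule Rats_coprime)
  have zx: "z = - (A * C * x)" using nA by (simp add: x_def)
  have "A * A * A * C * C * (A * C * C * x ^ 4 + B * B * x + D * B * B) = 0"
    using z unfolding zx q_root_def P_def Q_def A_B_C_D_def[symmetric]
    by (simp add: eval_nat_numeral algebra_simps)
  then have "A * C * C * x ^ 4 + B * B * x + D * B * B = 0" using nA by simp
  then have h1: "(A * C * C * x ^ 4 + B * B * x + D * B * B) * of_int n ^ 4 = 0" by simp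
  have h2: "(A * C * C * x ^ 4 + B * B * x + D * B * B) * of_int n ^ 4 =
      A * C * C * of_int m ^ 4 + B * B * of_int m * of_int n ^ 3 + D * B * B * of_int n ^ 4"
    unfolding mn(3) using mn(1) by (simp add: field_simps eval_nat_numeral)
  have "(of_int (a * c * c * m ^ 4 + b * b * m * n ^ 3 + d * b * b * n ^ 4) :: complex) =
      A * C * C * of_int m ^ 4 + B * B * of_int m * of_int n ^ 3 + D * B * B * of_int n ^ 4"
    by (simp add: A_B_C_D_def)
  also have "\<dots> = 0" unfolding h2[symmetric] by (rule h1)
  finally have "(of_int (a * c * c * m ^ 4 + b * b * m * n ^ 3 + d * b * b * n ^ 4) :: complex) = 0" .
  then have 0: "a * c * c * m ^ 4 + b * b * m * n ^ 3 + d * b * b * n ^ 4 = 0" by (simp only: of_int_eq_0_iff)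
  have 3: "3 dvd a - 1" "3 dvd b - 1" "3 dvd c - 2" "3 dvd d + 1"
    using cong by presburger+
  obtain a' b' c'' d' where "a - 1 = 3 * a'" "b - 1 = 3 * b'" "c - 2 = 3 * c''" "d + 1 = 3 * d'"
    using 3 unfolding dvd_def by blast
  then have e: "a = 3 * a' + 1" "b = 3 * b' + 1" "c = 3 * c'' + 2" "d = 3 * d' - 1" by linarith+
  have f: "3 dvd a * c * c - 1" "3 dvd b * b - 1" "3 dvd d * b * b + 1"
  proof -
    have "a * c * c - 1 = 3 * (a' * c * c + 3 * c'' * c'' + 4 * c'' + 1)" "b * b - 1 = 3 * (3 * b' * b' + 2 * b')"
      "d * b * b + 1 = 3 * (d' * b * b - 3 * b' * b' - 2 * b')" unfolding e by (simp_all add: algebra_simps)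
    then show "3 dvd a * c * c - 1" "3 dvd b * b - 1" "3 dvd d * b * b + 1" by simp_all
  qed
  have "m ^ 4 + m * n ^ 3 - n ^ 4 = - ((a * c * c - 1) * m ^ 4 + (b * b - 1) * (m * n ^ 3) + (d * b * b + 1) * n ^ 4)"
    using 0 by (simp add: algebra_simps)
  moreover have "3 dvd (a * c * c - 1) * m ^ 4 + (b * b - 1) * (m * n ^ 3) + (d * b * b + 1) * n ^ 4"
    by (rule dvd_add[OF dvd_add[OF dvd_mult2[OF f(1)] dvd_mult2[OF f(2)]] dvd_mult2[OF f(3)]])
  ultimately have "3 dvd m ^ 4 + m * n ^ 3 - n ^ 4" by (simp only: dvd_minus_iff)
  then have "3 dvd m \<and> 3 dvd n" by (rule quartic_mod_3)
  then show False using mn(2) coprime_common_divisor[of m n 3] by simp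
qed

text \<open>A descent at the prime 2. The right side of the cleared equation is divisible by 4, so
  the numerator is even; after cancelling 4 the term with the cube of the denominator, whose
  coefficient is odd, is even as well.\<close>

lemma c_root_irrational:
  assumes w: "c_root w"
  shows "w \<notin> \<rat>"
proof
  assume "w \<in> \<rat>"
  then obtain m n :: int where mn: "n \<noteq> 0" "coprime m n" "w = of_int m / of_int n" by (rule Rats_coprime)
  have "(of_int (m ^ 3) :: complex) = w ^ 3 * of_int n ^ 3" unfolding mn(3) using mn(1) by (simp add: power_divide)
  also have "\<dots> = of_int (4 * a * b * b * c * c * d * m * n\<^sup>2 + a * b ^ 4 * c\<^sup>2 * n ^ 3)"
    using w unfolding c_root_def mn(3) using mn(1) by (simp add: field_simps eval_nat_numeral)
  finally have eq: "m ^ 3 = 4 * a * b * b * c * c * d * m * n\<^sup>2 + a * b ^ 4 * c\<^sup>2 * n ^ 3"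
    by (simp only: of_int_eq_iff)
  then have eq2: "m ^ 3 = 4 * (4 * a * b * b * c' * c' * d * m * n\<^sup>2 + a * b ^ 4 * c'\<^sup>2 * n ^ 3)"
    unfolding cong(3) by (simp add: power2_eq_square algebra_simps)
  then have "even (m ^ 3)" by simp
  then have "even m" by simp
  then obtain m' where m': "m = 2 * m'" by auto
  have "2 * m' ^ 3 = 2 * (4 * a * b * b * c' * c' * d * m' * n\<^sup>2) + a * b ^ 4 * c'\<^sup>2 * n ^ 3"
    using eq2 unfolding m' by (simp add: power_mult_distrib algebra_simps)
  then have "a * b ^ 4 * c'\<^sup>2 * n ^ 3 = 2 * (m' ^ 3 - 4 * a * b * b * c' * c' * d * m' * n\<^sup>2)" by (simp add: algebra_simps)
  then have "even (a * b ^ 4 * c'\<^sup>2 * n ^ 3)" by simp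
  moreover have "odd a" "odd b" "odd c'" using cong by presburger+
  ultimately have "even n" by simp
  then show False using \<open>even m\<close> mn(2) coprime_common_divisor[of m n 2] by simp
qed

text \<open>The requirements of \<open>perms_of_four\<close> come from three sources. Complex
  conjugation exchanges the two nonreal roots; the irrational real roots are moved by some
  automorphism each; and an automorphism moving the irrational root \<open>w\<close> of the cubic
  cannot preserve the splitting of the roots into the real and the nonreal pair.\<close>

lemma Q_ring_S4:
  assumes e: "inj (e :: int \<times> int \<times> int \<times> int \<Rightarrow> 'a)"
  shows "G_ring 4 (sym_group 4) (Q_ring e)"
proof -
  obtain r1 r2 u where u: "Im u \<noteq> 0" "r1 \<noteq> r2"
    and es: "of_real r1 + of_real r2 + u + cnj u = 0"
    "of_real r1 * of_real r2 + of_real r1 * u + of_real r1 * cnj u + of_real r2 * u + of_real r2 * cnj u + u * cnj u = 0"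
    "of_real r1 * of_real r2 * u + of_real r1 * of_real r2 * cnj u + of_real r1 * u * cnj u + of_real r2 * u * cnj u = P"
    "of_real r1 * of_real r2 * u * cnj u = Q"
    by (rule real_roots)
  define u1 u2 u3 u4 where "u1 = complex_of_real r1" "u2 = complex_of_real r2" "u3 = u" "u4 = cnj u"
  note es' = es[folded u1_u2_u3_u4_def]
  have ne: "u1 \<noteq> u2" "u1 \<noteq> u3" "u1 \<noteq> u4" "u2 \<noteq> u3" "u2 \<noteq> u4" "u3 \<noteq> u4"
    using u by (auto simp: u1_u2_u3_u4_def complex_eq_iff)
  note roots = roots_of_quartic(1)[OF es']
  define R where "R = Q_ring e"
  have emb: "embedded_ring R 4"
    unfolding R_def using Q_embedded[OF e] roots ne by simp
  interpret embedded_ring R 4 by (rule emb)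
  define x0 where "x0 = e (0, 1, 0, 0)"
  have x0: "x0 \<in> carrier R" by (simp add: R_def x0_def Q_simps[OF e])
  define s1 s2 s3 s4 where "s1 = q_emb e u1" "s2 = q_emb e u2" "s3 = q_emb e u3" "s4 = q_emb e u4"
  have E: "embeddings R = {s1, s2, s3, s4}"
    unfolding R_def Q_embeddings[OF e] roots s1_s2_s3_s4_def by simp
  have v: "s1 x0 = u1" "s2 x0 = u2" "s3 x0 = u3" "s4 x0 = u4"
    by (simp_all add: s1_s2_s3_s4_def x0_def q_emb_apply[OF e])
  have sne: "s1 \<noteq> s2" "s3 \<noteq> s4" "s1 \<noteq> s3" "s1 \<noteq> s4" "s2 \<noteq> s3" "s2 \<noteq> s4"
    using ne v by metis+
  have val: "\<sigma> = \<tau>" if "\<sigma> \<in> embeddings R" "\<tau> \<in> embeddings R" "\<sigma> x0 = \<tau> x0" for \<sigma> \<tau>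
    using that ne v unfolding E by auto
  let ?L = "carrier (splitting_field R)"
  have rep: "\<exists>\<pi>\<in>galois_perms R. \<pi> permutes embeddings R \<and> (\<forall>\<sigma>\<in>embeddings R. \<pi> \<sigma> x0 = g (\<sigma> x0))"
    if g: "field_hom_on ?L g" for g
    using hom_induces_galois_perm[OF g] x0 by (auto simp: galois_perms_def)
  have ratP: "P \<in> \<rat>" "Q \<in> \<rat>" by (auto simp: P_def Q_def)
  have alg: "\<exists>p. poly_over \<rat> p \<and> p \<noteq> 0 \<and> poly p \<alpha> = 0" if "\<alpha> \<in> {u1, u2, u3, u4}" for \<alpha>
  proof (intro exI conjI)
    show "poly_over \<rat> [:Q, - P, 0, 0, 1:]" using ratP by (auto simp: poly_over_def coeff_pCons split: nat.split)
    have "q_root \<alpha>" using that roots by auto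
    then show "poly [:Q, - P, 0, 0, 1:] \<alpha> = 0" by (simp add: q_root_def eval_nat_numeral algebra_simps)
  qed simp
  \<comment> \<open>A homomorphism moving \<alpha> is found on a field containing all roots. All
    embeddings take values in that field, so it restricts to the splitting field.\<close>
  have moved: "\<exists>g. field_hom_on ?L g \<and> g \<alpha> \<noteq> \<alpha>"
    if \<alpha>: "\<alpha> \<notin> \<rat>" "poly_over \<rat> p" "p \<noteq> 0" "poly p \<alpha> = 0" for \<alpha> p
  proof -
    have "\<exists>F g. complex_subfield F \<and> {u1, u2, u3, u4} \<subseteq> F \<and> \<alpha> \<in> F \<and> field_hom_on F g \<and> g \<alpha> \<noteq> \<alpha>"
      by (rule irrational_moved[OF \<alpha> _ alg]) simp_all
    then obtain F g where F: "complex_subfield F" "{u1, u2, u3, u4} \<subseteq> F" "field_hom_on F g" "g \<alpha> \<noteq> \<alpha>" by blast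
    have int: "of_int z \<in> F" for z by (rule subfield_of_int[OF F(1)])
    have "q_emb e z (e x) \<in> F" if "z \<in> F" for z x
    proof -
      obtain n0 n1 n2 n3 where x: "x = (n0, n1, n2, n3)" by (cases x) auto
      show ?thesis unfolding x q_emb_apply[OF e] divide_inverse
        by (intro subfield_add[OF F(1)] subfield_mult[OF F(1)] subfield_inverse[OF F(1)] int that)
    qed
    then have "(\<Union>\<sigma>\<in>embeddings R. \<sigma> ` carrier R) \<subseteq> F"
      using F(2) unfolding E s1_s2_s3_s4_def unfolding R_def by (auto simp: Q_simps[OF e])
    then have "?L \<subseteq> F" unfolding carrier_splitting_field by (rule generate_field_least[OF F(1)])
    then have "field_hom_on ?L g" using F(3) by (auto simp: field_hom_on_def)
    then show ?thesis using F(4) by blast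
  qed
  have s_in: "s1 \<in> embeddings R" "s2 \<in> embeddings R" "s3 \<in> embeddings R" "s4 \<in> embeddings R" unfolding E by auto
  obtain \<pi>1 where \<pi>1: "\<pi>1 \<in> galois_perms R" "\<pi>1 s1 \<noteq> s1"
  proof -
    have "q_root u1" using roots by auto
    from q_root_irrational[OF this] obtain g where g: "field_hom_on ?L g" "g u1 \<noteq> u1" using moved alg[of u1] by blast
    obtain \<pi> where "\<pi> \<in> galois_perms R" "\<forall>\<sigma>\<in>embeddings R. \<pi> \<sigma> x0 = g (\<sigma> x0)" using rep[OF g(1)] by blast
    then show thesis using that[of \<pi>] g(2) s_in v by metis
  qed
  obtain \<pi>2 where \<pi>2: "\<pi>2 \<in> galois_perms R" "\<pi>2 s2 \<noteq> s2"
  proof -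
    have "q_root u2" using roots by auto
    from q_root_irrational[OF this] obtain g where g: "field_hom_on ?L g" "g u2 \<noteq> u2" using moved alg[of u2] by blast
    obtain \<pi> where "\<pi> \<in> galois_perms R" "\<forall>\<sigma>\<in>embeddings R. \<pi> \<sigma> x0 = g (\<sigma> x0)" using rep[OF g(1)] by blast
    then show thesis using that[of \<pi>] g(2) s_in v by metis
  qed
  define w where "w = (u1 * u2 + u3 * u4) / of_int a"
  have w: "c_root w" unfolding w_def using roots_of_quartic(2)[OF es'] by auto
  obtain \<pi>0 where \<pi>0: "\<pi>0 \<in> galois_perms R" "{\<pi>0 s3, \<pi>0 s4} \<noteq> {s3, s4}" "{\<pi>0 s3, \<pi>0 s4} \<noteq> {s1, s2}"
  proof -
    define p where "p = [: - (of_int a * of_int b ^ 4 * of_int c ^ 2),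
       - (4 * of_int a * of_int b * of_int b * of_int c * of_int c * of_int d), 0, 1 :: complex:]"
    have p: "poly_over \<rat> p" unfolding p_def by (auto simp: poly_over_def coeff_pCons split: nat.split)
    have p2: "p \<noteq> 0" "poly p w = 0"
      using w by (simp_all add: p_def c_root_def eval_nat_numeral algebra_simps)
    obtain g where g: "field_hom_on ?L g" "g w \<noteq> w" using moved[OF c_root_irrational[OF w] p p2] by blast
    obtain \<pi> where \<pi>: "\<pi> \<in> galois_perms R" "\<pi> permutes embeddings R" "\<forall>\<sigma>\<in>embeddings R. \<pi> \<sigma> x0 = g (\<sigma> x0)"
      using rep[OF g(1)] by blast
    note L = splitting_subfield[of R]
    have uL: "u1 \<in> ?L" "u2 \<in> ?L" "u3 \<in> ?L" "u4 \<in> ?L"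
      using splitting_mem[OF s_in(1) x0] splitting_mem[OF s_in(2) x0] splitting_mem[OF s_in(3) x0] splitting_mem[OF s_in(4) x0] v by auto
    have gu: "g u1 = \<pi> s1 x0" "g u2 = \<pi> s2 x0" "g u3 = \<pi> s3 x0" "g u4 = \<pi> s4 x0"
      using \<pi>(3) s_in v by auto
    have "g w = (g u1 * g u2 + g u3 * g u4) / of_int a"
      unfolding w_def divide_inverse using uL
      by (simp add: hom_mult[OF L g(1)] hom_add[OF L g(1)] hom_inverse[OF L g(1)] hom_of_int[OF L g(1)]
          subfield_mult[OF L] subfield_add[OF L] subfield_inverse[OF L] subfield_of_int[OF L])
    then have gw: "(\<pi> s1 x0 * \<pi> s2 x0 + \<pi> s3 x0 * \<pi> s4 x0) \<noteq> u1 * u2 + u3 * u4"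
      using g(2) unfolding gu w_def by auto
    have in4: "\<pi> s = s1 \<or> \<pi> s = s2 \<or> \<pi> s = s3 \<or> \<pi> s = s4" if "s \<in> embeddings R" for s
      using permutes_in_image[OF \<pi>(2), of s] that unfolding E by auto
    have inj: "\<pi> s1 \<noteq> \<pi> s2" "\<pi> s1 \<noteq> \<pi> s3" "\<pi> s1 \<noteq> \<pi> s4" "\<pi> s2 \<noteq> \<pi> s3" "\<pi> s2 \<noteq> \<pi> s4" "\<pi> s3 \<noteq> \<pi> s4"
      using permutes_inj[OF \<pi>(2)] sne by (auto simp: inj_eq)
    have no1: "{\<pi> s3, \<pi> s4} \<noteq> {s3, s4}"
    proof
      assume h: "{\<pi> s3, \<pi> s4} = {s3, s4}"
      then have "{\<pi> s1, \<pi> s2} = {s1, s2}" using in4[OF s_in(1)] in4[OF s_in(2)] inj sne by (auto simp: doubleton_eq_iff)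
      then show False using h gw v by (auto simp: doubleton_eq_iff mult.commute)
    qed
    have no2: "{\<pi> s3, \<pi> s4} \<noteq> {s1, s2}"
    proof
      assume h: "{\<pi> s3, \<pi> s4} = {s1, s2}"
      then have "{\<pi> s1, \<pi> s2} = {s3, s4}" using in4[OF s_in(1)] in4[OF s_in(2)] inj sne by (auto simp: doubleton_eq_iff)
      then show False using h gw v by (auto simp: doubleton_eq_iff mult.commute add.commute)
    qed
    show thesis by (rule that[OF \<pi>(1) no1 no2])
  qed
  have t34: "Transposition.transpose s3 s4 \<in> galois_perms R"
  proof -
    have "field_hom_on ?L cnj" by (simp add: field_hom_on_def)
    from rep[OF this] obtain \<pi> where \<pi>: "\<pi> \<in> galois_perms R" "\<pi> permutes embeddings R"
      "\<forall>\<sigma>\<in>embeddings R. \<pi> \<sigma> x0 = cnj (\<sigma> x0)" by blast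
    have in_E: "\<pi> s \<in> embeddings R" if "s \<in> embeddings R" for s using permutes_in_image[OF \<pi>(2)] that by simp
    have c: "cnj u1 = u1" "cnj u2 = u2" "cnj u3 = u4" "cnj u4 = u3" by (simp_all add: u1_u2_u3_u4_def)
    have ps: "\<pi> s1 = s1" "\<pi> s2 = s2" "\<pi> s3 = s4" "\<pi> s4 = s3"
      by (rule val; use in_E s_in \<pi>(3) v c in simp)+
    have "\<pi> = Transposition.transpose s3 s4"
    proof
      fix s show "\<pi> s = Transposition.transpose s3 s4 s"
      proof (cases "s \<in> embeddings R")
        case True
        then show ?thesis using ps sne unfolding E by (auto simp: transpose_def)
      next
        case False
        then show ?thesis using permutes_not_in[OF \<pi>(2)] s_in by (auto simp: transpose_def)
      qed
    qed
    then show ?thesis using \<pi>(1) by simp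
  qed
  define f where "f i = (if i = 1 then s1 else if i = 2 then s2 else if i = 3 then s3 else s4)" for i :: nat
  have "bij_betw f {1..4} (embeddings R)"
    unfolding E atLeast1_atMost_4 using sne by (auto simp: bij_betw_def inj_on_def f_def)
  then show ?thesis
    unfolding R_def[symmetric]
  proof (rule G_ringI)
    fix \<pi> assume "\<pi> permutes embeddings R"
    moreover have "\<rho> permutes embeddings R" if "\<rho> \<in> galois_perms R" for \<rho>
      using that unfolding galois_perms_def by blast
    ultimately show "\<pi> \<in> galois_perms R"
      using perms_of_four[OF E _ galois_perms_comp galois_perms_inv sne t34 \<pi>0 \<pi>1 \<pi>2] by blast
  qed
qed

end

text \<open>Estimating the reciprocal directly would call for a lower bound on the root. The cubic
  equation turns it into a polynomial in \<open>w\<close> over a coefficient, for which an upper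
  bound is enough.\<close>

lemma reciprocal_root_eq:
  fixes A B C D w :: complex
  assumes "w * (w * w) = 4 * A * B * B * C * C * D * w + A * B ^ 4 * C ^ 2" "w \<noteq> 0" "B \<noteq> 0" "C \<noteq> 0"
  shows "A * B * B * C / w = (w * w - 4 * A * B * B * C * C * D) / (B * B * C)"
proof -
  have "A * B * B * C * (B * B * C) = A * B ^ 4 * C ^ 2" by (simp add: eval_nat_numeral)
  also have "\<dots> = w * (w * w) - 4 * A * B * B * C * C * D * w" using assms(1) by simp
  also have "\<dots> = (w * w - 4 * A * B * B * C * C * D) * w" by (simp add: left_diff_distrib)
  finally have "A * B * B * C * (B * B * C) = (w * w - 4 * A * B * B * C * C * D) * w" .
  then show ?thesis using assms(2-4) by (subst frac_eq_eq) simp_all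
qed


section \<open>Sizes of the roots and minima of the family\<close>

lemma (in embedded_ring) succ_min_le_basis:
  assumes b: "int_basis R n b" and j: "j < n"
    and B: "\<And>i \<sigma>. i \<le> j \<Longrightarrow> \<sigma> \<in> embeddings R \<Longrightarrow> cmod (\<sigma> (b i)) \<le> B"
  shows "succ_min n R j \<le> B"
proof (rule succ_min_leI[OF j basis_independent(1)[OF b, of "j + 1"]])
  show "j + 1 \<le> n" using j by simp
  then show "card (b ` {..<j + 1}) = j + 1" by (rule basis_independent(2)[OF b])
  fix x assume "x \<in> b ` {..<j + 1}"
  then obtain i where "i \<le> j" "x = b i" by (auto simp: less_Suc_eq_le)
  then show "ring_length n R x \<le> B" using B by (auto intro: length_le)
qed

lemma inj_countable_infinite:
  "\<exists>e :: 'q :: countable \<Rightarrow> 'a :: infinite. inj e"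
proof -
  obtain f :: "nat \<Rightarrow> 'a" where "inj f" using infinite_countable_subset[OF infinite_UNIV] by blast
  then have "inj (f \<circ> to_nat :: 'q \<Rightarrow> 'a)" by (intro inj_compose) auto
  then show ?thesis by blast
qed

text \<open>For \<open>cmod u\<close> above \<open>2 * x\<close> each of the two lower terms is at
  most a quarter of the leading term.\<close>

lemma quartic_root_bound:
  fixes u P Q :: complex and x :: real
  assumes u: "u ^ 4 - P * u + Q = 0" and x: "x > 0" and PQ: "cmod P \<le> 2 * x ^ 3" "cmod Q \<le> 4 * x ^ 4"
  shows "cmod u \<le> 2 * x"
proof (rule ccontr)
  assume "\<not> cmod u \<le> 2 * x"
  define v where "v = cmod u"
  have v: "2 * x < v" using \<open>\<not> cmod u \<le> 2 * x\<close> by (simp add: v_def)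
  have "u ^ 4 = P * u - Q" using u by (simp add: algebra_simps)
  then have "v ^ 4 = cmod (P * u - Q)" by (simp add: v_def flip: norm_power)
  also have "\<dots> \<le> cmod P * v + cmod Q" unfolding v_def by (metis norm_mult norm_triangle_ineq4)
  also have "\<dots> \<le> 2 * x ^ 3 * v + 4 * x ^ 4"
    using PQ v x by (intro add_mono mult_right_mono) auto
  also have "\<dots> \<le> 2 * (v / 2) ^ 3 * v + 4 * (v / 2) ^ 4"
    using v x by (intro add_mono mult_right_mono mult_left_mono power_mono) auto
  also have "\<dots> = v ^ 4 / 2" by (simp add: eval_nat_numeral field_simps)
  finally have "v ^ 4 \<le> 0" by simp
  moreover have "v ^ 4 > 0" using v x by simp
  ultimately show False by simp
qed

text \<open>For \<open>cmod w\<close> above \<open>5 * y\<close> the lower terms reach at most 16/25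
  + 4/125 = 84/125 of the leading term.\<close>

lemma cubic_root_bound:
  fixes w P Q :: complex and y :: real
  assumes w: "w ^ 3 = P * w + Q" and y: "y > 0" and PQ: "cmod P \<le> 16 * y ^ 2" "cmod Q \<le> 4 * y ^ 3"
  shows "cmod w \<le> 5 * y"
proof (rule ccontr)
  assume "\<not> cmod w \<le> 5 * y"
  define v where "v = cmod w"
  have v: "5 * y < v" using \<open>\<not> cmod w \<le> 5 * y\<close> by (simp add: v_def)
  have "v ^ 3 = cmod (P * w + Q)" by (simp add: v_def flip: norm_power w)
  also have "\<dots> \<le> cmod P * v + cmod Q" unfolding v_def by (metis norm_mult norm_triangle_ineq)
  also have "\<dots> \<le> 16 * y ^ 2 * v + 4 * y ^ 3"
    using PQ v y by (intro add_mono mult_right_mono) auto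
  also have "\<dots> \<le> 16 * (v / 5) ^ 2 * v + 4 * (v / 5) ^ 3"
    using v y by (intro add_mono mult_right_mono mult_left_mono power_mono) auto
  also have "\<dots> = 84 / 125 * v ^ 3" by (simp add: eval_nat_numeral field_simps)
  finally have "v ^ 3 \<le> 0" by simp
  moreover have "v ^ 3 > 0" using v y by simp
  ultimately show False by simp
qed

lemma seven_pow_mod_6: "(7::int) ^ i mod 6 = 1"
proof -
  have "(7::int) ^ i mod 6 = (7 mod 6) ^ i mod 6" by (rule power_mod[symmetric])
  then show ?thesis by simp
qed

text \<open>The exponents in the bounds solve the system i = 2 p1 - q1, j = p1 + p3 - q2, k = 2 p2 -
  q2, l = 2 p3 - q1, and \<open>N\<close> is twice the sum of the p's and twice that of the q's. The
  three hypotheses say p1 \<le> p2, p2 \<le> p3 and q1 \<le> q2. The constant 21 covers the factors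
  2, 4, 5 for the quartic basis and 5, 41/2 for the cubic one.\<close>

theorem S4_family_minima:
  fixes i j k l :: nat
  assumes c1: "i + 2 * j \<le> l + 2 * k" and c2: "i + 2 * k \<le> l + 2 * j" and c3: "2 * j \<le> i + l"
  defines "N \<equiv> real (3 * i + 2 * j + 4 * k + 3 * l)"
  shows "\<exists>(R :: 'a :: infinite ring) (C :: 'b :: infinite ring).
    nondegenerate_ring 4 R \<and> cubic_resolvent R C \<and> G_ring 4 (sym_group 4) R \<and>
    7 powr N \<le> \<bar>real_of_int (disc 4 R)\<bar> \<and> \<bar>real_of_int (disc 4 R)\<bar> \<le> 5000 * 7 powr N \<and>
    succ_min 4 R 1 \<le> 21 * 7 powr (real (3 * i + l + 2 * j + 2 * k) / 4) \<and>
    succ_min 4 R 2 \<le> 21 * 7 powr (real (i + l + 2 * k) / 2) \<and>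
    succ_min 4 R 3 \<le> 21 * 7 powr (real (i + 3 * l + 2 * j + 2 * k) / 4) \<and>
    succ_min 3 C 1 \<le> 21 * 7 powr (real (i + l + 2 * j + 2 * k) / 2) \<and>
    succ_min 3 C 2 \<le> 21 * 7 powr (real (i + l + k))"
proof -
  define a b c d :: int where "a = 7 ^ i" "b = 7 ^ j" "c = 2 * 7 ^ k" "d = - (7 ^ l)"
  interpret S4_form_pair a b c d "7 ^ k"
  proof
    show "d mod 6 = 5" using seven_pow_mod_6[of l] unfolding a_b_c_d_def by presburger
  qed (simp_all add: a_b_c_d_def seven_pow_mod_6)
  have norms: "\<bar>real_of_int a\<bar> = 7 powr i" "\<bar>real_of_int b\<bar> = 7 powr j" "\<bar>real_of_int c\<bar> = 2 * 7 powr k" "\<bar>real_of_int d\<bar> = 7 powr l"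
    by (simp_all add: a_b_c_d_def powr_realpow)
  define p1 p2 p3 q1 q2 where "p1 = real (3 * i + l + 2 * j + 2 * k) / 4" "p2 = real (i + l + 2 * k) / 2"
    "p3 = real (i + 3 * l + 2 * j + 2 * k) / 4" "q1 = real (i + l + 2 * j + 2 * k) / 2" "q2 = real (i + l + k)"
  note pq = p1_p2_p3_q1_q2_def
  have nn: "0 \<le> real i" "0 \<le> real j" "0 \<le> real k" "0 \<le> real l" by simp_all
  have pq4: "4 * p1 = 3 * real i + real l + 2 * real j + 2 * real k" "2 * p2 = real i + real l + 2 * real k"
    "4 * p3 = real i + 3 * real l + 2 * real j + 2 * real k" "2 * q1 = real i + real l + 2 * real j + 2 * real k"
    "q2 = real i + real l + real k" by (simp_all add: pq)
  have ord: "0 \<le> p1" "p1 \<le> p2" "p2 \<le> p3" "0 \<le> q1" "q1 \<le> q2"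
    using nn of_nat_mono[OF c1, where ?'a = real] of_nat_mono[OF c2, where ?'a = real] of_nat_mono[OF c3, where ?'a = real]
    pq4 unfolding of_nat_add of_nat_mult of_nat_numeral by - linarith+
  have ex: "real (3 * i + 2 * j + 2 * k + l) = 4 * p1" "real (i + 2 * j + 2 * k + l) = 2 * q1"
    "p1 + p1 - real (i + j) = p2" "p1 + p2 - real (i + k) = p3" "q1 + q1 - real (j + j + k) = q2"
    using pq4 unfolding of_nat_add of_nat_mult of_nat_numeral by - linarith+
  have exle: "real (2 * i + 2 * j + k) \<le> 3 * p1" "real j \<le> p3" "real (i + 4 * j + 2 * k) \<le> 3 * q1"
    using nn of_nat_mono[OF c1, where ?'a = real] of_nat_mono[OF c2, where ?'a = real] of_nat_mono[OF c3, where ?'a = real]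
    pq4 unfolding of_nat_add of_nat_mult of_nat_numeral by - linarith+
  have ge1: "1 \<le> 7 powr t" if "0 \<le> t" for t :: real using that by (simp add: ge_one_powr_ge_zero)
  have mono: "7 powr s \<le> 7 powr t" if "s \<le> t" for s t :: real using that by simp
  have pw: "(7 powr t) ^ m = 7 powr (real m * t)" for t :: real and m
    by (simp add: powr_realpow[symmetric] powr_powr mult.commute)
  note normP = norm_mult norm_divide norms
  have P: "cmod P \<le> 2 * (7 powr p1) ^ 3"
  proof -
    have "cmod P = 2 * 7 powr real (2 * i + 2 * j + k)" by (simp add: P_def normP powr_add algebra_simps flip: powr_add)
    also have "\<dots> \<le> 2 * 7 powr (3 * p1)" by (intro mult_left_mono mono exle) simp
    finally show ?thesis by (simp add: pw)
  qed
  have Q: "cmod Q \<le> 4 * (7 powr p1) ^ 4"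
  proof -
    have "cmod Q = 4 * 7 powr real (3 * i + 2 * j + 2 * k + l)" by (simp add: Q_def normP powr_add algebra_simps flip: powr_add)
    also have "\<dots> = 4 * 7 powr (4 * p1)" by (simp only: ex)
    finally show ?thesis by (simp add: pw)
  qed
  have ub: "cmod u \<le> 2 * 7 powr p1" if "q_root u" for u
    by (rule quartic_root_bound[OF _ _ P Q]) (use that in \<open>auto simp: q_root_def\<close>)
  have vb: "cmod (u * u / (of_int a * of_int b)) \<le> 4 * 7 powr p2" if u: "q_root u" for u
  proof -
    have "cmod u * cmod u \<le> (2 * 7 powr p1) * (2 * 7 powr p1)" using ub[OF u] by (intro mult_mono) auto
    then have "cmod (u * u / (of_int a * of_int b)) \<le> (2 * 7 powr p1) * (2 * 7 powr p1) / (7 powr i * 7 powr j)"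
      by (simp add: normP divide_right_mono)
    also have "\<dots> = 4 * 7 powr (p1 + p1 - real (i + j))" unfolding powr_diff powr_add of_nat_add by simp
    also note ex(3)
    finally show ?thesis .
  qed
  \<comment> \<open>By the quartic equation the reciprocal equals \<open>b - u v / (a c)\<close>, so
    that upper bounds on u and v suffice.\<close>
  have wb: "cmod (of_int a * of_int b * of_int c * of_int d / u) \<le> 5 * 7 powr p3" if u: "q_root u" for u
  proof -
    let ?v = "u * u / (of_int a * of_int b)"
    have u0: "u \<noteq> 0" by (rule q_root_nz[OF u])
    have "u * (u * (u * u)) = P * u - Q" using u by (simp add: q_root_def eval_nat_numeral algebra_simps)
    then have "of_int a * of_int b * of_int c * of_int d / u = of_int b - u * ?v / (of_int a * of_int c)"
      using nzc u0 by (simp add: P_def Q_def field_simps)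
    then have "cmod (of_int a * of_int b * of_int c * of_int d / u) \<le> cmod (of_int b) + cmod (u * ?v / (of_int a * of_int c))"
      by (simp only: norm_triangle_ineq4)
    also have "cmod (u * ?v / (of_int a * of_int c)) = cmod u * cmod ?v / (7 powr i * (2 * 7 powr k))"
      by (simp add: normP)
    also have "\<dots> \<le> (2 * 7 powr p1) * (4 * 7 powr p2) / (7 powr i * (2 * 7 powr k))"
      using ub[OF u] vb[OF u] by (intro divide_right_mono mult_mono) auto
    also have "\<dots> = 4 * 7 powr (p1 + p2 - real (i + k))" unfolding powr_diff powr_add of_nat_add by simp
    also note ex(4)
    also have "cmod (of_int b) \<le> 7 powr p3" unfolding norm_of_int norms by (intro mono exle)
    finally show ?thesis by simp
  qed
  have w: "cmod w \<le> 5 * 7 powr q1" if "c_root w" for w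
  proof (rule cubic_root_bound)
    show "w ^ 3 = (4 * of_int a * of_int b * of_int b * of_int c * of_int c * of_int d) * w + of_int a * of_int b ^ 4 * of_int c ^ 2"
      using that by (simp add: c_root_def)
    have "cmod (4 * of_int a * of_int b * of_int b * of_int c * of_int c * of_int d) = 16 * 7 powr real (i + 2 * j + 2 * k + l)"
      by (simp add: normP powr_add algebra_simps flip: powr_add)
    also have "\<dots> = 16 * 7 powr (2 * q1)" by (simp only: ex)
    finally show "cmod (4 * of_int a * of_int b * of_int b * of_int c * of_int c * of_int d) \<le> 16 * (7 powr q1) ^ 2"
      by (simp add: pw)
    have "cmod (of_int a * of_int b ^ 4 * of_int c ^ 2) = 4 * 7 powr real (i + 4 * j + 2 * k)"
      by (simp add: normP norm_power power_mult_distrib pw flip: powr_add)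
    also have "\<dots> \<le> 4 * 7 powr (3 * q1)" by (intro mult_left_mono mono exle) simp
    finally show "cmod (of_int a * of_int b ^ 4 * of_int c ^ 2) \<le> 4 * (7 powr q1) ^ 3" by (simp add: pw)
  qed simp
  have tb: "cmod (of_int a * of_int b * of_int b * of_int c / w) \<le> 21 * 7 powr q2" if cw: "c_root w" for w
  proof -
    have w0: "w \<noteq> 0" by (rule c_root_nz[OF cw])
    have "w * (w * w) = 4 * of_int a * of_int b * of_int b * of_int c * of_int c * of_int d * w + of_int a * of_int b ^ 4 * of_int c ^ 2"
      using cw by (simp add: c_root_def power3_eq_cube algebra_simps)
    then have "of_int a * of_int b * of_int b * of_int c / w =
        (w * w - 4 * of_int a * of_int b * of_int b * of_int c * of_int c * of_int d) / (of_int b * of_int b * of_int c)"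
      by (rule reciprocal_root_eq) (use nzc w0 in simp_all)
    also have "cmod \<dots> \<le> (cmod w * cmod w + 16 * 7 powr real (i + 2 * j + 2 * k + l)) / (7 powr j * 7 powr j * (2 * 7 powr k))"
    proof -
      have "cmod (w * w - 4 * of_int a * of_int b * of_int b * of_int c * of_int c * of_int d)
          \<le> cmod (w * w) + cmod (4 * of_int a * of_int b * of_int b * of_int c * of_int c * of_int d)"
        by (rule norm_triangle_ineq4)
      also have "\<dots> = cmod w * cmod w + 16 * 7 powr real (i + 2 * j + 2 * k + l)"
        by (simp add: normP powr_add algebra_simps flip: powr_add)
      finally show ?thesis by (simp add: norm_divide norm_mult norms divide_right_mono)
    qed
    also have "\<dots> \<le> ((5 * 7 powr q1) * (5 * 7 powr q1) + 16 * 7 powr (q1 + q1)) / (7 powr j * 7 powr j * (2 * 7 powr k))"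
      unfolding ex using w[OF cw] by (intro divide_right_mono add_mono mult_mono) simp_all
    also have "\<dots> = 41 / 2 * 7 powr (q1 + q1 - real (j + j + k))"
      unfolding powr_diff powr_add of_nat_add by (simp add: field_simps)
    also note ex(5)
    finally show ?thesis by (rule order_trans) simp
  qed
  obtain e :: "int \<times> int \<times> int \<times> int \<Rightarrow> 'a" where e: "inj e" using inj_countable_infinite by blast
  obtain e' :: "int \<times> int \<times> int \<Rightarrow> 'b" where e': "inj e'" using inj_countable_infinite by blast
  obtain r1 r2 u where u: "Im u \<noteq> 0" "r1 \<noteq> r2"
    and es: "of_real r1 + of_real r2 + u + cnj u = 0"
    "of_real r1 * of_real r2 + of_real r1 * u + of_real r1 * cnj u + of_real r2 * u + of_real r2 * cnj u + u * cnj u = 0"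
    "of_real r1 * of_real r2 * u + of_real r1 * of_real r2 * cnj u + of_real r1 * u * cnj u + of_real r2 * u * cnj u = P"
    "of_real r1 * of_real r2 * u * cnj u = Q"
    by (rule real_roots)
  have ne: "complex_of_real r1 \<noteq> of_real r2" "of_real r1 \<noteq> u" "of_real r1 \<noteq> cnj u" "of_real r2 \<noteq> u" "of_real r2 \<noteq> cnj u" "u \<noteq> cnj u"
    using u by (auto simp: complex_eq_iff)
  note pair = cubic_resolvent_pair[OF es ne e e']
  interpret Rr: embedded_ring "Q_ring e" 4 by (rule pair(1))
  interpret Cr: embedded_ring "C_ring e'" 3 by (rule pair(2))
  have basis_bound: "cmod (\<sigma> (e (unit4 m))) \<le> (if m = 0 then 1 else if m = 1 then 2 * 7 powr p1 else if m = 2 then 4 * 7 powr p2 else 5 * 7 powr p3)"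
    if \<sigma>: "\<sigma> \<in> embeddings (Q_ring e)" for \<sigma> m
  proof -
    obtain z where z: "q_root z" "\<sigma> = q_emb e z" using \<sigma> by (auto simp: Q_embeddings[OF e])
    show ?thesis using ub[OF z(1)] vb[OF z(1)] wb[OF z(1)] unfolding z(2) by (simp add: unit4_def q_emb_apply[OF e])
  qed
  have cbasis_bound: "cmod (\<sigma> (e' (unit3 m))) \<le> (if m = 0 then 1 else if m = 1 then 5 * 7 powr q1 else 21 * 7 powr q2)"
    if \<sigma>: "\<sigma> \<in> embeddings (C_ring e')" for \<sigma> m
  proof -
    obtain z where z: "c_root z" "\<sigma> = c_emb e' z" using \<sigma> by (auto simp: C_embeddings[OF e'])
    show ?thesis using w[OF z(1)] tb[OF z(1)] unfolding z(2) by (simp add: unit3_def c_emb_apply[OF e'])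
  qed
  have chain: "1 \<le> 7 powr p1" "7 powr p1 \<le> 7 powr p2" "7 powr p2 \<le> 7 powr p3" "1 \<le> 7 powr q1" "7 powr q1 \<le> 7 powr q2"
    using ord ge1 mono by auto
  have m1: "succ_min 4 (Q_ring e) 1 \<le> 21 * 7 powr p1"
    by (rule Rr.succ_min_le_basis[OF Q_basis[OF e]], simp, rule order_trans[OF basis_bound]) (use chain in \<open>auto simp del: powr_le_cancel_iff\<close>)
  have m2: "succ_min 4 (Q_ring e) 2 \<le> 21 * 7 powr p2"
    by (rule Rr.succ_min_le_basis[OF Q_basis[OF e]], simp, rule order_trans[OF basis_bound]) (use chain in \<open>auto simp del: powr_le_cancel_iff\<close>)
  have m3: "succ_min 4 (Q_ring e) 3 \<le> 21 * 7 powr p3"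
    by (rule Rr.succ_min_le_basis[OF Q_basis[OF e]], simp, rule order_trans[OF basis_bound]) (use chain in \<open>auto simp del: powr_le_cancel_iff\<close>)
  have m4: "succ_min 3 (C_ring e') 1 \<le> 21 * 7 powr q1"
    by (rule Cr.succ_min_le_basis[OF C_basis[OF e']], simp, rule order_trans[OF cbasis_bound]) (use chain in \<open>auto simp del: powr_le_cancel_iff\<close>)
  have m5: "succ_min 3 (C_ring e') 2 \<le> 21 * 7 powr q2"
    by (rule Cr.succ_min_le_basis[OF C_basis[OF e']], simp, rule order_trans[OF cbasis_bound]) (use chain in \<open>auto simp del: powr_le_cancel_iff\<close>)
  have "card {u. q_root u} = 4" using roots_of_quartic(1)[OF es] ne by simp
  then have disc: "disc 4 (Q_ring e) = a * a * b * b * c * c * (256 * a * c * c * d ^ 3 - 27 * b * b)"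
    by (rule Q_disc[OF e])
  have expand: "A * A * B * B * (2 * C) * (2 * C) * (256 * A * (2 * C) * (2 * C) * (- L) ^ 3 - 27 * B * B) =
      - (4 * (A * A * B * B * C * C) * (1024 * (A * C * C * L ^ 3) + 27 * (B * B)))" for A B C L :: int
  proof -
    have L: "(- L) ^ 3 = - (L ^ 3)" by simp
    show ?thesis unfolding L by (simp add: algebra_simps)
  qed
  have "(7 ^ l) ^ 3 = (7::int) ^ (3 * l)" by (simp add: power_mult[symmetric] mult.commute)
  then have "a * a * b * b * c * c * (256 * a * c * c * d ^ 3 - 27 * b * b) =
      - (4 * (7 ^ (i + i + j + j + k + k)) * (1024 * 7 ^ (i + k + k + 3 * l) + 27 * 7 ^ (j + j)))"
    unfolding a_b_c_d_def expand power_add by simp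
  then have dsc: "disc 4 (Q_ring e) = - (4 * (7 ^ (i + i + j + j + k + k)) * (1024 * 7 ^ (i + k + k + 3 * l) + 27 * 7 ^ (j + j)))"
    using disc by simp
  have ex': "3 * i + 2 * j + 4 * k + 3 * l = (i + i + j + j + k + k) + (i + k + k + 3 * l)" by simp
  have "\<bar>real_of_int (disc 4 (Q_ring e))\<bar> = 4 * (7 ^ (i + i + j + j + k + k)) * (1024 * 7 ^ (i + k + k + 3 * l) + 27 * 7 ^ (j + j))"
    unfolding dsc by simp
  also have "\<dots> = 4096 * 7 ^ (3 * i + 2 * j + 4 * k + 3 * l) + 108 * (7 ^ (i + i + j + j + k + k) * 7 ^ (j + j))"
    unfolding ex' power_add[of _ "i + i + j + j + k + k" "i + k + k + 3 * l"] by (simp only: ring_distribs)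
  finally have D: "\<bar>real_of_int (disc 4 (Q_ring e))\<bar> = 4096 * 7 ^ (3 * i + 2 * j + 4 * k + 3 * l) + 108 * 7 ^ (i + i + j + j + k + k + (j + j))"
    by (simp add: power_add)
  have "(7::real) ^ (i + i + j + j + k + k + (j + j)) \<le> 7 ^ (3 * i + 2 * j + 4 * k + 3 * l)"
    by (rule power_increasing) (use c1 c2 c3 in auto)
  note le = this
  have N: "7 powr N = 7 ^ (3 * i + 2 * j + 4 * k + 3 * l)" unfolding N_def by (rule powr_realpow) simp
  have nn: "0 \<le> 108 * (7::real) ^ (i + i + j + j + k + k + (j + j))" "0 \<le> (7::real) ^ (3 * i + 2 * j + 4 * k + 3 * l)" by simp_all
  \<comment> \<open>5000 exceeds 4096 + 108, the constants of the two terms of the discriminant; the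
    exponent of the second term is at most that of the first.\<close>
  have Dle: "\<bar>real_of_int (disc 4 (Q_ring e))\<bar> \<le> 5000 * 7 powr N" using le nn unfolding D N by linarith
  have Dge: "7 powr N \<le> \<bar>real_of_int (disc 4 (Q_ring e))\<bar>" using nn unfolding D N by linarith
  have nd: "nondegenerate_ring 4 (Q_ring e)"
    unfolding nondegenerate_ring_def rank_ring_def using Q_cring[OF e] Q_basis[OF e] Rr.disc_nonzero by blast
  show ?thesis
    using nd pair(3) Q_ring_S4[OF e] Dge Dle m1 m2 m3 m4 m5 unfolding pq by blast
qed

section \<open>Limit points\<close>

lemma succ_min_finite:
  "\<exists>F. finite F \<and> (\<forall>(R :: ('a, 'm) ring_scheme) i. embedded_ring R n \<longrightarrow> i < n \<longrightarrow> succ_min n R i \<le> B \<longrightarrow> succ_min n R i \<in> F)"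
proof -
  obtain F where F: "finite F" "\<And>(R :: ('a, 'm) ring_scheme) x. embedded_ring R n \<Longrightarrow> x \<in> carrier R \<Longrightarrow>
    ring_length n R x \<le> B \<Longrightarrow> ring_length n R x \<in> F"
    using finite_ring_lengths[of n B, where ?'a = 'a and ?'m = 'm] by blast
  have "succ_min n R i \<in> F" if "embedded_ring R n" "i < n" "succ_min n R i \<le> B" for R :: "('a, 'm) ring_scheme" and i
    using embedded_ring.succ_min_length[OF that(1,2)] F(2)[OF that(1)] that(3) by metis
  then show ?thesis using F(1) by blast
qed

definition log_point :: "real \<Rightarrow> real \<times> real \<times> real \<times> real \<times> real \<Rightarrow> real \<times> real \<times> real \<times> real \<times> real" where
  "log_point D = (\<lambda>(l1, l2, l3, m1, m2). (log D l1, log D l2, log D l3, log D m1, log D m2))"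

definition S4_points :: "'a itself \<Rightarrow> 'b itself \<Rightarrow> (real \<times> real \<times> real \<times> real \<times> real) set" where
  "S4_points _ _ = {minima_point R C | (R :: 'a ring) (C :: 'b ring).
     nondegenerate_ring 4 R \<and> cubic_resolvent R C \<and> G_ring 4 (sym_group 4) R}"

lemma minima_point_log_point:
  "minima_point R C = log_point \<bar>real_of_int (disc 4 R)\<bar>
     (succ_min 4 R 1, succ_min 4 R 2, succ_min 4 R 3, succ_min 3 C 1, succ_min 3 C 2)"
  by (simp add: minima_point_def log_point_def Let_def)

text \<open>Every minimum is at least \<open>1 / K\<close>, so the bound on a product of minima
  bounds its largest factor.\<close>

lemma minima_bounds_upper:
  assumes K: "1 \<le> K" and b: "minima_bounds K D (l1, l2, l3, m1, m2)" and D: "D \<le> Y"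
  shows "l1 \<le> K ^ 3 * sqrt Y" "l2 \<le> K ^ 3 * sqrt Y" "l3 \<le> K ^ 3 * sqrt Y" "m1 \<le> K ^ 3 * sqrt Y" "m2 \<le> K ^ 3 * sqrt Y"
proof -
  have b': "1 \<le> K * l1" "l1 \<le> l2" "l2 \<le> l3" "l1 * l2 * l3 \<le> K * sqrt D" "1 \<le> K * m1" "m1 \<le> m2" "m1 * m2 \<le> K * sqrt D" "1 \<le> D"
    using b by (simp_all add: minima_bounds_def)
  have pos: "0 < l1" "0 < m1" using b'(1,5) K by (auto intro: zero_less_mult_pos[of K] less_le_trans[OF zero_less_one])
  have sq: "sqrt D \<le> sqrt Y" using D by simp
  have "1 \<le> K * l2" using b'(1,2) K by (meson mult_left_mono order_trans zero_le_one)
  have "l3 = 1 * 1 * l3" by simp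
  also have "\<dots> \<le> (K * l1) * (K * l2) * l3"
    using b' pos \<open>1 \<le> K * l2\<close> by (intro mult_mono) auto
  also have "\<dots> = K ^ 2 * (l1 * l2 * l3)" by (simp add: power2_eq_square)
  also have "\<dots> \<le> K ^ 2 * (K * sqrt Y)" using b'(4) sq K by (intro mult_left_mono order_trans[OF b'(4)]) auto
  finally have l3: "l3 \<le> K ^ 3 * sqrt Y" by (simp add: eval_nat_numeral)
  have "m2 = 1 * m2" by simp
  also have "\<dots> \<le> (K * m1) * m2" using b' pos by (intro mult_mono) auto
  also have "\<dots> = K * (m1 * m2)" by simp
  also have "\<dots> \<le> K * (K * sqrt Y)" using sq K by (intro mult_left_mono order_trans[OF b'(7)]) auto
  also have "\<dots> = K ^ 2 * sqrt Y" by (simp add: power2_eq_square)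
  also have "\<dots> \<le> K ^ 3 * sqrt Y" using K b'(8) D by (intro mult_right_mono power_increasing) auto
  finally have m2: "m2 \<le> K ^ 3 * sqrt Y" .
  show "l1 \<le> K ^ 3 * sqrt Y" "l2 \<le> K ^ 3 * sqrt Y" "l3 \<le> K ^ 3 * sqrt Y" "m1 \<le> K ^ 3 * sqrt Y" "m2 \<le> K ^ 3 * sqrt Y"
    using l3 m2 b' by auto
qed

text \<open>A point may come from many pairs; one is fixed for each point, and \<open>D\<close> and
  \<open>v\<close> give its discriminant and minima. When the discriminant is bounded, it is one of
  finitely many integers, and the minima are bounded and hence lie in finite sets of
  lengths.\<close>

lemma S4_points_structure:
  obtains K D v where "1 \<le> K"
    "\<And>p. p \<in> S4_points TYPE('a) TYPE('b) \<Longrightarrow> minima_bounds K (D p) (v p)"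
    "\<And>p. p \<in> S4_points TYPE('a) TYPE('b) \<Longrightarrow> p = log_point (D p) (v p)"
    "\<And>Y. finite {p \<in> S4_points TYPE('a) TYPE('b). D p \<le> Y}"
proof -
  let ?S = "S4_points TYPE('a) TYPE('b)"
  obtain K where K: "K \<ge> 1" and Kb: "\<And>(R :: 'a ring) (C :: 'b ring).
    nondegenerate_ring 4 R \<Longrightarrow> cubic_resolvent R C \<Longrightarrow> G_ring 4 (sym_group 4) R \<Longrightarrow>
    minima_bounds K \<bar>real_of_int (disc 4 R)\<bar>
      (succ_min 4 R 1, succ_min 4 R 2, succ_min 4 R 3, succ_min 3 C 1, succ_min 3 C 2)"
    using S4_pair_minima_bounds[where ?'a = 'a and ?'b = 'b and ?'m = unit and ?'k = unit] by blast
  have "\<exists>(R :: 'a ring) (C :: 'b ring). p = minima_point R C \<and> nondegenerate_ring 4 R \<and> cubic_resolvent R C \<and> G_ring 4 (sym_group 4) R"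
    if "p \<in> ?S" for p using that by (auto simp: S4_points_def)
  then obtain R C where RC: "\<And>p. p \<in> ?S \<Longrightarrow> p = minima_point (R p :: 'a ring) (C p :: 'b ring)"
    "\<And>p. p \<in> ?S \<Longrightarrow> nondegenerate_ring 4 (R p)" "\<And>p. p \<in> ?S \<Longrightarrow> cubic_resolvent (R p) (C p)"
    "\<And>p. p \<in> ?S \<Longrightarrow> G_ring 4 (sym_group 4) (R p)" by metis
  define D where "D p = \<bar>real_of_int (disc 4 (R p))\<bar>" for p
  define v where "v p = (succ_min 4 (R p) 1, succ_min 4 (R p) 2, succ_min 4 (R p) 3, succ_min 3 (C p) 1, succ_min 3 (C p) 2)" for p
  have b: "minima_bounds K (D p) (v p)" if "p \<in> ?S" for p
    unfolding D_def v_def by (rule Kb[OF RC(2-4)[OF that]])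
  have lp: "p = log_point (D p) (v p)" if "p \<in> ?S" for p
    using RC(1)[OF that] unfolding D_def v_def minima_point_log_point .
  have fin: "finite {p \<in> ?S. D p \<le> Y}" for Y
  proof -
    let ?B = "K ^ 3 * sqrt Y"
    obtain F1 where F1: "finite F1" "\<And>(R :: 'a ring) i. embedded_ring R 4 \<Longrightarrow> i < 4 \<Longrightarrow> succ_min 4 R i \<le> ?B \<Longrightarrow> succ_min 4 R i \<in> F1"
      using succ_min_finite[of 4 ?B, where ?'a = 'a and ?'m = unit] by blast
    obtain F2 where F2: "finite F2" "\<And>(R :: 'b ring) i. embedded_ring R 3 \<Longrightarrow> i < 3 \<Longrightarrow> succ_min 3 R i \<le> ?B \<Longrightarrow> succ_min 3 R i \<in> F2"
      using succ_min_finite[of 3 ?B, where ?'a = 'b and ?'m = unit] by blast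
    have "{p \<in> ?S. D p \<le> Y} \<subseteq> (\<lambda>(D, v). log_point D v) ` ((real_of_int ` {0..\<lfloor>Y\<rfloor>}) \<times> (F1 \<times> F1 \<times> F1 \<times> F2 \<times> F2))"
    proof
      fix p assume "p \<in> {p \<in> ?S. D p \<le> Y}"
      then have p: "p \<in> ?S" "D p \<le> Y" by simp_all
      note up = minima_bounds_upper[OF K b[OF p(1), unfolded v_def] p(2)]
      note emb = S4_pair_embedded[OF RC(2-4)[OF p(1)]]
      have "v p \<in> F1 \<times> F1 \<times> F1 \<times> F2 \<times> F2"
        unfolding v_def using F1(2)[OF emb(1) _ up(1)] F1(2)[OF emb(1) _ up(2)] F1(2)[OF emb(1) _ up(3)]
          F2(2)[OF emb(2) _ up(4)] F2(2)[OF emb(2) _ up(5)] by (simp del: One_nat_def)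
      moreover have "D p \<in> real_of_int ` {0..\<lfloor>Y\<rfloor>}"
        using p(2) unfolding D_def by (intro image_eqI[of _ _ "\<bar>disc 4 (R p)\<bar>"]) (auto simp: le_floor_iff)
      ultimately have "(D p, v p) \<in> (real_of_int ` {0..\<lfloor>Y\<rfloor>}) \<times> (F1 \<times> F1 \<times> F1 \<times> F2 \<times> F2)" by (rule SigmaI[rotated])
      moreover have "p = (\<lambda>(D, v). log_point D v) (D p, v p)" using lp[OF p(1)] by simp
      ultimately show "p \<in> (\<lambda>(D, v). log_point D v) ` ((real_of_int ` {0..\<lfloor>Y\<rfloor>}) \<times> (F1 \<times> F1 \<times> F1 \<times> F2 \<times> F2))"
        by (rule rev_image_eqI)
    qed
    then show ?thesis by (rule finite_subset) (use F1(1) F2(1) in auto)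
  qed
  show thesis by (rule that[OF K b lp fin])
qed

text \<open>Only finitely many points have bounded \<open>D\<close>, so an error of order \<open>1 / ln D\<close> disappears in the limit.\<close>

lemma limit_point_le:
  fixes S :: "'x :: t1_space set" and f :: "'x \<Rightarrow> real" and D :: "'x \<Rightarrow> real"
  assumes p: "p islimpt S" and f: "continuous_on UNIV f"
    and fin: "\<And>Y. finite {x \<in> S. D x \<le> Y}"
    and bound: "\<And>x. x \<in> S \<Longrightarrow> 1 < D x \<Longrightarrow> f x * ln (D x) \<le> c * ln (D x) + M"
  shows "f p \<le> c"
proof (rule ccontr)
  assume "\<not> f p \<le> c"
  define \<epsilon> where "\<epsilon> = (f p - c) / 2"
  have \<epsilon>: "\<epsilon> > 0" "c + \<epsilon> < f p" using \<open>\<not> f p \<le> c\<close> by (simp_all add: \<epsilon>_def field_simps)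
  define U where "U = {x. c + \<epsilon> < f x}"
  have "open U" unfolding U_def by (rule open_Collect_less) (use f in \<open>auto intro: continuous_intros\<close>)
  moreover have "p \<in> U" using \<epsilon> by (simp add: U_def)
  ultimately have inf: "infinite (U \<inter> S)" using p islimpt_eq_acc_point by blast
  define Y where "Y = max 1 (exp (M / \<epsilon>))"
  have "U \<inter> S \<subseteq> {x \<in> S. D x \<le> Y}"
  proof
    fix x assume x: "x \<in> U \<inter> S"
    show "x \<in> {x \<in> S. D x \<le> Y}"
    proof (cases "1 < D x")
      case True
      have "(c + \<epsilon>) * ln (D x) \<le> f x * ln (D x)" using x True by (intro mult_right_mono) (auto simp: U_def)
      then have "\<epsilon> * ln (D x) \<le> M" using bound[of x] x True by (simp add: algebra_simps)
      then have "ln (D x) \<le> M / \<epsilon>" using \<epsilon> by (simp add: pos_le_divide_eq mult.commute)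
      then have "exp (ln (D x)) \<le> exp (M / \<epsilon>)" by simp
      then have "D x \<le> exp (M / \<epsilon>)" using True by simp
      then show ?thesis using x by (simp add: Y_def)
    qed (use x in \<open>auto simp: Y_def\<close>)
  qed
  then show False using inf fin[of Y] finite_subset by blast
qed

section \<open>Limit points satisfy the inequalities\<close>

lemma ln_le_mult:
  assumes "x \<le> K * y" "0 < x" "0 < K" "0 < y"
  shows "ln x \<le> ln K + ln (y :: real)"
  using assms ln_mono[of x "K * y"] by (simp add: ln_mult)

text \<open>Logarithms of \<open>minima_bounds\<close> give each linear inequality multiplied by
  \<open>ln D\<close>, up to an error \<open>ln K\<close>, as \<open>limit_point_le\<close> demands.
  An equation is treated as two inequalities.\<close>

lemma limit_points_in_polytope:
  assumes "(p1, p2, p3, q1, q2) islimpt S4_points TYPE('a) TYPE('b)"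
  shows "0 \<le> p1 \<and> p1 \<le> p2 \<and> p2 \<le> p3 \<and> p1 + p2 + p3 = 1 / 2 \<and>
       0 \<le> q1 \<and> q1 \<le> q2 \<and> q1 + q2 = 1 / 2 \<and> q2 \<le> p1 + p3 \<and> q1 \<le> 2 * p1 \<and> q2 \<le> 2 * p2"
proof -
  let ?S = "S4_points TYPE('a) TYPE('b)"
  obtain K D v where K: "1 \<le> K" and bnd: "\<And>p. p \<in> ?S \<Longrightarrow> minima_bounds K (D p) (v p)"
    and lp: "\<And>p. p \<in> ?S \<Longrightarrow> p = log_point (D p) (v p)" and finD: "\<And>Y. finite {p \<in> ?S. D p \<le> Y}"
    by (rule S4_points_structure[where ?'a = 'a and ?'b = 'b]) (rule that)
  define k where "k = ln K"
  have ineqs: "- x1 * L \<le> k \<and> (x1 - x2) * L \<le> 0 \<and> (x2 - x3) * L \<le> 0 \<and> (x1 + x2 + x3) * L \<le> L / 2 + k \<and> - (x1 + x2 + x3) * L \<le> - L / 2 + k \<and>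
    - y1 * L \<le> k \<and> (y1 - y2) * L \<le> 0 \<and> (y1 + y2) * L \<le> L / 2 + k \<and> - (y1 + y2) * L \<le> - L / 2 + k \<and>
    (y2 - x1 - x3) * L \<le> k \<and> (y1 - 2 * x1) * L \<le> k \<and> (y2 - 2 * x2) * L \<le> k"
    if x: "(x1, x2, x3, y1, y2) \<in> ?S" "1 < D (x1, x2, x3, y1, y2)" "L = ln (D (x1, x2, x3, y1, y2))" for x1 x2 x3 y1 y2 L
  proof -
    obtain l1 l2 l3 m1 m2 where vv: "v (x1, x2, x3, y1, y2) = (l1, l2, l3, m1, m2)" by (metis prod_cases5)
    define E where "E = D (x1, x2, x3, y1, y2)"
    have E1: "1 < E" and LE: "L = ln E" using x by (simp_all add: E_def)
    have L0: "0 < L" using E1 by (simp add: LE)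
    have b: "1 \<le> K * l1" "l1 \<le> l2" "l2 \<le> l3" "sqrt E \<le> K * (l1 * l2 * l3)" "l1 * l2 * l3 \<le> K * sqrt E"
      "1 \<le> K * m1" "m1 \<le> m2" "sqrt E \<le> K * (m1 * m2)" "m1 * m2 \<le> K * sqrt E"
      "m2 \<le> K * (l1 * l3)" "m1 \<le> K * (l1 * l1)" "m2 \<le> K * (l2 * l2)"
      using bnd[OF x(1)] unfolding vv E_def[symmetric] by (simp_all add: minima_bounds_def)
    have logs: "x1 = log E l1" "x2 = log E l2" "x3 = log E l3" "y1 = log E m1" "y2 = log E m2"
      using lp[OF x(1)] unfolding vv E_def[symmetric] by (simp_all add: log_point_def)
    have xs: "x1 * L = ln l1" "x2 * L = ln l2" "x3 * L = ln l3" "y1 * L = ln m1" "y2 * L = ln m2"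
      unfolding logs log_def LE using E1 by simp_all
    have K0: "0 < K" using K by simp
    have pos: "0 < l1" "0 < m1" using b(1,6) K by (auto intro: zero_less_mult_pos[of K] less_le_trans[OF zero_less_one])
    then have pos': "0 < l2" "0 < l3" "0 < m2" using b by auto
    have sq: "ln (sqrt E) = L / 2" "0 < sqrt E" using E1 by (simp_all add: LE ln_sqrt)
    have "- ln l1 \<le> k" using ln_le_mult[OF b(1)] pos K0 by (simp add: k_def)
    moreover have "- ln m1 \<le> k" using ln_le_mult[OF b(6)] pos K0 by (simp add: k_def)
    moreover have "ln l1 \<le> ln l2" "ln l2 \<le> ln l3" "ln m1 \<le> ln m2" using b pos pos' by simp_all
    moreover have "L / 2 \<le> k + (ln l1 + ln l2 + ln l3)"
      using ln_le_mult[OF b(4)] pos pos' K0 sq by (simp add: k_def ln_mult)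
    moreover have "ln l1 + ln l2 + ln l3 \<le> k + L / 2"
      using ln_le_mult[OF b(5)] pos pos' K0 sq by (simp add: k_def ln_mult)
    moreover have "L / 2 \<le> k + (ln m1 + ln m2)"
      using ln_le_mult[OF b(8)] pos pos' K0 sq by (simp add: k_def ln_mult)
    moreover have "ln m1 + ln m2 \<le> k + L / 2"
      using ln_le_mult[OF b(9)] pos pos' K0 sq by (simp add: k_def ln_mult)
    moreover have "ln m2 \<le> k + (ln l1 + ln l3)"
      using ln_le_mult[OF b(10)] pos pos' K0 by (simp add: k_def ln_mult)
    moreover have "ln m1 \<le> k + (ln l1 + ln l1)"
      using ln_le_mult[OF b(11)] pos pos' K0 by (simp add: k_def ln_mult)
    moreover have "ln m2 \<le> k + (ln l2 + ln l2)"
      using ln_le_mult[OF b(12)] pos pos' K0 by (simp add: k_def ln_mult)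
    ultimately show ?thesis
      unfolding left_diff_distrib distrib_right mult_minus_left mult.assoc xs minus_add_distrib by auto
  qed
  have main: "g p1 p2 p3 q1 q2 \<le> c"
    if g: "continuous_on UNIV (\<lambda>(x1, x2, x3, y1, y2). g x1 x2 x3 y1 y2)"
      and bd: "\<And>x1 x2 x3 y1 y2 L. (x1, x2, x3, y1, y2) \<in> ?S \<Longrightarrow> 1 < D (x1, x2, x3, y1, y2) \<Longrightarrow> L = ln (D (x1, x2, x3, y1, y2)) \<Longrightarrow>
        g x1 x2 x3 y1 y2 * L \<le> c * L + k" for g c
  proof -
    have "(\<lambda>(x1, x2, x3, y1, y2). g x1 x2 x3 y1 y2) (p1, p2, p3, q1, q2) \<le> c"
    proof (rule limit_point_le[OF assms g finD])
      fix x assume x: "x \<in> ?S" "1 < D x"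
      obtain x1 x2 x3 y1 y2 where xx: "x = (x1, x2, x3, y1, y2)" by (cases x) auto
      show "(case x of (x1, x2, x3, y1, y2) \<Rightarrow> g x1 x2 x3 y1 y2) * ln (D x) \<le> c * ln (D x) + k"
        using bd[OF x[unfolded xx] refl] by (simp add: xx)
    qed
    then show ?thesis by simp
  qed
  have k0: "0 \<le> k" using K by (simp add: k_def)
  have half: "1 / 2 * L = L / 2" "- (1 / 2) * L = - L / 2" for L :: real by simp_all
  have c: "- p1 \<le> 0" "p1 - p2 \<le> 0" "p2 - p3 \<le> 0" "p1 + p2 + p3 \<le> 1 / 2" "- (p1 + p2 + p3) \<le> - (1 / 2)" "- q1 \<le> 0" "q1 - q2 \<le> 0"
    "q1 + q2 \<le> 1 / 2" "- (q1 + q2) \<le> - (1 / 2)" "q2 - p1 - p3 \<le> 0" "q1 - 2 * p1 \<le> 0" "q2 - 2 * p2 \<le> 0"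
    by (rule main, (auto simp: case_prod_beta intro!: continuous_intros)[1], use ineqs k0 in \<open>fastforce simp: half\<close>)+
  then show ?thesis by auto
qed

text \<open>Here \<open>t\<close> is the logarithm of a minimum, \<open>u * c\<close> its predicted
  value and \<open>L\<close> the logarithm of the discriminant. The error of
  \<open>t - p * L\<close> collects \<open>a\<close> from the estimates, \<open>10 * c\<close> from
  rounding and \<open>12 * c + h\<close> from replacing \<open>L\<close> by \<open>m * c\<close>; it
  is then divided by \<open>L\<close>, which is at least \<open>m * c\<close>.\<close>

lemma log_quotient_near:
  fixes t u p L m c a h :: real
  assumes "t \<le> a + u * c" "u * c \<le> t + a" "\<bar>u - m * p\<bar> \<le> 10" "m * c \<le> L" "L \<le> (m + 12) * c + h"
    "0 \<le> p" "p \<le> 1" "0 < c" "0 < m" "0 \<le> h" "0 \<le> a"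
  shows "\<bar>t / L - p\<bar> \<le> ((a + 22 * c + h) / c) / m"
proof -
  have mc: "0 < m * c" using assms by simp
  then have L: "0 < L" using assms(4) by linarith
  have "u * c \<le> (m * p + 10) * c" "(m * p - 10) * c \<le> u * c" using assms by (auto intro!: mult_right_mono)
  then have uc: "u * c \<le> p * (m * c) + 10 * c" "p * (m * c) - 10 * c \<le> u * c" by (simp_all add: algebra_simps)
  have "p * (m * c) \<le> p * L" using assms by (intro mult_left_mono) auto
  moreover have "p * L \<le> p * ((m + 12) * c + h)" using assms by (intro mult_left_mono) auto
  moreover have "p * ((m + 12) * c + h) = p * (m * c) + p * (12 * c + h)" by (simp add: algebra_simps)
  moreover have "p * (12 * c + h) \<le> 1 * (12 * c + h)" using assms by (intro mult_right_mono) auto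
  ultimately have pL: "p * (m * c) \<le> p * L" "p * L \<le> p * (m * c) + (12 * c + h)" by simp_all
  define U V W where "U = u * c" and "V = p * (m * c)" and "W = p * L"
  have "\<bar>t - W\<bar> \<le> a + 22 * c + h"
    using assms(1,2,8,10,11) uc pL unfolding U_def[symmetric] V_def[symmetric] W_def[symmetric] by linarith
  then have "\<bar>t - p * L\<bar> \<le> a + 22 * c + h" by (simp only: W_def)
  moreover have "t / L - p = (t - p * L) / L" using L by (simp add: field_simps)
  ultimately have "\<bar>t / L - p\<bar> \<le> (a + 22 * c + h) / L" using L by (simp add: divide_right_mono)
  also have "\<dots> \<le> (a + 22 * c + h) / (m * c)" using assms mc L by (intro divide_left_mono mult_pos_pos) auto
  finally show ?thesis by (simp add: mult.commute)
qed

text \<open>The errors are fixed linear combinations of the four rounding defects \<open>e\<close>,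
  \<open>f\<close>, \<open>g\<close> in [0, 1] and \<open>h\<close> in [-4, 0].\<close>

lemma rounding_error:
  fixes i j k l P1 P2 P3 Q1 Q2 u1 u2 u3 v1 v2 :: real
  assumes r: "i \<le> 2 * P1 - Q1" "2 * P1 - Q1 < i + 1" "j \<le> P1 + P3 - Q2" "P1 + P3 - Q2 < j + 1"
      "k \<le> 2 * P2 - Q2" "2 * P2 - Q2 < k + 1" "l \<le> 2 * P3 - Q1 + 4" "2 * P3 - Q1 < l - 3"
    and s: "P1 + P2 + P3 = Q1 + Q2"
    and u: "4 * u1 = 3 * i + l + 2 * j + 2 * k" "2 * u2 = i + l + 2 * k" "4 * u3 = i + 3 * l + 2 * j + 2 * k"
      "2 * v1 = i + l + 2 * j + 2 * k" "v2 = i + l + k"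
  shows "\<bar>u1 - P1\<bar> \<le> 10" "\<bar>u2 - P2\<bar> \<le> 10" "\<bar>u3 - P3\<bar> \<le> 10" "\<bar>v1 - Q1\<bar> \<le> 10" "\<bar>v2 - Q2\<bar> \<le> 10"
proof -
  define e f g h where "e = 2 * P1 - Q1 - i" and "f = P1 + P3 - Q2 - j" and "g = 2 * P2 - Q2 - k" and "h = 2 * P3 - Q1 - l"
  have b: "0 \<le> e" "e \<le> 1" "0 \<le> f" "f \<le> 1" "0 \<le> g" "g \<le> 1" "- 4 \<le> h" "h \<le> 0"
    using r by (simp_all add: e_def f_def g_def h_def)
  have "4 * (P1 - u1) = 3 * e + h + 2 * f + 2 * g" "2 * (P2 - u2) = e + h + 2 * g"
    "4 * (P3 - u3) = e + 3 * h + 2 * f + 2 * g" "2 * (Q1 - v1) = e + h + 2 * f + 2 * g" "Q2 - v2 = e + h + g"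
    using s u by (simp_all add: e_def f_def g_def h_def)
  then show "\<bar>u1 - P1\<bar> \<le> 10" "\<bar>u2 - P2\<bar> \<le> 10" "\<bar>u3 - P3\<bar> \<le> 10" "\<bar>v1 - Q1\<bar> \<le> 10" "\<bar>v2 - Q2\<bar> \<le> 10"
    using b by - (smt (verit))+
qed

text \<open>The scale \<open>m = Suc n\<close> is, up to a bounded error, the logarithm of the
  discriminant to base 7. The exponents of the family are \<open>m\<close> times the slacks,
  rounded, and all errors stay bounded while \<open>m\<close> grows.\<close>

lemma polytope_approx:
  assumes p: "0 \<le> p1" "p1 \<le> p2" "p2 \<le> p3" "p1 + p2 + p3 = 1 / 2"
    and q: "0 \<le> q1" "q1 \<le> q2" "q1 + q2 = 1 / 2"
    and pq: "q2 \<le> p1 + p3" "q1 \<le> 2 * p1" "q2 \<le> 2 * p2"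
  shows "\<exists>B. \<forall>n. \<exists>x1 x2 x3 y1 y2. (x1, x2, x3, y1, y2) \<in> S4_points TYPE('a :: infinite) TYPE('b :: infinite) \<and>
    \<bar>x1 - p1\<bar> \<le> B / real (Suc n) \<and> \<bar>x2 - p2\<bar> \<le> B / real (Suc n) \<and> \<bar>x3 - p3\<bar> \<le> B / real (Suc n) \<and>
    \<bar>y1 - q1\<bar> \<le> B / real (Suc n) \<and> \<bar>y2 - q2\<bar> \<le> B / real (Suc n)"
proof -
  obtain K where K: "K \<ge> 1" and Kb: "\<And>(R :: 'a ring) (C :: 'b ring).
    nondegenerate_ring 4 R \<Longrightarrow> cubic_resolvent R C \<Longrightarrow> G_ring 4 (sym_group 4) R \<Longrightarrow>
    minima_bounds K \<bar>real_of_int (disc 4 R)\<bar>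
      (succ_min 4 R 1, succ_min 4 R 2, succ_min 4 R 3, succ_min 3 C 1, succ_min 3 C 2)"
    using S4_pair_minima_bounds[where ?'a = 'a and ?'b = 'b and ?'m = unit and ?'k = unit] by blast
  define c where "c = ln (7 :: real)"
  define h where "h = ln (5000 :: real)"
  \<comment> \<open>The lower bound for one minimum subtracts the upper bounds for the others from
    the bound on the product; with three minima this costs \<open>ln 21\<close> twice.\<close>
  define a where "a = ln K + 2 * ln 21"
  have c0: "0 < c" and h0: "0 \<le> h" and l21: "0 \<le> ln (21 :: real)" and lK: "0 \<le> ln K" and a0: "0 \<le> a"
    using K by (simp_all add: c_def h_def a_def)
  have "\<exists>x1 x2 x3 y1 y2. (x1, x2, x3, y1, y2) \<in> S4_points TYPE('a) TYPE('b) \<and>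
    \<bar>x1 - p1\<bar> \<le> ((a + 22 * c + h) / c) / real (Suc n) \<and> \<bar>x2 - p2\<bar> \<le> ((a + 22 * c + h) / c) / real (Suc n) \<and>
    \<bar>x3 - p3\<bar> \<le> ((a + 22 * c + h) / c) / real (Suc n) \<and>
    \<bar>y1 - q1\<bar> \<le> ((a + 22 * c + h) / c) / real (Suc n) \<and> \<bar>y2 - q2\<bar> \<le> ((a + 22 * c + h) / c) / real (Suc n)" for n
  proof -
    define m where "m = real (Suc n)"
    have m0: "0 < m" by (simp add: m_def)
    \<comment> \<open>The summand 4 makes up for the losses of rounding down: the order conditions
      of the family hold even where the target inequalities are equalities, and \<open>N\<close>
      does not fall below \<open>m\<close>.\<close>
    define i j k l' l where "i = nat \<lfloor>m * (2 * p1 - q1)\<rfloor>" and "j = nat \<lfloor>m * (p1 + p3 - q2)\<rfloor>"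
      and "k = nat \<lfloor>m * (2 * p2 - q2)\<rfloor>" and "l' = nat \<lfloor>m * (2 * p3 - q1)\<rfloor>" and "l = l' + 4"
    have fl: "real (nat \<lfloor>m * r\<rfloor>) \<le> m * r" "m * r < real (nat \<lfloor>m * r\<rfloor>) + 1" if "0 \<le> r" for r
      using that m0 by (simp_all add: of_nat_nat)
    have nn: "0 \<le> 2 * p1 - q1" "0 \<le> p1 + p3 - q2" "0 \<le> 2 * p2 - q2" "0 \<le> 2 * p3 - q1" using p q pq by linarith+
    define P1 P2 P3 Q1 Q2 where "P1 = m * p1" and "P2 = m * p2" and "P3 = m * p3" and "Q1 = m * q1" and "Q2 = m * q2"
    have lin: "m * (2 * p1 - q1) = 2 * P1 - Q1" "m * (p1 + p3 - q2) = P1 + P3 - Q2" "m * (2 * p2 - q2) = 2 * P2 - Q2"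
      "m * (2 * p3 - q1) = 2 * P3 - Q1"
      by (simp_all add: P1_def P2_def P3_def Q1_def Q2_def algebra_simps)
    have l: "real l = real l' + 4" by (simp add: l_def)
    have "real i \<le> 2 * P1 - Q1" "2 * P1 - Q1 < real i + 1" unfolding i_def lin[symmetric] by (rule fl[OF nn(1)])+
    moreover have "real j \<le> P1 + P3 - Q2" "P1 + P3 - Q2 < real j + 1" unfolding j_def lin[symmetric] by (rule fl[OF nn(2)])+
    moreover have "real k \<le> 2 * P2 - Q2" "2 * P2 - Q2 < real k + 1" unfolding k_def lin[symmetric] by (rule fl[OF nn(3)])+
    moreover have "real l' \<le> 2 * P3 - Q1" "2 * P3 - Q1 < real l' + 1" unfolding l'_def lin[symmetric] by (rule fl[OF nn(4)])+
    ultimately have ijk: "real i \<le> 2 * P1 - Q1" "2 * P1 - Q1 < real i + 1" "real j \<le> P1 + P3 - Q2" "P1 + P3 - Q2 < real j + 1"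
      "real k \<le> 2 * P2 - Q2" "2 * P2 - Q2 < real k + 1" "real l \<le> 2 * P3 - Q1 + 4" "2 * P3 - Q1 < real l - 3"
      unfolding l by simp_all
    have ordP: "P1 \<le> P2" "P2 \<le> P3" "Q1 \<le> Q2" using p q m0 by (simp_all add: P1_def P2_def P3_def Q1_def Q2_def)
    have "2 * (P1 + P2 + P3) = m * (2 * (p1 + p2 + p3))" "2 * (Q1 + Q2) = m * (2 * (q1 + q2))"
      unfolding P1_def P2_def P3_def Q1_def Q2_def by (simp_all add: ring_distribs)
    then have sumP: "2 * (P1 + P2 + P3) = m" "2 * (Q1 + Q2) = m" unfolding p(4) q(3) by simp_all
    have "real i + 2 * real j < real l + 2 * real k" using ijk ordP by linarith
    then have c1: "i + 2 * j \<le> l + 2 * k" by linarith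
    have "real i + 2 * real k < real l + 2 * real j" using ijk ordP by linarith
    then have c2: "i + 2 * k \<le> l + 2 * j" by linarith
    have "2 * real j < real i + real l" using ijk ordP by linarith
    then have c3: "2 * j \<le> i + l" by linarith
    define N where "N = real (3 * i + 2 * j + 4 * k + 3 * l)"
    define u1 u2 u3 v1 v2 where "u1 = real (3 * i + l + 2 * j + 2 * k) / 4" "u2 = real (i + l + 2 * k) / 2"
      "u3 = real (i + 3 * l + 2 * j + 2 * k) / 4" "v1 = real (i + l + 2 * j + 2 * k) / 2" "v2 = real (i + l + k)"
    obtain R :: "'a ring" and C :: "'b ring" where RC: "nondegenerate_ring 4 R" "cubic_resolvent R C" "G_ring 4 (sym_group 4) R"
      and D: "7 powr N \<le> \<bar>real_of_int (disc 4 R)\<bar>" "\<bar>real_of_int (disc 4 R)\<bar> \<le> 5000 * 7 powr N"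
      and up: "succ_min 4 R 1 \<le> 21 * 7 powr u1" "succ_min 4 R 2 \<le> 21 * 7 powr u2" "succ_min 4 R 3 \<le> 21 * 7 powr u3"
      "succ_min 3 C 1 \<le> 21 * 7 powr v1" "succ_min 3 C 2 \<le> 21 * 7 powr v2"
      using S4_family_minima[OF c1 c2 c3, where ?'a = 'a and ?'b = 'b]
      unfolding N_def[symmetric] u1_u2_u3_v1_v2_def[symmetric] by blast
    define E l1 l2 l3 m1 m2 where "E = \<bar>real_of_int (disc 4 R)\<bar>" "l1 = succ_min 4 R 1" "l2 = succ_min 4 R 2"
      "l3 = succ_min 4 R 3" "m1 = succ_min 3 C 1" "m2 = succ_min 3 C 2"
    note E_defs = E_l1_l2_l3_m1_m2_def
    have b: "1 \<le> E" "1 \<le> K * l1" "l1 \<le> l2" "l2 \<le> l3" "sqrt E \<le> K * (l1 * l2 * l3)" "1 \<le> K * m1" "m1 \<le> m2" "sqrt E \<le> K * (m1 * m2)"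
      using Kb[OF RC] unfolding E_defs[symmetric] by (simp_all add: minima_bounds_def)
    have K0: "0 < K" using K by simp
    have pos: "0 < l1" "0 < m1" using b(2,6) K by (auto intro: zero_less_mult_pos[of K] less_le_trans[OF zero_less_one])
    then have pos': "0 < l2" "0 < l3" "0 < m2" using b by auto
    have lnup: "ln x \<le> ln 21 + u * c" if "x \<le> 21 * 7 powr u" "0 < x" for x u
      using ln_le_mult[OF that] by (simp add: c_def)
    have lu: "ln l1 \<le> ln 21 + u1 * c" "ln l2 \<le> ln 21 + u2 * c" "ln l3 \<le> ln 21 + u3 * c" "ln m1 \<le> ln 21 + v1 * c" "ln m2 \<le> ln 21 + v2 * c"
      using up pos pos' unfolding E_defs[symmetric] by (auto intro: lnup)
    have E0: "0 < E" using b by simp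
    have "ln (7 powr N) \<le> ln E" by (rule ln_mono) (use D E0 in \<open>simp_all add: E_defs\<close>)
    then have LN: "N * c \<le> ln E" by (simp add: c_def)
    have NL: "ln E \<le> h + N * c" using ln_le_mult[of E 5000 "7 powr N"] D E0 unfolding E_defs[symmetric] by (simp add: c_def h_def)
    have sq: "ln (sqrt E) = ln E / 2" "0 < sqrt E" using E0 by (simp_all add: ln_sqrt)
    have s1: "ln E / 2 \<le> ln K + (ln l1 + ln l2 + ln l3)"
      using ln_le_mult[OF b(5)] pos pos' K0 sq by (simp add: ln_mult)
    have s2: "ln E / 2 \<le> ln K + (ln m1 + ln m2)"
      using ln_le_mult[OF b(8)] pos pos' K0 sq by (simp add: ln_mult)
    have "u1 + u2 + u3 = N / 2" "v1 + v2 = N / 2" by (simp_all add: u1_u2_u3_v1_v2_def N_def field_simps)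
    then have "(u1 + u2 + u3) * c = N * c / 2" "(v1 + v2) * c = N * c / 2" by simp_all
    then have us: "u1 * c + u2 * c + u3 * c = N * c / 2" "v1 * c + v2 * c = N * c / 2" by (simp_all add: distrib_right)
    have lo: "u1 * c \<le> ln l1 + a" "u2 * c \<le> ln l2 + a" "u3 * c \<le> ln l3 + a" "v1 * c \<le> ln m1 + a" "v2 * c \<le> ln m2 + a"
      using us s1 s2 lu LN l21 unfolding a_def by linarith+
    have lu': "ln l1 \<le> a + u1 * c" "ln l2 \<le> a + u2 * c" "ln l3 \<le> a + u3 * c" "ln m1 \<le> a + v1 * c" "ln m2 \<le> a + v2 * c"
      using lu l21 lK unfolding a_def by linarith+
    \<comment> \<open>Without rounding, the combination defining \<open>N\<close> would be exactly
      \<open>m\<close>. The summand 4 enters through \<open>l\<close> with weight 3, whence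
      12.\<close>
    have Nm: "m \<le> N" "N \<le> m + 12" using ijk sumP by (simp_all add: N_def)
    have u4: "4 * u1 = 3 * real i + real l + 2 * real j + 2 * real k" "2 * u2 = real i + real l + 2 * real k"
      "4 * u3 = real i + 3 * real l + 2 * real j + 2 * real k" "2 * v1 = real i + real l + 2 * real j + 2 * real k"
      "v2 = real i + real l + real k"
      by (simp_all add: u1_u2_u3_v1_v2_def)
    have near: "\<bar>u1 - m * p1\<bar> \<le> 10" "\<bar>u2 - m * p2\<bar> \<le> 10" "\<bar>u3 - m * p3\<bar> \<le> 10" "\<bar>v1 - m * q1\<bar> \<le> 10" "\<bar>v2 - m * q2\<bar> \<le> 10"
      unfolding P1_def[symmetric] P2_def[symmetric] P3_def[symmetric] Q1_def[symmetric] Q2_def[symmetric]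
      using rounding_error[OF ijk _ u4] sumP by simp_all
    have "m * c \<le> N * c" "N * c \<le> (m + 12) * c" using Nm c0 by simp_all
    then have mL: "m * c \<le> ln E" "ln E \<le> (m + 12) * c + h" using LN NL by linarith+
    have le1: "p1 \<le> 1" "p2 \<le> 1" "p3 \<le> 1" "q1 \<le> 1" "q2 \<le> 1" "0 \<le> p2" "0 \<le> p3" "0 \<le> q2" using p q by linarith+
    have pt: "(ln l1 / ln E, ln l2 / ln E, ln l3 / ln E, ln m1 / ln E, ln m2 / ln E) \<in> S4_points TYPE('a) TYPE('b)"
    proof -
      have "minima_point R C \<in> S4_points TYPE('a) TYPE('b)" using RC unfolding S4_points_def by blast
      then show ?thesis unfolding minima_point_log_point E_defs[symmetric] by (simp add: log_point_def log_def)
    qed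
    show ?thesis unfolding m_def[symmetric]
      using pt log_quotient_near[OF lu'(1) lo(1) near(1) mL p(1) le1(1) c0 m0 h0 a0]
        log_quotient_near[OF lu'(2) lo(2) near(2) mL le1(6) le1(2) c0 m0 h0 a0]
        log_quotient_near[OF lu'(3) lo(3) near(3) mL le1(7) le1(3) c0 m0 h0 a0]
        log_quotient_near[OF lu'(4) lo(4) near(4) mL q(1) le1(4) c0 m0 h0 a0]
        log_quotient_near[OF lu'(5) lo(5) near(5) mL le1(8) le1(5) c0 m0 h0 a0]
      by blast
  qed
  then show ?thesis by blast
qed

section \<open>Every point of the polytope is a limit point\<close>

definition minima_polytope :: "(real \<times> real \<times> real \<times> real \<times> real) set" where
  "minima_polytope = {(p1, p2, p3, q1, q2).
     0 \<le> p1 \<and> p1 \<le> p2 \<and> p2 \<le> p3 \<and> p1 + p2 + p3 = 1 / 2 \<and>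
     0 \<le> q1 \<and> q1 \<le> q2 \<and> q1 + q2 = 1 / 2 \<and>
     q2 \<le> p1 + p3 \<and> q1 \<le> 2 * p1 \<and> q2 \<le> 2 * p2}"

lemma polytope_subset_closure:
  "minima_polytope \<subseteq> closure (S4_points TYPE('a :: infinite) TYPE('b :: infinite))"
proof
  fix z assume "z \<in> minima_polytope"
  then obtain p1 p2 p3 q1 q2 where z: "z = (p1, p2, p3, q1, q2)"
    and P: "0 \<le> p1" "p1 \<le> p2" "p2 \<le> p3" "p1 + p2 + p3 = 1 / 2" "0 \<le> q1" "q1 \<le> q2" "q1 + q2 = 1 / 2"
      "q2 \<le> p1 + p3" "q1 \<le> 2 * p1" "q2 \<le> 2 * p2"
    unfolding minima_polytope_def by blast
  obtain B x1 x2 x3 y1 y2 where x: "\<And>n. (x1 n, x2 n, x3 n, y1 n, y2 n) \<in> S4_points TYPE('a) TYPE('b)"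
    "\<And>n. \<bar>x1 n - p1\<bar> \<le> B / real (Suc n)" "\<And>n. \<bar>x2 n - p2\<bar> \<le> B / real (Suc n)" "\<And>n. \<bar>x3 n - p3\<bar> \<le> B / real (Suc n)"
    "\<And>n. \<bar>y1 n - q1\<bar> \<le> B / real (Suc n)" "\<And>n. \<bar>y2 n - q2\<bar> \<le> B / real (Suc n)"
    using polytope_approx[OF P, where ?'a = 'a and ?'b = 'b] by metis
  have lim: "f \<longlonglongrightarrow> r" if "\<And>n. \<bar>f n - r\<bar> \<le> B / real (Suc n)" for f and r :: real
  proof (rule LIM_zero_cancel, rule tendsto_sandwich[where f = "\<lambda>n. - (B / real (Suc n))" and h = "\<lambda>n. B / real (Suc n)"])
    show "(\<lambda>n. B / real (Suc n)) \<longlonglongrightarrow> 0" by (rule LIMSEQ_Suc[OF lim_const_over_n])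
    then show "(\<lambda>n. - (B / real (Suc n))) \<longlonglongrightarrow> 0" using tendsto_minus by fastforce
    have "- (B / real (Suc n)) \<le> f n - r \<and> f n - r \<le> B / real (Suc n)" for n using that[of n] by linarith
    then show "\<forall>\<^sub>F n in sequentially. - (B / real (Suc n)) \<le> f n - r"
      "\<forall>\<^sub>F n in sequentially. f n - r \<le> B / real (Suc n)" by simp_all
  qed
  have "(\<lambda>n. (x1 n, x2 n, x3 n, y1 n, y2 n)) \<longlonglongrightarrow> (p1, p2, p3, q1, q2)"
    by (intro tendsto_Pair lim x)
  then show "z \<in> closure (S4_points TYPE('a) TYPE('b))"
    unfolding z closure_sequential using x(1) by (intro exI[of _ "\<lambda>n. (x1 n, x2 n, x3 n, y1 n, y2 n)"]) simp
qed

lemma convex_minima_polytope: "convex minima_polytope"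
  unfolding convex_alt
proof (intro ballI allI impI)
  fix x y and t :: real assume xy: "x \<in> minima_polytope" "y \<in> minima_polytope" and t: "0 \<le> t \<and> t \<le> 1"
  obtain a1 a2 a3 b1 b2 where x: "x = (a1, a2, a3, b1, b2)" by (cases x) auto
  obtain c1 c2 c3 d1 d2 where y: "y = (c1, c2, c3, d1, d2)" by (cases y) auto
  have le: "f \<le> g \<Longrightarrow> f' \<le> g' \<Longrightarrow> (1 - t) * f + t * f' \<le> (1 - t) * g + t * g'" for f g f' g'
    using t by (intro add_mono mult_left_mono) auto
  have eq: "f = 1 / 2 \<Longrightarrow> f' = 1 / 2 \<Longrightarrow> (1 - t) * f + t * f' = 1 / 2" for f f'
    by (simp add: algebra_simps)
  have A: "0 \<le> a1" "a1 \<le> a2" "a2 \<le> a3" "a1 + a2 + a3 = 1 / 2" "0 \<le> b1" "b1 \<le> b2" "b1 + b2 = 1 / 2" "b2 \<le> a1 + a3" "b1 \<le> 2 * a1" "b2 \<le> 2 * a2"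
    using xy(1) by (simp_all add: x minima_polytope_def)
  have C: "0 \<le> c1" "c1 \<le> c2" "c2 \<le> c3" "c1 + c2 + c3 = 1 / 2" "0 \<le> d1" "d1 \<le> d2" "d1 + d2 = 1 / 2" "d2 \<le> c1 + c3" "d1 \<le> 2 * c1" "d2 \<le> 2 * c2"
    using xy(2) by (simp_all add: y minima_polytope_def)
  note facts = le[OF A(1) C(1)] le[OF A(2) C(2)] le[OF A(3) C(3)] eq[OF A(4) C(4)] le[OF A(5) C(5)] le[OF A(6) C(6)] eq[OF A(7) C(7)]
    le[OF A(8) C(8)] le[OF A(9) C(9)] le[OF A(10) C(10)]
  show "(1 - t) *\<^sub>R x + t *\<^sub>R y \<in> minima_polytope"
    using facts by (simp add: x y minima_polytope_def algebra_simps)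
qed

lemma convex_islimpt:
  fixes z w :: "'x :: real_normed_vector"
  assumes "convex S" "z \<in> S" "w \<in> S" "w \<noteq> z"
  shows "z islimpt S"
  unfolding islimpt_sequential
proof (intro exI[of _ "\<lambda>n. (1 - inverse (real (Suc n))) *\<^sub>R z + inverse (real (Suc n)) *\<^sub>R w"] conjI allI)
  fix n
  define u where "u = inverse (real (Suc n))"
  have u: "0 < u" "u \<le> 1" by (simp_all add: u_def field_simps)
  have "(1 - u) *\<^sub>R z + u *\<^sub>R w = z + u *\<^sub>R (w - z)" by (simp add: algebra_simps)
  then have "(1 - u) *\<^sub>R z + u *\<^sub>R w \<noteq> z" using u assms(4) by simp
  moreover have "(1 - u) *\<^sub>R z + u *\<^sub>R w \<in> S" using assms u by (simp add: convexD_alt)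
  ultimately show "(1 - inverse (real (Suc n))) *\<^sub>R z + inverse (real (Suc n)) *\<^sub>R w \<in> S - {z}"
    by (simp add: u_def)
next
  have "(\<lambda>n. (1 - inverse (real (Suc n))) *\<^sub>R z + inverse (real (Suc n)) *\<^sub>R w) \<longlonglongrightarrow> (1 - 0) *\<^sub>R z + 0 *\<^sub>R w"
    by (intro tendsto_intros LIMSEQ_inverse_real_of_nat)
  then show "(\<lambda>n. (1 - inverse (real (Suc n))) *\<^sub>R z + inverse (real (Suc n)) *\<^sub>R w) \<longlonglongrightarrow> z" by simp
qed

text \<open>The points approximating \<open>z\<close> might all equal \<open>z\<close>, so density
  alone does not give a limit point. A convex set with a second point has \<open>z\<close> as a
  limit point; hence so has the closure of the points of pairs, and a closure has the same limit
  points as the set itself.\<close>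

lemma polytope_subset_limit_points:
  assumes "z \<in> minima_polytope"
  shows "z islimpt S4_points TYPE('a :: infinite) TYPE('b :: infinite)"
proof -
  have "(1/6, 1/6, 1/6, 1/4, 1/4) \<in> minima_polytope" "(1/6, 1/6, 1/6, 1/5, 3/10) \<in> minima_polytope"
    by (simp_all add: minima_polytope_def)
  moreover have "(1/6, 1/6, 1/6, 1/4, 1/4) \<noteq> z \<or> (1/6, 1/6, 1/6, 1/5, 3/10) \<noteq> z" by auto
  ultimately obtain w where "w \<in> minima_polytope" "w \<noteq> z" by blast
  then have "z islimpt minima_polytope" by (rule convex_islimpt[OF convex_minima_polytope assms])
  then have "z islimpt closure (S4_points TYPE('a) TYPE('b))"
    by (rule islimpt_subset[OF _ polytope_subset_closure])
  then show ?thesis by (simp only: limpt_of_closure)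
qed

theorem theorem5p2:
  shows "P4 TYPE('a::infinite) TYPE('b::infinite) (sym_group 4) =
    {(p1, p2, p3, q1, q2).
       0 \<le> p1 \<and> p1 \<le> p2 \<and> p2 \<le> p3 \<and> p1 + p2 + p3 = 1 / 2 \<and>
       0 \<le> q1 \<and> q1 \<le> q2 \<and> q1 + q2 = 1 / 2 \<and>
       q2 \<le> p1 + p3 \<and> q1 \<le> 2 * p1 \<and> q2 \<le> 2 * p2}"
proof -
  have P4: "P4 TYPE('a) TYPE('b) (sym_group 4) = {p. p islimpt S4_points TYPE('a) TYPE('b)}"
    unfolding P4_def S4_points_def ..
  have "p \<in> minima_polytope" if "p islimpt S4_points TYPE('a) TYPE('b)" for p
    using that limit_points_in_polytope[where ?'a = 'a and ?'b = 'b]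
    by (cases p) (simp add: minima_polytope_def)
  then show ?thesis
    unfolding P4 minima_polytope_def[symmetric]
    using polytope_subset_limit_points[where ?'a = 'a and ?'b = 'b] by blast
qed

end
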